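(* Let $\mathcal D$ be a $B$-Hessian discretisation and $\mathcal M$ be a mesh of $\Omega$ (as in the context). Let $(\overline y,\overline p,\overline u)$ and $(\overline y_{\mathcal D},\overline p_{\mathcal D},\overline u_h)$ be the solutions of the continuous and the discrete KKT systems. Assume that - $\mathcal U_{ad}=\{u\in L^2(\omega): a\le u(x)\le b \text{ for a.e. } x\in\omega\}$ and $\mathcal U_h$ is the space of functions that are constant on each cell $K\in\mathcal M$; - the assumptions (A1)–(A4) listed in the context hold; - $\overline y$ and $\overline p$ belong to $H^4(\Omega)$, and $\overline u_d$ belongs to $H^2(\Omega)$. Let $\overline y_{\mathcal M}$ and $\overline p_{\mathcal M}$ be the functions $w_{\mathcal M}$ associated by (A1) with $w=\overline y$ and $w=\overline p$ respectively. Then there exist $C$ depending only on $\alpha$, and $C'$ depending only on $\Omega$, $B$, $\varrho$, an upper bound of $C^B_{\mathcal D}$ and $\eta$ (and on the constant $c_0$ of (A1)–(A4)), such that $$\|\overline y_{\mathcal M}-\Pi_{\mathcal D}\overline y_{\mathcal D}\|\le C'C\,h^2\Big(\|\overline u\|_{W^{1,\infty}(\mathcal M_1)}+\mathcal F(a,b,\overline y_d,\overline u_d,f,\overline y,\overline p)\Big),$$ $$\|\overline p_{\mathcal M}-\Pi_{\mathcal D}\overline p_{\mathcal D}\|\le C'C\,h^2\Big(\|\overline u\|_{W^{1,\infty}(\mathcal M_1)}+\mathcal F(a,b,\overline y_d,\overline u_d,f,\overline y,\overline p)\Big),$$ where $$\mathcal F(a,b,\overline y_d,\overline u_d,f,\overline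 y,\overline p)=\mathrm{minmod}(a,b)+\|\overline y_d\|+\|\overline u_d\|_{H^2(\Omega)}+\|f\|+\|\overline y\|_{H^4(\Omega)}+\|\overline p\|_{H^4(\Omega)},$$ with $\mathrm{minmod}(a,b)=0$ if $ab\le0$ and $\mathrm{minmod}(a,b)=\min(|a|,|b|)$ otherwise.
   Context: **Setting.** $\Omega\subset\mathbb R^d$ ($d\ge1$) is a bounded polytopal domain, $\mathcal S_d(\mathbb R)$ is the set of symmetric $d\times d$ matrices, $\xi:\phi=\sum_{i,j}\xi_{ij}\phi_{ij}$, $\mathcal H$ is the Hessian matrix. $(\cdot,\cdot)$ and $\|\cdot\|$ are the $L^2$ inner product and norm on $\Omega$ (scalar, vector or matrix valued functions). $B$ is a fourth-order tensor, constant over $\Omega$, acting linearly on matrices and mapping $\mathcal S_d(\mathbb R)$ to itself. Put $\mathcal H^B w=B\mathcal H w$. The coefficients $a_{ijkl}$ (with $a_{ijkl}=a_{jikl}=a_{ijlk}=a_{klij}$) are such that $a(z,w):=\sum_{i,j,k,l}\int_\Omega a_{ijkl}\,\partial_{ij}z\,\partial_{kl}w\,dx=\int_\Omega\mathcal H^Bz:\mathcal H^Bw\,dx$ for $z,w\in H^2_0(\Omega)$. Coercivity is assumed: there is $\varrho>0$ with $\|\mathcal H^Bw\|\ge\varrho\|w\|_{H^2(\Omega)}$ for all $w\in H^2_0(\Omega)$. **Mesh.** $\mathcal M$ is a finite family of non-empty connected polytopal open disjoint subsets (cells) of $\Omega$ with $\overline\Omega=\bigcup_{K\in\mathcal M}\overline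 K$ (a polytopal mesh: boundaries of cells are unions of closed flat faces, each face being either on $\partial\Omega$ and belonging to exactly one cell, or inside $\Omega$ and shared by exactly two cells); each cell $K$ is star-shaped with respect to its centroid $\overline x_K$. $h=\max_{K}\mathrm{diam}(K)$. With $\rho_K$ the maximal radius of a ball centred at $\overline x_K$ and included in $K$, regularity is assumed: $\mathrm{diam}(K)/\rho_K\le\eta$ for all $K\in\mathcal M$, for some $\eta>0$. $\omega\subset\Omega$ is a polygonal/polyhedral domain such that the cells of $\mathcal M$ contained in $\omega$ form a mesh of $\omega$. $\mathcal P_{\mathcal M}$ is the projection on piecewise constant functions: $(\mathcal P_{\mathcal M}v)_{|K}=\frac1{|K|}\int_Kv\,dx$ for $v\in L^1(\Omega)$, $K\in\mathcal M$. **Control problem.** $f,\overline y_d\in L^2(\Omega)$, $\alpha>0$, $a\le b$ are real constants. The desired control is (the restriction to $\omega$ of) $\overline u_d$. $\mathcal C:L^2(\omega)\to L^2(\Omega)$ is extension by zero, $\mathcal Cu=u\chi_\omega$; its adjoint $\mathcal C^*$ is restriction to $\omega$. The continuous KKT system is: find $(\overline y,\overline p,\overline u)\in H^2_0(\Omega)\times H^2_0(\Omega)\times\mathcal U_{ad}$ such that - $a(\overline y,w)=(f+\mathcal C\overline u,w)$ for all $w\in H^2_0(\Omega)$; - $a(w,\overline p)=(\overline y-\overline y_d,w)$ for all $w\in H^2_0(\Omega)$; - $(\mathcal C^*\overline p+\alpha(\overline u-\overline u_d),v-\overline u)_{L^2(\omega)}\ge0$ for all $v\in\mathcal U_{ad}$.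 **Hessian discretisation.** A $B$-Hessian discretisation is a quadruplet $\mathcal D=(X_{\mathcal D,0},\Pi_{\mathcal D},\nabla_{\mathcal D},\mathcal H^B_{\mathcal D})$ where $X_{\mathcal D,0}$ is a finite-dimensional real vector space and $\Pi_{\mathcal D}:X_{\mathcal D,0}\to L^2(\Omega)$, $\nabla_{\mathcal D}:X_{\mathcal D,0}\to L^2(\Omega)^d$, $\mathcal H^B_{\mathcal D}:X_{\mathcal D,0}\to L^2(\Omega;\mathcal S_d(\mathbb R))$ are linear, such that $\|\mathcal H^B_{\mathcal D}\cdot\|$ is a norm on $X_{\mathcal D,0}$. Put $a_{\mathcal D}(v,w)=\int_\Omega\mathcal H^B_{\mathcal D}v:\mathcal H^B_{\mathcal D}w\,dx$ and $$C^B_{\mathcal D}=\max_{w\in X_{\mathcal D,0}\setminus\{0\}}\max\Big(\frac{\|\Pi_{\mathcal D}w\|}{\|\mathcal H^B_{\mathcal D}w\|},\frac{\|\nabla_{\mathcal D}w\|}{\|\mathcal H^B_{\mathcal D}w\|}\Big).$$ The Hessian scheme for the equation with source $g\in L^2(\Omega)$ and clamped boundary conditions is: find $w_{\mathcal D}\in X_{\mathcal D,0}$ with $a_{\mathcal D}(w_{\mathcal D},v_{\mathcal D})=(g,\Pi_{\mathcal D}v_{\mathcal D})$ for all $v_{\mathcal D}\in X_{\mathcal D,0}$. **Discrete KKT system.** $\mathcal U_{ad,h}=\mathcal U_{ad}\cap\mathcal U_h$ (elements of $\mathcal U_h$ being restricted to $\omega$). Find $(\overline y_{\mathcal D},\overline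 p_{\mathcal D},\overline u_h)\in X_{\mathcal D,0}\times X_{\mathcal D,0}\times\mathcal U_{ad,h}$ such that - $a_{\mathcal D}(\overline y_{\mathcal D},w_{\mathcal D})=(f+\mathcal C\overline u_h,\Pi_{\mathcal D}w_{\mathcal D})$ for all $w_{\mathcal D}\in X_{\mathcal D,0}$; - $a_{\mathcal D}(w_{\mathcal D},\overline p_{\mathcal D})=(\Pi_{\mathcal D}\overline y_{\mathcal D}-\overline y_d,\Pi_{\mathcal D}w_{\mathcal D})$ for all $w_{\mathcal D}\in X_{\mathcal D,0}$; - $(\mathcal C^*\Pi_{\mathcal D}\overline p_{\mathcal D}+\alpha(\overline u_h-\overline u_d),v_h-\overline u_h)_{L^2(\omega)}\ge0$ for all $v_h\in\mathcal U_{ad,h}$. **Assumptions (A1)–(A4).** There is a constant $c_0>0$, depending only on $\Omega$, $\varrho$ and an upper bound of $C^B_{\mathcal D}$, such that: (A1) For each $w\in H^2(\Omega)$ there exists $w_{\mathcal M}\in L^2(\Omega)$ such that: (i) if $w\in H^4(\Omega)\cap H^2_0(\Omega)$ solves $\sum_{i,j,k,l}\partial_{kl}(a_{ijkl}\partial_{ij}w)=g\in L^2(\Omega)$ and $w_{\mathcal D}$ is the solution of the corresponding Hessian scheme, then $\|\Pi_{\mathcal D}w_{\mathcal D}-w_{\mathcal M}\|\le c_0h^2\|g\|$; (ii) for any $w\in H^2(\Omega)$: $|(w-w_{\mathcal M},\Pi_{\mathcal D}v_{\mathcal D})|\le c_0h^2\|\Pi_{\mathcal D}v_{\mathcal D}\|\,\|w\|_{H^2(\Omega)}$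 for all $v_{\mathcal D}\in X_{\mathcal D,0}$, and $\|\mathcal P_{\mathcal M}(w-w_{\mathcal M})\|\le c_0h^2\|w\|_{H^2(\Omega)}$. (A2) $\|\Pi_{\mathcal D}v_{\mathcal D}-\mathcal P_{\mathcal M}(\Pi_{\mathcal D}v_{\mathcal D})\|\le c_0h\|\mathcal H^B_{\mathcal D}v_{\mathcal D}\|$ for all $v_{\mathcal D}\in X_{\mathcal D,0}$. (A3) $\|\Pi_{\mathcal D}v_{\mathcal D}\|_{L^\infty(\Omega)}\le c_0\|\mathcal H^B_{\mathcal D}v_{\mathcal D}\|$ for all $v_{\mathcal D}\in X_{\mathcal D,0}$. (A4) Let $\mathcal M_2$ be the set of cells $K$ (of the mesh of $\omega$) such that $\overline u=a$ a.e. on $K$, or $\overline u=b$ a.e. on $K$, or $a<\overline u<b$ a.e. on $K$; let $\mathcal M_1$ be the set of remaining cells (of the mesh of $\omega$), and $\Omega_{1,\mathcal M}=\mathrm{int}(\bigcup_{K\in\mathcal M_1}\overline K)$. Then $|\Omega_{1,\mathcal M}|\le c_0h$ (Lebesgue measure) and $\overline u_{|\Omega_{1,\mathcal M}}\in W^{1,\infty}(\mathcal M_1)$, the broken Sobolev space of functions that are $W^{1,\infty}$ on each $K\in\mathcal M_1$, with its broken norm $\|\cdot\|_{W^{1,\infty}(\mathcal M_1)}$. *)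

theory Defs
  imports "HOL-Analysis.Analysis" "HOL-Probability.Essential_Supremum"
begin

section \<open>Lebesgue spaces\<close>

text \<open>Elements of Lebesgue and Sobolev spaces are represented by functions on the whole of
  \<open>\<real>\<^sup>d\<close>, of which only the values on the domain matter, up to null sets. The value type
  covers scalars, vectors and matrices; on matrices, the library inner product is
  \<open>\<xi> : \<phi>\<close> and the library norm is the Frobenius norm.\<close>

definition L2 :: "(real^'n) set \<Rightarrow> (real^'n \<Rightarrow> 'b::euclidean_space) set" where
  "L2 S = {f. f \<in> borel_measurable (lebesgue_on S) \<and> integrable (lebesgue_on S) (\<lambda>x. (norm (f x))\<^sup>2)}"

definition L2_inner :: "(real^'n) set \<Rightarrow> (real^'n \<Rightarrow> 'b::euclidean_space) \<Rightarrow> (real^'n \<Rightarrow> 'b) \<Rightarrow> real" where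
  "L2_inner S f g = integral\<^sup>L (lebesgue_on S) (\<lambda>x. f x \<bullet> g x)"

definition L2_norm :: "(real^'n) set \<Rightarrow> (real^'n \<Rightarrow> 'b::euclidean_space) \<Rightarrow> real" where
  "L2_norm S f = sqrt (integral\<^sup>L (lebesgue_on S) (\<lambda>x. (norm (f x))\<^sup>2))"

definition Linf :: "(real^'n) set \<Rightarrow> (real^'n \<Rightarrow> real) set" where
  "Linf S = {f. f \<in> borel_measurable (lebesgue_on S) \<and> esssup (lebesgue_on S) (\<lambda>x. ereal \<bar>f x\<bar>) < \<infinity>}"

definition Linf_norm :: "(real^'n) set \<Rightarrow> (real^'n \<Rightarrow> real) \<Rightarrow> real" where
  "Linf_norm S f = real_of_ereal (esssup (lebesgue_on S) (\<lambda>x. ereal \<bar>f x\<bar>))"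

section \<open>Weak derivatives and Sobolev spaces\<close>

definition partial_deriv :: "'n \<Rightarrow> (real^'n \<Rightarrow> real) \<Rightarrow> real^'n \<Rightarrow> real" where
  "partial_deriv i \<phi> x = frechet_derivative \<phi> (at x) (axis i 1)"

text \<open>A derivative of order \<open>m\<close> is indexed by a list of \<open>m\<close> coordinates:
  \<open>[i, j]\<close> stands for \<open>\<partial>\<^sub>i\<partial>\<^sub>j\<close>.\<close>

definition partial_derivs :: "'n list \<Rightarrow> (real^'n \<Rightarrow> real) \<Rightarrow> real^'n \<Rightarrow> real" where
  "partial_derivs is \<phi> = foldr partial_deriv is \<phi>"

fun Ck :: "nat \<Rightarrow> (real^'n \<Rightarrow> real) \<Rightarrow> bool" where
  "Ck 0 \<phi> \<longleftrightarrow> continuous_on UNIV \<phi>"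
| "Ck (Suc k) \<phi> \<longleftrightarrow> (\<forall>x. \<phi> differentiable (at x)) \<and> (\<forall>i. Ck k (partial_deriv i \<phi>))"

definition test_fun :: "(real^'n) set \<Rightarrow> (real^'n \<Rightarrow> real) set" where
  "test_fun S = {\<phi>. (\<forall>k. Ck k \<phi>) \<and> compact (closure {x. \<phi> x \<noteq> 0}) \<and> closure {x. \<phi> x \<noteq> 0} \<subseteq> S}"

definition locally_integrable :: "(real^'n) set \<Rightarrow> (real^'n \<Rightarrow> real) \<Rightarrow> bool" where
  "locally_integrable S f \<longleftrightarrow> (\<forall>K. compact K \<and> K \<subseteq> S \<longrightarrow> set_integrable lebesgue K f)"

definition is_weak_deriv :: "(real^'n) set \<Rightarrow> 'n list \<Rightarrow> (real^'n \<Rightarrow> real) \<Rightarrow> (real^'n \<Rightarrow> real) \<Rightarrow> bool" where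
  "is_weak_deriv S is f g \<longleftrightarrow> locally_integrable S f \<and> locally_integrable S g \<and>
     (\<forall>\<phi>\<in>test_fun S. L2_inner S f (partial_derivs is \<phi>) = (-1) ^ length is * L2_inner S g \<phi>)"

text \<open>Weak derivatives are unique almost everywhere; one representative is chosen.\<close>

definition weak_deriv :: "(real^'n) set \<Rightarrow> 'n list \<Rightarrow> (real^'n \<Rightarrow> real) \<Rightarrow> real^'n \<Rightarrow> real" where
  "weak_deriv S is f = (SOME g. is_weak_deriv S is f g)"

definition Hm :: "nat \<Rightarrow> (real^'n) set \<Rightarrow> (real^'n \<Rightarrow> real) set" where
  "Hm m S = {f \<in> L2 S. \<forall>is. length is \<le> m \<longrightarrow> (\<exists>g\<in>L2 S. is_weak_deriv S is f g)}"

text \<open>Summing over index lists gives the Euclidean norm of each derivative tensor; for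
  \<open>m = 2\<close> this is \<open>\<parallel>f\<parallel>\<^sup>2 + \<parallel>\<nabla>f\<parallel>\<^sup>2 + \<parallel>\<H>f\<parallel>\<^sup>2\<close>.\<close>

definition Hm_norm :: "nat \<Rightarrow> (real^'n) set \<Rightarrow> (real^'n \<Rightarrow> real) \<Rightarrow> real" where
  "Hm_norm m S f = sqrt (\<Sum>is | length is \<le> m. (L2_norm S (weak_deriv S is f))\<^sup>2)"

definition H20 :: "(real^'n) set \<Rightarrow> (real^'n \<Rightarrow> real) set" where
  "H20 S = {f \<in> Hm 2 S. \<exists>\<phi>. (\<forall>k. \<phi> k \<in> test_fun S) \<and>
              (\<lambda>k::nat. Hm_norm 2 S (\<lambda>x. f x - \<phi> k x)) \<longlonglongrightarrow> 0}"

definition W1inf :: "(real^'n) set \<Rightarrow> (real^'n \<Rightarrow> real) set" where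
  "W1inf S = {f \<in> Linf S. \<forall>i. \<exists>g\<in>Linf S. is_weak_deriv S [i] f g}"

definition W1inf_norm :: "(real^'n) set \<Rightarrow> (real^'n \<Rightarrow> real) \<Rightarrow> real" where
  "W1inf_norm S f = max (Linf_norm S f) (MAX i. Linf_norm S (weak_deriv S [i] f))"

text \<open>Broken spaces on a family of cells; on an empty family the norm is \<open>0\<close>.\<close>

definition W1inf_broken :: "(real^'n) set set \<Rightarrow> (real^'n \<Rightarrow> real) set" where
  "W1inf_broken \<K> = {f. \<forall>K\<in>\<K>. f \<in> W1inf K}"

definition W1inf_broken_norm :: "(real^'n) set set \<Rightarrow> (real^'n \<Rightarrow> real) \<Rightarrow> real" where
  "W1inf_broken_norm \<K> f = Max (insert 0 ((\<lambda>K. W1inf_norm K f) ` \<K>))"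

section \<open>The fourth-order operator\<close>

definition sym_mat :: "real^'n^'n \<Rightarrow> bool" where
  "sym_mat \<xi> \<longleftrightarrow> transpose \<xi> = \<xi>"

definition hessian :: "(real^'n) set \<Rightarrow> (real^'n \<Rightarrow> real) \<Rightarrow> real^'n \<Rightarrow> real^'n^'n" where
  "hessian S w x = (\<chi> i j. weak_deriv S [i, j] w x)"

definition hessianB :: "(real^'n^'n \<Rightarrow> real^'n^'n) \<Rightarrow> (real^'n) set \<Rightarrow> (real^'n \<Rightarrow> real)
    \<Rightarrow> real^'n \<Rightarrow> real^'n^'n" where
  "hessianB B S w x = B (hessian S w x)"

type_synonym 'n coeffs = "'n \<Rightarrow> 'n \<Rightarrow> 'n \<Rightarrow> 'n \<Rightarrow> real^'n \<Rightarrow> real"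

definition admissible_coeffs :: "(real^'n) set \<Rightarrow> 'n coeffs \<Rightarrow> bool" where
  "admissible_coeffs \<Omega> A \<longleftrightarrow>
     (\<forall>i j k l. A i j k l \<in> Linf \<Omega> \<and>
        (AE x in lebesgue_on \<Omega>. A i j k l x = A j i k l x \<and> A i j k l x = A i j l k x \<and>
                               A i j k l x = A k l i j x))"

definition bilinear_a :: "(real^'n) set \<Rightarrow> 'n coeffs \<Rightarrow> (real^'n \<Rightarrow> real) \<Rightarrow> (real^'n \<Rightarrow> real) \<Rightarrow> real" where
  "bilinear_a \<Omega> A z w = (\<Sum>i\<in>UNIV. \<Sum>j\<in>UNIV. \<Sum>k\<in>UNIV. \<Sum>l\<in>UNIV.
     integral\<^sup>L (lebesgue_on \<Omega>) (\<lambda>x. A i j k l x * weak_deriv \<Omega> [i, j] z x * weak_deriv \<Omega> [k, l] w x))"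

text \<open>The equation \<open>\<Sum>\<^sub>i\<^sub>j\<^sub>k\<^sub>l \<partial>\<^sub>k\<^sub>l(a\<^sub>i\<^sub>j\<^sub>k\<^sub>l \<partial>\<^sub>i\<^sub>j w) = g\<close>. The coefficients are only
  assumed to be bounded and measurable, so the outer derivatives are those of distributions;
  being of order two, they are transposed to the test function without a sign.\<close>

definition solves_pde :: "(real^'n) set \<Rightarrow> 'n coeffs \<Rightarrow> (real^'n \<Rightarrow> real) \<Rightarrow> (real^'n \<Rightarrow> real) \<Rightarrow> bool" where
  "solves_pde \<Omega> A w g \<longleftrightarrow> (\<forall>\<phi>\<in>test_fun \<Omega>.
     (\<Sum>i\<in>UNIV. \<Sum>j\<in>UNIV. \<Sum>k\<in>UNIV. \<Sum>l\<in>UNIV.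
        L2_inner \<Omega> (\<lambda>x. A i j k l x * weak_deriv \<Omega> [i, j] w x) (partial_derivs [k, l] \<phi>))
     = L2_inner \<Omega> g \<phi>)"

section \<open>Polytopal domains and meshes\<close>

text \<open>Flat faces need not be convex: they are finite unions of convex polytopes of dimension
  \<open>d - 1\<close> lying in one hyperplane.\<close>

definition flat_face :: "(real^'n) set \<Rightarrow> bool" where
  "flat_face \<sigma> \<longleftrightarrow> aff_dim \<sigma> = int CARD('n) - 1 \<and>
     (\<exists>P. finite P \<and> (\<forall>p\<in>P. polytope p \<and> aff_dim p = int CARD('n) - 1) \<and> \<sigma> = \<Union>P)"

definition polytopal :: "(real^'n) set \<Rightarrow> bool" where
  "polytopal S \<longleftrightarrow> (\<exists>F. finite F \<and> (\<forall>\<sigma>\<in>F. flat_face \<sigma>) \<and> frontier S = \<Union>F)"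

definition polytopal_domain :: "(real^'n) set \<Rightarrow> bool" where
  "polytopal_domain S \<longleftrightarrow> S \<noteq> {} \<and> open S \<and> connected S \<and> bounded S \<and> polytopal S"

text \<open>Faces are closed, so an interior face may touch \<open>\<partial>\<Omega>\<close> along its relative boundary.\<close>

definition polytopal_mesh :: "(real^'n) set \<Rightarrow> (real^'n) set set \<Rightarrow> bool" where
  "polytopal_mesh \<Omega> \<M> \<longleftrightarrow>
     finite \<M> \<and> (\<forall>K\<in>\<M>. polytopal_domain K \<and> K \<subseteq> \<Omega>) \<and> pairwise disjnt \<M> \<and>
     closure \<Omega> = (\<Union>K\<in>\<M>. closure K) \<and>
     (\<exists>F. finite F \<and> (\<forall>\<sigma>\<in>F. flat_face \<sigma>) \<and>
          pairwise (\<lambda>\<sigma> \<tau>. disjnt (rel_interior \<sigma>) (rel_interior \<tau>)) F \<and>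
          (\<forall>K\<in>\<M>. frontier K = \<Union>{\<sigma>\<in>F. \<sigma> \<subseteq> frontier K}) \<and>
          (\<forall>\<sigma>\<in>F. \<sigma> \<subseteq> frontier \<Omega> \<and> card {K\<in>\<M>. \<sigma> \<subseteq> frontier K} = 1 \<or>
                 rel_interior \<sigma> \<subseteq> \<Omega> \<and> card {K\<in>\<M>. \<sigma> \<subseteq> frontier K} = 2))"

definition centroid :: "(real^'n) set \<Rightarrow> real^'n" where
  "centroid K = (1 / measure lebesgue K) *\<^sub>R (LINT x:K|lebesgue. x)"

definition star_shaped_cells :: "(real^'n) set set \<Rightarrow> bool" where
  "star_shaped_cells \<M> \<longleftrightarrow> (\<forall>K\<in>\<M>. \<forall>x\<in>K. closed_segment (centroid K) x \<subseteq> K)"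

definition mesh_size :: "(real^'n) set set \<Rightarrow> real" where
  "mesh_size \<M> = (MAX K\<in>\<M>. diameter K)"

definition inner_radius :: "(real^'n) set \<Rightarrow> real" where
  "inner_radius K = Sup {r. ball (centroid K) r \<subseteq> K}"

definition mesh_regular :: "real \<Rightarrow> (real^'n) set set \<Rightarrow> bool" where
  "mesh_regular \<eta> \<M> \<longleftrightarrow> (\<forall>K\<in>\<M>. diameter K / inner_radius K \<le> \<eta>)"

definition submesh :: "(real^'n) set set \<Rightarrow> (real^'n) set \<Rightarrow> (real^'n) set set" where
  "submesh \<M> \<omega> = {K\<in>\<M>. K \<subseteq> \<omega>}"

definition proj_mesh :: "(real^'n) set set \<Rightarrow> (real^'n \<Rightarrow> real) \<Rightarrow> real^'n \<Rightarrow> real" where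
  "proj_mesh \<M> v x = (\<Sum>K\<in>\<M>. indicator K x * ((LINT z:K|lebesgue. v z) / measure lebesgue K))"

section \<open>Hessian discretisations\<close>

text \<open>The space \<open>XD\<close> is a finite-dimensional subspace of an ambient real vector space of type
  \<open>'x\<close>. With an infinite-dimensional \<open>'x\<close>, discretisations of every dimension are covered
  by one type, so that a bound quantified over all discretisations over \<open>'x\<close> is uniform in the
  dimension of \<open>XD\<close>.\<close>

record ('x, 'n) hessian_disc =
  XD :: "'x set"
  PiD :: "'x \<Rightarrow> real^'n \<Rightarrow> real"
  nablaD :: "'x \<Rightarrow> real^'n \<Rightarrow> real^'n"
  HessD :: "'x \<Rightarrow> real^'n \<Rightarrow> real^'n^'n"

definition linear_into_L2 ::
    "(real^'n) set \<Rightarrow> 'x::real_vector set \<Rightarrow> ('x \<Rightarrow> real^'n \<Rightarrow> 'b::euclidean_space) \<Rightarrow> bool" where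
  "linear_into_L2 S X T \<longleftrightarrow> (\<forall>v\<in>X. T v \<in> L2 S) \<and>
     (\<forall>v\<in>X. \<forall>w\<in>X. \<forall>r s. AE x in lebesgue_on S. T (r *\<^sub>R v + s *\<^sub>R w) x = r *\<^sub>R T v x + s *\<^sub>R T w x)"

definition is_norm_on :: "'x::real_vector set \<Rightarrow> ('x \<Rightarrow> real) \<Rightarrow> bool" where
  "is_norm_on X N \<longleftrightarrow> (\<forall>v\<in>X. 0 \<le> N v \<and> (N v = 0 \<longleftrightarrow> v = 0)) \<and>
     (\<forall>v\<in>X. \<forall>r. N (r *\<^sub>R v) = \<bar>r\<bar> * N v) \<and> (\<forall>v\<in>X. \<forall>w\<in>X. N (v + w) \<le> N v + N w)"

definition hessian_discretisation :: "(real^'n) set \<Rightarrow> ('x::real_vector, 'n) hessian_disc \<Rightarrow> bool" where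
  "hessian_discretisation \<Omega> D \<longleftrightarrow>
     subspace (XD D) \<and> (\<exists>S. finite S \<and> span S = XD D) \<and>
     linear_into_L2 \<Omega> (XD D) (PiD D) \<and> linear_into_L2 \<Omega> (XD D) (nablaD D) \<and>
     linear_into_L2 \<Omega> (XD D) (HessD D) \<and>
     (\<forall>v\<in>XD D. AE x in lebesgue_on \<Omega>. sym_mat (HessD D v x)) \<and>
     is_norm_on (XD D) (\<lambda>v. L2_norm \<Omega> (HessD D v))"

definition aD :: "(real^'n) set \<Rightarrow> ('x::real_vector, 'n) hessian_disc \<Rightarrow> 'x \<Rightarrow> 'x \<Rightarrow> real" where
  "aD \<Omega> D v w = L2_inner \<Omega> (HessD D v) (HessD D w)"

text \<open>Inserting \<open>0\<close> only matters for the trivial space, whose constant is then \<open>0\<close>.\<close>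

definition CD :: "(real^'n) set \<Rightarrow> ('x::real_vector, 'n) hessian_disc \<Rightarrow> real" where
  "CD \<Omega> D = Sup (insert 0 ((\<lambda>w. max (L2_norm \<Omega> (PiD D w) / L2_norm \<Omega> (HessD D w))
                                  (L2_norm \<Omega> (nablaD D w) / L2_norm \<Omega> (HessD D w))) ` (XD D - {0})))"

definition hessian_scheme :: "(real^'n) set \<Rightarrow> ('x::real_vector, 'n) hessian_disc \<Rightarrow>
    (real^'n \<Rightarrow> real) \<Rightarrow> 'x \<Rightarrow> bool" where
  "hessian_scheme \<Omega> D g wD \<longleftrightarrow> wD \<in> XD D \<and> (\<forall>vD\<in>XD D. aD \<Omega> D wD vD = L2_inner \<Omega> g (PiD D vD))"

section \<open>The control problem\<close>

definition extend_zero :: "(real^'n) set \<Rightarrow> (real^'n \<Rightarrow> real) \<Rightarrow> real^'n \<Rightarrow> real" where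
  "extend_zero \<omega> u x = indicator \<omega> x * u x"

definition Uad :: "(real^'n) set \<Rightarrow> real \<Rightarrow> real \<Rightarrow> (real^'n \<Rightarrow> real) set" where
  "Uad \<omega> a b = {u \<in> L2 \<omega>. AE x in lebesgue_on \<omega>. a \<le> u x \<and> u x \<le> b}"

definition Uh :: "(real^'n) set set \<Rightarrow> (real^'n \<Rightarrow> real) set" where
  "Uh \<M> = {v. \<forall>K\<in>\<M>. \<exists>c. AE x in lebesgue_on K. v x = c}"

definition Uadh :: "(real^'n) set set \<Rightarrow> (real^'n) set \<Rightarrow> real \<Rightarrow> real \<Rightarrow> (real^'n \<Rightarrow> real) set" where
  "Uadh \<M> \<omega> a b = {u \<in> Uad \<omega> a b. \<exists>v\<in>Uh \<M>. \<forall>x\<in>\<omega>. u x = v x}"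

text \<open>The restriction to \<open>\<omega>\<close> needs no notation in the variational inequalities: it is
  performed by the inner product over \<open>\<omega>\<close>.\<close>

definition KKT :: "(real^'n) set \<Rightarrow> 'n coeffs \<Rightarrow> (real^'n) set \<Rightarrow> (real^'n \<Rightarrow> real) \<Rightarrow> (real^'n \<Rightarrow> real) \<Rightarrow>
    (real^'n \<Rightarrow> real) \<Rightarrow> real \<Rightarrow> real \<Rightarrow> real \<Rightarrow>
    (real^'n \<Rightarrow> real) \<Rightarrow> (real^'n \<Rightarrow> real) \<Rightarrow> (real^'n \<Rightarrow> real) \<Rightarrow> bool" where
  "KKT \<Omega> A \<omega> f yd ud \<alpha> a b y p u \<longleftrightarrow>
     y \<in> H20 \<Omega> \<and> p \<in> H20 \<Omega> \<and> u \<in> Uad \<omega> a b \<and>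
     (\<forall>w\<in>H20 \<Omega>. bilinear_a \<Omega> A y w = L2_inner \<Omega> (\<lambda>x. f x + extend_zero \<omega> u x) w) \<and>
     (\<forall>w\<in>H20 \<Omega>. bilinear_a \<Omega> A w p = L2_inner \<Omega> (\<lambda>x. y x - yd x) w) \<and>
     (\<forall>v\<in>Uad \<omega> a b. L2_inner \<omega> (\<lambda>x. p x + \<alpha> * (u x - ud x)) (\<lambda>x. v x - u x) \<ge> 0)"

definition discrete_KKT :: "(real^'n) set \<Rightarrow> ('x::real_vector, 'n) hessian_disc \<Rightarrow> (real^'n) set set \<Rightarrow>
    (real^'n) set \<Rightarrow> (real^'n \<Rightarrow> real) \<Rightarrow> (real^'n \<Rightarrow> real) \<Rightarrow> (real^'n \<Rightarrow> real) \<Rightarrow>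
    real \<Rightarrow> real \<Rightarrow> real \<Rightarrow> 'x \<Rightarrow> 'x \<Rightarrow> (real^'n \<Rightarrow> real) \<Rightarrow> bool" where
  "discrete_KKT \<Omega> D \<M> \<omega> f yd ud \<alpha> a b yD pD uh \<longleftrightarrow>
     yD \<in> XD D \<and> pD \<in> XD D \<and> uh \<in> Uadh \<M> \<omega> a b \<and>
     (\<forall>wD\<in>XD D. aD \<Omega> D yD wD = L2_inner \<Omega> (\<lambda>x. f x + extend_zero \<omega> uh x) (PiD D wD)) \<and>
     (\<forall>wD\<in>XD D. aD \<Omega> D wD pD = L2_inner \<Omega> (\<lambda>x. PiD D yD x - yd x) (PiD D wD)) \<and>
     (\<forall>vh\<in>Uadh \<M> \<omega> a b.
        L2_inner \<omega> (\<lambda>x. PiD D pD x + \<alpha> * (uh x - ud x)) (\<lambda>x. vh x - uh x) \<ge> 0)"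

section \<open>Assumptions on the discretisation\<close>

definition A1_assoc :: "(real^'n) set \<Rightarrow> 'n coeffs \<Rightarrow> (real^'n) set set \<Rightarrow>
    ('x::real_vector, 'n) hessian_disc \<Rightarrow> real \<Rightarrow> (real^'n \<Rightarrow> real) \<Rightarrow> (real^'n \<Rightarrow> real) \<Rightarrow> bool" where
  "A1_assoc \<Omega> A \<M> D c0 w wM \<longleftrightarrow>
     wM \<in> L2 \<Omega> \<and>
     (\<forall>g\<in>L2 \<Omega>. \<forall>wD. w \<in> Hm 4 \<Omega> \<inter> H20 \<Omega> \<and> solves_pde \<Omega> A w g \<and> hessian_scheme \<Omega> D g wD \<longrightarrow>
        L2_norm \<Omega> (\<lambda>x. PiD D wD x - wM x) \<le> c0 * (mesh_size \<M>)\<^sup>2 * L2_norm \<Omega> g) \<and>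
     (\<forall>vD\<in>XD D. \<bar>L2_inner \<Omega> (\<lambda>x. w x - wM x) (PiD D vD)\<bar>
        \<le> c0 * (mesh_size \<M>)\<^sup>2 * L2_norm \<Omega> (PiD D vD) * Hm_norm 2 \<Omega> w) \<and>
     L2_norm \<Omega> (proj_mesh \<M> (\<lambda>x. w x - wM x)) \<le> c0 * (mesh_size \<M>)\<^sup>2 * Hm_norm 2 \<Omega> w"

definition A1 :: "(real^'n) set \<Rightarrow> 'n coeffs \<Rightarrow> (real^'n) set set \<Rightarrow>
    ('x::real_vector, 'n) hessian_disc \<Rightarrow> real \<Rightarrow> bool" where
  "A1 \<Omega> A \<M> D c0 \<longleftrightarrow> (\<forall>w\<in>Hm 2 \<Omega>. \<exists>wM. A1_assoc \<Omega> A \<M> D c0 w wM)"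

definition A2 :: "(real^'n) set \<Rightarrow> (real^'n) set set \<Rightarrow> ('x::real_vector, 'n) hessian_disc \<Rightarrow> real \<Rightarrow> bool" where
  "A2 \<Omega> \<M> D c0 \<longleftrightarrow> (\<forall>vD\<in>XD D.
     L2_norm \<Omega> (\<lambda>x. PiD D vD x - proj_mesh \<M> (PiD D vD) x) \<le> c0 * mesh_size \<M> * L2_norm \<Omega> (HessD D vD))"

definition A3 :: "(real^'n) set \<Rightarrow> ('x::real_vector, 'n) hessian_disc \<Rightarrow> real \<Rightarrow> bool" where
  "A3 \<Omega> D c0 \<longleftrightarrow> (\<forall>vD\<in>XD D. PiD D vD \<in> Linf \<Omega> \<and>
     Linf_norm \<Omega> (PiD D vD) \<le> c0 * L2_norm \<Omega> (HessD D vD))"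

definition mesh2 :: "(real^'n) set set \<Rightarrow> (real^'n) set \<Rightarrow> real \<Rightarrow> real \<Rightarrow> (real^'n \<Rightarrow> real) \<Rightarrow> (real^'n) set set" where
  "mesh2 \<M> \<omega> a b u = {K \<in> submesh \<M> \<omega>. (AE x in lebesgue_on K. u x = a) \<or> (AE x in lebesgue_on K. u x = b) \<or>
                                   (AE x in lebesgue_on K. a < u x \<and> u x < b)}"

definition mesh1 :: "(real^'n) set set \<Rightarrow> (real^'n) set \<Rightarrow> real \<Rightarrow> real \<Rightarrow> (real^'n \<Rightarrow> real) \<Rightarrow> (real^'n) set set" where
  "mesh1 \<M> \<omega> a b u = submesh \<M> \<omega> - mesh2 \<M> \<omega> a b u"

definition A4 :: "(real^'n) set set \<Rightarrow> (real^'n) set \<Rightarrow> real \<Rightarrow> real \<Rightarrow> (real^'n \<Rightarrow> real) \<Rightarrow> real \<Rightarrow> bool" where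
  "A4 \<M> \<omega> a b u c0 \<longleftrightarrow>
     measure lebesgue (interior (\<Union>K\<in>mesh1 \<M> \<omega> a b u. closure K)) \<le> c0 * mesh_size \<M> \<and>
     u \<in> W1inf_broken (mesh1 \<M> \<omega> a b u)"

section \<open>The data term of the estimate\<close>

definition minmod :: "real \<Rightarrow> real \<Rightarrow> real" where
  "minmod a b = (if a * b \<le> 0 then 0 else min \<bar>a\<bar> \<bar>b\<bar>)"

definition dataF :: "(real^'n) set \<Rightarrow> real \<Rightarrow> real \<Rightarrow> (real^'n \<Rightarrow> real) \<Rightarrow> (real^'n \<Rightarrow> real) \<Rightarrow>
    (real^'n \<Rightarrow> real) \<Rightarrow> (real^'n \<Rightarrow> real) \<Rightarrow> (real^'n \<Rightarrow> real) \<Rightarrow> real" where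
  "dataF \<Omega> a b yd ud f y p = minmod a b + L2_norm \<Omega> yd + Hm_norm 2 \<Omega> ud + L2_norm \<Omega> f +
     Hm_norm 4 \<Omega> y + Hm_norm 4 \<Omega> p"

end

theory Submission
  imports Defs
begin

text \<open>The discrete control \<open>u\<^sub>h\<close> is compared with the piecewise constant control \<open>v\<close> whose value on a cell \<open>K\<close>
  is the projection onto \<open>[a, b]\<close> of the mean over \<open>K\<close> of \<open>u\<^sub>d - p / \<alpha>\<close>. Testing the variational inequalities
  for \<open>u\<^sub>h\<close> and \<open>v\<close> with each other, and using the monotonicity of the discrete control-to-adjoint map, bounds
  \<open>\<alpha> \<parallel>u\<^sub>h - v\<parallel>\<close> by \<open>\<parallel>P\<^sub>M (\<Pi>\<^sub>D p' - p)\<parallel>\<close>, where \<open>p'\<close> is the discrete adjoint state of the control \<open>v\<close>. By (A1)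
  and the stability of the scheme, everything then reduces to testing \<open>v - u\<close> with discrete functions, where
  two quantities of order \<open>h\<close> are multiplied. That \<open>u\<close> is within order \<open>h\<close> of its cell means is a Poincare
  inequality on cells where \<open>u = u\<^sub>d - p / \<alpha>\<close>, and a Lipschitz bound on the cells of \<open>\<M>\<^sub>1\<close>. Both follow from
  an almost everywhere fundamental theorem of calculus for weakly differentiable functions along
  homotheties and translations.\<close>

section \<open>Test functions\<close>

text \<open>In general the optimal control is only within order \<open>h\<close> of piecewise
  constant functions, so a norm comparison of the discrete control with \<open>u\<close> cannot give
  order two. Two devices rescue the order. Differences that are only of order \<open>h\<close> in
  L2, such as v - u, or for which (A1) gives no norm bound, such as y - y_M, enter solely as
  functionals of discrete functions; hence stability of the scheme is proved for sources bounded in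
  the dual of the discrete Hessian norm. And the difference of two piecewise constant controls sees
  only the cell means of the adjoint error, which is exactly what (A1) controls for p - p_M.

  The Poincare and Lipschitz inequalities must hold with constants depending only on the dimension
  and \<eta>, once scaled by the diameter.

  The factor (1 + 1/\<alpha>)^2 has two sources: the formula of the control through p / \<alpha>,
  and the division by \<alpha> in the bound on the control error.\<close>

lemma partial_deriv_eq:
  assumes "(f has_derivative f') (at x)"
  shows "partial_deriv i f x = f' (axis i 1)"
  using frechet_derivative_at[OF assms] by (simp add: partial_deriv_def)

text \<open>\<open>Ck (Suc k)\<close> does not mention continuity of the function itself; in the
  base case differentiability supplies it.\<close>

lemma Ck_Suc_D: "Ck (Suc k) \<phi> \<Longrightarrow> Ck k \<phi>"
proof (induction k arbitrary: \<phi>)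
  case 0
  then show ?case
    by (auto intro!: continuous_at_imp_continuous_on differentiable_imp_continuous_within)
qed auto

lemma Ck_imp_continuous: "Ck k \<phi> \<Longrightarrow> continuous_on UNIV \<phi>"
proof (induction k)
  case (Suc k)
  then show ?case using Ck_Suc_D by blast
qed simp

lemma Ck_const: "Ck k (\<lambda>x::real^'n. c)"
proof (induction k arbitrary: c)
  case (Suc k)
  have "partial_deriv i (\<lambda>x::real^'n. c) = (\<lambda>x. 0)" for i
    by (simp add: partial_deriv_def fun_eq_iff)
  with Suc[of 0] show ?case by (simp only: Ck.simps) simp
qed simp

lemma partial_deriv_add:
  assumes "f differentiable (at x)" "g differentiable (at x)"
  shows "partial_deriv i (\<lambda>x. f x + g x) x = partial_deriv i f x + partial_deriv i g x"
  by (subst partial_deriv_eq[OF has_derivative_add[OF assms[unfolded frechet_derivative_works]]])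
    (simp add: partial_deriv_def)

lemma partial_deriv_mult:
  fixes f g :: "real^'n \<Rightarrow> real"
  assumes "f differentiable (at x)" "g differentiable (at x)"
  shows "partial_deriv i (\<lambda>x. f x * g x) x = f x * partial_deriv i g x + partial_deriv i f x * g x"
  by (subst partial_deriv_eq[OF has_derivative_mult[OF assms[unfolded frechet_derivative_works]]])
    (simp add: partial_deriv_def)

lemma Ck_add: "Ck k f \<Longrightarrow> Ck k g \<Longrightarrow> Ck k (\<lambda>x. f x + g x)"
proof (induction k arbitrary: f g)
  case 0
  then show ?case by (auto intro: continuous_intros)
next
  case (Suc k)
  then have "partial_deriv i (\<lambda>x. f x + g x) = (\<lambda>x. partial_deriv i f x + partial_deriv i g x)" for i
    by (auto simp: fun_eq_iff partial_deriv_add)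
  with Suc show ?case by (auto intro: differentiable_add)
qed

lemma Ck_mult: "Ck k f \<Longrightarrow> Ck k g \<Longrightarrow> Ck k (\<lambda>x. f x * g x)"
proof (induction k arbitrary: f g)
  case 0
  then show ?case by (auto intro: continuous_intros)
next
  case (Suc k)
  then have "partial_deriv i (\<lambda>x. f x * g x) = (\<lambda>x. f x * partial_deriv i g x + partial_deriv i f x * g x)" for i
    by (auto simp: fun_eq_iff partial_deriv_mult)
  with Suc Ck_Suc_D[OF Suc.prems(1)] Ck_Suc_D[OF Suc.prems(2)] show ?case
    by (auto intro!: differentiable_mult Ck_add)
qed

lemma Ck_prod: "finite I \<Longrightarrow> (\<And>i. i \<in> I \<Longrightarrow> Ck k (f i)) \<Longrightarrow> Ck k (\<lambda>x. \<Prod>i\<in>I. f i x)"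
  by (induction rule: finite_induct) (auto intro: Ck_const Ck_mult)

lemma has_derivative_scale_shift:
  fixes \<phi> :: "real^'n \<Rightarrow> real"
  assumes "\<phi> differentiable (at (s *\<^sub>R x + v))"
  shows "((\<lambda>x. \<phi> (s *\<^sub>R x + v)) has_derivative
           (\<lambda>h. s * frechet_derivative \<phi> (at (s *\<^sub>R x + v)) h)) (at x)"
proof -
  let ?D = "frechet_derivative \<phi> (at (s *\<^sub>R x + v))"
  have D: "(\<phi> has_derivative ?D) (at (s *\<^sub>R x + v))"
    using assms by (simp add: frechet_derivative_works)
  have "((\<lambda>x. s *\<^sub>R x + v) has_derivative (\<lambda>h. s *\<^sub>R h)) (at x)"
    by (auto intro!: derivative_eq_intros)
  from has_derivative_compose[OF this D]
  show ?thesis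
    using linear_frechet_derivative[OF assms] by (simp add: linear_cmul)
qed

lemma partial_deriv_scale_shift:
  fixes \<phi> :: "real^'n \<Rightarrow> real"
  assumes "\<phi> differentiable (at (s *\<^sub>R x + v))"
  shows "partial_deriv i (\<lambda>x. \<phi> (s *\<^sub>R x + v)) x = s * partial_deriv i \<phi> (s *\<^sub>R x + v)"
  using partial_deriv_eq[OF has_derivative_scale_shift[OF assms]] by (simp add: partial_deriv_def)

lemma Ck_scale_shift: "Ck k \<phi> \<Longrightarrow> Ck k (\<lambda>x. \<phi> (s *\<^sub>R x + v))"
proof (induction k arbitrary: \<phi>)
  case 0
  then show ?case
    by (auto intro!: continuous_on_compose2[of UNIV \<phi>] continuous_intros)
next
  case (Suc k)
  then have "partial_deriv i (\<lambda>x. \<phi> (s *\<^sub>R x + v)) = (\<lambda>x. s * partial_deriv i \<phi> (s *\<^sub>R x + v))" for i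
    by (auto simp: fun_eq_iff partial_deriv_scale_shift)
  moreover have "(\<lambda>x. \<phi> (s *\<^sub>R x + v)) differentiable (at x)" for x
    using has_derivative_scale_shift[of \<phi> s x v] Suc.prems by (auto simp: differentiable_def)
  ultimately show ?case
    using Suc by (auto intro!: Ck_mult Ck_const)
qed

lemma partial_deriv_coord:
  "((\<lambda>x::real^'n. g (x $ j)) has_derivative (\<lambda>h. D * h $ j)) (at x) \<Longrightarrow>
    partial_deriv i (\<lambda>x. g (x $ j)) x = (if i = j then D else 0)"
  by (auto simp: partial_deriv_eq axis_def)

lemma has_derivative_coord:
  fixes x :: "real^'n"
  assumes "(g has_field_derivative D) (at (x $ j))"
  shows "((\<lambda>x. g (x $ j)) has_derivative (\<lambda>h. D * h $ j)) (at x)"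
proof -
  have "((\<lambda>x::real^'n. x $ j) has_derivative (\<lambda>h. h $ j)) (at x)"
    by (rule bounded_linear_imp_has_derivative[OF bounded_linear_vec_nth])
  from has_derivative_compose[OF this assms[unfolded has_field_derivative_def]]
  show ?thesis .
qed

lemma Ck_coord: "Ck k (\<lambda>x::real^'n. x $ j)"
proof (cases k)
  case (Suc m)
  have d: "((\<lambda>x::real^'n. x $ j) has_derivative (\<lambda>h. 1 * h $ j)) (at x)" for x
    using has_derivative_coord[where g="\<lambda>x. x" and D=1] by (auto intro: DERIV_ident)
  from partial_deriv_coord[where g="\<lambda>x. x", OF d]
  have "partial_deriv i (\<lambda>x::real^'n. x $ j) = (\<lambda>x. if i = j then 1 else 0)" for i
    by (simp add: fun_eq_iff)
  with Suc d show ?thesis by (auto simp: differentiable_def Ck_const)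
qed (auto intro: continuous_intros)

section \<open>A smooth bump function on a box\<close>

definition flat_exp :: "nat \<Rightarrow> real \<Rightarrow> real" where
  "flat_exp m s = (if s > 0 then exp (- (1 / s)) / s ^ m else 0)"

lemma flat_exp_tendsto_0: "(flat_exp m \<longlongrightarrow> 0) (at 0)"
proof -
  have l: "(flat_exp m \<longlongrightarrow> 0) (at_left 0)"
    by (rule tendsto_eventually) (auto simp: eventually_at_filter flat_exp_def)
  have "((\<lambda>u. u ^ m / exp u) \<longlongrightarrow> (0::real)) at_top" by (rule tendsto_power_div_exp_0)
  from filterlim_compose[OF this filterlim_inverse_at_top_right]
  have "((\<lambda>s. inverse s ^ m / exp (inverse s)) \<longlongrightarrow> (0::real)) (at_right 0)" .
  then have r: "(flat_exp m \<longlongrightarrow> 0) (at_right 0)"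
    by (rule Lim_transform_eventually)
      (auto simp: eventually_at_filter flat_exp_def exp_minus field_simps)
  show ?thesis using l r by (simp add: filterlim_split_at)
qed

text \<open>The power of \<open>s\<close> in the denominator is there for this formula: it makes the
  family closed under differentiation up to linear combinations, so that smoothness of exp(-1/s)
  follows by one induction for all \<open>m\<close> together.\<close>

lemma flat_exp_deriv:
  "(flat_exp m has_field_derivative (- real m * flat_exp (Suc m) s + flat_exp (Suc (Suc m)) s)) (at s)"
proof -
  consider "s > 0" | "s < 0" | "s = 0" by linarith
  then show ?thesis
  proof cases
    case 1
    have power_eq: "s ^ n = s * s ^ (n - Suc 0)" if "n \<noteq> 0" for n
      using that by (cases n) auto
    have "((\<lambda>s. exp (- (1 / s)) / s ^ m) has_field_derivative
       (- real m * flat_exp (Suc m) s + flat_exp (Suc (Suc m)) s)) (at s)"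
      using 1 by ((cases m; auto intro!: derivative_eq_intros simp: flat_exp_def field_simps power2_eq_square),
          use power_eq in blast)
    then show ?thesis
      by (rule has_field_derivative_transform_within_open[of _ _ _ "{0<..}"])
        (use 1 in \<open>auto simp: flat_exp_def\<close>)
  next
    case 2
    have "((\<lambda>s. 0) has_field_derivative (- real m * flat_exp (Suc m) s + flat_exp (Suc (Suc m)) s)) (at s)"
      using 2 by (auto simp: flat_exp_def)
    then show ?thesis
      by (rule has_field_derivative_transform_within_open[of _ _ _ "{..<0}"])
        (use 2 in \<open>auto simp: flat_exp_def\<close>)
  next
    case 3
    \<comment> \<open>At 0 the difference quotient of \<open>flat_exp m\<close> is again a member of
      the family, \<open>flat_exp (Suc m)\<close>, and this tends to 0.\<close>
    have "((\<lambda>h. (flat_exp m (0 + h) - flat_exp m 0) / h) \<longlongrightarrow> 0) (at 0)"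
      using flat_exp_tendsto_0[of "Suc m"]
      by (rule Lim_transform_eventually)
        (auto simp: eventually_at_filter flat_exp_def)
    with 3 show ?thesis by (simp add: DERIV_def flat_exp_def)
  qed
qed

lemma Ck_flat_exp: "Ck k (\<lambda>x::real^'n. flat_exp m (\<alpha> * x $ j + \<gamma>))"
proof (induction k arbitrary: m)
  case 0
  have "isCont (flat_exp m) s" for s by (rule DERIV_isCont[OF flat_exp_deriv])
  then have "continuous_on UNIV (flat_exp m)" by (simp add: continuous_at_imp_continuous_on)
  then show ?case
    by (auto intro!: continuous_on_compose2[of UNIV "flat_exp m"] continuous_intros)
next
  case (Suc k)
  let ?D = "\<lambda>s. \<alpha> * (- real m * flat_exp (Suc m) s + flat_exp (Suc (Suc m)) s)"
  have "((\<lambda>r. flat_exp m (\<alpha> * r + \<gamma>)) has_field_derivative ?D (\<alpha> * r + \<gamma>)) (at r)" for r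
  proof -
    have "((\<lambda>r. \<alpha> * r + \<gamma>) has_field_derivative \<alpha>) (at r)"
      by (auto intro!: derivative_eq_intros)
    from DERIV_chain2[OF flat_exp_deriv[of m "\<alpha> * r + \<gamma>"] this] show ?thesis
      by (simp add: mult_ac)
  qed
  from has_derivative_coord[OF this]
  have d: "((\<lambda>x::real^'n. flat_exp m (\<alpha> * x $ j + \<gamma>)) has_derivative (\<lambda>h. ?D (\<alpha> * x $ j + \<gamma>) * h $ j)) (at x)" for x .
  from partial_deriv_coord[where g="\<lambda>r. flat_exp m (\<alpha> * r + \<gamma>)", OF d]
  have "partial_deriv i (\<lambda>x::real^'n. flat_exp m (\<alpha> * x $ j + \<gamma>)) =
      (\<lambda>x. if i = j then ?D (\<alpha> * x $ j + \<gamma>) else 0)" for i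
    by (simp add: fun_eq_iff)
  moreover have "Ck k (\<lambda>x::real^'n. ?D (\<alpha> * x $ j + \<gamma>))"
    by (intro Ck_mult Ck_add Ck_const Suc.IH)
  moreover have "Ck k (\<lambda>x::real^'n. if i = j then ?D (\<alpha> * x $ j + \<gamma>) else 0)" for i
    using calculation by (cases "i = j") (simp_all add: Ck_const)
  moreover have "(\<lambda>x::real^'n. flat_exp m (\<alpha> * x $ j + \<gamma>)) differentiable (at x)" for x
    using d by (auto simp: differentiable_def)
  ultimately show ?case by simp
qed

text \<open>Each coordinate contributes two flat exponentials, one for each face of the box.
  Steepening them with \<open>k\<close> gives smooth functions with values in [0, 1] that vanish off
  the box and converge pointwise to the indicator of the open box; they take the place of mollified
  indicators.\<close>

definition box_bump :: "real^'n \<Rightarrow> real^'n \<Rightarrow> nat \<Rightarrow> real^'n \<Rightarrow> real" where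
  "box_bump a b k x = (\<Prod>i\<in>UNIV. flat_exp 0 (real (Suc k) * (x $ i - a $ i)) *
                                 flat_exp 0 (real (Suc k) * (b $ i - x $ i)))"

lemma flat_exp_0_bounds: "0 \<le> flat_exp 0 s" "flat_exp 0 s \<le> 1"
  by (auto simp: flat_exp_def)

lemma box_bump_nonneg: "0 \<le> box_bump a b k x"
  unfolding box_bump_def by (intro prod_nonneg mult_nonneg_nonneg flat_exp_0_bounds)

lemma box_bump_le_1: "box_bump a b k x \<le> 1"
  unfolding box_bump_def
  by (intro prod_le_1 conjI mult_nonneg_nonneg mult_le_one flat_exp_0_bounds)

lemma box_bump_eq_0: "x \<notin> box a b \<Longrightarrow> box_bump a b k x = 0"
proof -
  assume "x \<notin> box a b"
  then obtain i where "x $ i \<le> a $ i \<or> b $ i \<le> x $ i"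
    by (auto simp: mem_box_cart not_less)
  then have "flat_exp 0 (real (Suc k) * (x $ i - a $ i)) * flat_exp 0 (real (Suc k) * (b $ i - x $ i)) = 0"
    by (auto simp: flat_exp_def zero_less_mult_iff)
  then show ?thesis unfolding box_bump_def by (intro prod_zero) auto
qed

lemma flat_exp_0_tendsto: "s > 0 \<Longrightarrow> (\<lambda>k. flat_exp 0 (real (Suc k) * s)) \<longlonglongrightarrow> 1"
proof -
  assume s: "s > 0"
  have "(\<lambda>k. exp (- (1 / s * (1 / real (Suc k))))) \<longlonglongrightarrow> exp (- (1 / s * 0))"
    by (intro tendsto_intros LIMSEQ_Suc[OF lim_1_over_n])
  then show ?thesis
    using s by (simp add: flat_exp_def mult.commute)
qed

lemma box_bump_tendsto: "(\<lambda>k. box_bump a b k x) \<longlonglongrightarrow> indicator (box a b) x"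
proof (cases "x \<in> box a b")
  case True
  then have "(\<lambda>k. box_bump a b k x) \<longlonglongrightarrow> (\<Prod>i\<in>(UNIV::'a set). 1 * 1)"
    unfolding box_bump_def
    by (intro tendsto_prod tendsto_mult flat_exp_0_tendsto) (auto simp: mem_box_cart)
  with True show ?thesis by simp
qed (simp add: box_bump_eq_0)

lemma Ck_box_bump: "Ck k (box_bump a b m)"
proof -
  have "Ck k (\<lambda>x. flat_exp 0 (real (Suc m) * x $ i + - real (Suc m) * a $ i) *
             flat_exp 0 (- real (Suc m) * x $ i + real (Suc m) * b $ i))" for i
    by (intro Ck_mult Ck_flat_exp)
  then have "Ck k (\<lambda>x. \<Prod>i\<in>UNIV. flat_exp 0 (real (Suc m) * x $ i + - real (Suc m) * a $ i) *
             flat_exp 0 (- real (Suc m) * x $ i + real (Suc m) * b $ i))"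
    by (intro Ck_prod) auto
  then show ?thesis
    by (simp add: box_bump_def[abs_def] algebra_simps)
qed

section \<open>Closure properties of test functions\<close>

lemma test_funI:
  assumes "\<And>k. Ck k \<phi>" "compact C" "C \<subseteq> S" "\<And>x. x \<notin> C \<Longrightarrow> \<phi> x = 0"
  shows "\<phi> \<in> test_fun S"
proof -
  have "closure {x. \<phi> x \<noteq> 0} \<subseteq> C"
    using assms by (intro closure_minimal) (auto intro: compact_imp_closed)
  moreover from this have "compact (closure {x. \<phi> x \<noteq> 0})"
    using assms(2) by (metis closed_closure compact_Int_closed inf.absorb_iff2)
  ultimately show ?thesis
    using assms by (auto simp: test_fun_def)
qed

lemma test_funE:
  assumes "\<phi> \<in> test_fun S"
  obtains C where "compact C" "C \<subseteq> S" "\<And>x. x \<notin> C \<Longrightarrow> \<phi> x = 0"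
proof (rule that)
  show "compact (closure {x. \<phi> x \<noteq> 0})" "closure {x. \<phi> x \<noteq> 0} \<subseteq> S"
    using assms by (simp_all add: test_fun_def)
  show "\<phi> x = 0" if "x \<notin> closure {x. \<phi> x \<noteq> 0}" for x
    using that closure_subset[of "{x. \<phi> x \<noteq> 0}"] by blast
qed

lemma test_fun_Ck: "\<phi> \<in> test_fun S \<Longrightarrow> Ck k \<phi>"
  by (simp add: test_fun_def)

lemma test_fun_differentiable: "\<phi> \<in> test_fun S \<Longrightarrow> \<phi> differentiable (at x)"
  using test_fun_Ck[of \<phi> S "Suc 0"] by simp

lemma test_fun_continuous: "\<phi> \<in> test_fun S \<Longrightarrow> continuous_on UNIV \<phi>"
  using test_fun_Ck Ck_imp_continuous by blast

lemma test_fun_mono: "S \<subseteq> T \<Longrightarrow> test_fun S \<subseteq> test_fun T"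
  by (auto simp: test_fun_def)

lemma test_fun_outside: "\<phi> \<in> test_fun S \<Longrightarrow> x \<notin> S \<Longrightarrow> \<phi> x = 0"
  by (metis test_funE subsetD)

lemma box_bump_test_fun: "cbox a b \<subseteq> S \<Longrightarrow> box_bump a b k \<in> test_fun S"
  by (rule test_funI[of _ "cbox a b"]) (auto simp: Ck_box_bump intro!: box_bump_eq_0 dest: subsetD[OF box_subset_cbox])

lemma test_fun_mult:
  assumes "\<phi> \<in> test_fun S" "\<And>k. Ck k \<psi>"
  shows "(\<lambda>x. \<psi> x * \<phi> x) \<in> test_fun S"
proof -
  obtain C where "compact C" "C \<subseteq> S" "\<And>x. x \<notin> C \<Longrightarrow> \<phi> x = 0" by (rule test_funE[OF assms(1)]) blast
  then show ?thesis using assms by (intro test_funI[of _ C] Ck_mult) (auto simp: test_fun_Ck)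
qed

lemma zero_test_fun: "(\<lambda>x. 0) \<in> test_fun S"
  by (rule test_funI[of _ "{}"]) (auto simp: Ck_const)

lemma test_fun_partial_deriv:
  assumes "\<phi> \<in> test_fun S"
  shows "partial_deriv i \<phi> \<in> test_fun S"
proof -
  obtain C where C: "compact C" "C \<subseteq> S" "\<And>x. x \<notin> C \<Longrightarrow> \<phi> x = 0" by (rule test_funE[OF assms]) blast
  have "partial_deriv i \<phi> x = 0" if "x \<notin> C" for x
  proof -
    have "((\<lambda>x. 0) has_derivative (\<lambda>h. 0)) (at x)" by simp
    then have "(\<phi> has_derivative (\<lambda>h. 0)) (at x)"
      by (rule has_derivative_transform_within_open[of _ _ _ _ "- C"])
        (use C that in \<open>auto intro: compact_imp_closed\<close>)
    then show ?thesis by (simp add: partial_deriv_eq)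
  qed
  moreover have "Ck k (partial_deriv i \<phi>)" for k
    using test_fun_Ck[OF assms, of "Suc k"] by simp
  ultimately show ?thesis using C by (intro test_funI[of _ C]) auto
qed

lemma test_fun_partial_derivs: "\<phi> \<in> test_fun S \<Longrightarrow> partial_derivs is \<phi> \<in> test_fun S"
  by (induction "is") (auto simp: partial_derivs_def test_fun_partial_deriv)

lemma test_fun_bounded:
  assumes "\<phi> \<in> test_fun S"
  obtains M where "M \<ge> 0" "\<And>x. \<bar>\<phi> x\<bar> \<le> M"
proof -
  obtain C where C: "compact C" "C \<subseteq> S" "\<And>x. x \<notin> C \<Longrightarrow> \<phi> x = 0" by (rule test_funE[OF assms]) blast
  have "compact (\<phi> ` C)"
    using C(1) test_fun_continuous[OF assms] by (metis compact_continuous_image continuous_on_subset subset_UNIV)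
  then obtain B where B: "\<forall>y\<in>\<phi> ` C. norm y \<le> B"
    using compact_imp_bounded bounded_iff by blast
  show ?thesis
  proof (rule that[of "max 0 B"])
    show "\<bar>\<phi> x\<bar> \<le> max 0 B" for x
      using B C(3)[of x] by (cases "x \<in> C") fastforce+
  qed simp
qed

lemma test_fun_measurable [measurable_dest]: "\<phi> \<in> test_fun S \<Longrightarrow> \<phi> \<in> borel_measurable borel"
  using test_fun_continuous borel_measurable_continuous_onI by blast

text \<open>The measure is left open because both \<open>lborel\<close> and \<open>lebesgue\<close>
  are needed: the calculus is done for the former, while local integrability is defined through the
  latter.\<close>

lemma integrable_mult_test_fun:
  assumes "integrable M f" "\<phi> \<in> test_fun S" "sets borel \<subseteq> sets M" "space M = UNIV"
  shows "integrable M (\<lambda>x. f x * \<phi> x)"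
proof -
  obtain B where B: "B \<ge> 0" "\<And>x. \<bar>\<phi> x\<bar> \<le> B" using test_fun_bounded[OF assms(2)] by auto
  have [measurable]: "\<phi> \<in> borel_measurable M"
    using test_fun_measurable[OF assms(2)] assms(3,4) by (auto simp: measurable_def)
  have [measurable]: "f \<in> borel_measurable M" using assms(1) by auto
  show ?thesis
    by (rule Bochner_Integration.integrable_bound[of _ "\<lambda>x. B * f x"])
      (use assms(1) B in \<open>auto simp: abs_mult mult.commute intro!: mult_right_mono\<close>)
qed

lemma test_fun_integrable:
  assumes "\<phi> \<in> test_fun S"
  shows "integrable lborel \<phi>"
proof -
  obtain C where C: "compact C" "C \<subseteq> S" "\<And>x. x \<notin> C \<Longrightarrow> \<phi> x = 0" by (rule test_funE[OF assms]) blast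
  have "integrable lborel (indicator C :: _ \<Rightarrow> real)"
    using C(1) emeasure_compact_finite[OF C(1)]
    by (intro integrable_real_indicator) (auto simp: compact_imp_closed)
  from integrable_mult_test_fun[OF this assms]
  have "integrable lborel (\<lambda>x. indicator C x * \<phi> x)" by simp
  moreover have "(\<lambda>x. indicator C x * \<phi> x) = \<phi>"
    using C(3) by (auto simp: fun_eq_iff indicator_def)
  ultimately show ?thesis by simp
qed

section \<open>Integration by parts and the fundamental lemma\<close>

lemma nn_integral_scale_shift:
  fixes f :: "'a::euclidean_space \<Rightarrow> ennreal"
  assumes [measurable]: "f \<in> borel_measurable borel" and "s \<noteq> 0"
  shows "(\<integral>\<^sup>+x. f x \<partial>lborel) = ennreal (\<bar>s\<bar> ^ DIM('a)) * (\<integral>\<^sup>+x. f (s *\<^sub>R x + v) \<partial>lborel)"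
  by (subst lborel_affine[OF \<open>s \<noteq> 0\<close>, of v])
    (simp add: nn_integral_density nn_integral_distr nn_integral_cmult add.commute ennreal_power)

lemma integrable_scale_shift:
  fixes f :: "'a::euclidean_space \<Rightarrow> real"
  assumes f: "integrable lborel f" and "s \<noteq> 0"
  shows "integrable lborel (\<lambda>x. f (s *\<^sub>R x + v))"
proof -
  have [measurable]: "f \<in> borel_measurable borel" using borel_measurable_integrable[OF f] by simp
  have "ennreal (\<bar>s\<bar> ^ DIM('a)) * (\<integral>\<^sup>+x. ennreal (norm (f (s *\<^sub>R x + v))) \<partial>lborel) < \<infinity>"
    using f nn_integral_scale_shift[of "\<lambda>x. ennreal (norm (f x))" s v] \<open>s \<noteq> 0\<close>
    by (simp add: integrable_iff_bounded)
  then show ?thesis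
    using \<open>s \<noteq> 0\<close> by (auto simp: integrable_iff_bounded ennreal_mult_less_top)
qed

lemma integral_scale_shift:
  fixes f :: "'a::euclidean_space \<Rightarrow> real"
  assumes [measurable]: "f \<in> borel_measurable borel" and "s \<noteq> 0"
  shows "integral\<^sup>L lborel f = \<bar>s\<bar> ^ DIM('a) * integral\<^sup>L lborel (\<lambda>x. f (s *\<^sub>R x + v))"
proof -
  have "integral\<^sup>L lborel f = integral\<^sup>L (density (distr lborel borel (\<lambda>x. v + s *\<^sub>R x)) (\<lambda>_. ennreal (\<bar>s\<bar> ^ DIM('a)))) f"
    by (subst lborel_affine[OF \<open>s \<noteq> 0\<close>, of v]) (simp add: ennreal_power)
  also have "\<dots> = \<bar>s\<bar> ^ DIM('a) * integral\<^sup>L lborel (\<lambda>x. f (s *\<^sub>R x + v))"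
    by (subst integral_density) (auto simp: integral_distr add.commute)
  finally show ?thesis .
qed

lemma AE_scale_shift:
  fixes P :: "'a::euclidean_space \<Rightarrow> bool"
  assumes "AE x in lborel. P x" "s \<noteq> 0"
  shows "AE x in lborel. P (s *\<^sub>R x + v)"
proof -
  from assms(1) obtain N where N: "{x\<in>space lborel. \<not> P x} \<subseteq> N" "emeasure lborel N = 0" "N \<in> sets lborel"
    by (rule AE_E)
  have "(\<integral>\<^sup>+x. indicator N (s *\<^sub>R x + v) \<partial>lborel) = 0"
    using nn_integral_scale_shift[of "indicator N" s v] N \<open>s \<noteq> 0\<close> by simp
  then have "AE x in lborel. indicator N (s *\<^sub>R x + v) = (0::ennreal)"
    by (subst (asm) nn_integral_0_iff_AE) (use N(3) in measurable)
  then show ?thesis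
    by eventually_elim (use N(1) in \<open>auto simp: indicator_def split: if_splits\<close>)
qed

section \<open>Differentiation along curves and integration by parts for test functions\<close>

lemma frechet_derivative_sum_partial:
  fixes \<phi> :: "real^'n \<Rightarrow> real"
  assumes "\<phi> differentiable (at y)"
  shows "frechet_derivative \<phi> (at y) v = (\<Sum>i\<in>UNIV. v $ i * partial_deriv i \<phi> y)"
proof -
  have l: "linear (frechet_derivative \<phi> (at y))" by (rule linear_frechet_derivative[OF assms])
  have "v = (\<Sum>i\<in>UNIV. v $ i *\<^sub>R axis i 1)"
    by (simp add: vec_eq_iff axis_def if_distrib[of "\<lambda>x. _ * x"] sum.delta cong: if_cong)
  then have "frechet_derivative \<phi> (at y) v = frechet_derivative \<phi> (at y) (\<Sum>i\<in>UNIV. v $ i *\<^sub>R axis i 1)"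
    by simp
  also have "\<dots> = (\<Sum>i\<in>UNIV. v $ i * partial_deriv i \<phi> y)"
    using l by (simp add: linear_sum linear_cmul partial_deriv_def)
  finally show ?thesis .
qed

lemma has_field_derivative_along_curve:
  fixes \<phi> :: "real^'n \<Rightarrow> real"
  assumes "\<phi> differentiable (at (\<gamma> t))" "(\<gamma> has_vector_derivative \<gamma>') (at t within T)"
  shows "((\<lambda>t. \<phi> (\<gamma> t)) has_field_derivative (\<Sum>i\<in>UNIV. \<gamma>' $ i * partial_deriv i \<phi> (\<gamma> t))) (at t within T)"
proof -
  let ?D = "frechet_derivative \<phi> (at (\<gamma> t))"
  have D: "(\<phi> has_derivative ?D) (at (\<gamma> t))"
    using assms by (simp add: frechet_derivative_works)
  have "((\<lambda>t. \<phi> (\<gamma> t)) has_derivative (\<lambda>h. ?D (h *\<^sub>R \<gamma>'))) (at t within T)"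
    using has_derivative_compose[OF assms(2)[unfolded has_vector_derivative_def] D] .
  moreover have "?D (h *\<^sub>R \<gamma>') = (\<Sum>i\<in>UNIV. \<gamma>' $ i * partial_deriv i \<phi> (\<gamma> t)) * h" for h
    using linear_frechet_derivative[OF assms(1)]
    by (simp add: linear_cmul frechet_derivative_sum_partial[OF assms(1)] sum_distrib_left mult_ac)
  ultimately show ?thesis by (simp add: has_field_derivative_def)
qed

text \<open>Translation invariance does the work: every difference quotient of \<phi> has integral
  zero, and the quotients converge to the partial derivative under a common integrable bound. No
  iterated integration over coordinates is involved.\<close>

lemma integral_partial_deriv_test_fun:
  fixes \<phi> :: "real^'n \<Rightarrow> real"
  assumes \<phi>: "\<phi> \<in> test_fun S"
  shows "integral\<^sup>L lborel (partial_deriv i \<phi>) = 0"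
proof -
  define e where "e = (axis i 1 :: real^'n)"
  define D where "D n x = (\<phi> (x + (1 / real (Suc n)) *\<^sub>R e) - \<phi> x) * real (Suc n)" for n x
  have der: "((\<lambda>t. \<phi> (x + t *\<^sub>R e)) has_field_derivative partial_deriv i \<phi> (x + t *\<^sub>R e)) (at t)" for x t
  proof -
    have "((\<lambda>t. x + t *\<^sub>R e) has_vector_derivative e) (at t)"
      by (auto intro!: derivative_eq_intros)
    from has_field_derivative_along_curve[where \<phi> = \<phi>, OF _ this] show ?thesis
      by (simp add: test_fun_differentiable[OF \<phi>] e_def axis_def if_distrib[of "\<lambda>c. c * _"] sum.delta cong: if_cong)
  qed
  have m [measurable]: "\<phi> \<in> borel_measurable borel" "partial_deriv i \<phi> \<in> borel_measurable borel"
    using \<phi> test_fun_partial_deriv[OF \<phi>] test_fun_measurable by blast+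
  obtain B where B: "B \<ge> 0" "\<And>x. \<bar>partial_deriv i \<phi> x\<bar> \<le> B"
    using test_fun_bounded[OF test_fun_partial_deriv[OF \<phi>]] by blast
  obtain C where C: "compact C" "C \<subseteq> S" "\<And>x. x \<notin> C \<Longrightarrow> \<phi> x = 0"
    by (rule test_funE[OF \<phi>]) blast
  obtain R where R: "\<And>x. x \<in> C \<Longrightarrow> norm x \<le> R"
    using compact_imp_bounded[OF C(1)] by (auto simp: bounded_iff)
  \<comment> \<open>The shifts have length at most 1, so off the ball of radius R + 1 both values of
    \<phi> in the quotient vanish; on the ball the mean value theorem applies.\<close>
  have bnd: "\<bar>D n x\<bar> \<le> B * indicator (cball 0 (R + 1)) x" for n x
  proof (cases "x \<in> cball 0 (R + 1)")
    case True
    have "\<exists>z. 0 < z \<and> z < 1 / real (Suc n) \<and> \<phi> (x + (1 / real (Suc n)) *\<^sub>R e) - \<phi> (x + 0 *\<^sub>R e) =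
        (1 / real (Suc n) - 0) * partial_deriv i \<phi> (x + z *\<^sub>R e)"
      by (rule MVT2) (auto simp: der)
    then obtain z where "\<phi> (x + (1 / real (Suc n)) *\<^sub>R e) - \<phi> x = (1 / real (Suc n)) * partial_deriv i \<phi> (x + z *\<^sub>R e)"
      by auto
    then have "D n x = partial_deriv i \<phi> (x + z *\<^sub>R e)" by (simp add: D_def)
    with True B show ?thesis by simp
  next
    case False
    then have x: "norm x > R + 1" by simp
    have e1: "norm ((1 / real (Suc n)) *\<^sub>R e) \<le> 1" by (simp add: e_def)
    have "norm x \<le> norm (x + (1 / real (Suc n)) *\<^sub>R e) + norm ((1 / real (Suc n)) *\<^sub>R e)"
      by (metis add_diff_cancel_right' norm_triangle_ineq4)
    with e1 x have "norm (x + (1 / real (Suc n)) *\<^sub>R e) > R" "norm x > R" by linarith+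
    then have "x + (1 / real (Suc n)) *\<^sub>R e \<notin> C" "x \<notin> C" using R by fastforce+
    with False C(3) show ?thesis by (simp add: D_def)
  qed
  have "(\<lambda>n. integral\<^sup>L lborel (D n)) \<longlonglongrightarrow> integral\<^sup>L lborel (partial_deriv i \<phi>)"
  proof (rule integral_dominated_convergence)
    show "integrable lborel (\<lambda>x::real^'n. B * indicator (cball 0 (R + 1)) x)"
      using emeasure_compact_finite[of "cball 0 (R + 1) :: (real^'n) set"]
      by (intro integrable_mult_right integrable_real_indicator) auto
    show "AE x in lborel. (\<lambda>n. D n x) \<longlonglongrightarrow> partial_deriv i \<phi> x"
    proof (rule AE_I2)
      fix x
      have "((\<lambda>h. (\<phi> (x + h *\<^sub>R e) - \<phi> x) / h) \<longlongrightarrow> partial_deriv i \<phi> x) (at 0)"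
        using der[of x 0] by (simp add: DERIV_def)
      moreover have "filterlim (\<lambda>n. 1 / real (Suc n)) (at 0) sequentially"
        using LIMSEQ_Suc[OF lim_1_over_n[where 'a = real]]
        by (auto simp: filterlim_at)
      ultimately have "(\<lambda>n. (\<phi> (x + (1 / real (Suc n)) *\<^sub>R e) - \<phi> x) / (1 / real (Suc n))) \<longlonglongrightarrow> partial_deriv i \<phi> x"
        by (rule filterlim_compose)
      then show "(\<lambda>n. D n x) \<longlonglongrightarrow> partial_deriv i \<phi> x" by (simp add: D_def)
    qed
    show "AE x in lborel. norm (D n x) \<le> B * indicator (cball 0 (R + 1)) x" for n
      using bnd by simp
  qed (simp_all add: D_def[abs_def])
  moreover have "integral\<^sup>L lborel (D n) = 0" for n
  proof -
    have "integrable lborel \<phi>" by (rule test_fun_integrable[OF \<phi>])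
    moreover have "integrable lborel (\<lambda>x. \<phi> (x + (1 / real (Suc n)) *\<^sub>R e))"
      using integrable_scale_shift[OF calculation, of 1] by simp
    moreover have "integral\<^sup>L lborel \<phi> = integral\<^sup>L lborel (\<lambda>x. \<phi> (x + (1 / real (Suc n)) *\<^sub>R e))"
      using integral_scale_shift[OF m(1), of 1] by simp
    ultimately show ?thesis by (simp add: D_def[abs_def])
  qed
  ultimately show ?thesis by (simp add: LIMSEQ_const_iff)
qed

lemma integral_by_parts_test_fun:
  fixes \<phi> \<psi> :: "real^'n \<Rightarrow> real"
  assumes \<phi>: "\<phi> \<in> test_fun S" and \<psi>: "\<psi> \<in> test_fun T"
  shows "integral\<^sup>L lborel (\<lambda>x. \<psi> x * partial_deriv i \<phi> x) = - integral\<^sup>L lborel (\<lambda>x. partial_deriv i \<psi> x * \<phi> x)"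
proof -
  have "partial_deriv i (\<lambda>x. \<psi> x * \<phi> x) = (\<lambda>x. \<psi> x * partial_deriv i \<phi> x + partial_deriv i \<psi> x * \<phi> x)"
    by (simp add: fun_eq_iff partial_deriv_mult test_fun_differentiable[OF \<phi>] test_fun_differentiable[OF \<psi>])
  then have "integral\<^sup>L lborel (\<lambda>x. \<psi> x * partial_deriv i \<phi> x + partial_deriv i \<psi> x * \<phi> x) = 0"
    using integral_partial_deriv_test_fun[OF test_fun_mult[OF \<phi> test_fun_Ck[OF \<psi>]], of i] by simp
  moreover have "integrable lborel (\<lambda>x. \<psi> x * partial_deriv i \<phi> x)"
    by (rule integrable_mult_test_fun[OF test_fun_integrable[OF \<psi>] test_fun_partial_deriv[OF \<phi>]]) auto
  moreover have "integrable lborel (\<lambda>x. partial_deriv i \<psi> x * \<phi> x)"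
    by (rule integrable_mult_test_fun[OF test_fun_integrable[OF test_fun_partial_deriv[OF \<psi>]] \<phi>]) auto
  ultimately show ?thesis by simp
qed

text \<open>The outermost derivative of \<phi> is moved first and therefore ends up innermost on
  \<psi>; this is the origin of \<open>rev\<close>.\<close>

lemma integral_by_parts_list:
  fixes \<phi> \<psi> :: "real^'n \<Rightarrow> real"
  assumes \<phi>: "\<phi> \<in> test_fun S" and \<psi>: "\<psi> \<in> test_fun T"
  shows "integral\<^sup>L lborel (\<lambda>x. \<psi> x * partial_derivs is \<phi> x) =
    (-1) ^ length is * integral\<^sup>L lborel (\<lambda>x. partial_derivs (rev is) \<psi> x * \<phi> x)"
  using \<psi>
proof (induction "is" arbitrary: \<psi>)
  case (Cons i "is")
  have "integral\<^sup>L lborel (\<lambda>x. \<psi> x * partial_derivs (i # is) \<phi> x) =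
      - integral\<^sup>L lborel (\<lambda>x. partial_deriv i \<psi> x * partial_derivs is \<phi> x)"
    using integral_by_parts_test_fun[OF test_fun_partial_derivs[OF \<phi>] Cons.prems, of i "is"]
    by (simp add: partial_derivs_def)
  also have "\<dots> = - ((-1) ^ length is * integral\<^sup>L lborel (\<lambda>x. partial_derivs (rev is) (partial_deriv i \<psi>) x * \<phi> x))"
    using Cons.IH[OF test_fun_partial_deriv[OF Cons.prems]] by simp
  finally show ?case by (simp add: partial_derivs_def)
qed (simp add: partial_derivs_def)

text \<open>A Dynkin argument: open boxes are stable under intersection and generate the Borel sets.
  The vanishing of the total integral is what makes the complement step work, since the whole space
  is not a box.\<close>

lemma set_integral_zero_on_boxes:
  fixes g :: "'a::euclidean_space \<Rightarrow> real"
  assumes g: "integrable lborel g" and "integral\<^sup>L lborel g = 0"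
    and box: "\<And>a b. (\<integral>x. indicator (box a b) x * g x \<partial>lborel) = 0"
  shows "AE x in lborel. g x = 0"
proof (rule sigma_finite_measure.density_zero[OF sigma_finite_lborel g])
  have si: "set_integrable lborel A g" if "A \<in> sets borel" for A
    unfolding set_integrable_def using g that by (intro integrable_mult_indicator) auto
  let ?E = "range (\<lambda>(a, b). box a b :: 'a set)"
  fix A :: "'a set" assume "A \<in> sets lborel"
  then have "A \<in> sigma_sets UNIV ?E" by (simp add: borel_eq_box)
  have sb: "sigma_sets UNIV ?E = sets (borel :: 'a measure)"
    by (simp add: borel_eq_box)
  have "Int_stable ?E" by (auto simp: Int_stable_def box_Int_box)
  moreover have "?E \<subseteq> Pow UNIV" by simp
  ultimately show "set_lebesgue_integral lborel A g = 0"
    using \<open>A \<in> sigma_sets UNIV ?E\<close>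
  proof (induction rule: sigma_sets_induct_disjoint)
    case (basic A)
    then show ?case using box by (auto simp: set_lebesgue_integral_def)
  next
    case empty
    show ?case by (simp add: set_lebesgue_integral_def)
  next
    case (compl A)
    then have A: "A \<in> sets borel" using sb by simp
    have "integral\<^sup>L lborel g = set_lebesgue_integral lborel (A \<union> (UNIV - A)) g"
      by (simp add: set_lebesgue_integral_def)
    also have "\<dots> = set_lebesgue_integral lborel A g + set_lebesgue_integral lborel (UNIV - A) g"
      using A by (intro set_integral_Un si) auto
    finally show ?case using compl assms by simp
  next
    case (union F)
    then have "range F \<subseteq> sets borel" using sb by auto
    then have "set_lebesgue_integral lborel (\<Union>i. F i) g = (\<Sum>i. set_lebesgue_integral lborel (F i) g)"
      using union(1) by (intro lebesgue_integral_countable_add si) (auto simp: disjoint_family_on_def)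
    then show ?case using union by simp
  qed
qed

text \<open>Composition with affine maps and Fubini are carried out with Borel functions, whereas
  \<open>L2\<close> only provides Lebesgue measurable ones; this lemma is the passage between the
  two. Vanishing off \<open>S\<close> lets integrals over \<open>S\<close> be written over the whole
  space.\<close>

lemma ex_borel_representative:
  fixes f :: "'a::euclidean_space \<Rightarrow> real"
  assumes "f \<in> borel_measurable (lebesgue_on S)" "S \<in> sets borel"
  shows "\<exists>f'\<in>borel_measurable borel. (\<forall>x. x \<notin> S \<longrightarrow> f' x = 0) \<and> (AE x in lborel. x \<in> S \<longrightarrow> f x = f' x)"
proof -
  have [measurable]: "S \<in> sets borel" by fact
  have "(\<lambda>x. indicator S x *\<^sub>R f x) \<in> borel_measurable lebesgue"
    using assms by (subst (asm) borel_measurable_restrict_space_iff) auto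
  then obtain f' where [measurable]: "f' \<in> borel_measurable lborel" and f': "AE x in lborel. indicator S x *\<^sub>R f x = f' x"
    using completion_ex_borel_measurable_real by blast
  show ?thesis
    by (rule bexI[of _ "\<lambda>x. indicator S x * f' x"])
      (use f' in \<open>auto elim!: eventually_mono simp: indicator_def\<close>)
qed

lemma AE_lebesgue_on_iff:
  fixes S :: "'a::euclidean_space set"
  assumes "S \<in> sets lebesgue"
  shows "(AE x in lebesgue_on S. P x) \<longleftrightarrow> (AE x in lborel. x \<in> S \<longrightarrow> P x)"
  using assms by (simp add: AE_restrict_space_iff AE_completion_iff)

lemma L2_inner_lebesgue:
  "S \<in> sets lebesgue \<Longrightarrow> L2_inner S f g = integral\<^sup>L lebesgue (\<lambda>x. indicator S x *\<^sub>R (f x \<bullet> g x))"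
  by (simp add: L2_inner_def integral_restrict_space)

lemma L2_inner_borel:
  fixes f g :: "real^'n \<Rightarrow> real"
  assumes "S \<in> sets borel" "f \<in> borel_measurable borel" "g \<in> borel_measurable borel" "\<And>x. x \<notin> S \<Longrightarrow> g x = 0"
  shows "L2_inner S f g = integral\<^sup>L lborel (\<lambda>x. f x * g x)"
proof -
  have "L2_inner S f g = integral\<^sup>L lebesgue (\<lambda>x. f x * g x)"
    using assms(1,4) by (subst L2_inner_lebesgue) (auto intro!: Bochner_Integration.integral_cong simp: indicator_def)
  also have "\<dots> = integral\<^sup>L lborel (\<lambda>x. f x * g x)"
    using assms(2,3) by (intro integral_completion) simp
  finally show ?thesis .
qed

text \<open>Local: inside a closed box contained in \<open>S\<close>, box bumps turn the hypothesis
  into vanishing integrals over all smaller open boxes, which determine the function almost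
  everywhere. Global: an open set is a countable union of closed boxes.\<close>

lemma fundamental_lemma:
  fixes g :: "real^'n \<Rightarrow> real"
  assumes S: "open S" and g: "locally_integrable S g"
    and 0: "\<And>\<phi>. \<phi> \<in> test_fun S \<Longrightarrow> L2_inner S g \<phi> = 0"
  shows "AE x in lborel. x \<in> S \<longrightarrow> g x = 0"
proof -
  have loc: "AE x in lborel. x \<in> cbox c d \<longrightarrow> g x = 0" if cd: "cbox c d \<subseteq> S" for c d
  proof -
    have gi: "set_integrable lebesgue (cbox c d) g"
      using g cd by (auto simp: locally_integrable_def)
    then have "g \<in> borel_measurable (lebesgue_on (cbox c d))"
      by (auto simp: set_integrable_def borel_measurable_restrict_space_iff dest: borel_measurable_integrable)
    from ex_borel_representative[OF this borel_closed[OF closed_cbox]]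
    obtain g' where [measurable]: "g' \<in> borel_measurable borel" and g'0: "\<And>x. x \<notin> cbox c d \<Longrightarrow> g' x = 0"
      and g': "AE x in lborel. x \<in> cbox c d \<longrightarrow> g x = g' x"
      by auto
    have eq: "AE x in lebesgue. indicator (cbox c d) x *\<^sub>R g x = g' x"
      unfolding AE_completion_iff using g' by eventually_elim (simp add: indicator_def g'0)
    have "integrable lebesgue g'"
      using gi[unfolded set_integrable_def] by (rule integrable_cong_AE_imp) (use eq in \<open>auto intro: measurable_completion\<close>)
    then have g'i: "integrable lborel g'" by (simp add: integrable_completion)
    have box: "(\<integral>x. indicator (box a b) x * g' x \<partial>lborel) = 0" if ab: "box a b \<subseteq> box c d" for a b
    proof (cases "box a b = {}")
      case False
      then have sub: "cbox a b \<subseteq> cbox c d"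
        using ab by (metis closure_box closure_mono box_subset_cbox closure_minimal closed_cbox subset_trans)
      have "(\<lambda>k. (\<integral>x. box_bump a b k x * g' x \<partial>lborel)) \<longlonglongrightarrow> (\<integral>x. indicator (box a b) x * g' x \<partial>lborel)"
      proof (rule integral_dominated_convergence)
        show "integrable lborel (\<lambda>x. \<bar>g' x\<bar>)" using g'i by simp
        have [measurable]: "box_bump a b k \<in> borel_measurable borel" for k
          using test_fun_measurable[OF box_bump_test_fun[OF subset_UNIV]] .
        show "(\<lambda>x. box_bump a b k x * g' x) \<in> borel_measurable lborel" for k by measurable
        show "AE x in lborel. (\<lambda>k. box_bump a b k x * g' x) \<longlonglongrightarrow> indicator (box a b) x * g' x"
          by (intro AE_I2 tendsto_mult box_bump_tendsto tendsto_const)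
        show "AE x in lborel. norm (box_bump a b k x * g' x) \<le> \<bar>g' x\<bar>" for k
          using box_bump_nonneg[of a b k] box_bump_le_1[of a b k]
          by (auto simp: abs_mult intro!: mult_left_le_one_le)
      qed measurable
      moreover have "(\<integral>x. box_bump a b k x * g' x \<partial>lborel) = 0" for k
      proof -
        have t: "box_bump a b k \<in> test_fun S" "box_bump a b k \<in> test_fun UNIV"
          using sub cd by (auto intro!: box_bump_test_fun)
        have [measurable]: "box_bump a b k \<in> borel_measurable borel" by (rule test_fun_measurable[OF t(1)])
        have "(\<integral>x. box_bump a b k x * g' x \<partial>lborel) = (\<integral>x. box_bump a b k x * g' x \<partial>lebesgue)"
          by (rule integral_completion[symmetric]) measurable
        also have "\<dots> = (\<integral>x. box_bump a b k x * (indicator (cbox c d) x *\<^sub>R g x) \<partial>lebesgue)"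
        proof (rule integral_cong_AE)
          have m: "(\<lambda>x. indicator (cbox c d) x *\<^sub>R g x) \<in> borel_measurable lebesgue"
            by (rule borel_measurable_integrable[OF gi[unfolded set_integrable_def]])
          show "(\<lambda>x. box_bump a b k x * (indicator (cbox c d) x *\<^sub>R g x)) \<in> borel_measurable lebesgue"
            by (rule borel_measurable_times[OF measurable_completion m]) measurable
          show "AE x in lebesgue. box_bump a b k x * g' x = box_bump a b k x * (indicator (cbox c d) x *\<^sub>R g x)"
            using eq by eventually_elim simp
        qed (intro measurable_completion, measurable)
        also have "\<dots> = (\<integral>x. indicator S x *\<^sub>R (g x \<bullet> box_bump a b k x) \<partial>lebesgue)"
          using ab cd box_subset_cbox[of c d]
          by (intro Bochner_Integration.integral_cong) (auto simp: indicator_def intro!: box_bump_eq_0)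
        also have "\<dots> = L2_inner S g (box_bump a b k)"
          using S by (simp add: L2_inner_lebesgue)
        finally show ?thesis using 0[OF t(1)] by simp
      qed
      ultimately show ?thesis by (simp add: LIMSEQ_const_iff)
    qed simp
    \<comment> \<open>The boundary of a box is null, so the representative, supported in the closed
      box, may be treated as supported in the open one; arbitrary boxes can then be intersected with
      it.\<close>
    have cd_null: "AE x in lborel. x \<notin> cbox c d - box c d"
      by (intro AE_not_in) (auto simp: null_sets_def emeasure_lborel_cbox_eq emeasure_lborel_box_eq
            emeasure_Diff box_subset_cbox)
    have box': "(\<integral>x. indicator (box a b) x * g' x \<partial>lborel) = 0" for a b
    proof -
      obtain a' b' where ab': "box a b \<inter> box c d = box a' b'" by (simp add: box_Int_box)
      have "(\<integral>x. indicator (box a b) x * g' x \<partial>lborel) = (\<integral>x. indicator (box a' b') x * g' x \<partial>lborel)"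
        using cd_null
        by (intro integral_cong_AE) (auto elim!: eventually_mono simp: ab'[symmetric] indicator_def g'0)
      also have "\<dots> = 0" using ab' by (intro box) auto
      finally show ?thesis .
    qed
    have "integral\<^sup>L lborel g' = (\<integral>x. indicator (box c d) x * g' x \<partial>lborel)"
      using cd_null by (intro integral_cong_AE) (auto elim!: eventually_mono simp: indicator_def g'0)
    with box have "integral\<^sup>L lborel g' = 0" by simp
    from set_integral_zero_on_boxes[OF g'i this box'] g' show ?thesis
      by eventually_elim auto
  qed
  obtain \<D> where \<D>: "countable \<D>" "\<D> \<subseteq> Pow S" "\<And>X. X \<in> \<D> \<Longrightarrow> \<exists>a b. X = cbox a b" "\<Union>\<D> = S"
    using open_countable_Union_open_cbox[OF S] by metis
  have "AE x in lborel. \<forall>X\<in>\<D>. x \<in> X \<longrightarrow> g x = 0"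
    unfolding AE_ball_countable[OF \<D>(1)] using \<D>(2,3) loc by blast
  then show ?thesis
    by eventually_elim (use \<D>(4) in blast)
qed

section \<open>Lebesgue and Sobolev spaces\<close>

lemma L2_measurable: "f \<in> L2 S \<Longrightarrow> f \<in> borel_measurable (lebesgue_on S)"
  by (simp add: L2_def)

lemma L2_integrable_inner:
  assumes "f \<in> L2 S" "g \<in> L2 S"
  shows "integrable (lebesgue_on S) (\<lambda>x. f x \<bullet> g x)"
proof -
  have [measurable]: "f \<in> borel_measurable (lebesgue_on S)" "g \<in> borel_measurable (lebesgue_on S)"
    using assms by (auto simp: L2_def)
  have "integrable (lebesgue_on S) (\<lambda>x. (norm (f x))\<^sup>2 + (norm (g x))\<^sup>2)"
    using assms by (simp add: L2_def)
  then show ?thesis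
  proof (rule Bochner_Integration.integrable_bound)
    have "norm (f x \<bullet> g x) \<le> norm ((norm (f x))\<^sup>2 + (norm (g x))\<^sup>2)" for x
    proof -
      have "\<bar>f x \<bullet> g x\<bar> \<le> norm (f x) * norm (g x)" by (rule Cauchy_Schwarz_ineq2)
      also have "\<dots> \<le> (norm (f x))\<^sup>2 + (norm (g x))\<^sup>2"
        using sum_squares_bound[of "norm (f x)" "norm (g x)"] mult_nonneg_nonneg[OF norm_ge_zero[of "f x"] norm_ge_zero[of "g x"]]
        by (simp only: mult.assoc)
      finally show ?thesis by simp
    qed
    then show "AE x in lebesgue_on S. norm (f x \<bullet> g x) \<le> norm ((norm (f x))\<^sup>2 + (norm (g x))\<^sup>2)" by simp
  qed measurable
qed

lemma L2I: "f \<in> borel_measurable (lebesgue_on S) \<Longrightarrow> integrable (lebesgue_on S) (\<lambda>x. (norm (f x))\<^sup>2) \<Longrightarrow> f \<in> L2 S"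
  by (simp add: L2_def)

lemma L2_bound:
  assumes "g \<in> borel_measurable (lebesgue_on S)" "f \<in> L2 S"
    and "AE x in lebesgue_on S. norm (g x) \<le> C * norm (f x)"
  shows "g \<in> L2 S"
proof (rule L2I)
  have i: "integrable (lebesgue_on S) (\<lambda>x. C\<^sup>2 * (norm (f x))\<^sup>2)"
    using assms(2) by (simp add: L2_def)
  have [measurable]: "g \<in> borel_measurable (lebesgue_on S)" by fact
  show "integrable (lebesgue_on S) (\<lambda>x. (norm (g x))\<^sup>2)"
    by (rule Bochner_Integration.integrable_bound[OF i])
      (use assms(3) in \<open>auto elim!: eventually_mono simp: power_mult_distrib[symmetric] intro!: power_mono\<close>)
qed fact

lemma L2_add:
  assumes "f \<in> L2 S" "g \<in> L2 S"
  shows "(\<lambda>x. f x + g x) \<in> L2 S"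
proof (rule L2I)
  have "(norm (f x + g x))\<^sup>2 = (norm (f x))\<^sup>2 + 2 * (f x \<bullet> g x) + (norm (g x))\<^sup>2" for x
    by (simp add: power2_norm_eq_inner inner_add inner_commute)
  then show "integrable (lebesgue_on S) (\<lambda>x. (norm (f x + g x))\<^sup>2)"
    using assms L2_integrable_inner[OF assms] by (simp add: L2_def)
qed (use assms in \<open>auto simp: L2_def\<close>)

lemma L2_scaleR: "f \<in> L2 S \<Longrightarrow> (\<lambda>x. c *\<^sub>R f x) \<in> L2 S"
  by (auto simp: L2_def power_mult_distrib)

lemma L2_mult: "f \<in> L2 S \<Longrightarrow> (\<lambda>x. c * f x :: real) \<in> L2 S"
  using L2_scaleR[of f S c] by simp

lemma L2_diff: "f \<in> L2 S \<Longrightarrow> g \<in> L2 S \<Longrightarrow> (\<lambda>x. f x - g x) \<in> L2 S"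
  using L2_add[of f S "\<lambda>x. (-1) *\<^sub>R g x"] L2_scaleR[of g S "-1"] by simp

lemma L2_zero: "(\<lambda>x. 0) \<in> L2 S"
  by (simp add: L2_def)

lemma L2_sum: "finite I \<Longrightarrow> (\<And>i. i \<in> I \<Longrightarrow> f i \<in> L2 S) \<Longrightarrow> (\<lambda>x. \<Sum>i\<in>I. f i x) \<in> L2 S"
  by (induction rule: finite_induct) (auto intro: L2_add L2_zero)

lemma L2_inner_commute: "L2_inner S f g = L2_inner S g f"
  by (simp add: L2_inner_def inner_commute)

lemma L2_inner_add_left:
  "f \<in> L2 S \<Longrightarrow> g \<in> L2 S \<Longrightarrow> h \<in> L2 S \<Longrightarrow> L2_inner S (\<lambda>x. f x + g x) h = L2_inner S f h + L2_inner S g h"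
  by (simp add: L2_inner_def inner_add_left L2_integrable_inner)

lemma L2_inner_add_right:
  "f \<in> L2 S \<Longrightarrow> g \<in> L2 S \<Longrightarrow> h \<in> L2 S \<Longrightarrow> L2_inner S h (\<lambda>x. f x + g x) = L2_inner S h f + L2_inner S h g"
  by (simp add: L2_inner_def inner_add_right L2_integrable_inner)

lemma L2_inner_diff_left:
  "f \<in> L2 S \<Longrightarrow> g \<in> L2 S \<Longrightarrow> h \<in> L2 S \<Longrightarrow> L2_inner S (\<lambda>x. f x - g x) h = L2_inner S f h - L2_inner S g h"
  by (simp add: L2_inner_def inner_diff_left L2_integrable_inner)

lemma L2_inner_diff_right:
  "f \<in> L2 S \<Longrightarrow> g \<in> L2 S \<Longrightarrow> h \<in> L2 S \<Longrightarrow> L2_inner S h (\<lambda>x. f x - g x) = L2_inner S h f - L2_inner S h g"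
  by (simp add: L2_inner_def inner_diff_right L2_integrable_inner)

lemma L2_inner_scaleR_left: "L2_inner S (\<lambda>x. c *\<^sub>R f x) h = c * L2_inner S f h"
  by (simp add: L2_inner_def)

lemma L2_inner_mult_left: "L2_inner S (\<lambda>x. c * f x :: real) h = c * L2_inner S f h"
  by (simp add: L2_inner_def mult.assoc)

lemma L2_inner_cong_AE:
  assumes "f \<in> L2 S" "f' \<in> L2 S" "g \<in> L2 S" "g' \<in> L2 S"
    and "AE x in lebesgue_on S. f x = f' x" "AE x in lebesgue_on S. g x = g' x"
  shows "L2_inner S f g = L2_inner S f' g'"
  unfolding L2_inner_def
proof (rule integral_cong_AE)
  show "AE x in lebesgue_on S. f x \<bullet> g x = f' x \<bullet> g' x"
    using assms(5,6) by eventually_elim simp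
qed (use L2_integrable_inner[OF assms(1,3)] L2_integrable_inner[OF assms(2,4)] in auto)

lemma L2_norm_nonneg: "0 \<le> L2_norm S f"
  by (simp add: L2_norm_def)

lemma L2_norm_square: "(L2_norm S f)\<^sup>2 = L2_inner S f f"
  by (simp add: L2_norm_def L2_inner_def power2_norm_eq_inner integral_nonneg)

lemma L2_norm_cong_AE:
  assumes "f \<in> L2 S" "g \<in> L2 S" "AE x in lebesgue_on S. f x = g x"
  shows "L2_norm S f = L2_norm S g"
  using L2_inner_cong_AE[OF assms(1,2,1,2,3,3)] L2_norm_square[of S f] L2_norm_square[of S g]
  by (metis L2_norm_nonneg power2_eq_iff_nonneg)

lemma L2_norm_scaleR: "L2_norm S (\<lambda>x. c *\<^sub>R f x) = \<bar>c\<bar> * L2_norm S f"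
  by (simp add: L2_norm_def power_mult_distrib real_sqrt_mult)

lemma L2_norm_minus_commute: "L2_norm S (\<lambda>x. f x - g x) = L2_norm S (\<lambda>x. g x - f x)"
  by (simp add: L2_norm_def norm_minus_commute)

text \<open>The usual quadratic form in two parameters. As functions are not identified almost
  everywhere, the form is only semidefinite, and the case of a vanishing norm is settled by letting
  the parameter make the linear term dominate.\<close>

lemma L2_Cauchy_Schwarz:
  assumes f: "f \<in> L2 S" and g: "g \<in> L2 S"
  shows "\<bar>L2_inner S f g\<bar> \<le> L2_norm S f * L2_norm S g"
proof -
  let ?F = "L2_norm S f" and ?G = "L2_norm S g" and ?I = "L2_inner S f g"
  have q: "0 \<le> s\<^sup>2 * ?F\<^sup>2 - 2 * s * t * ?I + t\<^sup>2 * ?G\<^sup>2" for s t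
  proof -
    have "0 \<le> L2_inner S (\<lambda>x. s *\<^sub>R f x - t *\<^sub>R g x) (\<lambda>x. s *\<^sub>R f x - t *\<^sub>R g x)"
      by (metis L2_norm_square zero_le_power2)
    also have "\<dots> = s * (s * L2_inner S f f) - s * (t * L2_inner S f g) - (t * (s * L2_inner S g f) - t * (t * L2_inner S g g))"
      by (simp add: L2_inner_diff_left L2_inner_diff_right L2_scaleR L2_diff f g L2_inner_scaleR_left
          L2_inner_commute[of S _ "\<lambda>x. _ *\<^sub>R _ x"] L2_inner_commute[of S g f] right_diff_distrib)
    finally show ?thesis
      by (simp add: L2_norm_square L2_norm_square[unfolded power2_eq_square] L2_inner_commute[of S g f]
          power2_eq_square algebra_simps)
  qed
  show ?thesis
  proof (cases "?F * ?G = 0")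
    case False
    then have pos: "?F * ?G > 0" using L2_norm_nonneg[of S f] L2_norm_nonneg[of S g]
      by (metis mult_nonneg_nonneg order_le_less)
    have "?F * ?G * ?I \<le> ?F * ?G * (?F * ?G)" using q[of ?G ?F] by (simp add: power2_eq_square algebra_simps)
    then have 1: "?I \<le> ?F * ?G" using pos mult_le_cancel_left_pos by blast
    have "?F * ?G * (- ?I) \<le> ?F * ?G * (?F * ?G)" using q[of ?G "- ?F"] by (simp add: power2_eq_square algebra_simps)
    then have "- ?I \<le> ?F * ?G" using pos mult_le_cancel_left_pos by blast
    with 1 show ?thesis by simp
  next
    case True
    have "?I = 0"
    proof (rule ccontr)
      assume I: "?I \<noteq> 0"
      from True consider "?F = 0" | "?G = 0" by auto
      then show False
      proof cases
        case 1
        \<comment> \<open>The parameter is chosen so that the linear term equals -2 (G^2 + 1), which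
          beats the remaining quadratic term G^2.\<close>
        with q[of "(?G\<^sup>2 + 1) / ?I" 1] I have "?G\<^sup>2 + 2 \<le> 0" by simp
        then show False using zero_le_power2[of ?G] by linarith
      next
        case 2
        with q[of 1 "(?F\<^sup>2 + 1) / ?I"] I have "?F\<^sup>2 + 2 \<le> 0" by simp
        then show False using zero_le_power2[of ?F] by linarith
      qed
    qed
    with True show ?thesis by (simp only:)
  qed
qed

lemma L2_norm_triangle:
  assumes f: "f \<in> L2 S" and g: "g \<in> L2 S"
  shows "L2_norm S (\<lambda>x. f x + g x) \<le> L2_norm S f + L2_norm S g"
proof (rule power2_le_imp_le)
  have "(L2_norm S (\<lambda>x. f x + g x))\<^sup>2 = L2_inner S f f + 2 * L2_inner S f g + L2_inner S g g"
    by (simp add: L2_norm_square L2_inner_add_left L2_inner_add_right f g L2_add L2_inner_commute[of S g f])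
  also have "\<dots> \<le> (L2_norm S f)\<^sup>2 + 2 * (L2_norm S f * L2_norm S g) + (L2_norm S g)\<^sup>2"
    using L2_Cauchy_Schwarz[OF f g] by (simp add: L2_norm_square)
  also have "\<dots> = (L2_norm S f + L2_norm S g)\<^sup>2" by (simp add: power2_sum)
  finally show "(L2_norm S (\<lambda>x. f x + g x))\<^sup>2 \<le> (L2_norm S f + L2_norm S g)\<^sup>2" .
qed (simp add: L2_norm_nonneg)

lemma L2_norm_diff_triangle:
  assumes "f \<in> L2 S" "g \<in> L2 S" "h \<in> L2 S"
  shows "L2_norm S (\<lambda>x. f x - h x) \<le> L2_norm S (\<lambda>x. f x - g x) + L2_norm S (\<lambda>x. g x - h x)"
  using L2_norm_triangle[OF L2_diff[OF assms(1,2)] L2_diff[OF assms(2,3)]] by simp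

section \<open>Change of representative and restriction to subsets\<close>

lemma borel_measurable_lebesgue_on_AE:
  fixes f :: "'a::euclidean_space \<Rightarrow> real"
  assumes "f \<in> borel_measurable (lebesgue_on S)" "AE x in lebesgue_on S. f x = g x" "S \<in> sets lebesgue"
  shows "g \<in> borel_measurable (lebesgue_on S)"
proof -
  have S: "S \<inter> space lebesgue \<in> sets lebesgue" using assms by simp
  have "AE x in lebesgue. indicator S x *\<^sub>R f x = indicator S x *\<^sub>R g x"
    using assms(2) unfolding AE_restrict_space_iff[OF S] by eventually_elim (auto simp: indicator_def)
  from borel_measurable_AE[OF _ this] assms(1) show ?thesis
    unfolding borel_measurable_restrict_space_iff[OF S] by blast
qed

lemma L2_AE:
  assumes "f \<in> L2 S" "AE x in lebesgue_on S. f x = (g x :: real)" "S \<in> sets lebesgue"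
  shows "g \<in> L2 S"
  by (rule L2_bound[OF borel_measurable_lebesgue_on_AE[OF L2_measurable[OF assms(1)] assms(2,3)] assms(1), of 1])
    (use assms(2) in \<open>auto elim!: eventually_mono\<close>)

lemma L2_subset:
  assumes "f \<in> L2 S" "T \<subseteq> S" "T \<in> sets lebesgue" "S \<in> sets lebesgue"
  shows "f \<in> L2 T"
proof -
  have T: "T \<inter> space lebesgue \<in> sets lebesgue" and S: "S \<inter> space lebesgue \<in> sets lebesgue"
    using assms by auto
  have eq: "indicator T x *\<^sub>R (indicator S x *\<^sub>R f x) = indicator T x *\<^sub>R f x"
    "indicator T x *\<^sub>R (indicator S x *\<^sub>R (norm (f x))\<^sup>2) = indicator T x *\<^sub>R (norm (f x))\<^sup>2" for x
    using assms(2) by (auto simp: indicator_def)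
  have mT: "(indicator T :: _ \<Rightarrow> real) \<in> borel_measurable lebesgue" using assms by simp
  show ?thesis
  proof (rule L2I)
    have mf: "(\<lambda>x. indicator S x *\<^sub>R f x) \<in> borel_measurable lebesgue"
      using assms(1) by (simp add: L2_def borel_measurable_restrict_space_iff[OF S])
    have "(\<lambda>x. indicator T x *\<^sub>R (indicator S x *\<^sub>R f x)) \<in> borel_measurable lebesgue"
      by (rule borel_measurable_scaleR[OF mT mf])
    then show "f \<in> borel_measurable (lebesgue_on T)"
      by (simp only: eq borel_measurable_restrict_space_iff[OF T])
    have "integrable lebesgue (\<lambda>x. indicator S x *\<^sub>R (norm (f x))\<^sup>2)"
      using assms(1) by (simp add: L2_def integrable_restrict_space[OF S])
    from integrable_mult_indicator[OF assms(3) this]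
    show "integrable (lebesgue_on T) (\<lambda>x. (norm (f x))\<^sup>2)"
      by (simp only: eq integrable_restrict_space[OF T])
  qed
qed

lemma L2_norm_subset:
  assumes "f \<in> L2 S" "T \<subseteq> S" "T \<in> sets lebesgue" "S \<in> sets lebesgue"
  shows "L2_norm T f \<le> L2_norm S f"
proof -
  have T: "T \<inter> space lebesgue \<in> sets lebesgue" and S: "S \<inter> space lebesgue \<in> sets lebesgue"
    using assms by auto
  have "integrable lebesgue (\<lambda>x. indicator S x *\<^sub>R (norm (f x))\<^sup>2)"
    using assms(1) by (simp add: L2_def integrable_restrict_space[OF S])
  moreover have "integrable lebesgue (\<lambda>x. indicator T x *\<^sub>R (norm (f x))\<^sup>2)"
    using L2_subset[OF assms] by (simp add: L2_def integrable_restrict_space[OF T])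
  ultimately show ?thesis
    unfolding L2_norm_def integral_restrict_space[OF T] integral_restrict_space[OF S]
    by (intro real_sqrt_le_mono integral_mono) (use assms(2) in \<open>auto simp: indicator_def\<close>)
qed

lemma L2_integrable_finite_measure:
  assumes "f \<in> L2 S" "emeasure lebesgue S < \<infinity>" "S \<in> sets lebesgue"
  shows "integrable (lebesgue_on S) (f :: _ \<Rightarrow> real)"
proof -
  have "(\<lambda>x. 1::real) \<in> L2 S"
    using assms by (intro L2I) (auto simp: integrable_restrict_space)
  from L2_integrable_inner[OF assms(1) this] show ?thesis by simp
qed

lemma L2_locally_integrable:
  assumes "f \<in> L2 S" "S \<in> sets lebesgue"
  shows "locally_integrable S f"
  unfolding locally_integrable_def
proof (intro allI impI, elim conjE)
  fix K assume K: "compact K" "K \<subseteq> S"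
  have Kl: "K \<in> sets lebesgue" using K(1) by (simp add: compact_imp_closed borel_closed)
  have "emeasure lebesgue K < \<infinity>" using emeasure_compact_finite[OF K(1)] K(1)
    by (simp add: compact_imp_closed borel_closed)
  from L2_integrable_finite_measure[OF L2_subset[OF assms(1) K(2) Kl assms(2)] this Kl]
  show "set_integrable lebesgue K f"
    using Kl by (simp add: set_integrable_def integrable_restrict_space)
qed

lemma test_fun_L2:
  assumes \<phi>: "\<phi> \<in> test_fun T" and "S \<in> sets lebesgue"
  shows "\<phi> \<in> L2 S"
proof -
  have "integrable lborel (\<lambda>x. \<phi> x * \<phi> x)"
    by (rule integrable_mult_test_fun[OF test_fun_integrable[OF \<phi>] \<phi>]) auto
  then have "integrable lebesgue (\<lambda>x. (norm (\<phi> x))\<^sup>2)"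
    using test_fun_measurable[OF \<phi>] by (subst integrable_completion) (auto simp: power2_eq_square)
  moreover have "\<phi> \<in> borel_measurable lebesgue" using test_fun_measurable[OF \<phi>] by (simp add: measurable_completion)
  ultimately have "\<phi> \<in> L2 UNIV" by (simp add: L2_def lebesgue_on_UNIV_eq)
  then show ?thesis using assms by (intro L2_subset[of \<phi> UNIV S]) auto
qed

section \<open>Weak derivatives and Sobolev norms\<close>

lemma weak_deriv_works: "is_weak_deriv S is f g \<Longrightarrow> is_weak_deriv S is f (weak_deriv S is f)"
  unfolding weak_deriv_def by (rule someI[where P = "is_weak_deriv S is f"])

lemma integrable_locally_mult_test_fun:
  fixes g :: "real^'n \<Rightarrow> real"
  assumes g: "locally_integrable S g" and \<phi>: "\<phi> \<in> test_fun S" and S: "S \<in> sets lebesgue"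
  shows "integrable (lebesgue_on S) (\<lambda>x. g x * \<phi> x)"
proof -
  obtain C where C: "compact C" "C \<subseteq> S" "\<And>x. x \<notin> C \<Longrightarrow> \<phi> x = 0"
    by (rule test_funE[OF \<phi>]) blast
  have "integrable lebesgue (\<lambda>x. indicator C x *\<^sub>R g x)"
    using g C by (simp add: locally_integrable_def set_integrable_def)
  then have "integrable lebesgue (\<lambda>x. indicator C x *\<^sub>R g x * \<phi> x)"
    by (rule integrable_mult_test_fun[OF _ \<phi>]) auto
  moreover have "(\<lambda>x. indicator C x *\<^sub>R g x * \<phi> x) = (\<lambda>x. indicator S x *\<^sub>R (g x * \<phi> x))"
    using C by (auto simp: fun_eq_iff indicator_def)
  ultimately show ?thesis using S by (simp add: integrable_restrict_space)
qed

lemma weak_deriv_unique: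
  fixes f g g' :: "real^'n \<Rightarrow> real"
  assumes S: "open S" and g: "is_weak_deriv S is f g" and g': "is_weak_deriv S is f g'"
  shows "AE x in lebesgue_on S. g x = g' x"
proof -
  have Sm: "S \<in> sets lebesgue" using S by simp
  have li: "locally_integrable S g" "locally_integrable S g'" using g g' by (auto simp: is_weak_deriv_def)
  have "locally_integrable S (\<lambda>x. g x - g' x)"
    using li by (auto simp: locally_integrable_def intro!: set_integral_diff)
  moreover have "L2_inner S (\<lambda>x. g x - g' x) \<phi> = 0" if "\<phi> \<in> test_fun S" for \<phi>
  proof -
    have "L2_inner S g \<phi> = L2_inner S g' \<phi>"
      using g g' that by (auto simp: is_weak_deriv_def)
    then show ?thesis
      using integrable_locally_mult_test_fun[OF _ that Sm] li
      by (simp add: L2_inner_def left_diff_distrib)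
  qed
  ultimately have "AE x in lborel. x \<in> S \<longrightarrow> g x - g' x = 0" by (intro fundamental_lemma S)
  then show ?thesis using Sm by (simp add: AE_lebesgue_on_iff)
qed

lemma weak_deriv_test_fun:
  assumes S: "open S" and \<phi>: "\<phi> \<in> test_fun S"
  shows "is_weak_deriv S is \<phi> (partial_derivs (rev is) \<phi>)"
proof -
  have Sm: "S \<in> sets borel" "S \<in> sets lebesgue" using S by auto
  have m: "\<psi> \<in> borel_measurable borel" if "\<psi> \<in> test_fun S" for \<psi> using test_fun_measurable[OF that] .
  show ?thesis
    unfolding is_weak_deriv_def
  proof (intro conjI ballI)
    show "locally_integrable S \<phi>" "locally_integrable S (partial_derivs (rev is) \<phi>)"
      using \<phi> by (auto intro!: L2_locally_integrable test_fun_L2 test_fun_partial_derivs Sm)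
    fix \<psi> assume \<psi>: "\<psi> \<in> test_fun S"
    have "L2_inner S \<phi> (partial_derivs is \<psi>) = integral\<^sup>L lborel (\<lambda>x. \<phi> x * partial_derivs is \<psi> x)"
      using \<psi> \<phi> by (intro L2_inner_borel Sm m test_fun_partial_derivs) (auto intro: test_fun_outside test_fun_partial_derivs)
    moreover have "L2_inner S (partial_derivs (rev is) \<phi>) \<psi> = integral\<^sup>L lborel (\<lambda>x. partial_derivs (rev is) \<phi> x * \<psi> x)"
      using \<psi> \<phi> by (intro L2_inner_borel Sm m test_fun_partial_derivs) (auto intro: test_fun_outside)
    ultimately show "L2_inner S \<phi> (partial_derivs is \<psi>) = (- 1) ^ length is * L2_inner S (partial_derivs (rev is) \<phi>) \<psi>"
      using integral_by_parts_list[OF \<psi> \<phi>] by simp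
  qed
qed

lemma weak_deriv_test_fun_eq:
  assumes "open S" "\<phi> \<in> test_fun S"
  shows "AE x in lebesgue_on S. weak_deriv S is \<phi> x = partial_derivs (rev is) \<phi> x"
  using weak_deriv_unique[OF assms(1) weak_deriv_works] weak_deriv_test_fun[OF assms] by blast

lemma Hm_weak_deriv:
  assumes S: "open S" and f: "f \<in> Hm m S" and l: "length is \<le> m"
  shows "is_weak_deriv S is f (weak_deriv S is f)" "weak_deriv S is f \<in> L2 S"
proof -
  obtain g where g: "g \<in> L2 S" "is_weak_deriv S is f g" using f l by (auto simp: Hm_def)
  show w: "is_weak_deriv S is f (weak_deriv S is f)" by (rule weak_deriv_works[OF g(2)])
  show "weak_deriv S is f \<in> L2 S"
    by (rule L2_AE[OF g(1) weak_deriv_unique[OF S g(2) w]]) (use S in auto)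
qed

text \<open>\<open>Hm_norm\<close> uses chosen representatives even at order zero, so the function
  itself has to be recovered from its own chosen representative.\<close>

lemma weak_deriv_Nil:
  assumes S: "open S" and f: "f \<in> L2 S"
  shows "AE x in lebesgue_on S. weak_deriv S [] f x = f x"
proof -
  have "is_weak_deriv S [] f f"
    using L2_locally_integrable[OF f] S by (auto simp: is_weak_deriv_def partial_derivs_def)
  then show ?thesis using weak_deriv_unique[OF S weak_deriv_works] by blast
qed

lemma finite_lists_length_le': "finite {is :: 'n::finite list. length is \<le> m}"
  using finite_lists_length_le[of "UNIV :: 'n set" m] by simp

lemma weak_deriv_le_Hm_norm:
  assumes "length is \<le> m"
  shows "L2_norm S (weak_deriv S is f) \<le> Hm_norm m S f"
proof -
  have "(L2_norm S (weak_deriv S is f))\<^sup>2 \<le> (\<Sum>is | length is \<le> m. (L2_norm S (weak_deriv S is f))\<^sup>2)"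
    by (rule member_le_sum) (use assms in \<open>auto simp: finite_lists_length_le'\<close>)
  then show ?thesis unfolding Hm_norm_def by (simp add: real_le_rsqrt)
qed

lemma L2_norm_le_Hm_norm:
  assumes S: "open S" and f: "f \<in> Hm m S"
  shows "L2_norm S f \<le> Hm_norm m S f"
proof -
  have "f \<in> L2 S" using f by (simp add: Hm_def)
  then have "L2_norm S f = L2_norm S (weak_deriv S [] f)"
    using Hm_weak_deriv(2)[OF S f, of "[]"] AE_symmetric[OF weak_deriv_Nil[OF S \<open>f \<in> L2 S\<close>]]
    by (intro L2_norm_cong_AE) auto
  then show ?thesis using weak_deriv_le_Hm_norm[of "[]" m S f] by simp
qed

lemma Hm_norm_mono: "m \<le> n \<Longrightarrow> Hm_norm m S f \<le> Hm_norm n S f"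
  unfolding Hm_norm_def by (intro real_sqrt_le_mono sum_mono2) (auto simp: finite_lists_length_le')

lemma Hm_mono: "m \<le> n \<Longrightarrow> Hm n S \<subseteq> Hm m S"
  by (auto simp: Hm_def)

lemma Hm_norm_nonneg: "0 \<le> Hm_norm m S f"
  by (simp add: Hm_norm_def sum_nonneg)

lemma test_fun_Hm:
  assumes S: "open S" and \<phi>: "\<phi> \<in> test_fun S"
  shows "\<phi> \<in> Hm m S"
proof -
  have Sm: "S \<in> sets lebesgue" using S by simp
  show ?thesis
    using test_fun_L2[OF \<phi> Sm] weak_deriv_test_fun[OF S \<phi>] test_fun_L2[OF test_fun_partial_derivs[OF \<phi>] Sm]
    by (auto simp: Hm_def)
qed

lemma L2_norm_zero: "L2_norm S (\<lambda>x. 0) = 0"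
  by (simp add: L2_norm_def)

lemma partial_derivs_zero: "partial_derivs is (\<lambda>x. 0) = (\<lambda>x. 0)"
proof (induction "is")
  case (Cons i "is")
  then have "partial_derivs (i # is) (\<lambda>x. 0) = partial_deriv i (\<lambda>x. 0)"
    by (simp add: partial_derivs_def)
  then show ?case by (simp add: partial_deriv_def fun_eq_iff)
qed (simp add: partial_derivs_def)

text \<open>The constant sequence approximates \<phi>. What has to be checked is that the zero
  function has zero Sobolev norm: its chosen weak derivatives are zero only almost
  everywhere.\<close>

lemma test_fun_H20:
  assumes S: "open S" and \<phi>: "\<phi> \<in> test_fun S"
  shows "\<phi> \<in> H20 S"
proof -
  have "L2_norm S (weak_deriv S is (\<lambda>x. 0)) = L2_norm S (\<lambda>x. 0 :: real)" if "length is \<le> 2" for "is" :: "'a list"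
    using Hm_weak_deriv(2)[OF S test_fun_Hm[OF S zero_test_fun] that] weak_deriv_test_fun_eq[OF S zero_test_fun, of "is"]
    by (intro L2_norm_cong_AE L2_zero) (auto simp: partial_derivs_zero)
  then have "Hm_norm 2 S (\<lambda>x. 0) = 0"
    by (simp add: Hm_norm_def L2_norm_zero)
  then show ?thesis
    unfolding H20_def using test_fun_Hm[OF S \<phi>] \<phi> by (auto intro!: exI[of _ "\<lambda>_. \<phi>"])
qed

lemma Linf_measurable: "f \<in> Linf S \<Longrightarrow> f \<in> borel_measurable (lebesgue_on S)"
  by (simp add: Linf_def)

text \<open>Integrating by parts reverses the order of the derivatives of the test function; instead of
  proving that they commute, the symmetry of the coefficients in the last two indices is used.\<close>

lemma bilinear_a_test_fun:
  assumes S: "open S" and A: "admissible_coeffs S A" and w: "w \<in> Hm 2 S" and \<phi>: "\<phi> \<in> test_fun S"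
  shows "bilinear_a S A w \<phi> = (\<Sum>i\<in>UNIV. \<Sum>j\<in>UNIV. \<Sum>k\<in>UNIV. \<Sum>l\<in>UNIV.
        L2_inner S (\<lambda>x. A i j k l x * weak_deriv S [i, j] w x) (partial_derivs [k, l] \<phi>))"
  unfolding bilinear_a_def
proof (rule sum.cong[OF refl], rule sum.cong[OF refl])
  fix i j
  have "integral\<^sup>L (lebesgue_on S) (\<lambda>x. A i j k l x * weak_deriv S [i, j] w x * weak_deriv S [k, l] \<phi> x) =
    L2_inner S (\<lambda>x. A i j l k x * weak_deriv S [i, j] w x) (partial_derivs [l, k] \<phi>)" for k l
    unfolding L2_inner_def
  proof (rule integral_cong_AE)
    have "AE x in lebesgue_on S. A i j k l x = A i j l k x"
      using A by (auto simp: admissible_coeffs_def elim!: eventually_mono)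
    with weak_deriv_test_fun_eq[OF S \<phi>, of "[k, l]"]
    show "AE x in lebesgue_on S. A i j k l x * weak_deriv S [i, j] w x * weak_deriv S [k, l] \<phi> x =
        (A i j l k x * weak_deriv S [i, j] w x) \<bullet> partial_derivs [l, k] \<phi> x"
      by eventually_elim simp
    have [measurable]: "A i j k l \<in> borel_measurable (lebesgue_on S)" for i j k l
      using A by (auto simp: admissible_coeffs_def intro!: Linf_measurable)
    have [measurable]: "weak_deriv S [i, j] w \<in> borel_measurable (lebesgue_on S)"
      using Hm_weak_deriv(2)[OF S w, of "[i, j]"] by (auto intro: L2_measurable)
    have [measurable]: "weak_deriv S [k, l] \<phi> \<in> borel_measurable (lebesgue_on S)"
      using Hm_weak_deriv(2)[OF S test_fun_Hm[OF S \<phi>], of "[k, l]" 2] by (auto intro: L2_measurable)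
    have [measurable]: "partial_derivs [l, k] \<phi> \<in> borel_measurable (lebesgue_on S)"
      using test_fun_L2[OF test_fun_partial_derivs[OF \<phi>], of S "[l, k]"] S by (auto intro: L2_measurable)
    show "(\<lambda>x. A i j k l x * weak_deriv S [i, j] w x * weak_deriv S [k, l] \<phi> x) \<in> borel_measurable (lebesgue_on S)"
      "(\<lambda>x. (A i j l k x * weak_deriv S [i, j] w x) \<bullet> partial_derivs [l, k] \<phi> x) \<in> borel_measurable (lebesgue_on S)"
      by measurable
  qed
  then show "(\<Sum>k\<in>UNIV. \<Sum>l\<in>UNIV. integral\<^sup>L (lebesgue_on S) (\<lambda>x. A i j k l x * weak_deriv S [i, j] w x * weak_deriv S [k, l] \<phi> x)) =
      (\<Sum>k\<in>UNIV. \<Sum>l\<in>UNIV. L2_inner S (\<lambda>x. A i j k l x * weak_deriv S [i, j] w x) (partial_derivs [k, l] \<phi>))"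
    by (subst (2) sum.swap) simp
qed

text \<open>This turns the weak equations of the KKT system into the distributional equation under
  which (A1) gives the error of the scheme.\<close>

lemma solves_pdeI:
  assumes S: "open S" and A: "admissible_coeffs S A" and w: "w \<in> Hm 2 S"
    and "\<And>\<phi>. \<phi> \<in> H20 S \<Longrightarrow> bilinear_a S A w \<phi> = L2_inner S g \<phi>"
  shows "solves_pde S A w g"
  using assms(4)[OF test_fun_H20[OF S]] by (simp add: solves_pde_def bilinear_a_test_fun[OF S A w])

section \<open>Sobolev functions along affine maps\<close>

lemma integrable_pair_times_indicator:
  fixes w :: "'a::euclidean_space \<Rightarrow> real"
  assumes "integrable lborel w"
  shows "integrable (lborel \<Otimes>\<^sub>M lborel) (\<lambda>(t::real, z). indicator {0..1} t * w z)"
proof (rule lborel_pair.Fubini_integrable)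
  have [measurable]: "w \<in> borel_measurable borel" using borel_measurable_integrable[OF assms] by simp
  show "(\<lambda>(t::real, z). indicator {0..1} t * w z) \<in> borel_measurable (lborel \<Otimes>\<^sub>M lborel)" by measurable
  show "integrable lborel (\<lambda>t::real. LBINT z. norm (case (t, z) of (t, z) \<Rightarrow> indicator {0..1} t * w z))"
    by (simp add: abs_mult)
  show "AE t::real in lborel. integrable lborel (\<lambda>z. case (t, z) of (t, z) \<Rightarrow> indicator {0..1} t * w z)"
    using assms by simp
qed

lemma integrable_mult_bound:
  fixes f g :: "'a \<Rightarrow> real"
  assumes "integrable M f" "g \<in> borel_measurable M" "\<And>x. \<bar>g x\<bar> \<le> C * \<bar>f x\<bar>"
  shows "integrable M g"
  by (rule Bochner_Integration.integrable_bound[of _ "\<lambda>x. C * \<bar>f x\<bar>"])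
    (use assms order_trans[OF _ abs_ge_self] in auto)

lemma one_plus_mult_ge_min:
  fixes \<beta> t :: real
  assumes "0 \<le> t" "t \<le> 1"
  shows "1 + t * \<beta> \<ge> min 1 (1 + \<beta>)"
proof (cases "\<beta> \<ge> 0")
  case False
  then have "t * \<beta> \<ge> 1 * \<beta>" using assms by (intro mult_right_mono_neg) auto
  then show ?thesis by simp
qed (use assms in simp)

text \<open>For fixed \<open>t\<close> the L1 norm along the map is that of \<open>g\<close> divided
  by the d-th power of 1 + t \<beta>. This ratio stays positive on [0, 1], so the norm is continuous
  in \<open>t\<close> and Fubini applies.\<close>

lemma integrable_pair_scale_shift:
  fixes g :: "'a::euclidean_space \<Rightarrow> real"
  assumes g: "integrable lborel g" and \<beta>: "\<beta> > -1"
  shows "integrable (lborel \<Otimes>\<^sub>M lborel) (\<lambda>(t::real, x). indicator {0..1} t * g ((1 + t * \<beta>) *\<^sub>R x + t *\<^sub>R v))"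
proof (rule lborel_pair.Fubini_integrable)
  have [measurable]: "g \<in> borel_measurable borel" using borel_measurable_integrable[OF g] by simp
  have pos: "1 + t * \<beta> > 0" if "t \<in> {0..1}" for t
    using one_plus_mult_ge_min[of t \<beta>] \<beta> that by auto
  show "(\<lambda>(t::real, x). indicator {0..1} t * g ((1 + t * \<beta>) *\<^sub>R x + t *\<^sub>R v)) \<in> borel_measurable (lborel \<Otimes>\<^sub>M lborel)"
    by measurable
  have I: "(LBINT x. norm (g ((1 + t * \<beta>) *\<^sub>R x + t *\<^sub>R v))) = (1 / (1 + t * \<beta>)) ^ DIM('a) * (LBINT x. norm (g x))"
    if "t \<in> {0..1}" for t
    using integral_scale_shift[of "\<lambda>x. norm (g x)" "1 + t * \<beta>" "t *\<^sub>R v"] pos[OF that] by (simp add: field_simps)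
  have "integrable lborel (\<lambda>t. indicator {0..1} t *\<^sub>R ((1 / (1 + t * \<beta>)) ^ DIM('a) * (LBINT x. norm (g x))))"
    using pos by (intro borel_integrable_compact continuous_intros) fastforce+
  then show "integrable lborel (\<lambda>t::real. LBINT x. norm (case (t, x) of (t, x) \<Rightarrow> indicator {0..1} t * g ((1 + t * \<beta>) *\<^sub>R x + t *\<^sub>R v)))"
    by (rule back_subst[where P = "integrable lborel"]) (auto simp: fun_eq_iff indicator_def I[unfolded real_norm_def])
  show "AE t::real in lborel. integrable lborel (\<lambda>x. case (t, x) of (t, x) \<Rightarrow> indicator {0..1} t * g ((1 + t * \<beta>) *\<^sub>R x + t *\<^sub>R v))"
  proof (rule AE_I2)
    fix t :: real
    show "integrable lborel (\<lambda>x. case (t, x) of (t, x) \<Rightarrow> indicator {0..1} t * g ((1 + t * \<beta>) *\<^sub>R x + t *\<^sub>R v))"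
      using integrable_scale_shift[OF g, of "1 + t * \<beta>" "t *\<^sub>R v"] pos[of t] by (cases "t \<in> {0..1}") auto
  qed
qed

text \<open>The formula is tested with \<open>\<phi> \<in> test_fun U\<close>. Changing variables moves the affine maps to \<open>\<phi>\<close>, where the
  fundamental theorem of calculus applies pointwise, and the derivative in \<open>t\<close> of the transported density
  \<open>\<phi> (S\<^sub>t z) / \<Lambda>\<^sub>t\<^sup>d\<close> is a divergence in \<open>z\<close>, so that the definition of the weak gradient takes over.
  This avoids approximating \<open>w\<close> by smooth functions.\<close>

lemma weak_gradient_along_affine_maps:
  fixes w :: "real^'n \<Rightarrow> real" and g :: "'n \<Rightarrow> real^'n \<Rightarrow> real"
  assumes w: "integrable lborel w" and g: "\<And>i. integrable lborel (g i)"
    and weak: "\<And>i \<phi>. \<phi> \<in> test_fun K \<Longrightarrow>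
      (LBINT x. w x * partial_deriv i \<phi> x) = - (LBINT x. g i x * \<phi> x)"
    and U: "open U" and \<beta>: "\<beta> > -1"
    and T: "\<And>t x. 0 \<le> t \<Longrightarrow> t \<le> 1 \<Longrightarrow> x \<in> U \<Longrightarrow> (1 + t * \<beta>) *\<^sub>R x + t *\<^sub>R v \<in> K"
  shows "AE x in lborel. x \<in> U \<longrightarrow> w ((1 + \<beta>) *\<^sub>R x + v) - w x =
    (LBINT t. indicator {0..1} t * (\<Sum>i\<in>UNIV. g i ((1 + t * \<beta>) *\<^sub>R x + t *\<^sub>R v) * (\<beta> * x $ i + v $ i)))"
proof -
  let ?d = "CARD('n)"
  \<comment> \<open>\<open>Tt t\<close> joins the identity at t = 0 to the affine map of the
    statement at t = 1, with ratio \<open>\<Lambda> t\<close>; \<open>St t\<close> is the inverse of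
    \<open>Tt t\<close>.\<close>
  define \<Lambda> where "\<Lambda> t = 1 + t * \<beta>" for t
  define Tt where "Tt t x = \<Lambda> t *\<^sub>R x + t *\<^sub>R v" for t and x :: "real^'n"
  define St where "St t z = (1 / \<Lambda> t) *\<^sub>R z + (- t / \<Lambda> t) *\<^sub>R v" for t and z :: "real^'n"
  define R where "R x = (LBINT t. indicator {0..1} t * (\<Sum>i\<in>UNIV. g i (Tt t x) * (\<beta> * x $ i + v $ i)))" for x
  have [measurable]: "w \<in> borel_measurable borel" "\<And>i. g i \<in> borel_measurable borel"
    using borel_measurable_integrable[OF w] borel_measurable_integrable[OF g] by simp_all
  have [measurable]: "\<Lambda> \<in> borel_measurable borel" unfolding \<Lambda>_def by measurable
  have pos: "\<Lambda> t \<ge> min 1 (1 + \<beta>)" "\<Lambda> t > 0" if "0 \<le> t" "t \<le> 1" for t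
  proof -
    show "\<Lambda> t \<ge> min 1 (1 + \<beta>)" unfolding \<Lambda>_def by (rule one_plus_mult_ge_min[OF that])
    then show "\<Lambda> t > 0" using \<beta> by linarith
  qed
  have ST: "St t (Tt t x) = x" if "0 \<le> t" "t \<le> 1" for t x
    using pos(2)[OF that] by (simp add: St_def Tt_def scaleR_add_right)
  have TS: "Tt t (St t z) = z" if "0 \<le> t" "t \<le> 1" for t z
    using pos(2)[OF that] by (simp add: St_def Tt_def scaleR_diff_right)
  have Gint: "integrable (lborel \<Otimes>\<^sub>M lborel) (\<lambda>(t, x). indicator {0..1} t * g i (Tt t x))" for i
    unfolding Tt_def \<Lambda>_def by (rule integrable_pair_scale_shift[OF g \<beta>])
  have coord [measurable]: "(\<lambda>x::real^'n. x $ i) \<in> borel_measurable borel" for i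
    by (intro borel_measurable_continuous_onI continuous_intros)
  have [measurable]: "(\<lambda>x. g i (Tt (fst x) (snd x))) \<in> borel_measurable (borel \<Otimes>\<^sub>M borel)" for i
    unfolding Tt_def by measurable
  \<comment> \<open>The weight \<open>c\<close> makes the velocity \<beta> x + v bounded. It will be
    the indicator of a compact set, for local integrability of the remainder, and later the test
    function.\<close>
  have Gint2: "integrable (lborel \<Otimes>\<^sub>M lborel) (\<lambda>(t, x). indicator {0..1} t * (\<Sum>i\<in>UNIV. g i (Tt t x) * (c x * (\<beta> * x $ i + v $ i))))"
    if [measurable]: "c \<in> borel_measurable borel" and c: "\<And>x i. \<bar>c x * (\<beta> * x $ i + v $ i)\<bar> \<le> M" for c M
  proof -
    have "integrable (lborel \<Otimes>\<^sub>M lborel) (\<lambda>(t, x). indicator {0..1} t * g i (Tt t x) * (c x * (\<beta> * x $ i + v $ i)))" for i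
    proof (rule integrable_mult_bound[OF Gint[of i], where C = M])
      show "\<bar>case p of (t, x) \<Rightarrow> indicator {0..1} t * g i (Tt t x) * (c x * (\<beta> * x $ i + v $ i))\<bar>
          \<le> M * \<bar>case p of (t, x) \<Rightarrow> indicator {0..1} t * g i (Tt t x)\<bar>" for p
        using mult_left_mono[OF c[of "snd p" i] abs_ge_zero[of "indicator {0..1} (fst p) * g i (Tt (fst p) (snd p))"]]
        by (simp only: split_beta' abs_mult mult.commute[of M])
    qed (simp add: split_beta')
    then have "integrable (lborel \<Otimes>\<^sub>M lborel) (\<lambda>p. \<Sum>i\<in>UNIV. (\<lambda>(t, x). indicator {0..1} t * g i (Tt t x) * (c x * (\<beta> * x $ i + v $ i))) p)"
      by (intro Bochner_Integration.integrable_sum)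
    then show ?thesis
      by (rule back_subst[where P = "integrable (lborel \<Otimes>\<^sub>M lborel)"])
        (simp add: fun_eq_iff sum_distrib_left mult.assoc)
  qed
  have [measurable]: "(\<lambda>x. Tt t x) \<in> borel_measurable borel" for t unfolding Tt_def by measurable
  have [measurable]: "R \<in> borel_measurable borel"
    unfolding R_def Tt_def by measurable
  have R_mult: "c x * R x = (LBINT t. indicator {0..1} t * (\<Sum>i\<in>UNIV. g i (Tt t x) * (c x * (\<beta> * x $ i + v $ i))))" for c x
  proof -
    have "c x * R x = (LBINT t. c x * (indicator {0..1} t * (\<Sum>i\<in>UNIV. g i (Tt t x) * (\<beta> * x $ i + v $ i))))"
      unfolding R_def by simp
    also have "\<dots> = (LBINT t. indicator {0..1} t * (\<Sum>i\<in>UNIV. g i (Tt t x) * (c x * (\<beta> * x $ i + v $ i))))"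
      by (intro Bochner_Integration.integral_cong refl) (simp only: sum_distrib_left mult_ac)
    finally show ?thesis .
  qed
  have R_int: "integrable lborel (\<lambda>x. c x * R x)"
    if "c \<in> borel_measurable borel" and "\<And>x i. \<bar>c x * (\<beta> * x $ i + v $ i)\<bar> \<le> M" for c M
    using lborel_pair.integrable_snd[OF Gint2[OF that]] by (simp add: R_mult)
  define h where "h x = w (Tt 1 x) - w x - R x" for x
  have [measurable]: "h \<in> borel_measurable borel" unfolding h_def by measurable
  have wT: "integrable lborel (\<lambda>x. w (Tt 1 x))"
    unfolding Tt_def using pos(2)[of 1] by (intro integrable_scale_shift w) auto
  have "AE x in lborel. x \<in> U \<longrightarrow> h x = 0"
  proof (rule fundamental_lemma[OF U])
    show "locally_integrable U h"
      unfolding locally_integrable_def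
    proof (intro allI impI, elim conjE)
      fix C :: "(real^'n) set" assume C: "compact C" "C \<subseteq> U"
      then have [measurable]: "C \<in> sets borel" by (simp add: compact_imp_closed)
      obtain B where B: "\<And>x. x \<in> C \<Longrightarrow> norm x \<le> B" using compact_imp_bounded[OF C(1)] by (auto simp: bounded_iff)
      have "\<bar>indicator C x * (\<beta> * x $ i + v $ i)\<bar> \<le> \<bar>\<bar>\<beta>\<bar> * B\<bar> + norm v" for x i
      proof (cases "x \<in> C")
        case True
        have "\<bar>\<beta> * x $ i + v $ i\<bar> \<le> \<bar>\<beta>\<bar> * \<bar>x $ i\<bar> + \<bar>v $ i\<bar>" by (metis abs_mult abs_triangle_ineq)
        also have "\<dots> \<le> \<bar>\<beta>\<bar> * B + norm v"
          using B[OF True] component_le_norm_cart[of x i] component_le_norm_cart[of v i]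
          by (intro add_mono mult_left_mono) auto
        finally show ?thesis using True by simp
      qed auto
      from R_int[OF _ this] have "integrable lborel (\<lambda>x. indicator C x * R x)" by simp
      moreover have "integrable lborel (\<lambda>x. indicator C x * w x)" "integrable lborel (\<lambda>x. indicator C x * w (Tt 1 x))"
        using integrable_mult_indicator[OF _ w, of C] integrable_mult_indicator[OF _ wT, of C] by simp_all
      ultimately have "integrable lborel (\<lambda>x. indicator C x *\<^sub>R h x)"
        by (simp add: h_def right_diff_distrib)
      then show "set_integrable lebesgue C h"
        unfolding set_integrable_def by (subst integrable_completion) auto
    qed
  next
    fix \<phi> assume \<phi>: "\<phi> \<in> test_fun U"
    have [measurable]: "\<phi> \<in> borel_measurable borel" by (rule test_fun_measurable[OF \<phi>])
    \<comment> \<open>The vector field \<theta> is \<phi> times the velocity \<beta> x + v; its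
      divergence is the source of the time derivative below.\<close>
    define \<theta> where "\<theta> i x = (\<beta> * x $ i + v $ i) * \<phi> x" for i x
    have lin: "Ck k (\<lambda>x::real^'n. \<beta> * x $ i + v $ i)" for i k
      by (intro Ck_add Ck_mult Ck_const Ck_coord)
    have \<theta>: "\<theta> i \<in> test_fun U" for i
      unfolding \<theta>_def by (rule test_fun_mult[OF \<phi> lin])
    have [measurable]: "\<theta> i \<in> borel_measurable borel" for i by (rule test_fun_measurable[OF \<theta>])
    have d\<theta>: "partial_deriv i (\<theta> i) x = (\<beta> * x $ i + v $ i) * partial_deriv i \<phi> x + \<beta> * \<phi> x" for i x
    proof -
      have "((\<lambda>r. \<beta> * r + v $ i) has_field_derivative \<beta>) (at r)" for r by (auto intro!: derivative_eq_intros)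
      from partial_deriv_coord[where g = "\<lambda>r. \<beta> * r + v $ i" and i = i, OF has_derivative_coord[OF this, where j = i and x = x]]
      have "partial_deriv i (\<lambda>x::real^'n. \<beta> * x $ i + v $ i) x = \<beta>" by simp
      moreover have "(\<lambda>x::real^'n. \<beta> * x $ i + v $ i) differentiable (at x)"
        using lin[of "Suc 0" i] by simp
      ultimately show ?thesis
        unfolding \<theta>_def by (subst partial_deriv_mult) (auto intro: test_fun_differentiable[OF \<phi>])
    qed
    have d\<theta>_t: "partial_deriv i (\<theta> i) \<in> test_fun U" for i by (rule test_fun_partial_deriv[OF \<theta>])
    have [measurable]: "partial_deriv i (\<theta> i) \<in> borel_measurable borel" for i by (rule test_fun_measurable[OF d\<theta>_t])
    \<comment> \<open>Only here does it matter that the paths starting in \<open>U\<close> remain in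
      \<open>K\<close>: the transported field has its support in the image of a compact subset of
      \<open>U\<close>, hence is admissible in the weak derivative on \<open>K\<close>.\<close>
    have \<theta>S: "(\<lambda>z. \<theta> i (St t z)) \<in> test_fun K" if t: "0 \<le> t" "t \<le> 1" for i t
    proof -
      obtain C where C: "compact C" "C \<subseteq> U" "\<And>x. x \<notin> C \<Longrightarrow> \<theta> i x = 0"
        by (rule test_funE[OF \<theta>]) blast
      show ?thesis
      proof (rule test_funI[of _ "Tt t ` C"])
        show "Ck k (\<lambda>z. \<theta> i (St t z))" for k
          unfolding St_def by (rule Ck_scale_shift[OF test_fun_Ck[OF \<theta>]])
        show "compact (Tt t ` C)"
          unfolding Tt_def using C(1) by (intro compact_continuous_image continuous_intros)
        show "Tt t ` C \<subseteq> K" using T[OF t] C(2) by (auto simp: Tt_def \<Lambda>_def)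
        show "\<theta> i (St t x) = 0" if "x \<notin> Tt t ` C" for x
          using that TS[OF t, of x] by (intro C(3)) (metis image_eqI)
      qed
    qed
    \<comment> \<open>The time derivative of \<phi>(S_t z) / \<Lambda>_t^d. Since S_t z moves with
      velocity -(\<beta> S_t z + v) / \<Lambda>_t, differentiating the two factors produces exactly
      minus the divergence in z of \<theta>(S_t z) / \<Lambda>_t^d.\<close>
    define P where "P t z = - ((1 / \<Lambda> t) ^ ?d * (\<Sum>i\<in>UNIV. (1 / \<Lambda> t) * partial_deriv i (\<theta> i) (St t z)))" for t z
    have FTC: "(LBINT t. indicator {0..1} t * P t z) = (1 / \<Lambda> 1) ^ ?d * \<phi> (St 1 z) - \<phi> z" for z
    proof -
      define \<psi> where "\<psi> t = (1 / \<Lambda> t) ^ ?d * \<phi> (St t z)" for t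
      have "(LBINT t. indicator {0..1} t *\<^sub>R P t z) = \<psi> 1 - \<psi> 0"
      proof (rule integral_FTC_Icc)
        fix t :: real assume t: "0 \<le> t" "t \<le> 1"
        have Lp: "\<Lambda> t > 0" by (rule pos(2)[OF t])
        have dL: "(\<Lambda> has_field_derivative \<beta>) (at t within {0..1})"
          unfolding \<Lambda>_def by (auto intro!: derivative_eq_intros)
        have dS: "((\<lambda>t. St t z) has_vector_derivative (- (1 / \<Lambda> t)) *\<^sub>R (\<beta> *\<^sub>R St t z + v)) (at t within {0..1})"
          unfolding St_def using Lp
          by ((auto intro!: derivative_eq_intros dL simp: scaleR_add_right field_simps power2_eq_square)[1],
              simp add: scaleR_add_left[symmetric] add_divide_distrib[symmetric])
        have d1: "((\<lambda>t. \<phi> (St t z)) has_field_derivative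
            (\<Sum>i\<in>UNIV. ((- (1 / \<Lambda> t)) *\<^sub>R (\<beta> *\<^sub>R St t z + v)) $ i * partial_deriv i \<phi> (St t z))) (at t within {0..1})"
          by (rule has_field_derivative_along_curve[OF test_fun_differentiable[OF \<phi>] dS])
        have d2: "((\<lambda>t. (1 / \<Lambda> t) ^ ?d) has_field_derivative (- (real ?d * \<beta> * (1 / \<Lambda> t) ^ ?d * (1 / \<Lambda> t)))) (at t within {0..1})"
        proof -
          have power_eq: "\<Lambda> t ^ n = \<Lambda> t * \<Lambda> t ^ (n - Suc 0)" if "n \<noteq> 0" for n
            using that by (cases n) auto
          show ?thesis
            using Lp by ((cases "?d"; auto intro!: derivative_eq_intros dL simp: field_simps power2_eq_square),
                use power_eq in blast)
        qed
        have "(\<psi> has_field_derivative P t z) (at t within {0..1})"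
          unfolding \<psi>_def
          by (rule DERIV_cong[OF DERIV_mult[OF d2 d1]])
            (simp add: P_def d\<theta> sum.distrib sum_distrib_left algebra_simps sum_negf sum_subtractf)
        then show "(\<psi> has_vector_derivative P t z) (at t within {0..1})"
          by (simp add: has_real_derivative_iff_has_vector_derivative)
      next
        have c: "continuous_on {0..1} \<Lambda>" unfolding \<Lambda>_def by (intro continuous_intros)
        have ne: "\<forall>t\<in>{0..1}. \<Lambda> t \<noteq> 0" using pos(2) by fastforce
        have cS: "continuous_on {0..1} (\<lambda>t. St t z)"
          unfolding St_def by (intro continuous_intros c ne)
        have "continuous_on {0..1} (\<lambda>t. partial_deriv i (\<theta> i) (St t z))" for i
          by (rule continuous_on_compose2[OF test_fun_continuous[OF d\<theta>_t] cS]) simp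
        then show "continuous_on {0..1} (\<lambda>t. P t z)"
          unfolding P_def by (intro continuous_intros c ne)
      qed simp
      then show ?thesis by (simp add: \<psi>_def \<Lambda>_def St_def)
    qed
    obtain M where M: "\<And>i x. \<bar>partial_deriv i (\<theta> i) x\<bar> \<le> M"
    proof -
      have "\<forall>i. \<exists>M. \<forall>x. \<bar>partial_deriv i (\<theta> i) x\<bar> \<le> M"
        using test_fun_bounded[OF d\<theta>_t] by metis
      then obtain M where M: "\<And>i x. \<bar>partial_deriv i (\<theta> i) x\<bar> \<le> M i" by metis
      have "\<bar>partial_deriv i (\<theta> i) x\<bar> \<le> Max (range M)" for i x
        by (rule order_trans[OF M[of i x] Max_ge]) auto
      then show ?thesis by (rule that)
    qed
    have [measurable]: "(\<lambda>p. P (fst p) (snd p)) \<in> borel_measurable (borel \<Otimes>\<^sub>M borel)"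
      unfolding P_def St_def by measurable
    define m where "m = min 1 (1 + \<beta>)"
    have m: "m > 0" using \<beta> by (simp add: m_def)
    have Pb: "\<bar>P t z\<bar> \<le> (1 / m) ^ ?d * (\<Sum>i\<in>(UNIV::'n set). (1 / m) * M)" if t: "0 \<le> t" "t \<le> 1" for t z
    proof -
      have L: "0 < 1 / \<Lambda> t" "1 / \<Lambda> t \<le> 1 / m"
        using pos[OF t] m by (auto simp: m_def intro!: divide_left_mono)
      have M0: "M \<ge> 0" using M order_trans abs_ge_zero by blast
      have "\<bar>\<Sum>i\<in>UNIV. (1 / \<Lambda> t) * partial_deriv i (\<theta> i) (St t z)\<bar> \<le> (\<Sum>i\<in>(UNIV::'n set). (1 / m) * M)"
        using L M M0 m by (intro order_trans[OF sum_abs] sum_mono) (auto simp: abs_mult simp del: times_divide_eq_left intro!: mult_mono)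
      moreover have "(1 / \<Lambda> t) ^ ?d \<le> (1 / m) ^ ?d" using L by (intro power_mono) auto
      ultimately show ?thesis
        unfolding P_def abs_minus_cancel abs_mult using L m by (intro mult_mono) auto
    qed
    have Pint: "integrable (lborel \<Otimes>\<^sub>M lborel) (\<lambda>(t, z). indicator {0..1} t * P t z * w z)"
    proof (rule integrable_mult_bound[OF integrable_pair_times_indicator[OF w]])
      show "\<bar>case p of (t, z) \<Rightarrow> indicator {0..1} t * P t z * w z\<bar> \<le>
          (1 / m) ^ ?d * (\<Sum>i\<in>(UNIV::'n set). (1 / m) * M) * \<bar>case p of (t, z) \<Rightarrow> indicator {0..1} t * w z\<bar>" for p
      proof (cases p)
        case (Pair t z)
        show ?thesis
        proof (cases "t \<in> {0..1}")
          case True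
          then show ?thesis using mult_right_mono[OF Pb[of t z] abs_ge_zero[of "w z"]] Pair
            by (simp add: abs_mult mult_ac)
        qed (simp add: Pair)
      qed
    qed (simp add: split_beta')
    \<comment> \<open>The divergence is moved onto \<open>w\<close> by the weak derivative;
      substituting z = T_t x then cancels the power of \<Lambda>_t.\<close>
    have inner: "(LBINT z. P t z * w z) = (LBINT x. (\<Sum>i\<in>UNIV. g i (Tt t x) * \<theta> i x))" if t: "0 \<le> t" "t \<le> 1" for t
    proof -
      have Lp: "\<Lambda> t > 0" by (rule pos(2)[OF t])
      have pd: "partial_deriv i (\<lambda>z. \<theta> i (St t z)) z = (1 / \<Lambda> t) * partial_deriv i (\<theta> i) (St t z)" for i z
        unfolding St_def by (rule partial_deriv_scale_shift[OF test_fun_differentiable[OF \<theta>]])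
      have int1: "integrable lborel (\<lambda>z. w z * partial_deriv i (\<lambda>z. \<theta> i (St t z)) z)" for i
        by (rule integrable_mult_test_fun[OF w test_fun_partial_deriv[OF \<theta>S[OF t]]]) auto
      have "(LBINT z. P t z * w z) = (LBINT z. - ((1 / \<Lambda> t) ^ ?d) * (\<Sum>i\<in>UNIV. w z * partial_deriv i (\<lambda>z. \<theta> i (St t z)) z))"
        by (intro Bochner_Integration.integral_cong refl)
          (simp add: P_def pd sum_distrib_left sum_distrib_right mult_ac sum_negf)
      also have "\<dots> = - ((1 / \<Lambda> t) ^ ?d) * (\<Sum>i\<in>UNIV. LBINT z. w z * partial_deriv i (\<lambda>z. \<theta> i (St t z)) z)"
        using int1 by (simp only: integral_mult_right_zero Bochner_Integration.integral_sum)
      also have "\<dots> = (\<Sum>i\<in>UNIV. (1 / \<Lambda> t) ^ ?d * (LBINT z. g i z * \<theta> i (St t z)))"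
        using weak[OF \<theta>S[OF t]] by (simp add: sum_negf sum_distrib_left)
      also have "\<dots> = (\<Sum>i\<in>UNIV. LBINT x. g i (Tt t x) * \<theta> i x)"
      proof (intro sum.cong refl)
        fix i
        have [measurable]: "(\<lambda>z. \<theta> i (St t z)) \<in> borel_measurable borel" by (rule test_fun_measurable[OF \<theta>S[OF t]])
        have "(LBINT z. g i z * \<theta> i (St t z)) = \<bar>\<Lambda> t\<bar> ^ DIM(real^'n) * (LBINT x. g i (\<Lambda> t *\<^sub>R x + t *\<^sub>R v) * \<theta> i (St t (\<Lambda> t *\<^sub>R x + t *\<^sub>R v)))"
          using Lp by (intro integral_scale_shift[where f = "\<lambda>z. g i z * \<theta> i (St t z)"]) auto
        then show "(1 / \<Lambda> t) ^ ?d * (LBINT z. g i z * \<theta> i (St t z)) = (LBINT x. g i (Tt t x) * \<theta> i x)"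
          using Lp ST[OF t] by (simp add: Tt_def power_divide)
      qed
      also have "\<dots> = (LBINT x. (\<Sum>i\<in>UNIV. g i (Tt t x) * \<theta> i x))"
      proof (rule Bochner_Integration.integral_sum[symmetric])
        fix i
        have "integrable lborel (\<lambda>x. g i (Tt t x))"
          unfolding Tt_def using Lp by (intro integrable_scale_shift g) auto
        then show "integrable lborel (\<lambda>x. g i (Tt t x) * \<theta> i x)"
          by (rule integrable_mult_test_fun[OF _ \<theta>]) auto
      qed
      finally show ?thesis .
    qed
    have w\<phi>: "integrable lborel (\<lambda>z. w z * \<phi> z)" "integrable lborel (\<lambda>x. w (Tt 1 x) * \<phi> x)"
      by (auto intro!: integrable_mult_test_fun[OF w \<phi>] integrable_mult_test_fun[OF wT \<phi>])
    have L1: "\<Lambda> 1 > 0" using pos(2)[of 1] by simp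
    have \<phi>S: "(\<lambda>z. \<phi> (St 1 z)) \<in> test_fun UNIV"
    proof -
      obtain C where C: "compact C" "C \<subseteq> U" "\<And>x. x \<notin> C \<Longrightarrow> \<phi> x = 0"
        by (rule test_funE[OF \<phi>]) blast
      show ?thesis
      proof (rule test_funI[of _ "Tt 1 ` C"])
        show "Ck k (\<lambda>z. \<phi> (St 1 z))" for k
          unfolding St_def by (rule Ck_scale_shift[OF test_fun_Ck[OF \<phi>]])
        show "compact (Tt 1 ` C)"
          unfolding Tt_def using C(1) by (intro compact_continuous_image continuous_intros)
        show "\<phi> (St 1 x) = 0" if "x \<notin> Tt 1 ` C" for x
          using that TS[of 1 x] by (intro C(3)) (metis image_eqI order_refl zero_le_one)
      qed simp
    qed
    have [measurable]: "(\<lambda>z. \<phi> (St 1 z)) \<in> borel_measurable borel" by (rule test_fun_measurable[OF \<phi>S])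
    have w\<phi>S: "integrable lborel (\<lambda>z. w z * \<phi> (St 1 z))"
      by (rule integrable_mult_test_fun[OF w \<phi>S]) auto
    have "(LBINT x. w (Tt 1 x) * \<phi> x) - (LBINT z. w z * \<phi> z) =
        (1 / \<Lambda> 1) ^ ?d * (LBINT z. w z * \<phi> (St 1 z)) - (LBINT z. w z * \<phi> z)"
    proof -
      have "(LBINT z. w z * \<phi> (St 1 z)) = \<bar>\<Lambda> 1\<bar> ^ DIM(real^'n) * (LBINT x. w (\<Lambda> 1 *\<^sub>R x + 1 *\<^sub>R v) * \<phi> (St 1 (\<Lambda> 1 *\<^sub>R x + 1 *\<^sub>R v)))"
        using L1 by (intro integral_scale_shift[where f = "\<lambda>z. w z * \<phi> (St 1 z)"]) auto
      then show ?thesis using L1 ST[of 1] by (simp add: Tt_def power_divide)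
    qed
    also have "\<dots> = (LBINT z. (LBINT t. indicator {0..1} t * P t z * w z))"
    proof -
      have "(LBINT t. indicator {0..1} t * P t z * w z) = (1 / \<Lambda> 1) ^ ?d * (w z * \<phi> (St 1 z)) - w z * \<phi> z" for z
      proof -
        have "(LBINT t. indicator {0..1} t * P t z * w z) = (LBINT t. indicator {0..1} t * P t z) * w z"
          by (rule integral_mult_left_zero)
        then show ?thesis unfolding FTC by (simp add: algebra_simps)
      qed
      then show ?thesis using w\<phi> w\<phi>S by simp
    qed
    also have "\<dots> = (LBINT t. (LBINT z. indicator {0..1} t * P t z * w z))"
      by (rule lborel_pair.Fubini_integral) (use Pint in \<open>simp add: split_beta'\<close>)
    also have "\<dots> = (LBINT t. (LBINT x. indicator {0..1} t * (\<Sum>i\<in>UNIV. g i (Tt t x) * \<theta> i x)))"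
    proof (rule Bochner_Integration.integral_cong[OF refl])
      fix t :: real
      show "(LBINT z. indicator {0..1} t * P t z * w z) = (LBINT x. indicator {0..1} t * (\<Sum>i\<in>UNIV. g i (Tt t x) * \<theta> i x))"
        using inner[of t] by (cases "t \<in> {0..1}") auto
    qed
    also have "\<dots> = (LBINT x. (LBINT t. indicator {0..1} t * (\<Sum>i\<in>UNIV. g i (Tt t x) * \<theta> i x)))"
    proof (rule lborel_pair.Fubini_integral[symmetric])
      have "\<forall>i. \<exists>M. \<forall>x. \<bar>\<theta> i x\<bar> \<le> M" using test_fun_bounded[OF \<theta>] by metis
      then obtain N where N: "\<And>i x. \<bar>\<theta> i x\<bar> \<le> N i" by metis
      have "\<bar>\<phi> x * (\<beta> * x $ i + v $ i)\<bar> \<le> Max (range N)" for i x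
        by (rule order_trans[OF _ Max_ge[of _ "N i"]]) (use N[of i x] in \<open>auto simp: \<theta>_def mult.commute\<close>)
      from Gint2[OF _ this] show "integrable (lborel \<Otimes>\<^sub>M lborel) (\<lambda>(t, x). indicator {0..1} t * (\<Sum>i\<in>UNIV. g i (Tt t x) * \<theta> i x))"
        by (simp add: \<theta>_def mult.commute)
    qed
    also have "\<dots> = (LBINT x. \<phi> x * R x)"
      unfolding R_mult \<theta>_def by (simp only: mult.commute[of _ "\<phi> _"])
    finally have main: "(LBINT x. w (Tt 1 x) * \<phi> x) - (LBINT z. w z * \<phi> z) = (LBINT x. \<phi> x * R x)" .
    have R\<phi>: "integrable lborel (\<lambda>x. \<phi> x * R x)"
    proof -
      have "\<forall>i. \<exists>M. \<forall>x. \<bar>\<theta> i x\<bar> \<le> M" using test_fun_bounded[OF \<theta>] by metis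
      then obtain N where N: "\<And>i x. \<bar>\<theta> i x\<bar> \<le> N i" by metis
      have "\<bar>\<phi> x * (\<beta> * x $ i + v $ i)\<bar> \<le> Max (range N)" for i x
        by (rule order_trans[OF _ Max_ge[of _ "N i"]]) (use N[of i x] in \<open>auto simp: \<theta>_def mult.commute\<close>)
      from R_int[OF _ this] show ?thesis by simp
    qed
    have "L2_inner U h \<phi> = (LBINT x. h x * \<phi> x)"
      using U by (intro L2_inner_borel) (auto intro: test_fun_outside[OF \<phi>])
    also have "\<dots> = (LBINT x. w (Tt 1 x) * \<phi> x - w x * \<phi> x - \<phi> x * R x)"
      by (simp add: h_def algebra_simps)
    also have "\<dots> = 0" using w\<phi> R\<phi> main by simp
    finally show "L2_inner U h \<phi> = 0" .
  qed
  then show ?thesis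
    by eventually_elim (simp add: h_def R_def Tt_def \<Lambda>_def)
qed

section \<open>Poincare and Lipschitz estimates on star-shaped cells\<close>

text \<open>Cauchy-Schwarz against the indicator. If the integrand is not integrable, the integral
  on the left is 0 by convention, so no integrability assumption is needed and the right side may be
  infinite.\<close>

lemma nn_Jensen_indicator:
  fixes s :: "'a \<Rightarrow> real"
  assumes [measurable]: "A \<in> sets M" "s \<in> borel_measurable M"
  shows "ennreal ((LINT t|M. indicator A t * s t)\<^sup>2) \<le> emeasure M A * (\<integral>\<^sup>+t. indicator A t * ennreal ((s t)\<^sup>2) \<partial>M)"
proof (cases "integrable M (\<lambda>t. indicator A t * s t)")
  case True
  have "ennreal \<bar>LINT t|M. indicator A t * s t\<bar> \<le> (\<integral>\<^sup>+t. ennreal \<bar>indicator A t * s t\<bar> \<partial>M)"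
    using integral_norm_bound_ennreal[OF True] by simp
  also have "\<dots> = (\<integral>\<^sup>+t. indicator A t * (indicator A t * ennreal \<bar>s t\<bar>) \<partial>M)"
    by (intro nn_integral_cong) (auto simp: indicator_def)
  finally have "(ennreal \<bar>LINT t|M. indicator A t * s t\<bar>)\<^sup>2 \<le> (\<integral>\<^sup>+t. indicator A t * (indicator A t * ennreal \<bar>s t\<bar>) \<partial>M)\<^sup>2"
    by (rule power_mono) simp
  also have "\<dots> \<le> (\<integral>\<^sup>+t. (indicator A t)\<^sup>2 \<partial>M) * (\<integral>\<^sup>+t. (indicator A t * ennreal \<bar>s t\<bar>)\<^sup>2 \<partial>M)"
    by (rule Cauchy_Schwarz_nn_integral) measurable
  also have "(\<integral>\<^sup>+t. (indicator A t)\<^sup>2 \<partial>M) = emeasure M A"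
  proof -
    have "(\<integral>\<^sup>+t. (indicator A t)\<^sup>2 \<partial>M) = (\<integral>\<^sup>+t. indicator A t \<partial>M)"
      by (intro nn_integral_cong) (auto simp: indicator_def)
    then show ?thesis by simp
  qed
  also have "(\<integral>\<^sup>+t. (indicator A t * ennreal \<bar>s t\<bar>)\<^sup>2 \<partial>M) = (\<integral>\<^sup>+t. indicator A t * ennreal ((s t)\<^sup>2) \<partial>M)"
    by (intro nn_integral_cong) (auto simp: indicator_def ennreal_power)
  finally show ?thesis by (simp add: ennreal_power)
qed (simp add: not_integrable_integral_eq)

lemma abs_integral_unit_interval_le:
  fixes s :: "real \<Rightarrow> real"
  assumes "\<And>t. t \<in> {0..1} \<Longrightarrow> \<bar>s t\<bar> \<le> (C::real)" "0 \<le> C"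
  shows "\<bar>LBINT t. indicator {0..1} t * s t\<bar> \<le> C"
proof (cases "integrable lborel (\<lambda>t. indicator {0..1} t * s t)")
  case True
  have "\<bar>LBINT t. indicator {0..1} t * s t\<bar> \<le> (LBINT t::real. indicator {0..1} t * C)"
  proof -
    have "\<bar>LBINT t. indicator {0..1} t * s t\<bar> \<le> (LBINT t. \<bar>indicator {0..1} t * s t\<bar>)"
      using integral_norm_bound[of lborel "\<lambda>t. indicator {0..1} t * s t"] by simp
    also have "\<dots> \<le> (LBINT t::real. indicator {0..1} t * C)"
    proof (rule Bochner_Integration.integral_mono)
    show "\<bar>indicator {0..1} t * s t\<bar> \<le> indicator {0..1} t * C" for t
      using assms(1)[of t] by (cases "t \<in> {0..1}") auto
    qed (use True in auto)
    finally show ?thesis .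
  qed
  then show ?thesis by simp
qed (use assms in \<open>simp add: not_integrable_integral_eq\<close>)

lemma sum_mult_square_le:
  fixes a :: "'n::finite \<Rightarrow> real" and c :: "real^'n"
  shows "(\<Sum>i\<in>UNIV. a i * c $ i)\<^sup>2 \<le> (norm c)\<^sup>2 * (\<Sum>i\<in>UNIV. (a i)\<^sup>2)"
proof -
  let ?a = "(\<chi> i. a i) :: real^'n"
  have "(?a \<bullet> c)\<^sup>2 \<le> (?a \<bullet> ?a) * (c \<bullet> c)" by (rule Cauchy_Schwarz_ineq)
  then show ?thesis
    unfolding power2_norm_eq_inner by (simp add: inner_vec_def power2_eq_square mult.commute)
qed

text \<open>Jensen in \<open>t\<close>, then Fubini, then a change of variables at each fixed
  \<open>t\<close>. The latter costs the d-th power of 1 / (1 + t \<beta>), and 1 + t \<beta> is at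
  least the smaller of its two end values. The right side runs over the whole space, so
  \<open>g\<close> is cut off to the cell before this is applied to a cell.\<close>

lemma nn_integral_affine_difference_le:
  fixes w :: "real^'n \<Rightarrow> real" and g :: "'n \<Rightarrow> real^'n \<Rightarrow> real"
  assumes w: "integrable lborel w" and g: "\<And>i. integrable lborel (g i)"
    and weak: "\<And>i \<phi>. \<phi> \<in> test_fun K \<Longrightarrow>
      (LBINT x. w x * partial_deriv i \<phi> x) = - (LBINT x. g i x * \<phi> x)"
    and U: "open U" and \<beta>: "\<beta> > -1"
    and T: "\<And>t x. 0 \<le> t \<Longrightarrow> t \<le> 1 \<Longrightarrow> x \<in> U \<Longrightarrow> (1 + t * \<beta>) *\<^sub>R x + t *\<^sub>R v \<in> K"
    and H: "\<And>x. x \<in> U \<Longrightarrow> norm (\<beta> *\<^sub>R x + v) \<le> H"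
  shows "(\<integral>\<^sup>+x. indicator U x * ennreal ((w ((1 + \<beta>) *\<^sub>R x + v) - w x)\<^sup>2) \<partial>lborel)
    \<le> ennreal (H\<^sup>2 * (1 / min 1 (1 + \<beta>)) ^ CARD('n)) * (\<integral>\<^sup>+x. ennreal (\<Sum>i\<in>UNIV. (g i x)\<^sup>2) \<partial>lborel)"
proof -
  let ?G = "\<lambda>x. ennreal (\<Sum>i\<in>UNIV. (g i x)\<^sup>2)"
  let ?T = "\<lambda>t x. (1 + t * \<beta>) *\<^sub>R x + t *\<^sub>R v"
  define m where "m = min 1 (1 + \<beta>)"
  have m: "m > 0" using \<beta> by (simp add: m_def)
  have [measurable]: "w \<in> borel_measurable borel" "\<And>i. g i \<in> borel_measurable borel"
    using borel_measurable_integrable[OF w] borel_measurable_integrable[OF g] by simp_all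
  have [measurable]: "U \<in> sets borel" using U by simp
  have coord [measurable]: "(\<lambda>x::real^'n. x $ i) \<in> borel_measurable borel" for i
    by (intro borel_measurable_continuous_onI continuous_intros)
  have weak_gradient: "AE x in lborel. x \<in> U \<longrightarrow> w ((1 + \<beta>) *\<^sub>R x + v) - w x =
      (LBINT t. indicator {0..1} t * (\<Sum>i\<in>UNIV. g i (?T t x) * (\<beta> * x $ i + v $ i)))"
    using w g weak U \<beta> T by (rule weak_gradient_along_affine_maps)
  have "(\<integral>\<^sup>+x. indicator U x * ennreal ((w ((1 + \<beta>) *\<^sub>R x + v) - w x)\<^sup>2) \<partial>lborel)
      \<le> (\<integral>\<^sup>+x. indicator U x * (\<integral>\<^sup>+t. indicator {0..1} t * (ennreal (H\<^sup>2) * ?G (?T t x)) \<partial>lborel) \<partial>lborel)"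
  proof (rule nn_integral_mono_AE)
    show "AE x in lborel. indicator U x * ennreal ((w ((1 + \<beta>) *\<^sub>R x + v) - w x)\<^sup>2)
        \<le> indicator U x * (\<integral>\<^sup>+t. indicator {0..1} t * (ennreal (H\<^sup>2) * ?G (?T t x)) \<partial>lborel)"
      using weak_gradient
    proof eventually_elim
      case (elim x)
      show ?case
      proof (cases "x \<in> U")
        case True
        let ?s = "\<lambda>t. \<Sum>i\<in>UNIV. g i (?T t x) * (\<beta> * x $ i + v $ i)"
        have "ennreal ((w ((1 + \<beta>) *\<^sub>R x + v) - w x)\<^sup>2) = ennreal ((LBINT t. indicator {0..1} t * ?s t)\<^sup>2)"
          using elim True by simp
        also have "\<dots> \<le> emeasure lborel {0..1::real} * (\<integral>\<^sup>+t. indicator {0..1} t * ennreal ((?s t)\<^sup>2) \<partial>lborel)"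
          by (rule nn_Jensen_indicator) measurable
        also have "\<dots> = (\<integral>\<^sup>+t. indicator {0..1} t * ennreal ((?s t)\<^sup>2) \<partial>lborel)" by simp
        also have "\<dots> \<le> (\<integral>\<^sup>+t. indicator {0..1} t * (ennreal (H\<^sup>2) * ?G (?T t x)) \<partial>lborel)"
        proof (intro nn_integral_mono mult_left_mono)
          fix t
          have "(?s t)\<^sup>2 \<le> (norm (\<beta> *\<^sub>R x + v))\<^sup>2 * (\<Sum>i\<in>UNIV. (g i (?T t x))\<^sup>2)"
            using sum_mult_square_le[of "\<lambda>i. g i (?T t x)" "\<beta> *\<^sub>R x + v"] by simp
          also have "\<dots> \<le> H\<^sup>2 * (\<Sum>i\<in>UNIV. (g i (?T t x))\<^sup>2)"
            using H[OF True] by (intro mult_right_mono power_mono sum_nonneg) auto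
          finally show "ennreal ((?s t)\<^sup>2) \<le> ennreal (H\<^sup>2) * ?G (?T t x)"
            by (simp add: ennreal_mult[symmetric] sum_nonneg)
        qed simp
        finally show ?thesis using True by simp
      qed simp
    qed
  qed
  also have "\<dots> = (\<integral>\<^sup>+x. (\<integral>\<^sup>+t. indicator U x * (indicator {0..1} t * (ennreal (H\<^sup>2) * ?G (?T t x))) \<partial>lborel) \<partial>lborel)"
    by (intro nn_integral_cong nn_integral_cmult[symmetric]) measurable
  also have "\<dots> = (\<integral>\<^sup>+t. (\<integral>\<^sup>+x. indicator U x * (indicator {0..1} t * (ennreal (H\<^sup>2) * ?G (?T t x))) \<partial>lborel) \<partial>lborel)"
    by (rule lborel_pair.Fubini') measurable
  also have "\<dots> \<le> (\<integral>\<^sup>+t. indicator {0..1} (t::real) * (ennreal (H\<^sup>2 * (1 / m) ^ CARD('n)) * (\<integral>\<^sup>+x. ?G x \<partial>lborel)) \<partial>lborel)"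
  proof (rule nn_integral_mono)
    fix t :: real
    show "(\<integral>\<^sup>+x. indicator U x * (indicator {0..1} t * (ennreal (H\<^sup>2) * ?G (?T t x))) \<partial>lborel)
        \<le> indicator {0..1} t * (ennreal (H\<^sup>2 * (1 / m) ^ CARD('n)) * (\<integral>\<^sup>+x. ?G x \<partial>lborel))"
    proof (cases "t \<in> {0..1}")
      case True
      have L: "m \<le> 1 + t * \<beta>" using True one_plus_mult_ge_min[of t \<beta>] by (simp add: m_def)
      have "(\<integral>\<^sup>+x. indicator U x * (indicator {0..1} t * (ennreal (H\<^sup>2) * ?G (?T t x))) \<partial>lborel)
          \<le> (\<integral>\<^sup>+x. ennreal (H\<^sup>2) * ?G (?T t x) \<partial>lborel)"
        by (intro nn_integral_mono) (auto simp: indicator_def)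
      also have "\<dots> = ennreal (H\<^sup>2) * (\<integral>\<^sup>+x. ?G (?T t x) \<partial>lborel)"
        by (rule nn_integral_cmult) measurable
      also have "(\<integral>\<^sup>+x. ?G (?T t x) \<partial>lborel) \<le> ennreal ((1 / m) ^ CARD('n)) * (\<integral>\<^sup>+x. ?G x \<partial>lborel)"
      proof -
        have "(\<integral>\<^sup>+x. ?G (?T t x) \<partial>lborel) = ennreal ((1 / (1 + t * \<beta>)) ^ CARD('n)) *
            (ennreal (\<bar>1 + t * \<beta>\<bar> ^ DIM(real^'n)) * (\<integral>\<^sup>+x. ?G (?T t x) \<partial>lborel))"
          using L m by (simp add: mult.assoc[symmetric] ennreal_mult[symmetric] power_mult_distrib[symmetric])
        also have "ennreal (\<bar>1 + t * \<beta>\<bar> ^ DIM(real^'n)) * (\<integral>\<^sup>+x. ?G (?T t x) \<partial>lborel) = (\<integral>\<^sup>+x. ?G x \<partial>lborel)"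
          using L m by (intro nn_integral_scale_shift[symmetric]) auto
        also have "ennreal ((1 / (1 + t * \<beta>)) ^ CARD('n)) * (\<integral>\<^sup>+x. ?G x \<partial>lborel) \<le> ennreal ((1 / m) ^ CARD('n)) * (\<integral>\<^sup>+x. ?G x \<partial>lborel)"
          using L m by (intro mult_right_mono ennreal_leI power_mono divide_left_mono) auto
        finally show ?thesis .
      qed
      finally show ?thesis
        using True m by (simp add: ennreal_mult mult.assoc mult_left_mono)
    qed simp
  qed
  also have "\<dots> = ennreal (H\<^sup>2 * (1 / m) ^ CARD('n)) * (\<integral>\<^sup>+x. ?G x \<partial>lborel)"
    by (subst nn_integral_multc) auto
  finally show ?thesis by (simp add: m_def)
qed

lemma emeasure_ball_double:
  fixes c :: "real^'n"
  assumes "r > 0"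
  shows "emeasure lborel (ball (0::real^'n) (2 * r)) = ennreal (2 ^ CARD('n)) * emeasure lborel (ball c r)"
  using assms by (simp add: emeasure_ball power_mult_distrib ennreal_mult[symmetric] unit_ball_vol_nonneg mult_ac)

text \<open>The constant is the mean over the ball. By Jensen, the deviation from the mean is
  bounded by the squared differences of values at pairs of points; writing the second point as x +
  v, every fixed translation \<open>v\<close> is handled by the affine estimate. Relevant
  translations fill a ball of radius 2 r, whose volume is 2^d times that of the original one: this
  is the factor in the constant.\<close>

lemma Poincare_ball:
  fixes w :: "real^'n \<Rightarrow> real" and g :: "'n \<Rightarrow> real^'n \<Rightarrow> real"
  assumes w: "integrable lborel w" and g: "\<And>i. integrable lborel (g i)"
    and weak: "\<And>i \<phi>. \<phi> \<in> test_fun K \<Longrightarrow>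
      (LBINT x. w x * partial_deriv i \<phi> x) = - (LBINT x. g i x * \<phi> x)"
    and r: "r > 0" and ball: "ball c r \<subseteq> K"
  shows "\<exists>a. (\<integral>\<^sup>+x. indicator (ball c r) x * ennreal ((w x - a)\<^sup>2) \<partial>lborel)
    \<le> ennreal (2 ^ CARD('n) * (2 * r)\<^sup>2) * (\<integral>\<^sup>+x. ennreal (\<Sum>i\<in>UNIV. (g i x)\<^sup>2) \<partial>lborel)"
proof -
  let ?G = "\<integral>\<^sup>+x. ennreal (\<Sum>i\<in>UNIV. (g i x)\<^sup>2) \<partial>lborel"
  define B where "B = ball c r"
  have [measurable]: "B \<in> sets borel" by (simp add: B_def)
  have [measurable]: "w \<in> borel_measurable borel" "\<And>i. g i \<in> borel_measurable borel"
    using borel_measurable_integrable[OF w] borel_measurable_integrable[OF g] by simp_all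
  have Bpos: "0 < measure lborel B" using r by (simp add: B_def content_ball_pos)
  have Bfin: "emeasure lborel B = ennreal (measure lborel B)"
    using emeasure_lborel_ball_finite[of c r] unfolding B_def by (intro emeasure_eq_ennreal_measure) auto
  have wB: "integrable lborel (\<lambda>y. indicator B y * w y)"
    using integrable_mult_indicator[OF _ w, of B] by simp
  define a where "a = (1 / measure lborel B) * (LBINT y. indicator B y * w y)"
  have pt: "ennreal ((w x - a)\<^sup>2) \<le> ennreal (1 / measure lborel B) * (\<integral>\<^sup>+y. indicator B y * ennreal ((w y - w x)\<^sup>2) \<partial>lborel)" for x
  proof -
    have "(LBINT y. indicator B y * (w y - w x)) = measure lborel B * (a - w x)"
      using wB Bpos Bfin by (simp add: right_diff_distrib a_def)
    then have "ennreal ((measure lborel B)\<^sup>2 * (w x - a)\<^sup>2) = ennreal ((LBINT y. indicator B y * (w y - w x))\<^sup>2)"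
      by (simp add: power_mult_distrib power2_commute)
    also have "\<dots> \<le> emeasure lborel B * (\<integral>\<^sup>+y. indicator B y * ennreal ((w y - w x)\<^sup>2) \<partial>lborel)"
      by (rule nn_Jensen_indicator) measurable
    finally have "ennreal (1 / (measure lborel B)\<^sup>2) * ennreal ((measure lborel B)\<^sup>2 * (w x - a)\<^sup>2)
        \<le> ennreal (1 / (measure lborel B)\<^sup>2) * (ennreal (measure lborel B) * (\<integral>\<^sup>+y. indicator B y * ennreal ((w y - w x)\<^sup>2) \<partial>lborel))"
      unfolding Bfin by (rule mult_left_mono) simp
    moreover have "ennreal (1 / (measure lborel B)\<^sup>2) * ennreal ((measure lborel B)\<^sup>2 * (w x - a)\<^sup>2) = ennreal ((w x - a)\<^sup>2)"
      using Bpos by (subst ennreal_mult[symmetric]) auto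
    moreover have "ennreal (1 / (measure lborel B)\<^sup>2) * ennreal (measure lborel B) = ennreal (1 / measure lborel B)"
      using Bpos by (subst ennreal_mult[symmetric]) (auto simp: power2_eq_square)
    ultimately show ?thesis by (simp only: mult.assoc[symmetric])
  qed
  have shift: "(\<integral>\<^sup>+y. indicator B y * ennreal ((w y - w x)\<^sup>2) \<partial>lborel) = (\<integral>\<^sup>+v. indicator B (x + v) * ennreal ((w (x + v) - w x)\<^sup>2) \<partial>lborel)" for x
    using nn_integral_scale_shift[of "\<lambda>y. indicator B y * ennreal ((w y - w x)\<^sup>2)" 1 x] by (simp add: add.commute)
  have inner: "(\<integral>\<^sup>+x. indicator B x * (indicator B (x + v) * ennreal ((w (x + v) - w x)\<^sup>2)) \<partial>lborel)
      \<le> indicator (ball 0 (2 * r)) v * (ennreal ((2 * r)\<^sup>2) * ?G)" for v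
  proof (cases "v \<in> ball 0 (2 * r)")
    case True
    \<comment> \<open>The points that the translation keeps in the ball; convexity keeps the whole
      connecting segment there.\<close>
    let ?U = "B \<inter> (\<lambda>x. x + v) -` B"
    have U: "open ?U"
      by (intro open_Int open_vimage continuous_intros) (auto simp: B_def)
    have T: "(1 + t * 0) *\<^sub>R x + t *\<^sub>R v \<in> K" if "0 \<le> t" "t \<le> 1" "x \<in> ?U" for t x
    proof -
      have "(1 - t) *\<^sub>R x + t *\<^sub>R (x + v) \<in> B"
        using that convex_ball[of c r] unfolding convex_alt B_def by blast
      moreover have "(1 - t) *\<^sub>R x + t *\<^sub>R (x + v) = x + t *\<^sub>R v" by (simp add: algebra_simps)
      ultimately show ?thesis using ball by (auto simp: B_def)
    qed
    have "norm (0 *\<^sub>R x + v) \<le> 2 * r" for x using True by simp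
    from nn_integral_affine_difference_le[OF w g weak U _ T this]
    have "(\<integral>\<^sup>+x. indicator ?U x * ennreal ((w (x + v) - w x)\<^sup>2) \<partial>lborel) \<le> ennreal ((2 * r)\<^sup>2) * ?G" by simp
    moreover have "indicator ?U x * e = indicator B x * (indicator B (x + v) * e)" for x and e :: ennreal
      by (auto simp: indicator_def)
    ultimately show ?thesis using True by simp
  next
    case False
    have "x \<notin> B \<or> x + v \<notin> B" for x
    proof (rule ccontr)
      assume "\<not> ?thesis"
      then have "dist c x < r" "dist c (x + v) < r" by (auto simp: B_def)
      then have "dist x (x + v) < 2 * r" by (metis dist_commute dist_triangle_half_l mult.commute field_sum_of_halves mult_2 nonzero_mult_div_cancel_left zero_neq_numeral)
      with False show False by (simp add: dist_norm)
    qed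
    then have "indicator B x * (indicator B (x + v) * ennreal ((w (x + v) - w x)\<^sup>2)) = 0" for x
      by (auto simp: indicator_def)
    then show ?thesis by (simp only: nn_integral_const) simp
  qed
  have "(\<integral>\<^sup>+x. indicator B x * ennreal ((w x - a)\<^sup>2) \<partial>lborel)
      \<le> (\<integral>\<^sup>+x. ennreal (1 / measure lborel B) * (\<integral>\<^sup>+v. indicator B x * (indicator B (x + v) * ennreal ((w (x + v) - w x)\<^sup>2)) \<partial>lborel) \<partial>lborel)"
  proof (rule nn_integral_mono)
    fix x
    show "indicator B x * ennreal ((w x - a)\<^sup>2)
        \<le> ennreal (1 / measure lborel B) * (\<integral>\<^sup>+v. indicator B x * (indicator B (x + v) * ennreal ((w (x + v) - w x)\<^sup>2)) \<partial>lborel)"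
      using pt[of x] unfolding shift by (cases "x \<in> B") auto
  qed
  also have "\<dots> = ennreal (1 / measure lborel B) * (\<integral>\<^sup>+x. (\<integral>\<^sup>+v. indicator B x * (indicator B (x + v) * ennreal ((w (x + v) - w x)\<^sup>2)) \<partial>lborel) \<partial>lborel)"
    by (rule nn_integral_cmult) measurable
  also have "(\<integral>\<^sup>+x. (\<integral>\<^sup>+v. indicator B x * (indicator B (x + v) * ennreal ((w (x + v) - w x)\<^sup>2)) \<partial>lborel) \<partial>lborel)
      = (\<integral>\<^sup>+v. (\<integral>\<^sup>+x. indicator B x * (indicator B (x + v) * ennreal ((w (x + v) - w x)\<^sup>2)) \<partial>lborel) \<partial>lborel)"
    by (rule lborel_pair.Fubini') measurable
  also have "\<dots> \<le> (\<integral>\<^sup>+v. indicator (ball (0::real^'n) (2 * r)) v * (ennreal ((2 * r)\<^sup>2) * ?G) \<partial>lborel)"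
    by (intro nn_integral_mono inner)
  also have "\<dots> = emeasure lborel (ball (0::real^'n) (2 * r)) * (ennreal ((2 * r)\<^sup>2) * ?G)"
    by (subst nn_integral_multc) (auto intro!: borel_measurable_indicator)
  also have "emeasure lborel (ball (0::real^'n) (2 * r)) = ennreal (2 ^ CARD('n)) * ennreal (measure lborel B)"
    using emeasure_ball_double[OF r, of c] Bfin by (simp add: B_def)
  also have "ennreal (1 / measure lborel B) * (ennreal (2 ^ CARD('n)) * ennreal (measure lborel B) * (ennreal ((2 * r)\<^sup>2) * ?G))
      = ennreal (2 ^ CARD('n) * (2 * r)\<^sup>2) * ?G"
    using Bpos by (simp add: ennreal_mult[symmetric] mult.assoc[symmetric])
  finally show ?thesis
    unfolding B_def by (intro exI[of _ a]) (simp add: mult_left_mono)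
qed

lemma homothety_ball:
  fixes c x :: "'a::real_normed_vector"
  assumes "dist c x \<le> H" "0 < s" "s * H < r"
  shows "s *\<^sub>R x + (1 - s) *\<^sub>R c \<in> ball c r"
proof -
  have "c - (s *\<^sub>R x + (1 - s) *\<^sub>R c) = s *\<^sub>R (c - x)" by (simp add: algebra_simps)
  then have "dist c (s *\<^sub>R x + (1 - s) *\<^sub>R c) = s * dist c x" using assms(2) by (simp add: dist_norm)
  also have "\<dots> \<le> s * H" using assms(1,2) by simp
  finally show ?thesis using assms(3) by simp
qed

text \<open>In the notation of the affine estimates the homothety of ratio \<open>s\<close> about
  \<open>c\<close> has \<beta> = s - 1 and translation part (1 - s) c; the intermediate maps move
  \<open>x\<close> along its segment to \<open>c\<close>.\<close>

lemma homothety_mem: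
  fixes c x :: "'a::real_normed_vector"
  assumes star: "\<And>x. x \<in> K \<Longrightarrow> closed_segment c x \<subseteq> K" and s: "0 < s" "s < 1"
    and "0 \<le> t" "t \<le> 1" "x \<in> K"
  shows "(1 + t * (s - 1)) *\<^sub>R x + t *\<^sub>R ((1 - s) *\<^sub>R c) \<in> K"
proof -
  have "(1 - t * (1 - s)) *\<^sub>R x + (t * (1 - s)) *\<^sub>R c \<in> closed_segment x c"
    unfolding closed_segment_def using assms by (auto intro!: exI[of _ "t * (1 - s)"] mult_le_one)
  moreover have "(1 - t * (1 - s)) *\<^sub>R x + (t * (1 - s)) *\<^sub>R c = (1 + t * (s - 1)) *\<^sub>R x + t *\<^sub>R ((1 - s) *\<^sub>R c)"
    by (simp add: algebra_simps)
  ultimately show ?thesis using star[OF \<open>x \<in> K\<close>] by (auto simp: closed_segment_commute)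
qed

lemma homothety_norm:
  fixes c x :: "'a::real_normed_vector"
  assumes H: "\<And>x. x \<in> K \<Longrightarrow> dist c x \<le> H" and s: "0 < s" "s < 1" and x: "x \<in> K"
  shows "norm ((s - 1) *\<^sub>R x + (1 - s) *\<^sub>R c) \<le> H"
proof -
  have "(s - 1) *\<^sub>R x + (1 - s) *\<^sub>R c = (1 - s) *\<^sub>R (c - x)" by (simp add: algebra_simps)
  then have "norm ((s - 1) *\<^sub>R x + (1 - s) *\<^sub>R c) = (1 - s) * dist c x" using s by (simp add: dist_norm)
  also have "\<dots> \<le> 1 * dist c x" using s by (intro mult_right_mono) auto
  finally show ?thesis using H[OF x] by simp
qed

lemma ennreal_double_sum:
  assumes "0 \<le> a" "0 \<le> b"
  shows "2 * (ennreal a * G) + 2 * (ennreal b * G) = ennreal (2 * a + 2 * b) * G"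
proof -
  have "ennreal (2 * a + 2 * b) = 2 * ennreal a + 2 * ennreal b"
    using assms by (simp add: ennreal_plus ennreal_mult)
  then show ?thesis by (simp add: distrib_right mult.assoc)
qed

lemma ennreal_square_diff_le:
  fixes p q a :: real
  shows "ennreal ((p - a)\<^sup>2) \<le> 2 * ennreal ((q - p)\<^sup>2) + 2 * ennreal ((q - a)\<^sup>2)"
proof -
  have "(p - a)\<^sup>2 \<le> 2 * (q - p)\<^sup>2 + 2 * (q - a)\<^sup>2"
    using zero_le_power2[of "(q - p) + (q - a)"] by (simp add: power2_eq_square algebra_simps)
  then have "ennreal ((p - a)\<^sup>2) \<le> ennreal (2 * (q - p)\<^sup>2 + 2 * (q - a)\<^sup>2)"
    by (rule ennreal_leI)
  then show ?thesis by (simp add: ennreal_plus ennreal_mult)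
qed

text \<open>The homothety of ratio \<open>s\<close> about \<open>c\<close> moves \<open>K\<close> into the ball along segments inside \<open>K\<close>; on the
  ball, which is convex, translations suffice.\<close>

lemma Poincare_star_shaped_borel:
  fixes w :: "real^'n \<Rightarrow> real" and g :: "'n \<Rightarrow> real^'n \<Rightarrow> real"
  assumes w: "integrable lborel w" and g: "\<And>i. integrable lborel (g i)"
    and weak: "\<And>i \<phi>. \<phi> \<in> test_fun K \<Longrightarrow>
      (LBINT x. w x * partial_deriv i \<phi> x) = - (LBINT x. g i x * \<phi> x)"
    and K: "open K" and star: "\<And>x. x \<in> K \<Longrightarrow> closed_segment c x \<subseteq> K"
    and H: "\<And>x. x \<in> K \<Longrightarrow> dist c x \<le> H"
    and r: "r > 0" and ball: "ball c r \<subseteq> K" and s: "0 < s" "s < 1" "s * H < r"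
  shows "\<exists>a. (\<integral>\<^sup>+x. indicator K x * ennreal ((w x - a)\<^sup>2) \<partial>lborel)
    \<le> ennreal (2 * (1 / s) ^ CARD('n) * (H\<^sup>2 + 2 ^ CARD('n) * (2 * r)\<^sup>2)) * (\<integral>\<^sup>+x. ennreal (\<Sum>i\<in>UNIV. (g i x)\<^sup>2) \<partial>lborel)"
proof -
  let ?G = "\<integral>\<^sup>+x. ennreal (\<Sum>i\<in>UNIV. (g i x)\<^sup>2) \<partial>lborel"
  have [measurable]: "K \<in> sets borel" "ball c r \<in> sets borel" using K by simp_all
  have [measurable]: "w \<in> borel_measurable borel" "\<And>i. g i \<in> borel_measurable borel"
    using borel_measurable_integrable[OF w] borel_measurable_integrable[OF g] by simp_all
  obtain a where a: "(\<integral>\<^sup>+x. indicator (ball c r) x * ennreal ((w x - a)\<^sup>2) \<partial>lborel)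
    \<le> ennreal (2 ^ CARD('n) * (2 * r)\<^sup>2) * ?G"
    using Poincare_ball[OF w g weak r ball] by blast
  let ?S = "\<lambda>x. s *\<^sub>R x + (1 - s) *\<^sub>R c"
  have S: "?S x \<in> ball c r" if "x \<in> K" for x
    by (rule homothety_ball[OF H[OF that] s(1,3)])
  have 1: "(\<integral>\<^sup>+x. indicator K x * ennreal ((w (?S x) - w x)\<^sup>2) \<partial>lborel) \<le> ennreal (H\<^sup>2 * (1 / s) ^ CARD('n)) * ?G"
    using nn_integral_affine_difference_le[OF w g weak K _ homothety_mem[OF star s(1,2)] homothety_norm[OF H s(1,2)]] s
    by simp
  \<comment> \<open>After the contraction only values in the ball occur, and undoing it by a change
    of variables costs the factor (1/s)^d.\<close>
  have 2: "(\<integral>\<^sup>+x. indicator K x * ennreal ((w (?S x) - a)\<^sup>2) \<partial>lborel)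
      \<le> ennreal ((1 / s) ^ CARD('n) * (2 ^ CARD('n) * (2 * r)\<^sup>2)) * ?G"
  proof -
    let ?f = "\<lambda>x. indicator (ball c r) x * ennreal ((w x - a)\<^sup>2)"
    have "(\<integral>\<^sup>+x. indicator K x * ennreal ((w (?S x) - a)\<^sup>2) \<partial>lborel) \<le> (\<integral>\<^sup>+x. ?f (?S x) \<partial>lborel)"
      using S by (intro nn_integral_mono) (auto simp: indicator_def)
    also have "\<dots> = ennreal ((1 / s) ^ CARD('n)) * (ennreal (\<bar>s\<bar> ^ DIM(real^'n)) * (\<integral>\<^sup>+x. ?f (?S x) \<partial>lborel))"
      using s by (simp add: mult.assoc[symmetric] ennreal_mult[symmetric] power_mult_distrib[symmetric])
    also have "ennreal (\<bar>s\<bar> ^ DIM(real^'n)) * (\<integral>\<^sup>+x. ?f (?S x) \<partial>lborel) = (\<integral>\<^sup>+x. ?f x \<partial>lborel)"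
      using s by (intro nn_integral_scale_shift[symmetric]) auto
    also have "ennreal ((1 / s) ^ CARD('n)) * (\<integral>\<^sup>+x. ?f x \<partial>lborel) \<le> ennreal ((1 / s) ^ CARD('n)) * (ennreal (2 ^ CARD('n) * (2 * r)\<^sup>2) * ?G)"
      by (intro mult_left_mono a) simp
    also have "\<dots> = ennreal ((1 / s) ^ CARD('n) * (2 ^ CARD('n) * (2 * r)\<^sup>2)) * ?G"
      using s by (simp add: ennreal_mult mult.assoc)
    finally show ?thesis .
  qed
  have "(\<integral>\<^sup>+x. indicator K x * ennreal ((w x - a)\<^sup>2) \<partial>lborel)
      \<le> (\<integral>\<^sup>+x. 2 * (indicator K x * ennreal ((w (?S x) - w x)\<^sup>2)) + 2 * (indicator K x * ennreal ((w (?S x) - a)\<^sup>2)) \<partial>lborel)"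
  proof (rule nn_integral_mono)
    fix x
    have "ennreal ((w x - a)\<^sup>2) \<le> 2 * ennreal ((w (?S x) - w x)\<^sup>2) + 2 * ennreal ((w (?S x) - a)\<^sup>2)"
      by (rule ennreal_square_diff_le)
    then show "indicator K x * ennreal ((w x - a)\<^sup>2)
        \<le> 2 * (indicator K x * ennreal ((w (?S x) - w x)\<^sup>2)) + 2 * (indicator K x * ennreal ((w (?S x) - a)\<^sup>2))"
      by (cases "x \<in> K") auto
  qed
  also have "\<dots> = 2 * (\<integral>\<^sup>+x. indicator K x * ennreal ((w (?S x) - w x)\<^sup>2) \<partial>lborel) + 2 * (\<integral>\<^sup>+x. indicator K x * ennreal ((w (?S x) - a)\<^sup>2) \<partial>lborel)"
    by (simp add: nn_integral_add nn_integral_cmult)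
  also have "\<dots> \<le> 2 * (ennreal (H\<^sup>2 * (1 / s) ^ CARD('n)) * ?G) + 2 * (ennreal ((1 / s) ^ CARD('n) * (2 ^ CARD('n) * (2 * r)\<^sup>2)) * ?G)"
    by (intro add_mono mult_left_mono 1 2) auto
  also have "\<dots> = ennreal (2 * (1 / s) ^ CARD('n) * (H\<^sup>2 + 2 ^ CARD('n) * (2 * r)\<^sup>2)) * ?G"
  proof -
    have "2 * (1 / s) ^ CARD('n) * (H\<^sup>2 + 2 ^ CARD('n) * (2 * r)\<^sup>2) =
        2 * (H\<^sup>2 * (1 / s) ^ CARD('n)) + 2 * ((1 / s) ^ CARD('n) * (2 ^ CARD('n) * (2 * r)\<^sup>2))"
      by (simp add: algebra_simps)
    then show ?thesis
      by (simp only:) (rule ennreal_double_sum; use s in simp)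
  qed
  finally show ?thesis by blast
qed

section \<open>The Lipschitz estimate: differences along affine maps, then the ball, then the
  cell\<close>

lemma Lipschitz_affine_difference:
  fixes w :: "real^'n \<Rightarrow> real" and g :: "'n \<Rightarrow> real^'n \<Rightarrow> real"
  assumes w: "integrable lborel w" and g: "\<And>i. integrable lborel (g i)"
    and weak: "\<And>i \<phi>. \<phi> \<in> test_fun K \<Longrightarrow>
      (LBINT x. w x * partial_deriv i \<phi> x) = - (LBINT x. g i x * \<phi> x)"
    and U: "open U" and \<beta>: "\<beta> > -1"
    and T: "\<And>t x. 0 \<le> t \<Longrightarrow> t \<le> 1 \<Longrightarrow> x \<in> U \<Longrightarrow> (1 + t * \<beta>) *\<^sub>R x + t *\<^sub>R v \<in> K"
    and H: "\<And>x. x \<in> U \<Longrightarrow> norm (\<beta> *\<^sub>R x + v) \<le> H"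
    and L: "\<And>i x. \<bar>g i x\<bar> \<le> L"
  shows "AE x in lborel. x \<in> U \<longrightarrow> \<bar>w ((1 + \<beta>) *\<^sub>R x + v) - w x\<bar> \<le> real CARD('n) * L * H"
proof -
  have "AE x in lborel. x \<in> U \<longrightarrow> w ((1 + \<beta>) *\<^sub>R x + v) - w x =
      (LBINT t. indicator {0..1} t * (\<Sum>i\<in>UNIV. g i ((1 + t * \<beta>) *\<^sub>R x + t *\<^sub>R v) * (\<beta> * x $ i + v $ i)))"
    using w g weak U \<beta> T by (rule weak_gradient_along_affine_maps)
  then show ?thesis
  proof eventually_elim
    case (elim x)
    show ?case
    proof
      assume x: "x \<in> U"
      have L0: "0 \<le> L" using L order_trans abs_ge_zero by blast
      have H0: "0 \<le> H" using H[OF x] norm_ge_zero order_trans by blast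
      have "\<bar>g i y * (\<beta> * x $ i + v $ i)\<bar> \<le> L * H" for i y
      proof -
        have "\<bar>\<beta> * x $ i + v $ i\<bar> \<le> H"
          using component_le_norm_cart[of "\<beta> *\<^sub>R x + v" i] H[OF x] by simp
        then show ?thesis unfolding abs_mult using L[of i y] L0 by (intro mult_mono) auto
      qed
      then have "\<bar>\<Sum>i\<in>UNIV. g i ((1 + t * \<beta>) *\<^sub>R x + t *\<^sub>R v) * (\<beta> * x $ i + v $ i)\<bar> \<le> (\<Sum>i\<in>(UNIV::'n set). L * H)" for t
        by (intro order_trans[OF sum_abs] sum_mono)
      then have "\<bar>LBINT t. indicator {0..1} t * (\<Sum>i\<in>UNIV. g i ((1 + t * \<beta>) *\<^sub>R x + t *\<^sub>R v) * (\<beta> * x $ i + v $ i))\<bar> \<le> (\<Sum>i\<in>(UNIV::'n set). L * H)"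
        using L0 H0 by (intro abs_integral_unit_interval_le) auto
      then show "\<bar>w ((1 + \<beta>) *\<^sub>R x + v) - w x\<bar> \<le> real CARD('n) * L * H"
        using elim x by (simp add: mult.assoc)
    qed
  qed
qed

text \<open>For each translation \<open>v\<close> the difference w(x + v) - w(x) is bounded for
  almost every \<open>x\<close>, with a null set depending on \<open>v\<close>. To average over the
  second point, the order of the two quantifiers has to be exchanged.\<close>

lemma Lipschitz_ball_average:
  fixes w :: "real^'n \<Rightarrow> real" and g :: "'n \<Rightarrow> real^'n \<Rightarrow> real"
  assumes w: "integrable lborel w" and g: "\<And>i. integrable lborel (g i)"
    and weak: "\<And>i \<phi>. \<phi> \<in> test_fun K \<Longrightarrow>
      (LBINT x. w x * partial_deriv i \<phi> x) = - (LBINT x. g i x * \<phi> x)"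
    and r: "r > 0" and ball: "ball c r \<subseteq> K" and L: "\<And>i x. \<bar>g i x\<bar> \<le> L"
  shows "\<exists>a. AE x in lborel. x \<in> ball c r \<longrightarrow> \<bar>w x - a\<bar> \<le> real CARD('n) * L * (2 * r)"
proof -
  define B where "B = ball c r"
  define C where "C = real CARD('n) * L * (2 * r)"
  have [measurable]: "B \<in> sets borel" by (simp add: B_def)
  have [measurable]: "w \<in> borel_measurable borel"
    using borel_measurable_integrable[OF w] by simp
  have Bpos: "0 < measure lborel B" using r by (simp add: B_def content_ball_pos)
  have Bfin: "emeasure lborel B < \<infinity>" using emeasure_lborel_ball_finite[of c r] by (simp add: B_def)
  have wB: "integrable lborel (\<lambda>y. indicator B y * w y)"
    using integrable_mult_indicator[OF _ w, of B] by simp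
  define a where "a = (1 / measure lborel B) * (LBINT y. indicator B y * w y)"
  have "AE x in lborel. x \<in> B \<longrightarrow> x + v \<in> B \<longrightarrow> \<bar>w (x + v) - w x\<bar> \<le> C" for v
  proof (cases "norm v \<le> 2 * r")
    case True
    let ?U = "B \<inter> (\<lambda>x. x + v) -` B"
    have U: "open ?U"
      by (intro open_Int open_vimage continuous_intros) (auto simp: B_def)
    have T: "(1 + t * 0) *\<^sub>R x + t *\<^sub>R v \<in> K" if "0 \<le> t" "t \<le> 1" "x \<in> ?U" for t x
    proof -
      have "(1 - t) *\<^sub>R x + t *\<^sub>R (x + v) \<in> B"
        using that convex_ball[of c r] unfolding convex_alt B_def by blast
      moreover have "(1 - t) *\<^sub>R x + t *\<^sub>R (x + v) = x + t *\<^sub>R v" by (simp add: algebra_simps)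
      ultimately show ?thesis using ball by (auto simp: B_def)
    qed
    have "norm (0 *\<^sub>R x + v) \<le> 2 * r" for x using True by simp
    from Lipschitz_affine_difference[OF w g weak U _ T this L]
    have "AE x in lborel. x \<in> ?U \<longrightarrow> \<bar>w (x + v) - w x\<bar> \<le> C" by (simp add: C_def)
    then show ?thesis by eventually_elim auto
  next
    case False
    have "x \<notin> B \<or> x + v \<notin> B" for x
    proof (rule ccontr)
      assume "\<not> ?thesis"
      then have "dist c x < r" "dist c (x + v) < r" by (auto simp: B_def)
      then have "dist x (x + v) < 2 * r" using dist_triangle3[of x "x + v" c] by linarith
      with False show False by (simp add: dist_norm)
    qed
    then show ?thesis by auto
  qed
  then have "AE v in lborel. AE x in lborel. x \<in> B \<longrightarrow> x + v \<in> B \<longrightarrow> \<bar>w (x + v) - w x\<bar> \<le> C"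
    by simp
  \<comment> \<open>Fubini for null sets in the product. Afterwards \<open>x\<close> is fixed and x
    + v covers almost every point of the ball.\<close>
  then have "AE x in lborel. AE v in lborel. x \<in> B \<longrightarrow> x + v \<in> B \<longrightarrow> \<bar>w (x + v) - w x\<bar> \<le> C"
    by (subst lborel_pair.AE_commute) measurable
  then have "AE x in lborel. x \<in> B \<longrightarrow> \<bar>w x - a\<bar> \<le> C"
  proof eventually_elim
    case (elim x)
    show ?case
    proof
      assume x: "x \<in> B"
      from AE_scale_shift[OF elim, of 1 "- x"] x
      have ae: "AE y in lborel. y \<in> B \<longrightarrow> \<bar>w y - w x\<bar> \<le> C" by simp
      have int: "integrable lborel (\<lambda>y. indicator B y * (w y - w x))"
        using wB Bfin by (simp add: right_diff_distrib)
      have "measure lborel B * (a - w x) = (LBINT y. indicator B y * (w y - w x))"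
        using wB Bpos Bfin by (simp add: right_diff_distrib a_def)
      then have "measure lborel B * \<bar>a - w x\<bar> = \<bar>LBINT y. indicator B y * (w y - w x)\<bar>"
        using Bpos by (metis abs_mult abs_of_pos)
      also have "\<dots> \<le> (LBINT y. \<bar>indicator B y * (w y - w x)\<bar>)"
        using integral_norm_bound[of lborel "\<lambda>y. indicator B y * (w y - w x)"] by simp
      also have "\<dots> \<le> (LBINT y. indicator B y * C)"
      proof (rule integral_mono_AE)
        show "AE y in lborel. \<bar>indicator B y * (w y - w x)\<bar> \<le> indicator B y * C"
          using ae by eventually_elim (auto simp: indicator_def)
        show "integrable lborel (\<lambda>y. indicator B y * C)"
          using Bfin by (intro integrable_mult_left integrable_real_indicator) auto
      qed (use int in simp)
      also have "\<dots> = measure lborel B * C" using Bfin by simp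
      finally show "\<bar>w x - a\<bar> \<le> C" using Bpos by (simp add: abs_minus_commute)
    qed
  qed
  then show ?thesis unfolding B_def C_def by blast
qed

text \<open>Two displacements add up: the homothety moves a point by at most H, and two points of
  the ball differ by at most 2 r.\<close>

lemma Lipschitz_star_shaped_borel:
  fixes w :: "real^'n \<Rightarrow> real" and g :: "'n \<Rightarrow> real^'n \<Rightarrow> real"
  assumes w: "integrable lborel w" and g: "\<And>i. integrable lborel (g i)"
    and weak: "\<And>i \<phi>. \<phi> \<in> test_fun K \<Longrightarrow>
      (LBINT x. w x * partial_deriv i \<phi> x) = - (LBINT x. g i x * \<phi> x)"
    and K: "open K" and star: "\<And>x. x \<in> K \<Longrightarrow> closed_segment c x \<subseteq> K"
    and H: "\<And>x. x \<in> K \<Longrightarrow> dist c x \<le> H"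
    and r: "r > 0" and ball: "ball c r \<subseteq> K" and s: "0 < s" "s < 1" "s * H < r"
    and L: "\<And>i x. \<bar>g i x\<bar> \<le> L"
  shows "\<exists>a. AE x in lborel. x \<in> K \<longrightarrow> \<bar>w x - a\<bar> \<le> real CARD('n) * L * (H + 2 * r)"
proof -
  obtain a where a: "AE x in lborel. x \<in> ball c r \<longrightarrow> \<bar>w x - a\<bar> \<le> real CARD('n) * L * (2 * r)"
    using Lipschitz_ball_average[OF w g weak r ball L] by blast
  let ?S = "\<lambda>x. s *\<^sub>R x + (1 - s) *\<^sub>R c"
  have "AE x in lborel. x \<in> K \<longrightarrow> \<bar>w ((1 + (s - 1)) *\<^sub>R x + (1 - s) *\<^sub>R c) - w x\<bar> \<le> real CARD('n) * L * H"
    by (rule Lipschitz_affine_difference[OF w g weak K _ homothety_mem[OF star s(1,2)] homothety_norm[OF H s(1,2)] L])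
      (use s in auto)
  moreover have "AE x in lborel. ?S x \<in> ball c r \<longrightarrow> \<bar>w (?S x) - a\<bar> \<le> real CARD('n) * L * (2 * r)"
    by (rule AE_scale_shift[OF a]) (use s in simp)
  ultimately have "AE x in lborel. x \<in> K \<longrightarrow> \<bar>w x - a\<bar> \<le> real CARD('n) * L * (H + 2 * r)"
  proof eventually_elim
    case (elim x)
    show ?case
    proof
      assume x: "x \<in> K"
      have "\<bar>w (?S x) - w x\<bar> \<le> real CARD('n) * L * H" "\<bar>w (?S x) - a\<bar> \<le> real CARD('n) * L * (2 * r)"
        using elim x homothety_ball[OF H[OF x] s(1,3)] by simp_all
      then have "\<bar>w x - a\<bar> \<le> real CARD('n) * L * H + real CARD('n) * L * (2 * r)" by linarith
      then show "\<bar>w x - a\<bar> \<le> real CARD('n) * L * (H + 2 * r)" by (simp only: distrib_left)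
    qed
  qed
  then show ?thesis by blast
qed

section \<open>From Borel representatives on the whole space back to L2 functions on a cell\<close>

lemma L2_borel_representative:
  fixes f :: "real^'n \<Rightarrow> real"
  assumes K: "open K" "emeasure lborel K < \<infinity>" and f: "f \<in> L2 K"
  shows "\<exists>w. integrable lborel w \<and> (AE x in lborel. x \<in> K \<longrightarrow> f x = w x) \<and> w \<in> L2 K"
proof -
  have Km: "K \<in> sets borel" "K \<in> sets lebesgue" using K by auto
  obtain w where w: "w \<in> borel_measurable borel" "\<And>x. x \<notin> K \<Longrightarrow> w x = 0" "AE x in lborel. x \<in> K \<longrightarrow> f x = w x"
    using ex_borel_representative[OF L2_measurable[OF f] Km(1)] by blast
  have "integrable (lebesgue_on K) f"
    using L2_integrable_finite_measure[OF f _ Km(2)] K Km by simp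
  then have i: "integrable lebesgue (\<lambda>x. indicator K x *\<^sub>R f x)"
    using Km by (simp add: integrable_restrict_space)
  have ae: "AE x in lebesgue. indicator K x *\<^sub>R f x = w x"
    unfolding AE_completion_iff using w(3) by eventually_elim (auto simp: indicator_def w(2))
  have "integrable lebesgue w"
    using i by (rule integrable_cong_AE_imp) (use ae w in \<open>auto intro: measurable_completion\<close>)
  then have "integrable lborel w" using w(1) by (simp add: integrable_completion)
  moreover have "w \<in> L2 K"
    using w(3) Km by (intro L2_AE[OF f]) (auto simp: AE_lebesgue_on_iff)
  ultimately show ?thesis using w(3) by blast
qed

lemma weak_gradient_representatives:
  fixes f w :: "real^'n \<Rightarrow> real" and D g :: "'n \<Rightarrow> real^'n \<Rightarrow> real"
  assumes K: "open K" and f: "f \<in> L2 K" and D: "D i \<in> L2 K" and weak: "is_weak_deriv K [i] f (D i)"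
    and w: "integrable lborel w" "AE x in lborel. x \<in> K \<longrightarrow> f x = w x" "w \<in> L2 K"
    and g: "integrable lborel (g i)" "AE x in lborel. x \<in> K \<longrightarrow> D i x = g i x" "g i \<in> L2 K"
    and \<phi>: "\<phi> \<in> test_fun K"
  shows "(LBINT x. w x * partial_deriv i \<phi> x) = - (LBINT x. g i x * \<phi> x)"
proof -
  have Km: "K \<in> sets borel" "K \<in> sets lebesgue" using K by auto
  have d: "partial_deriv i \<phi> \<in> test_fun K" by (rule test_fun_partial_deriv[OF \<phi>])
  have wm: "w \<in> borel_measurable borel" "g i \<in> borel_measurable borel"
    using borel_measurable_integrable[OF w(1)] borel_measurable_integrable[OF g(1)] by simp_all
  have "(LBINT x. w x * partial_deriv i \<phi> x) = L2_inner K w (partial_deriv i \<phi>)"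
    by (rule L2_inner_borel[symmetric, OF Km(1) wm(1) test_fun_measurable[OF d] test_fun_outside[OF d]])
  also have "\<dots> = L2_inner K f (partial_deriv i \<phi>)"
    using w f test_fun_L2[OF d Km(2)] Km by (intro L2_inner_cong_AE) (auto simp: AE_lebesgue_on_iff elim!: eventually_mono)
  also have "\<dots> = - L2_inner K (D i) \<phi>"
    using weak \<phi> by (simp add: is_weak_deriv_def partial_derivs_def)
  also have "L2_inner K (D i) \<phi> = L2_inner K (g i) \<phi>"
    using g D test_fun_L2[OF \<phi> Km(2)] Km by (intro L2_inner_cong_AE) (auto simp: AE_lebesgue_on_iff elim!: eventually_mono)
  also have "\<dots> = (LBINT x. g i x * \<phi> x)"
    by (rule L2_inner_borel[OF Km(1) wm(2) test_fun_measurable[OF \<phi>] test_fun_outside[OF \<phi>]])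
  finally show ?thesis .
qed

lemma nn_integral_L2_norm:
  fixes f w :: "real^'n \<Rightarrow> real"
  assumes K: "open K" and f: "f \<in> L2 K" and w: "w \<in> borel_measurable borel" "AE x in lborel. x \<in> K \<longrightarrow> f x = w x"
  shows "(\<integral>\<^sup>+x. indicator K x * ennreal ((w x)\<^sup>2) \<partial>lborel) = ennreal ((L2_norm K f)\<^sup>2)"
proof -
  have Km [measurable]: "K \<in> sets borel" "K \<in> sets lebesgue" using K by auto
  have wL: "w \<in> L2 K" using w Km by (intro L2_AE[OF f]) (auto simp: AE_lebesgue_on_iff)
  have "(\<integral>\<^sup>+x. indicator K x * ennreal ((w x)\<^sup>2) \<partial>lborel) = (\<integral>\<^sup>+x. indicator K x * ennreal ((w x)\<^sup>2) \<partial>lebesgue)"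
    using w(1) by (intro nn_integral_completion[symmetric]) measurable
  also have "\<dots> = (\<integral>\<^sup>+x. ennreal ((w x)\<^sup>2) \<partial>lebesgue_on K)"
    using Km by (simp add: nn_integral_restrict_space mult.commute)
  also have "\<dots> = ennreal (integral\<^sup>L (lebesgue_on K) (\<lambda>x. (w x)\<^sup>2))"
    using wL by (intro nn_integral_eq_integral) (auto simp: L2_def)
  also have "integral\<^sup>L (lebesgue_on K) (\<lambda>x. (w x)\<^sup>2) = (L2_norm K w)\<^sup>2"
    by (simp add: L2_norm_def integral_nonneg)
  also have "L2_norm K w = L2_norm K f"
    using w(2) Km by (intro L2_norm_cong_AE wL f) (auto simp: AE_lebesgue_on_iff elim!: eventually_mono)
  finally show ?thesis .
qed

lemma L2_const:
  assumes "emeasure lborel S < \<infinity>" "S \<in> sets borel"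
  shows "(\<lambda>x. a :: real) \<in> L2 S"
  using assms by (intro L2I) (auto simp: integrable_restrict_space)

lemma Poincare_star_shaped:
  fixes f :: "real^'n \<Rightarrow> real" and D :: "'n \<Rightarrow> real^'n \<Rightarrow> real"
  assumes K: "open K" "emeasure lborel K < \<infinity>"
    and f: "f \<in> L2 K" and D: "\<And>i. D i \<in> L2 K" and weak: "\<And>i. is_weak_deriv K [i] f (D i)"
    and star: "\<And>x. x \<in> K \<Longrightarrow> closed_segment c x \<subseteq> K"
    and H: "\<And>x. x \<in> K \<Longrightarrow> dist c x \<le> H"
    and r: "r > 0" and ball: "ball c r \<subseteq> K" and s: "0 < s" "s < 1" "s * H < r"
  shows "\<exists>a. (L2_norm K (\<lambda>x. f x - a))\<^sup>2
    \<le> 2 * (1 / s) ^ CARD('n) * (H\<^sup>2 + 2 ^ CARD('n) * (2 * r)\<^sup>2) * (\<Sum>i\<in>UNIV. (L2_norm K (D i))\<^sup>2)"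
proof -
  have Km [measurable]: "K \<in> sets borel" using K by auto
  obtain w where w: "integrable lborel w" "AE x in lborel. x \<in> K \<longrightarrow> f x = w x" "w \<in> L2 K"
    using L2_borel_representative[OF K f] by blast
  have "\<forall>i. \<exists>g. integrable lborel g \<and> (AE x in lborel. x \<in> K \<longrightarrow> D i x = g x) \<and> g \<in> L2 K"
    using L2_borel_representative[OF K D] by blast
  from choice[OF this] obtain g where g: "\<And>i. integrable lborel (g i)" "\<And>i. AE x in lborel. x \<in> K \<longrightarrow> D i x = g i x" "\<And>i. g i \<in> L2 K"
    by blast
  \<comment> \<open>Cutting the gradient off to \<open>K\<close> makes the integral over the whole
    space in the Borel version equal to the norm over \<open>K\<close>.\<close>
  define G where "G i = (\<lambda>x. indicator K x * g i x)" for i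
  have [measurable]: "w \<in> borel_measurable borel" "\<And>i. g i \<in> borel_measurable borel"
    using borel_measurable_integrable[OF w(1)] borel_measurable_integrable[OF g(1)] by simp_all
  have Gi: "integrable lborel (G i)" for i
    using integrable_mult_indicator[OF _ g(1), of K i] by (simp add: G_def)
  have GK: "AE x in lborel. x \<in> K \<longrightarrow> D i x = G i x" for i
    using g(2)[of i] by eventually_elim (simp add: G_def)
  have GL: "G i \<in> L2 K" for i
    by (rule L2_AE[OF D[of i]]) (use GK[of i] K in \<open>simp_all only: AE_lebesgue_on_iff lmeasurable_open sets_completionI_sets borel_open sets_lborel\<close>)
  have [measurable]: "G i \<in> borel_measurable borel" for i unfolding G_def by measurable
  have wk: "(LBINT x. w x * partial_deriv i \<phi> x) = - (LBINT x. G i x * \<phi> x)" if "\<phi> \<in> test_fun K" for i \<phi>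
    by (rule weak_gradient_representatives[where D = D, OF K(1) f D weak w Gi GK GL that])
  obtain a where "(\<integral>\<^sup>+x. indicator K x * ennreal ((w x - a)\<^sup>2) \<partial>lborel)
    \<le> ennreal (2 * (1 / s) ^ CARD('n) * (H\<^sup>2 + 2 ^ CARD('n) * (2 * r)\<^sup>2)) * (\<integral>\<^sup>+x. ennreal (\<Sum>i\<in>UNIV. (G i x)\<^sup>2) \<partial>lborel)"
    using Poincare_star_shaped_borel[OF w(1) Gi wk K(1) star H r ball s] by blast
  moreover have "(\<integral>\<^sup>+x. indicator K x * ennreal ((w x - a)\<^sup>2) \<partial>lborel) = ennreal ((L2_norm K (\<lambda>x. f x - a))\<^sup>2)"
    by (rule nn_integral_L2_norm[OF K(1) L2_diff[OF f L2_const]])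
      (use w(2) K in \<open>auto elim!: eventually_mono\<close>)
  moreover have "(\<integral>\<^sup>+x. ennreal (\<Sum>i\<in>UNIV. (G i x)\<^sup>2) \<partial>lborel) = ennreal (\<Sum>i\<in>UNIV. (L2_norm K (D i))\<^sup>2)"
  proof -
    have "(\<integral>\<^sup>+x. ennreal (\<Sum>i\<in>UNIV. (G i x)\<^sup>2) \<partial>lborel) = (\<integral>\<^sup>+x. (\<Sum>i\<in>UNIV. indicator K x * ennreal ((G i x)\<^sup>2)) \<partial>lborel)"
      by (intro nn_integral_cong) (auto simp: G_def indicator_def)
    also have "\<dots> = (\<Sum>i\<in>UNIV. (\<integral>\<^sup>+x. indicator K x * ennreal ((G i x)\<^sup>2) \<partial>lborel))"
      by (rule nn_integral_sum) measurable
    also have "\<dots> = (\<Sum>i\<in>UNIV. ennreal ((L2_norm K (D i))\<^sup>2))"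
      using nn_integral_L2_norm[OF K(1) D _ GK] by simp
    finally show ?thesis by simp
  qed
  ultimately have "ennreal ((L2_norm K (\<lambda>x. f x - a))\<^sup>2)
      \<le> ennreal (2 * (1 / s) ^ CARD('n) * (H\<^sup>2 + 2 ^ CARD('n) * (2 * r)\<^sup>2) * (\<Sum>i\<in>UNIV. (L2_norm K (D i))\<^sup>2))"
    using s by (simp add: ennreal_mult sum_nonneg)
  then show ?thesis
    using s by (subst (asm) ennreal_le_iff) (auto intro!: mult_nonneg_nonneg sum_nonneg add_nonneg_nonneg)
qed

lemma Lipschitz_star_shaped:
  fixes f :: "real^'n \<Rightarrow> real" and D :: "'n \<Rightarrow> real^'n \<Rightarrow> real"
  assumes K: "open K" "emeasure lborel K < \<infinity>"
    and f: "f \<in> L2 K" and D: "\<And>i. D i \<in> L2 K" and weak: "\<And>i. is_weak_deriv K [i] f (D i)"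
    and L: "\<And>i. AE x in lebesgue_on K. \<bar>D i x\<bar> \<le> L" "0 \<le> L"
    and star: "\<And>x. x \<in> K \<Longrightarrow> closed_segment c x \<subseteq> K"
    and H: "\<And>x. x \<in> K \<Longrightarrow> dist c x \<le> H"
    and r: "r > 0" and ball: "ball c r \<subseteq> K" and s: "0 < s" "s < 1" "s * H < r"
  shows "\<exists>a. AE x in lebesgue_on K. \<bar>f x - a\<bar> \<le> real CARD('n) * L * (H + 2 * r)"
proof -
  have Km: "K \<in> sets lebesgue" using K by auto
  obtain w where w: "integrable lborel w" "AE x in lborel. x \<in> K \<longrightarrow> f x = w x" "w \<in> L2 K"
    using L2_borel_representative[OF K f] by blast
  have "\<forall>i. \<exists>g. integrable lborel g \<and> (AE x in lborel. x \<in> K \<longrightarrow> D i x = g x) \<and> g \<in> L2 K"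
    using L2_borel_representative[OF K D] by blast
  from choice[OF this] obtain g where g: "\<And>i. integrable lborel (g i)" "\<And>i. AE x in lborel. x \<in> K \<longrightarrow> D i x = g i x" "\<And>i. g i \<in> L2 K"
    by blast
  \<comment> \<open>The truncation changes the derivative only on a null set and turns its almost
    everywhere bound into the pointwise bound that the Borel version requires.\<close>
  define G where "G i = (\<lambda>x. if \<bar>g i x\<bar> \<le> L then g i x else 0)" for i
  have [measurable]: "\<And>i. g i \<in> borel_measurable borel"
    using borel_measurable_integrable[OF g(1)] by simp_all
  have Gi: "integrable lborel (G i)" for i
    by (rule Bochner_Integration.integrable_bound[OF g(1)[of i]]) (auto simp: G_def)
  have GK: "AE x in lborel. x \<in> K \<longrightarrow> D i x = G i x" for i
    using g(2)[of i] L(1)[of i, unfolded AE_lebesgue_on_iff[OF Km]]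
    by eventually_elim (auto simp: G_def)
  have GL: "G i \<in> L2 K" for i
    by (rule L2_AE[OF D[of i]]) (use GK[of i] K in \<open>simp_all only: AE_lebesgue_on_iff lmeasurable_open sets_completionI_sets borel_open sets_lborel\<close>)
  have wk: "(LBINT x. w x * partial_deriv i \<phi> x) = - (LBINT x. G i x * \<phi> x)" if "\<phi> \<in> test_fun K" for i \<phi>
    by (rule weak_gradient_representatives[where D = D, OF K(1) f D weak w Gi GK GL that])
  have Gb: "\<bar>G i x\<bar> \<le> L" for i x using L(2) by (simp add: G_def)
  obtain a where "AE x in lborel. x \<in> K \<longrightarrow> \<bar>w x - a\<bar> \<le> real CARD('n) * L * (H + 2 * r)"
    using Lipschitz_star_shaped_borel[OF w(1) Gi wk K(1) star H r ball s Gb] by blast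
  with w(2) have "AE x in lborel. x \<in> K \<longrightarrow> \<bar>f x - a\<bar> \<le> real CARD('n) * L * (H + 2 * r)"
    by eventually_elim auto
  then show ?thesis using Km by (auto simp: AE_lebesgue_on_iff)
qed

section \<open>Hessian schemes\<close>

text \<open>Linear algebra for the discrete space: the first conclusion yields solutions of the
  Hessian scheme, the second makes the supremum in \<open>CD\<close> finite. Both go by induction on
  the spanning set, with a Gram-Schmidt step in which the orthogonal projection of the new vector
  comes from the first conclusion for the smaller span.\<close>

lemma inner_product_on_finite_span:
  fixes a :: "'x::real_vector \<Rightarrow> 'x \<Rightarrow> real"
  assumes "finite S" and X: "subspace X" "S \<subseteq> X"
    and add: "\<And>u v w. u \<in> X \<Longrightarrow> v \<in> X \<Longrightarrow> w \<in> X \<Longrightarrow> a (u + v) w = a u w + a v w"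
    and scale: "\<And>r u w. u \<in> X \<Longrightarrow> w \<in> X \<Longrightarrow> a (r *\<^sub>R u) w = r * a u w"
    and sym: "\<And>u v. a u v = a v u"
    and pos: "\<And>v. v \<in> X \<Longrightarrow> v \<noteq> 0 \<Longrightarrow> 0 < a v v"
  shows Riesz_on_finite_span: "(\<And>u v. u \<in> X \<Longrightarrow> v \<in> X \<Longrightarrow> F (u + v) = F u + F v) \<Longrightarrow>
      (\<And>r v. v \<in> X \<Longrightarrow> F (r *\<^sub>R v) = r * F v) \<Longrightarrow>
      \<exists>w\<in>span S. \<forall>v\<in>span S. a w v = F v" (is "PROP ?A1 \<Longrightarrow> PROP ?A2 \<Longrightarrow> _")
    and seminorm_bounded_on_finite_span: "(\<And>u v. u \<in> X \<Longrightarrow> v \<in> X \<Longrightarrow> N (u + v) \<le> N u + N v) \<Longrightarrow>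
      (\<And>r v. v \<in> X \<Longrightarrow> N (r *\<^sub>R v) = \<bar>r\<bar> * N v) \<Longrightarrow>
      \<exists>M\<ge>0. \<forall>v\<in>span S. N v \<le> M * sqrt (a v v)"
proof -
  have add': "a w (u + v) = a w u + a w v" if "u \<in> X" "v \<in> X" "w \<in> X" for u v w
    using add[OF that] sym[of w "u + v"] sym[of w u] sym[of w v] by simp
  have scale': "a w (r *\<^sub>R u) = r * a w u" if "u \<in> X" "w \<in> X" for r u w
    using scale[OF that] sym[of w "r *\<^sub>R u"] sym[of w u] by simp
  \<comment> \<open>The new direction is e = s - r, where \<open>r\<close> represents the functional
    a(s, .) on the smaller span, that is, the orthogonal projection of \<open>s\<close>.\<close>
  have split: "\<exists>e\<in>span (insert s S). e \<noteq> 0 \<and> (\<forall>v\<in>span S. a e v = 0) \<and>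
      (\<forall>v\<in>span (insert s S). \<exists>v0\<in>span S. \<exists>k. v = v0 + k *\<^sub>R e)"
    if S: "insert s S \<subseteq> X" "s \<notin> span S" and r: "r \<in> span S" "\<forall>v\<in>span S. a r v = a s v" for s S r
  proof (rule bexI[of _ "s - r"], intro conjI ballI)
    have SX: "span S \<subseteq> X" using S X(1) span_minimal[of S X] by blast
    show "s - r \<noteq> 0" using S r by auto
    show "a (s - r) v = 0" if "v \<in> span S" for v
      using add[of "s - r" r v] that r S SX X(1) subspace_diff[of X s r] by auto
    show "s - r \<in> span (insert s S)"
    proof (rule span_diff)
      show "s \<in> span (insert s S)" by (rule span_base) simp
      show "r \<in> span (insert s S)" using r span_mono[of S "insert s S"] by blast
    qed
    fix v assume "v \<in> span (insert s S)"
    then obtain k where k: "v - k *\<^sub>R s \<in> span S" using span_breakdown_eq by blast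
    have "v - k *\<^sub>R s + k *\<^sub>R r \<in> span S" using k r by (intro span_add span_scale)
    moreover have "v = (v - k *\<^sub>R s + k *\<^sub>R r) + k *\<^sub>R (s - r)" by (simp add: scaleR_diff_right)
    ultimately show "\<exists>v0\<in>span S. \<exists>k. v = v0 + k *\<^sub>R (s - r)" by blast
  qed
  have expand: "a (v0 + k *\<^sub>R e) (w0 + c *\<^sub>R e) = a v0 w0 + c * a e v0 + k * a e w0 + k * c * a e e"
    if "v0 \<in> X" "w0 \<in> X" "e \<in> X" for v0 w0 e k c
  proof -
    have X': "c *\<^sub>R e \<in> X" "k *\<^sub>R e \<in> X" "w0 + c *\<^sub>R e \<in> X" for c k
      using that X(1) by (auto intro: subspace_scale subspace_add)
    show ?thesis
      using that X' sym[of v0 e] by (simp add: add scale add' scale' algebra_simps)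
  qed
  have riesz: "\<exists>w\<in>span S. \<forall>v\<in>span S. a w v = F v"
    if l: "\<And>u v. u \<in> X \<Longrightarrow> v \<in> X \<Longrightarrow> F (u + v) = F u + F v" "\<And>r v. v \<in> X \<Longrightarrow> F (r *\<^sub>R v) = r * F v"
      and "finite S" "S \<subseteq> X" for F S
    using that(3,4,1,2)
  proof (induction S arbitrary: F rule: finite_induct)
    case empty
    have "0 \<in> X" using X(1) by (rule subspace_0)
    have "F 0 = 0" using empty(3)[OF \<open>0 \<in> X\<close>, of 0] by simp
    moreover have "a 0 0 = 0" using scale[of 0 0 0] \<open>0 \<in> X\<close> by simp
    ultimately show ?case by simp
  next
    case (insert s S)
    have SX: "span S \<subseteq> X" "span (insert s S) \<subseteq> X" using insert.prems X(1) by (intro span_minimal; simp)+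
    show ?case
    proof (cases "s \<in> span S")
      case True
      then show ?thesis using insert by (simp add: span_redundant)
    next
      case False
      have "s \<in> X" using insert.prems by simp
      then have "\<exists>w\<in>span S. \<forall>v\<in>span S. a w v = a s v"
        using insert.prems X(1)
        by (intro insert.IH) (auto simp: add' scale')
      then obtain r where r: "r \<in> span S" "\<forall>v\<in>span S. a r v = a s v" by blast
      obtain e where e: "e \<in> span (insert s S)" "e \<noteq> 0" "\<And>v. v \<in> span S \<Longrightarrow> a e v = 0"
        "\<And>v. v \<in> span (insert s S) \<Longrightarrow> \<exists>v0\<in>span S. \<exists>k. v = v0 + k *\<^sub>R e"
        using split[OF insert.prems(1) False r] by blast
      have eX: "e \<in> X" using e SX by auto
      have ep: "a e e > 0" using pos[OF eX e(2)] .
      obtain w where w: "w \<in> span S" "\<forall>v\<in>span S. a w v = F v"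
        using insert.IH insert.prems by blast
      \<comment> \<open>The component of the representer along \<open>e\<close>, forced by testing
        with \<open>e\<close>.\<close>
      let ?c = "F e / a e e"
      show ?thesis
      proof (intro bexI ballI)
        show "w + ?c *\<^sub>R e \<in> span (insert s S)"
          using w e(1) span_mono[of S "insert s S"] by (intro span_add span_scale) auto
        fix v assume "v \<in> span (insert s S)"
        then obtain v0 k where v: "v0 \<in> span S" "v = v0 + k *\<^sub>R e" using e(4) by blast
        have "a (w + ?c *\<^sub>R e) v = F v0 + k * F e"
          using v w e(3) ep SX eX expand[of w v0 e ?c k] by (auto simp: subset_iff)
        then show "a (w + ?c *\<^sub>R e) v = F v"
          using v insert.prems(2)[of v0 "k *\<^sub>R e"] insert.prems(3)[of e k] SX eX X(1) by (auto simp: subspace_scale subset_iff)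
      qed
    qed
  qed
  show "\<exists>w\<in>span S. \<forall>v\<in>span S. a w v = F v" if "PROP ?A1" "PROP ?A2"
    using riesz[OF that \<open>finite S\<close> X(2)] .
  show "\<exists>M\<ge>0. \<forall>v\<in>span S. N v \<le> M * sqrt (a v v)"
    if N: "\<And>u v. u \<in> X \<Longrightarrow> v \<in> X \<Longrightarrow> N (u + v) \<le> N u + N v" "\<And>r v. v \<in> X \<Longrightarrow> N (r *\<^sub>R v) = \<bar>r\<bar> * N v"
    using \<open>finite S\<close> X(2)
  proof (induction S rule: finite_induct)
    case empty
    have "0 \<in> X" using X(1) by (rule subspace_0)
    then have "N 0 = 0" using N(2)[of 0 0] by simp
    then show ?case by (intro exI[of _ 0]) simp
  next
    case (insert s S)
    have SX: "span S \<subseteq> X" "span (insert s S) \<subseteq> X" using insert.prems X(1) by (intro span_minimal; simp)+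
    show ?case
    proof (cases "s \<in> span S")
      case True
      then show ?thesis using insert by (simp add: span_redundant)
    next
      case False
      have "s \<in> X" using insert.prems by simp
      then have "\<exists>w\<in>span S. \<forall>v\<in>span S. a w v = a s v"
        using insert X(1)
        by (intro riesz) (auto simp: add' scale')
      then obtain r where r: "r \<in> span S" "\<forall>v\<in>span S. a r v = a s v" by blast
      obtain e where e: "e \<in> span (insert s S)" "e \<noteq> 0" "\<And>v. v \<in> span S \<Longrightarrow> a e v = 0"
        "\<And>v. v \<in> span (insert s S) \<Longrightarrow> \<exists>v0\<in>span S. \<exists>k. v = v0 + k *\<^sub>R e"
        using split[OF insert.prems(1) False r] by blast
      have eX: "e \<in> X" using e SX by auto
      have ep: "a e e > 0" using pos[OF eX e(2)] .
      obtain M where M: "M \<ge> 0" "\<And>v. v \<in> span S \<Longrightarrow> N v \<le> M * sqrt (a v v)"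
        using insert.IH insert.prems by blast
      \<comment> \<open>By Pythagoras both components of a vector are bounded by the vector itself,
        so the constants of the old span and of the new direction simply add.\<close>
      let ?E = "\<bar>N e\<bar> / sqrt (a e e)"
      show ?thesis
      proof (intro exI[of _ "M + ?E"] conjI ballI)
        show "M + ?E \<ge> 0" using M(1) ep by simp
        fix v assume "v \<in> span (insert s S)"
        then obtain v0 k where v: "v0 \<in> span S" "v = v0 + k *\<^sub>R e" using e(4) by blast
        have v0X: "v0 \<in> X" using v SX by auto
        have av: "a v v = a v0 v0 + k\<^sup>2 * a e e"
          using expand[of v0 v0 e k k] v0X eX v e(3) by (simp add: power2_eq_square)
        have p0: "0 \<le> a v0 v0" using pos[OF v0X] scale[of 0 0 0] subspace_0[OF X(1)] by (cases "v0 = 0") auto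
        have "N v \<le> N v0 + \<bar>k\<bar> * N e"
          using v N(1)[OF v0X, of "k *\<^sub>R e"] N(2)[OF eX, of k] subspace_scale[OF X(1) eX, of k] by simp
        also have "\<dots> \<le> M * sqrt (a v0 v0) + ?E * sqrt (k\<^sup>2 * a e e)"
          using M(2)[OF v(1)] ep mult_left_mono[OF abs_ge_self[of "N e"] abs_ge_zero[of k]]
          by (intro add_mono) (simp_all add: real_sqrt_mult mult.commute)
        also have "\<dots> \<le> M * sqrt (a v v) + ?E * sqrt (a v v)"
          using M(1) ep p0 by (intro add_mono mult_left_mono) (auto simp: av)
        finally show "N v \<le> (M + ?E) * sqrt (a v v)" by (simp add: distrib_right)
      qed
    qed
  qed
qed

section \<open>Reconstruction operators, solvability and stability of the scheme\<close>

lemma linear_into_L2_mem: "linear_into_L2 S X T \<Longrightarrow> v \<in> X \<Longrightarrow> T v \<in> L2 S"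
  by (simp add: linear_into_L2_def)

lemma linear_into_L2_comb:
  assumes "linear_into_L2 S X T" "u \<in> X" "v \<in> X"
  shows "AE x in lebesgue_on S. T (r *\<^sub>R u + s *\<^sub>R v) x = r *\<^sub>R T u x + s *\<^sub>R T v x"
  using assms by (simp add: linear_into_L2_def)

lemma linear_into_L2_inner:
  assumes T: "linear_into_L2 S X T" and X: "subspace X" and uv: "u \<in> X" "v \<in> X" and g: "g \<in> L2 S"
  shows "L2_inner S (T (r *\<^sub>R u + s *\<^sub>R v)) g = r * L2_inner S (T u) g + s * L2_inner S (T v) g"
proof -
  have m: "r *\<^sub>R u + s *\<^sub>R v \<in> X" using X uv by (intro subspace_add subspace_scale)
  note L = linear_into_L2_mem[OF T]
  have "L2_inner S (T (r *\<^sub>R u + s *\<^sub>R v)) g = L2_inner S (\<lambda>x. r *\<^sub>R T u x + s *\<^sub>R T v x) g"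
    by (rule L2_inner_cong_AE) (use L linear_into_L2_comb[OF T uv] m uv g in \<open>auto intro!: L2_add L2_scaleR\<close>)
  also have "\<dots> = r * L2_inner S (T u) g + s * L2_inner S (T v) g"
    using L uv g by (simp add: L2_inner_add_left L2_scaleR L2_inner_scaleR_left)
  finally show ?thesis .
qed

lemma linear_into_L2_norm:
  assumes T: "linear_into_L2 S X T" and X: "subspace X" and uv: "u \<in> X" "v \<in> X"
  shows "L2_norm S (T (u + v)) \<le> L2_norm S (T u) + L2_norm S (T v)"
    and "L2_norm S (T (r *\<^sub>R u)) = \<bar>r\<bar> * L2_norm S (T u)"
    and "L2_norm S (T (u - v)) = L2_norm S (\<lambda>x. T u x - T v x)"
proof -
  note L = linear_into_L2_mem[OF T]
  have m: "u + v \<in> X" "r *\<^sub>R u \<in> X" "u - v \<in> X" "0 \<in> X"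
    using X uv by (auto intro: subspace_add subspace_scale subspace_diff subspace_0)
  have "L2_norm S (T (u + v)) = L2_norm S (\<lambda>x. T u x + T v x)"
    using linear_into_L2_comb[OF T uv, of 1 1] by (intro L2_norm_cong_AE L2_add L m uv) simp
  then show "L2_norm S (T (u + v)) \<le> L2_norm S (T u) + L2_norm S (T v)"
    using L2_norm_triangle[OF L[OF uv(1)] L[OF uv(2)]] by simp
  have "L2_norm S (T (r *\<^sub>R u)) = L2_norm S (\<lambda>x. r *\<^sub>R T u x)"
    using linear_into_L2_comb[OF T uv(1) m(4), of r 0] by (intro L2_norm_cong_AE L2_scaleR L m uv) simp
  then show "L2_norm S (T (r *\<^sub>R u)) = \<bar>r\<bar> * L2_norm S (T u)"
    by (simp add: L2_norm_scaleR)
  show "L2_norm S (T (u - v)) = L2_norm S (\<lambda>x. T u x - T v x)"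
    using linear_into_L2_comb[OF T uv, of 1 "-1"] by (intro L2_norm_cong_AE L2_diff L m uv) simp
qed

context
  fixes \<Omega> :: "(real^'n) set" and D :: "('x::real_vector, 'n) hessian_disc"
  assumes D: "hessian_discretisation \<Omega> D"
begin

lemma discretisation_parts:
  "subspace (XD D)" "linear_into_L2 \<Omega> (XD D) (PiD D)" "linear_into_L2 \<Omega> (XD D) (nablaD D)"
  "linear_into_L2 \<Omega> (XD D) (HessD D)" "\<exists>S. finite S \<and> span S = XD D"
  "is_norm_on (XD D) (\<lambda>v. L2_norm \<Omega> (HessD D v))"
  using D by (simp_all add: hessian_discretisation_def)

lemma PiD_L2: "v \<in> XD D \<Longrightarrow> PiD D v \<in> L2 \<Omega>"
  by (rule linear_into_L2_mem[OF discretisation_parts(2)])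

lemma HessD_L2: "v \<in> XD D \<Longrightarrow> HessD D v \<in> L2 \<Omega>"
  by (rule linear_into_L2_mem[OF discretisation_parts(4)])

lemma aD_sym: "aD \<Omega> D u v = aD \<Omega> D v u"
  by (simp add: aD_def L2_inner_commute)

lemma aD_self: "aD \<Omega> D v v = (L2_norm \<Omega> (HessD D v))\<^sup>2"
  by (simp add: aD_def L2_norm_square)

lemma aD_comb:
  "u \<in> XD D \<Longrightarrow> v \<in> XD D \<Longrightarrow> w \<in> XD D \<Longrightarrow> aD \<Omega> D (r *\<^sub>R u + s *\<^sub>R v) w = r * aD \<Omega> D u w + s * aD \<Omega> D v w"
  unfolding aD_def by (rule linear_into_L2_inner[OF discretisation_parts(4,1)]) (auto intro: HessD_L2)

lemma aD_add: "u \<in> XD D \<Longrightarrow> v \<in> XD D \<Longrightarrow> w \<in> XD D \<Longrightarrow> aD \<Omega> D (u + v) w = aD \<Omega> D u w + aD \<Omega> D v w"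
  using aD_comb[of u v w 1 1] by simp

lemma aD_diff: "u \<in> XD D \<Longrightarrow> v \<in> XD D \<Longrightarrow> w \<in> XD D \<Longrightarrow> aD \<Omega> D (u - v) w = aD \<Omega> D u w - aD \<Omega> D v w"
  using aD_comb[of u v w 1 "-1"] by simp

lemma aD_scale: "u \<in> XD D \<Longrightarrow> w \<in> XD D \<Longrightarrow> aD \<Omega> D (r *\<^sub>R u) w = r * aD \<Omega> D u w"
  using aD_comb[of u u w r 0] by simp

lemma aD_pos:
  assumes v: "v \<in> XD D" "v \<noteq> 0"
  shows "0 < aD \<Omega> D v v"
proof -
  have "L2_norm \<Omega> (HessD D v) \<noteq> 0"
    using discretisation_parts(6) v by (simp add: is_norm_on_def)
  then show ?thesis using L2_norm_nonneg[of \<Omega> "HessD D v"] by (simp add: aD_self)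
qed

lemma PiD_inner_comb:
  "u \<in> XD D \<Longrightarrow> v \<in> XD D \<Longrightarrow> g \<in> L2 \<Omega> \<Longrightarrow>
    L2_inner \<Omega> g (PiD D (r *\<^sub>R u + s *\<^sub>R v)) = r * L2_inner \<Omega> g (PiD D u) + s * L2_inner \<Omega> g (PiD D v)"
  using linear_into_L2_inner[OF discretisation_parts(2,1)] by (simp add: L2_inner_commute[of \<Omega> g])

text \<open>Needed for the auxiliary states with sources other than the discrete ones, which link
  the discrete solution to the functions of (A1).\<close>

lemma hessian_scheme_exists:
  assumes g: "g \<in> L2 \<Omega>"
  shows "\<exists>w. hessian_scheme \<Omega> D g w"
proof -
  obtain S where S: "finite S" "span S = XD D" using discretisation_parts(5) by blast
  have "\<exists>w\<in>span S. \<forall>v\<in>span S. aD \<Omega> D w v = L2_inner \<Omega> g (PiD D v)"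
  proof (rule Riesz_on_finite_span[OF S(1) discretisation_parts(1) _ aD_add aD_scale aD_sym aD_pos])
    show "S \<subseteq> XD D" using S(2) span_superset by blast
    show "L2_inner \<Omega> g (PiD D (u + v)) = L2_inner \<Omega> g (PiD D u) + L2_inner \<Omega> g (PiD D v)"
      if "u \<in> XD D" "v \<in> XD D" for u v
      using PiD_inner_comb[OF that g, of 1 1] by simp
    show "L2_inner \<Omega> g (PiD D (r *\<^sub>R v)) = r * L2_inner \<Omega> g (PiD D v)" if "v \<in> XD D" for r v
      using PiD_inner_comb[OF that that g, of r 0] by simp
  qed
  then show ?thesis by (auto simp: hessian_scheme_def S(2))
qed

lemma discrete_bounded:
  assumes T: "linear_into_L2 \<Omega> (XD D) T"
  shows "\<exists>M\<ge>0. \<forall>v\<in>XD D. L2_norm \<Omega> (T v) \<le> M * L2_norm \<Omega> (HessD D v)"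
proof -
  obtain S where S: "finite S" "span S = XD D" using discretisation_parts(5) by blast
  have "\<exists>M\<ge>0. \<forall>v\<in>span S. L2_norm \<Omega> (T v) \<le> M * sqrt (aD \<Omega> D v v)"
    by (rule seminorm_bounded_on_finite_span[OF S(1) discretisation_parts(1) _ aD_add aD_scale aD_sym aD_pos])
      (use S(2) span_superset[of S] linear_into_L2_norm[OF T discretisation_parts(1)] in auto)
  then show ?thesis by (simp add: S(2) aD_self L2_norm_nonneg)
qed

text \<open>A supremum of reals bounds its set only when the set is bounded above; here the finite
  dimension of the discrete space guarantees this. The zero vector is outside the quotients and is
  treated separately.\<close>

lemma CD_bounds:
  shows CD_nonneg: "0 \<le> CD \<Omega> D"
    and PiD_le_CD: "v \<in> XD D \<Longrightarrow> L2_norm \<Omega> (PiD D v) \<le> CD \<Omega> D * L2_norm \<Omega> (HessD D v)"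
proof -
  let ?H = "\<lambda>w. L2_norm \<Omega> (HessD D w)"
  let ?q = "\<lambda>w. max (L2_norm \<Omega> (PiD D w) / ?H w) (L2_norm \<Omega> (nablaD D w) / ?H w)"
  obtain M1 M2 where M: "M1 \<ge> 0" "\<And>v. v \<in> XD D \<Longrightarrow> L2_norm \<Omega> (PiD D v) \<le> M1 * ?H v"
      "M2 \<ge> 0" "\<And>v. v \<in> XD D \<Longrightarrow> L2_norm \<Omega> (nablaD D v) \<le> M2 * ?H v"
    using discrete_bounded[OF discretisation_parts(2)] discrete_bounded[OF discretisation_parts(3)] by blast
  have pos: "?H v > 0" if "v \<in> XD D - {0}" for v
    using aD_pos[of v] that L2_norm_nonneg[of \<Omega> "HessD D v"] by (simp add: aD_self order_less_le)
  have "?q v \<le> max M1 M2" if "v \<in> XD D - {0}" for v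
    using pos[OF that] M(2,4)[of v] that by (auto simp: divide_le_eq le_max_iff_disj)
  then have bdd: "bdd_above (insert 0 (?q ` (XD D - {0})))"
    unfolding bdd_above_insert by (intro bdd_aboveI2[where M = "max M1 M2"])
  show nn: "0 \<le> CD \<Omega> D"
    unfolding CD_def by (rule cSup_upper[OF _ bdd]) simp
  assume v: "v \<in> XD D"
  show "L2_norm \<Omega> (PiD D v) \<le> CD \<Omega> D * ?H v"
  proof (cases "v = 0")
    case True
    have "?H v = 0" using discretisation_parts(6) v True by (simp add: is_norm_on_def)
    then show ?thesis using M(2)[OF v] by simp
  next
    case False
    then have "?q v \<le> CD \<Omega> D"
      unfolding CD_def using v by (intro cSup_upper[OF _ bdd]) auto
    then have "L2_norm \<Omega> (PiD D v) / ?H v \<le> CD \<Omega> D" by simp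
    then show ?thesis using pos[of v] v False by (simp add: divide_le_eq)
  qed
qed

lemma PiD_diff_norm:
  "u \<in> XD D \<Longrightarrow> v \<in> XD D \<Longrightarrow> L2_norm \<Omega> (\<lambda>x. PiD D u x - PiD D v x) = L2_norm \<Omega> (PiD D (u - v))"
  using linear_into_L2_norm(3)[OF discretisation_parts(2,1)] by simp

lemma hessian_scheme_mem: "hessian_scheme \<Omega> D g w \<Longrightarrow> w \<in> XD D"
  by (simp add: hessian_scheme_def)

lemma hessian_scheme_diff:
  assumes w: "hessian_scheme \<Omega> D g w" "hessian_scheme \<Omega> D g' w'" and g: "g \<in> L2 \<Omega>" "g' \<in> L2 \<Omega>"
  shows "hessian_scheme \<Omega> D (\<lambda>x. g x - g' x) (w - w')"
  using w g discretisation_parts(1)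
  by (auto simp: hessian_scheme_def subspace_diff aD_diff L2_inner_diff_left PiD_L2)

text \<open>Test with the difference of the two solutions. The hypothesis measures the difference of
  the sources only through discrete test functions: this is what lets v - u and y - y_M contribute
  at order two.\<close>

lemma hessian_scheme_stable:
  assumes w: "hessian_scheme \<Omega> D g w" "hessian_scheme \<Omega> D g' w'" and g: "g \<in> L2 \<Omega>" "g' \<in> L2 \<Omega>"
    and cD: "CD \<Omega> D \<le> cD"
    and K: "\<And>v. v \<in> XD D \<Longrightarrow> \<bar>L2_inner \<Omega> (\<lambda>x. g x - g' x) (PiD D v)\<bar> \<le> K * L2_norm \<Omega> (HessD D v)" and "0 \<le> K"
  shows "L2_norm \<Omega> (\<lambda>x. PiD D w x - PiD D w' x) \<le> cD * K"
proof -
  have s: "hessian_scheme \<Omega> D (\<lambda>x. g x - g' x) (w - w')" by (rule hessian_scheme_diff[OF w g])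
  note m = hessian_scheme_mem[OF s]
  let ?H = "L2_norm \<Omega> (HessD D (w - w'))"
  have "?H * ?H \<le> K * ?H"
    using s m K[OF m] by (auto simp: hessian_scheme_def aD_self power2_eq_square)
  then have HK: "?H \<le> K"
    using \<open>0 \<le> K\<close> L2_norm_nonneg[of \<Omega> "HessD D (w - w')"] by (cases "?H = 0") (auto simp: mult_le_cancel_right)
  have "L2_norm \<Omega> (\<lambda>x. PiD D w x - PiD D w' x) \<le> CD \<Omega> D * ?H"
    using PiD_diff_norm[OF hessian_scheme_mem[OF w(1)] hessian_scheme_mem[OF w(2)]] PiD_le_CD[OF m] by simp
  also have "\<dots> \<le> cD * K"
    using cD CD_nonneg HK by (intro mult_mono) (auto simp: L2_norm_nonneg)
  finally show ?thesis .
qed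

text \<open>\<open>cD\<close> occurs twice, once to bound the source as a functional in the Hessian
  norm, once to return from the Hessian norm of the solution to its reconstruction.\<close>

lemma hessian_scheme_stable_L2:
  assumes w: "hessian_scheme \<Omega> D g w" "hessian_scheme \<Omega> D g' w'" and g: "g \<in> L2 \<Omega>" "g' \<in> L2 \<Omega>"
    and cD: "CD \<Omega> D \<le> cD"
  shows "L2_norm \<Omega> (\<lambda>x. PiD D w x - PiD D w' x) \<le> cD\<^sup>2 * L2_norm \<Omega> (\<lambda>x. g x - g' x)"
proof -
  let ?d = "\<lambda>x. g x - g' x"
  have c0: "0 \<le> cD" using cD CD_nonneg by simp
  have "\<bar>L2_inner \<Omega> ?d (PiD D v)\<bar> \<le> L2_norm \<Omega> ?d * cD * L2_norm \<Omega> (HessD D v)" if v: "v \<in> XD D" for v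
  proof -
    have "\<bar>L2_inner \<Omega> ?d (PiD D v)\<bar> \<le> L2_norm \<Omega> ?d * L2_norm \<Omega> (PiD D v)"
      by (rule L2_Cauchy_Schwarz[OF L2_diff[OF g] PiD_L2[OF v]])
    also have "\<dots> \<le> L2_norm \<Omega> ?d * (cD * L2_norm \<Omega> (HessD D v))"
      using PiD_le_CD[OF v] mult_right_mono[OF cD L2_norm_nonneg[of \<Omega> "HessD D v"]]
      by (intro mult_left_mono) (auto simp: L2_norm_nonneg)
    finally show ?thesis by (simp only: mult.assoc)
  qed
  from hessian_scheme_stable[OF w g cD this] c0 show ?thesis
    by (simp add: L2_norm_nonneg power2_eq_square mult_ac)
qed

end

section \<open>Meshes and cell means\<close>

text \<open>A polytope of dimension d - 1 is convex with empty interior, hence null. This is why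
  cell boundaries can be ignored in every integral over a mesh.\<close>

lemma negligible_flat_face:
  fixes \<sigma> :: "(real^'n) set"
  assumes "flat_face \<sigma>"
  shows "negligible \<sigma>"
proof -
  obtain P where P: "finite P" "\<And>p. p \<in> P \<Longrightarrow> polytope p \<and> aff_dim p = int CARD('n) - 1" "\<sigma> = \<Union>P"
    using assms by (auto simp: flat_face_def)
  have "negligible p" if "p \<in> P" for p
  proof -
    have "interior p = {}"
      using P(2)[OF that] low_dim_interior[of p] by auto
    then show ?thesis
      using P(2)[OF that] negligible_convex_interior polytope_imp_convex by blast
  qed
  then show ?thesis using P by (auto intro: negligible_Union)
qed

lemma negligible_frontier_polytopal:
  assumes "polytopal_domain S"
  shows "negligible (frontier S)"
proof -
  obtain F where "finite F" "\<forall>\<sigma>\<in>F. flat_face \<sigma>" "frontier S = \<Union>F"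
    using assms unfolding polytopal_domain_def polytopal_def by blast
  then show ?thesis using negligible_flat_face by (metis negligible_Union)
qed

lemma polytopal_domain_measure:
  assumes "polytopal_domain S"
  shows "open S" "bounded S" "S \<noteq> {}" "S \<in> sets lebesgue" "S \<in> sets borel" "emeasure lborel S < \<infinity>"
    "emeasure lebesgue S < \<infinity>" "0 < measure lebesgue S" "S \<in> lmeasurable"
proof -
  show o: "open S" "bounded S" "S \<noteq> {}" using assms by (simp_all add: polytopal_domain_def)
  then show "S \<in> sets lebesgue" "S \<in> sets borel" by auto
  show f: "emeasure lborel S < \<infinity>" using emeasure_bounded_finite[OF o(2)] .
  then show "emeasure lebesgue S < \<infinity>" using o(1) by simp
  then show l: "S \<in> lmeasurable" using \<open>S \<in> sets lebesgue\<close> o(1) by (intro fmeasurableI) auto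
  have "\<not> negligible S" using open_not_negligible o by blast
  then show "0 < measure lebesgue S"
    using negligible_iff_measure0[OF l] by (simp add: zero_less_measure_iff)
qed

lemma mesh_parts:
  assumes "polytopal_mesh S M"
  shows "finite M" "\<forall>K\<in>M. polytopal_domain K \<and> K \<subseteq> S" "pairwise disjnt M" "closure S = (\<Union>K\<in>M. closure K)"
proof -
  note M = assms[unfolded polytopal_mesh_def]
  show "finite M" by (rule conjunct1[OF M])
  show "\<forall>K\<in>M. polytopal_domain K \<and> K \<subseteq> S" by (rule conjunct1[OF conjunct2[OF M]])
  show "pairwise disjnt M" by (rule conjunct1[OF conjunct2[OF conjunct2[OF M]]])
  show "closure S = (\<Union>K\<in>M. closure K)" by (rule conjunct1[OF conjunct2[OF conjunct2[OF conjunct2[OF M]]]])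
qed

lemma mesh_cell:
  assumes "polytopal_mesh S M" "K \<in> M"
  shows "polytopal_domain K" "K \<subseteq> S" "finite M"
  using mesh_parts(1,2)[OF assms(1)] assms(2) by simp_all

lemma mesh_disjoint: "polytopal_mesh S M \<Longrightarrow> K \<in> M \<Longrightarrow> K' \<in> M \<Longrightarrow> x \<in> K \<Longrightarrow> x \<in> K' \<Longrightarrow> K = K'"
  using mesh_parts(3) unfolding pairwise_def disjnt_def by blast

text \<open>The mesh covers the domain only by closures; what the open cells miss lies on finitely
  many null frontiers.\<close>

lemma mesh_AE_covered:
  fixes S :: "(real^'n) set"
  assumes M: "polytopal_mesh S M"
  shows "AE x in lborel. x \<in> S \<longrightarrow> (\<exists>K\<in>M. x \<in> K)"
proof -
  have "negligible (\<Union>K\<in>M. frontier K)"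
    using mesh_parts(1,2)[OF M] by (intro negligible_Union) (auto intro: negligible_frontier_polytopal)
  then have "AE x in lborel. x \<notin> (\<Union>K\<in>M. frontier K)"
    using AE_not_in[of "\<Union>K\<in>M. frontier K" lebesgue]
    by (simp add: negligible_iff_null_sets AE_completion_iff)
  then show ?thesis
  proof eventually_elim
    case (elim x)
    show ?case
    proof
      assume "x \<in> S"
      then have "x \<in> closure S" using closure_subset by blast
      then obtain K where K: "K \<in> M" "x \<in> closure K" using mesh_parts(4)[OF M] by blast
      have "interior K = K" using polytopal_domain_measure(1)[OF mesh_cell(1)[OF M K(1)]] by (simp add: interior_open)
      then have "x \<in> K" using K elim by (auto simp: frontier_def)
      then show "\<exists>K\<in>M. x \<in> K" using K by blast
    qed
  qed
qed

lemma mesh_sum_indicator: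
  assumes M: "polytopal_mesh S M" and K: "K \<in> M" "x \<in> K"
  shows "(\<Sum>K'\<in>M. indicator K' x * F K') = (F K :: real)"
proof -
  have "(\<Sum>K'\<in>M. indicator K' x * F K') = (\<Sum>K'\<in>M. if K' = K then F K else 0)"
  proof (rule sum.cong[OF refl])
    fix K' assume K': "K' \<in> M"
    show "indicator K' x * F K' = (if K' = K then F K else 0)"
      using mesh_disjoint[OF M K' K(1) _ K(2)] K(2) by (cases "x \<in> K'") auto
  qed
  then show ?thesis using K(1) mesh_cell(3)[OF M K(1)] by simp
qed

lemma integral_mesh:
  fixes f :: "real^'n \<Rightarrow> real"
  assumes M: "polytopal_mesh S M" and S: "S \<in> sets lebesgue" and f: "integrable (lebesgue_on S) f"
  shows "integral\<^sup>L (lebesgue_on S) f = (\<Sum>K\<in>M. integral\<^sup>L (lebesgue_on K) f)"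
proof -
  have K: "K \<in> sets lebesgue" "K \<subseteq> S" if "K \<in> M" for K
    using polytopal_domain_measure(4)[OF mesh_cell(1)[OF M that]] mesh_cell(2)[OF M that] by auto
  have iS: "integrable lebesgue (\<lambda>x. indicator S x * f x)"
    using f S by (simp add: integrable_restrict_space)
  have iK: "integrable lebesgue (\<lambda>x. indicator K x * f x)" if "K \<in> M" for K
  proof -
    have "integrable lebesgue (\<lambda>x. indicator K x *\<^sub>R (indicator S x * f x))"
      by (rule integrable_mult_indicator[OF K(1)[OF that] iS])
    moreover have "(\<lambda>x. indicator K x *\<^sub>R (indicator S x * f x)) = (\<lambda>x. indicator K x * f x)"
      using K(2)[OF that] by (auto simp: fun_eq_iff indicator_def)
    ultimately show ?thesis by simp
  qed
  have "AE x in lebesgue. indicator S x * f x = (\<Sum>K\<in>M. indicator K x * f x)"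
    unfolding AE_completion_iff using mesh_AE_covered[OF M]
  proof eventually_elim
    case (elim x)
    show ?case
    proof (cases "x \<in> S")
      case True
      then obtain K where "K \<in> M" "x \<in> K" using elim by blast
      then show ?thesis using True mesh_sum_indicator[OF M, of K x "\<lambda>_. f x"] by simp
    next
      case False
      then have "(\<Sum>K\<in>M. indicator K x * f x) = 0"
        using K(2) by (intro sum.neutral) (auto simp: indicator_def)
      then show ?thesis using False by simp
    qed
  qed
  then have "integral\<^sup>L lebesgue (\<lambda>x. indicator S x * f x) = integral\<^sup>L lebesgue (\<lambda>x. \<Sum>K\<in>M. indicator K x * f x)"
    using iS iK by (intro integral_cong_AE) (auto intro!: borel_measurable_sum borel_measurable_integrable)
  also have "\<dots> = (\<Sum>K\<in>M. integral\<^sup>L lebesgue (\<lambda>x. indicator K x * f x))"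
    by (rule Bochner_Integration.integral_sum[OF iK])
  finally show ?thesis
    using S K(1) by (simp add: integral_restrict_space)
qed

lemma L2_cell:
  assumes "polytopal_mesh S M" "S \<in> sets lebesgue" "K \<in> M" "f \<in> L2 S"
  shows "f \<in> L2 K"
  using L2_subset[OF assms(4)] mesh_cell(1,2)[OF assms(1,3)] polytopal_domain_measure(4) assms(2) by blast

lemma L2_inner_mesh:
  assumes "polytopal_mesh S M" "S \<in> sets lebesgue" "f \<in> L2 S" "g \<in> L2 S"
  shows "L2_inner S f g = (\<Sum>K\<in>M. L2_inner K f g)"
  unfolding L2_inner_def by (rule integral_mesh[OF assms(1,2) L2_integrable_inner[OF assms(3,4)]])

lemma L2_norm_mesh:
  assumes "polytopal_mesh S M" "S \<in> sets lebesgue" "f \<in> L2 S"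
  shows "(L2_norm S f)\<^sup>2 = (\<Sum>K\<in>M. (L2_norm K f)\<^sup>2)"
  unfolding L2_norm_square by (rule L2_inner_mesh[OF assms assms(3)])

section \<open>Cell means and the projection on piecewise constant functions\<close>

definition cell_mean :: "(real^'n) set \<Rightarrow> (real^'n \<Rightarrow> real) \<Rightarrow> real" where
  "cell_mean K v = integral\<^sup>L (lebesgue_on K) v / measure lebesgue K"

lemma proj_mesh_eq_sum:
  assumes M: "polytopal_mesh S M"
  shows "proj_mesh M v x = (\<Sum>K\<in>M. indicator K x * cell_mean K v)"
  unfolding proj_mesh_def cell_mean_def
  by (intro sum.cong refl)
    (simp add: set_lebesgue_integral_def integral_restrict_space polytopal_domain_measure(4)[OF mesh_cell(1)[OF M]])

lemma proj_mesh_cell: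
  "polytopal_mesh S M \<Longrightarrow> K \<in> M \<Longrightarrow> x \<in> K \<Longrightarrow> proj_mesh M v x = cell_mean K v"
  by (simp add: proj_mesh_eq_sum mesh_sum_indicator)

lemma piecewise_constant_L2:
  fixes S :: "(real^'n) set" and F :: "(real^'n) set \<Rightarrow> real"
  assumes M: "polytopal_mesh S M" and S: "polytopal_domain S"
  shows "(\<lambda>x. \<Sum>K\<in>M. indicator K x * F K) \<in> L2 S"
proof (rule L2_sum)
  show "finite M" by (rule mesh_parts(1)[OF M])
  fix K assume K: "K \<in> M"
  have "(indicator K :: _ \<Rightarrow> real) \<in> borel_measurable lebesgue"
    using polytopal_domain_measure(4)[OF mesh_cell(1)[OF M K]] by simp
  then have "(indicator K :: _ \<Rightarrow> real) \<in> borel_measurable (lebesgue_on S)"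
    by (rule measurable_restrict_space1)
  then have "(\<lambda>x. indicator K x * F K) \<in> borel_measurable (lebesgue_on S)"
    by (intro borel_measurable_times) auto
  then show "(\<lambda>x. indicator K x * F K) \<in> L2 S"
    using L2_const[OF polytopal_domain_measure(6,5)[OF S], of "F K"]
    by (rule L2_bound[where C = 1]) (auto simp: indicator_def)
qed

lemma proj_mesh_L2:
  assumes "polytopal_mesh S M" "polytopal_domain S"
  shows "proj_mesh M v \<in> L2 S"
  using piecewise_constant_L2[OF assms, of "\<lambda>K. cell_mean K v"]
  by (simp add: proj_mesh_eq_sum[OF assms(1), abs_def])

context
  fixes K :: "(real^'n) set"
  assumes K: "polytopal_domain K"
begin

lemmas K_meas = polytopal_domain_measure[OF K]

lemma cell_const_L2: "(\<lambda>x. c :: real) \<in> L2 K"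
  by (rule L2_const[OF K_meas(6,5)])

lemma cell_integrable: "f \<in> L2 K \<Longrightarrow> integrable (lebesgue_on K) (f :: _ \<Rightarrow> real)"
  by (rule L2_integrable_finite_measure[OF _ K_meas(7,4)])

lemma cell_integral_const: "integral\<^sup>L (lebesgue_on K) (\<lambda>x. c :: real) = c * measure lebesgue K"
  using K_meas by (simp add: measure_restrict_space)

lemma cell_integral_mean: "integral\<^sup>L (lebesgue_on K) v = measure lebesgue K * cell_mean K v"
  using K_meas(8) by (simp add: cell_mean_def)

lemma L2_inner_cell_const: "f \<in> L2 K \<Longrightarrow> L2_inner K f (\<lambda>x. c) = c * measure lebesgue K * cell_mean K f"
  by (simp add: L2_inner_def cell_integral_mean)

lemma cell_mean_const: "cell_mean K (\<lambda>x. c) = c"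
  using K_meas(8) unfolding cell_mean_def cell_integral_const by simp

lemma cell_mean_diff: "f \<in> L2 K \<Longrightarrow> g \<in> L2 K \<Longrightarrow> cell_mean K (\<lambda>x. f x - g x) = cell_mean K f - cell_mean K g"
  by (simp add: cell_mean_def cell_integrable diff_divide_distrib)

lemma cell_mean_mult: "cell_mean K (\<lambda>x. c * f x) = c * cell_mean K f"
  by (simp add: cell_mean_def)

lemma cell_mean_mono:
  assumes "f \<in> L2 K" "g \<in> L2 K" "AE x in lebesgue_on K. f x \<le> g x"
  shows "cell_mean K f \<le> cell_mean K g"
  unfolding cell_mean_def using assms K_meas(8)
  by (intro divide_right_mono integral_mono_AE cell_integrable) auto

lemma cell_mean_cong:
  assumes "f \<in> L2 K" "g \<in> L2 K" "AE x in lebesgue_on K. f x = g x"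
  shows "cell_mean K f = cell_mean K g"
proof (rule antisym)
  show "cell_mean K f \<le> cell_mean K g"
    by (rule cell_mean_mono[OF assms(1,2)]) (use assms(3) in \<open>eventually_elim, simp\<close>)
  show "cell_mean K g \<le> cell_mean K f"
    by (rule cell_mean_mono[OF assms(2,1)]) (use assms(3) in \<open>eventually_elim, simp\<close>)
qed

lemma L2_norm_cell_const: "(L2_norm K (\<lambda>x. c :: real))\<^sup>2 = c\<^sup>2 * measure lebesgue K"
  unfolding L2_norm_square L2_inner_cell_const[OF cell_const_L2] cell_mean_const
  by (simp add: power2_eq_square)

text \<open>Pythagoras, because f minus its mean is orthogonal to constants. The choice of
  \<open>a\<close> gives two facts: an estimate with an unspecified constant may be used for the
  mean, and taking means is a contraction.\<close>

lemma L2_norm_cell_mean_decomp: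
  assumes f: "f \<in> L2 K"
  shows "(L2_norm K (\<lambda>x. f x - a))\<^sup>2 =
    (L2_norm K (\<lambda>x. f x - cell_mean K f))\<^sup>2 + (cell_mean K f - a)\<^sup>2 * measure lebesgue K"
proof -
  have *: "(L2_norm K (\<lambda>x. f x - b))\<^sup>2 = L2_inner K f f - 2 * b * measure lebesgue K * cell_mean K f + b\<^sup>2 * measure lebesgue K" for b
    unfolding L2_norm_square
    by (simp add: L2_inner_diff_left L2_inner_diff_right L2_diff f cell_const_L2 L2_inner_cell_const
        L2_inner_commute[of K "\<lambda>x. b" f] cell_mean_const power2_eq_square)
  show ?thesis unfolding * by (simp add: power2_eq_square algebra_simps)
qed

lemma cell_mean_best:
  "f \<in> L2 K \<Longrightarrow> (L2_norm K (\<lambda>x. f x - cell_mean K f))\<^sup>2 \<le> (L2_norm K (\<lambda>x. f x - a))\<^sup>2"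
  using L2_norm_cell_mean_decomp[of f a] K_meas(8) by simp

lemma cell_mean_contraction:
  "f \<in> L2 K \<Longrightarrow> (cell_mean K f)\<^sup>2 * measure lebesgue K \<le> (L2_norm K f)\<^sup>2"
  using L2_norm_cell_mean_decomp[of f 0] by simp

end

lemma L2_norm_proj_mesh_le:
  assumes M: "polytopal_mesh S M" and S: "polytopal_domain S" and f: "f \<in> L2 S"
  shows "L2_norm S (proj_mesh M f) \<le> L2_norm S f"
proof (rule power2_le_imp_le)
  note Sm = polytopal_domain_measure(4)[OF S]
  have "(L2_norm K (proj_mesh M f))\<^sup>2 \<le> (L2_norm K f)\<^sup>2" if K: "K \<in> M" for K
  proof -
    note pK = mesh_cell(1)[OF M K]
    have "L2_norm K (proj_mesh M f) = L2_norm K (\<lambda>x. cell_mean K f)"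
    proof (rule L2_norm_cong_AE)
      show "AE x in lebesgue_on K. proj_mesh M f x = cell_mean K f"
        using proj_mesh_cell[OF M K] by (auto intro!: AE_I2)
    qed (use L2_cell[OF M Sm K proj_mesh_L2[OF M S]] cell_const_L2[OF pK] in auto)
    then show ?thesis
      using L2_norm_cell_const[OF pK] cell_mean_contraction[OF pK L2_cell[OF M Sm K f]] by simp
  qed
  then show "(L2_norm S (proj_mesh M f))\<^sup>2 \<le> (L2_norm S f)\<^sup>2"
    unfolding L2_norm_mesh[OF M Sm f] L2_norm_mesh[OF M Sm proj_mesh_L2[OF M S]] by (rule sum_mono)
qed (rule L2_norm_nonneg)

lemma proj_mesh_diff:
  assumes M: "polytopal_mesh S M" and S: "polytopal_domain S" and f: "f \<in> L2 S" "g \<in> L2 S"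
  shows "proj_mesh M (\<lambda>x. f x - g x) x = proj_mesh M f x - proj_mesh M g x"
proof -
  have "cell_mean K (\<lambda>x. f x - g x) = cell_mean K f - cell_mean K g" if "K \<in> M" for K
    using cell_mean_diff[OF mesh_cell(1)[OF M that]] L2_cell[OF M polytopal_domain_measure(4)[OF S] that] f by blast
  then show ?thesis
    unfolding proj_mesh_eq_sum[OF M] by (simp add: right_diff_distrib sum_subtractf)
qed

text \<open>Star-shapedness puts the centroid into the open set \<open>K\<close>, so the inner radius is positive and the
  regularity bound is not the vacuous \<open>x / 0 = 0\<close>.\<close>

lemma cell_geometry:
  fixes K :: "(real^'n) set"
  assumes K: "polytopal_domain K" and star: "\<And>x. x \<in> K \<Longrightarrow> closed_segment (centroid K) x \<subseteq> K"
    and reg: "diameter K / inner_radius K \<le> \<eta>" and \<eta>: "\<eta> > 0"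
  shows "0 < diameter K" "ball (centroid K) (diameter K / \<eta>) \<subseteq> K"
    "x \<in> K \<Longrightarrow> dist (centroid K) x \<le> diameter K"
proof -
  let ?c = "centroid K"
  note Km = polytopal_domain_measure[OF K]
  obtain x0 where "x0 \<in> K" using Km(3) by blast
  then have c: "?c \<in> K" using star by blast
  then obtain e where e: "e > 0" "ball ?c e \<subseteq> K" using Km(1) openE by blast
  have le: "2 * r \<le> diameter K" if "ball ?c r \<subseteq> K" "r > 0" for r
    using diameter_subset[OF that(1) Km(2)] that(2) by simp
  show d: "0 < diameter K" using le[OF e(2,1)] e(1) by simp
  show "dist ?c x \<le> diameter K" if "x \<in> K"
    using diameter_bounded_bound[OF Km(2) c that] .
  let ?R = "{r. ball ?c r \<subseteq> K}"
  have bdd: "bdd_above ?R"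
  proof (rule bdd_aboveI[of _ "diameter K"])
    fix r assume "r \<in> ?R"
    then show "r \<le> diameter K" using le[of r] d by (cases "r > 0") auto
  qed
  have ne: "e \<in> ?R" using e by simp
  have "e \<le> inner_radius K" unfolding inner_radius_def by (rule cSup_upper[OF ne bdd])
  then have pos: "inner_radius K > 0" using e(1) by simp
  then have "diameter K / \<eta> \<le> inner_radius K"
    using reg \<eta> by (simp add: divide_le_eq mult.commute)
  moreover have "ball ?c (inner_radius K) \<subseteq> K"
  proof
    fix y assume "y \<in> ball ?c (inner_radius K)"
    then have "dist ?c y < Sup ?R" by (simp add: inner_radius_def)
    then obtain r where "r \<in> ?R" "dist ?c y < r" using less_cSup_iff[OF _ bdd] ne by blast
    then show "y \<in> K" by auto
  qed
  ultimately show "ball ?c (diameter K / \<eta>) \<subseteq> K" by (meson subset_ball subset_trans)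
qed

text \<open>The constant of the star-shaped estimate for H the diameter, r = diameter / \<eta> and
  ratio s = 1 / (\<eta> + 1), divided by the squared diameter.\<close>

definition Poincare_const :: "nat \<Rightarrow> real \<Rightarrow> real" where
  "Poincare_const d \<eta> = 2 * (\<eta> + 1) ^ d * (1 + 2 ^ d * (2 / \<eta>)\<^sup>2)"

lemma Poincare_cell:
  fixes f :: "real^'n \<Rightarrow> real"
  assumes K: "polytopal_domain K" and star: "\<And>x. x \<in> K \<Longrightarrow> closed_segment (centroid K) x \<subseteq> K"
    and reg: "diameter K / inner_radius K \<le> \<eta>" and \<eta>: "\<eta> > 0"
    and f: "f \<in> L2 K" and D: "\<And>i. D i \<in> L2 K" and weak: "\<And>i. is_weak_deriv K [i] f (D i)"
  shows "(L2_norm K (\<lambda>x. f x - cell_mean K f))\<^sup>2 \<le>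
    Poincare_const CARD('n) \<eta> * (diameter K)\<^sup>2 * (\<Sum>i\<in>UNIV. (L2_norm K (D i))\<^sup>2)"
proof -
  note Km = polytopal_domain_measure[OF K]
  note G = cell_geometry[OF K star reg \<eta>]
  \<comment> \<open>The ratio must be below 1 and, to carry the cell into the ball of radius
    diameter / \<eta>, strictly below 1 / \<eta>; 1 / (\<eta> + 1) is both.\<close>
  have s: "0 < 1 / (\<eta> + 1)" "1 / (\<eta> + 1) < 1" using \<eta> by auto
  have s3: "1 / (\<eta> + 1) * diameter K < diameter K / \<eta>"
    using G(1) \<eta> by (simp add: divide_strict_left_mono)
  have r: "diameter K / \<eta> > 0" using G(1) \<eta> by simp
  obtain a where "(L2_norm K (\<lambda>x. f x - a))\<^sup>2 \<le> 2 * (1 / (1 / (\<eta> + 1))) ^ CARD('n) *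
      ((diameter K)\<^sup>2 + 2 ^ CARD('n) * (2 * (diameter K / \<eta>))\<^sup>2) * (\<Sum>i\<in>UNIV. (L2_norm K (D i))\<^sup>2)"
    using Poincare_star_shaped[OF Km(1,6) f D weak star G(3) r G(2) s s3] by blast
  also have "2 * (1 / (1 / (\<eta> + 1))) ^ CARD('n) * ((diameter K)\<^sup>2 + 2 ^ CARD('n) * (2 * (diameter K / \<eta>))\<^sup>2)
      = Poincare_const CARD('n) \<eta> * (diameter K)\<^sup>2"
    by (simp add: Poincare_const_def power_mult_distrib power_divide algebra_simps)
  finally show ?thesis using cell_mean_best[OF K f, of a] by linarith
qed

lemma Lipschitz_cell:
  fixes f :: "real^'n \<Rightarrow> real"
  assumes K: "polytopal_domain K" and star: "\<And>x. x \<in> K \<Longrightarrow> closed_segment (centroid K) x \<subseteq> K"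
    and reg: "diameter K / inner_radius K \<le> \<eta>" and \<eta>: "\<eta> > 0"
    and f: "f \<in> L2 K" and D: "\<And>i. D i \<in> L2 K" and weak: "\<And>i. is_weak_deriv K [i] f (D i)"
    and L: "\<And>i. AE x in lebesgue_on K. \<bar>D i x\<bar> \<le> L" "0 \<le> L"
  shows "\<exists>a. AE x in lebesgue_on K. \<bar>f x - a\<bar> \<le> real CARD('n) * (1 + 2 / \<eta>) * diameter K * L"
proof -
  note Km = polytopal_domain_measure[OF K]
  note G = cell_geometry[OF K star reg \<eta>]
  have s: "0 < 1 / (\<eta> + 1)" "1 / (\<eta> + 1) < 1" using \<eta> by auto
  have s3: "1 / (\<eta> + 1) * diameter K < diameter K / \<eta>"
    using G(1) \<eta> by (simp add: divide_strict_left_mono)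
  have r: "diameter K / \<eta> > 0" using G(1) \<eta> by simp
  have "real CARD('n) * L * (diameter K + 2 * (diameter K / \<eta>)) = real CARD('n) * (1 + 2 / \<eta>) * diameter K * L"
    by (simp add: algebra_simps)
  with Lipschitz_star_shaped[OF Km(1,6) f D weak L star G(3) r G(2) s s3] show ?thesis by (simp only:)
qed

section \<open>The control problem\<close>

lemma extend_zero_L2:
  assumes u: "u \<in> L2 \<omega>" and \<omega>: "\<omega> \<subseteq> \<Omega>" "\<omega> \<in> sets lebesgue" and \<Omega>: "\<Omega> \<in> sets lebesgue"
  shows "extend_zero \<omega> u \<in> L2 \<Omega>"
proof (rule L2I)
  have eq: "indicator \<Omega> x *\<^sub>R (extend_zero \<omega> u x) = indicator \<omega> x *\<^sub>R u x"
    "indicator \<Omega> x *\<^sub>R (norm (extend_zero \<omega> u x))\<^sup>2 = indicator \<omega> x *\<^sub>R (norm (u x))\<^sup>2" for x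
    using \<omega>(1) by (auto simp: extend_zero_def indicator_def)
  have S: "\<Omega> \<inter> space lebesgue \<in> sets lebesgue" "\<omega> \<inter> space lebesgue \<in> sets lebesgue" using \<omega> \<Omega> by auto
  show "extend_zero \<omega> u \<in> borel_measurable (lebesgue_on \<Omega>)"
    using L2_measurable[OF u] unfolding borel_measurable_restrict_space_iff[OF S(1)] borel_measurable_restrict_space_iff[OF S(2)] eq .
  show "integrable (lebesgue_on \<Omega>) (\<lambda>x. (norm (extend_zero \<omega> u x))\<^sup>2)"
    using u unfolding L2_def integrable_restrict_space[OF S(1)] eq integrable_restrict_space[OF S(2)] by simp
qed

lemma L2_inner_extend_zero:
  fixes u g :: "real^'n \<Rightarrow> real"
  assumes \<omega>: "\<omega> \<subseteq> \<Omega>" "\<omega> \<in> sets lebesgue" and \<Omega>: "\<Omega> \<in> sets lebesgue"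
  shows "L2_inner \<Omega> (extend_zero \<omega> u) g = L2_inner \<omega> u g"
proof -
  have "indicator \<Omega> x *\<^sub>R (extend_zero \<omega> u x \<bullet> g x) = indicator \<omega> x *\<^sub>R (u x \<bullet> g x)" for x
    using \<omega>(1) by (auto simp: extend_zero_def indicator_def)
  then show ?thesis using \<omega> \<Omega> by (simp only: L2_inner_lebesgue)
qed

lemma L2_norm_extend_zero:
  fixes u :: "real^'n \<Rightarrow> real"
  assumes \<omega>: "\<omega> \<subseteq> \<Omega>" "\<omega> \<in> sets lebesgue" and \<Omega>: "\<Omega> \<in> sets lebesgue"
  shows "L2_norm \<Omega> (extend_zero \<omega> u) = L2_norm \<omega> u"
proof -
  have "L2_inner \<Omega> (extend_zero \<omega> u) (extend_zero \<omega> u) = L2_inner \<omega> (extend_zero \<omega> u) u"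
    by (simp add: L2_inner_extend_zero[OF assms] L2_inner_commute)
  also have "\<dots> = L2_inner \<omega> u u"
    using \<omega>(2) unfolding L2_inner_lebesgue[OF \<omega>(2)]
    by (intro Bochner_Integration.integral_cong) (auto simp: extend_zero_def indicator_def)
  finally show ?thesis by (metis L2_norm_nonneg L2_norm_square power2_eq_iff_nonneg)
qed

section \<open>Projection onto the bounds and the formula for the optimal control\<close>

definition clip :: "real \<Rightarrow> real \<Rightarrow> real \<Rightarrow> real" where
  "clip a b t = max a (min b t)"

lemma clip_bounds: "a \<le> b \<Longrightarrow> a \<le> clip a b t \<and> clip a b t \<le> b"
  by (simp add: clip_def)

lemma clip_id: "a \<le> t \<Longrightarrow> t \<le> b \<Longrightarrow> clip a b t = t"
  by (simp add: clip_def)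

lemma clip_mono: "s \<le> t \<Longrightarrow> clip a b s \<le> clip a b t"
  by (auto simp: clip_def)

lemma clip_variational: "a \<le> b \<Longrightarrow> a \<le> v \<Longrightarrow> v \<le> b \<Longrightarrow> 0 \<le> (clip a b t - t) * (v - clip a b t)"
  by (auto simp: clip_def max_def min_def intro: mult_nonneg_nonneg mult_nonpos_nonpos)

text \<open>Projection onto [a, b] does not increase distances and sends 0 to a point of modulus
  minmod(a, b), which is the distance of 0 from the interval. This is how minmod gets into the data
  term.\<close>

lemma abs_clip_le: "a \<le> b \<Longrightarrow> \<bar>clip a b t\<bar> \<le> \<bar>t\<bar> + minmod a b"
proof -
  assume ab: "a \<le> b"
  consider "a > 0" | "b < 0" | "a \<le> 0" "0 \<le> b" using ab by linarith
  then show ?thesis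
  proof cases
    case 1
    then have "minmod a b = a" using ab by (simp add: minmod_def mult_le_0_iff)
    then show ?thesis using 1 by (auto simp: clip_def)
  next
    case 2
    then have "minmod a b = - b" using ab by (simp add: minmod_def mult_le_0_iff)
    then show ?thesis using 2 ab by (auto simp: clip_def)
  next
    case 3
    then have "minmod a b = 0" by (simp add: minmod_def mult_le_0_iff)
    then show ?thesis using 3 by (auto simp: clip_def)
  qed
qed

lemma bounded_L2:
  assumes \<omega>: "polytopal_domain \<omega>" and u: "u \<in> borel_measurable (lebesgue_on \<omega>)"
    and b: "AE x in lebesgue_on \<omega>. a \<le> u x \<and> u x \<le> (b::real)"
  shows "u \<in> L2 \<omega>"
  by (rule L2_bound[OF u cell_const_L2[OF \<omega>, of "max \<bar>a\<bar> \<bar>b\<bar>"], where C = 1])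
    (use b in eventually_elim, auto)

text \<open>Test the variational inequality with the clipped function itself. Its pointwise
  characterisation as a projection bounds the integrand by -\<alpha> (v - u)^2, so the integral can
  be nonnegative only if v = u almost everywhere.\<close>

lemma control_projection_formula:
  fixes u p ud :: "real^'n \<Rightarrow> real"
  assumes \<omega>: "polytopal_domain \<omega>" and p: "p \<in> L2 \<omega>" and ud: "ud \<in> L2 \<omega>" and \<alpha>: "\<alpha> > 0" and ab: "a \<le> b"
    and u: "u \<in> Uad \<omega> a b"
    and vi: "\<And>v. v \<in> Uad \<omega> a b \<Longrightarrow> 0 \<le> L2_inner \<omega> (\<lambda>x. p x + \<alpha> * (u x - ud x)) (\<lambda>x. v x - u x)"
  shows "AE x in lebesgue_on \<omega>. u x = clip a b (ud x - p x / \<alpha>)"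
proof -
  define v where "v x = clip a b (ud x - p x / \<alpha>)" for x
  have [measurable]: "p \<in> borel_measurable (lebesgue_on \<omega>)" "ud \<in> borel_measurable (lebesgue_on \<omega>)"
    using p ud by (auto intro: L2_measurable)
  have vm: "v \<in> borel_measurable (lebesgue_on \<omega>)"
    unfolding v_def clip_def by measurable
  have vL: "v \<in> L2 \<omega>"
    by (rule bounded_L2[OF \<omega> vm, of a b]) (simp add: v_def clip_bounds ab)
  have v: "v \<in> Uad \<omega> a b" using vL by (simp add: Uad_def v_def clip_bounds ab)
  have uL: "u \<in> L2 \<omega>" and ub: "AE x in lebesgue_on \<omega>. a \<le> u x \<and> u x \<le> b" using u by (auto simp: Uad_def)
  have s: "(\<lambda>x. p x + \<alpha> * (u x - ud x)) \<in> L2 \<omega>"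
    by (intro L2_add L2_mult L2_diff p ud uL)
  have d: "(\<lambda>x. v x - u x) \<in> L2 \<omega>" by (intro L2_diff vL uL)
  have i: "integrable (lebesgue_on \<omega>) (\<lambda>x. (v x - u x)\<^sup>2)"
    using d by (simp add: L2_def)
  have "integral\<^sup>L (lebesgue_on \<omega>) (\<lambda>x. (p x + \<alpha> * (u x - ud x)) \<bullet> (v x - u x))
      \<le> integral\<^sup>L (lebesgue_on \<omega>) (\<lambda>x. - \<alpha> * (v x - u x)\<^sup>2)"
  proof (rule integral_mono_AE)
    show "AE x in lebesgue_on \<omega>. (p x + \<alpha> * (u x - ud x)) \<bullet> (v x - u x) \<le> - \<alpha> * (v x - u x)\<^sup>2"
      using ub
    proof eventually_elim
      case (elim x)
      define q where "q = ud x - p x / \<alpha>"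
      have nn: "0 \<le> \<alpha> * ((v x - q) * (u x - v x))"
        using clip_variational[OF ab, of "u x" q] elim \<alpha> by (simp add: v_def q_def)
      have eq: "p x + \<alpha> * (u x - ud x) = \<alpha> * (u x - q)" using \<alpha> by (simp add: q_def algebra_simps)
      show ?case unfolding eq using nn by (simp add: power2_eq_square algebra_simps)
    qed
  qed (use L2_integrable_inner[OF s d] i in auto)
  with vi[OF v] have "\<alpha> * integral\<^sup>L (lebesgue_on \<omega>) (\<lambda>x. (v x - u x)\<^sup>2) \<le> 0"
    by (simp add: L2_inner_def)
  then have "integral\<^sup>L (lebesgue_on \<omega>) (\<lambda>x. (v x - u x)\<^sup>2) \<le> 0"
    using \<alpha> by (simp add: mult_le_0_iff)
  moreover have "0 \<le> integral\<^sup>L (lebesgue_on \<omega>) (\<lambda>x. (v x - u x)\<^sup>2)"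
    by (rule integral_nonneg_AE) simp
  ultimately have "integral\<^sup>L (lebesgue_on \<omega>) (\<lambda>x. (v x - u x)\<^sup>2) = 0"
    by (rule antisym)
  then have "AE x in lebesgue_on \<omega>. (v x - u x)\<^sup>2 = 0"
    using integral_nonneg_eq_0_iff_AE[OF i] by simp
  then show ?thesis by eventually_elim (simp add: v_def)
qed

section \<open>Almost everywhere statements, weak derivatives and essential bounds on cells\<close>

lemma AE_cell:
  assumes "AE x in lebesgue_on S. P x" "K \<subseteq> S" "K \<in> sets lebesgue" "S \<in> sets lebesgue"
  shows "AE x in lebesgue_on K. P x"
  using assms(1) unfolding AE_lebesgue_on_iff[OF assms(3)] AE_lebesgue_on_iff[OF assms(4)]
  by eventually_elim (use assms(2) in auto)

text \<open>Cells have positive measure, so a statement about constants that is deduced almost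
  everywhere on a cell is simply true.\<close>

lemma AE_const_on_cell:
  assumes K: "polytopal_domain K" and "AE x in lebesgue_on K. P"
  shows P
proof (rule ccontr)
  assume "\<not> P"
  with assms(2) have "AE x in lborel. x \<notin> K"
    by (simp add: AE_lebesgue_on_iff[OF polytopal_domain_measure(4)[OF K]])
  then have "emeasure lborel K = 0"
    using polytopal_domain_measure(5)[OF K] by (subst (asm) AE_iff_measurable[of K]) auto
  then show False using polytopal_domain_measure(8,5)[OF K] by (simp add: measure_def)
qed

lemma weak_deriv_restrict:
  fixes f :: "real^'n \<Rightarrow> real"
  assumes S: "S \<in> sets lebesgue" and K: "K \<in> sets lebesgue" "K \<subseteq> S" and w: "is_weak_deriv S is f g"
  shows "is_weak_deriv K is f g"
proof -
  have eq: "L2_inner K h \<phi> = L2_inner S h \<phi>" if "\<phi> \<in> test_fun K" for h \<phi> :: "real^'n \<Rightarrow> real"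
  proof -
    have "indicator K x *\<^sub>R (h x \<bullet> \<phi> x) = indicator S x *\<^sub>R (h x \<bullet> \<phi> x)" for x
      using K(2) test_fun_outside[OF that, of x] by (auto simp: indicator_def)
    then show ?thesis using S K(1) by (simp only: L2_inner_lebesgue)
  qed
  have t: "\<phi> \<in> test_fun S" if "\<phi> \<in> test_fun K" for \<phi> using test_fun_mono[OF K(2)] that by blast
  show ?thesis
    unfolding is_weak_deriv_def
  proof (intro conjI ballI)
    show "locally_integrable K f" "locally_integrable K g"
      using w K(2) unfolding is_weak_deriv_def locally_integrable_def by blast+
    fix \<phi> assume \<phi>: "\<phi> \<in> test_fun K"
    show "L2_inner K f (partial_derivs is \<phi>) = (- 1) ^ length is * L2_inner K g \<phi>"
      using w t[OF \<phi>] by (simp add: eq[OF \<phi>] eq[OF test_fun_partial_derivs[OF \<phi>]] is_weak_deriv_def)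
  qed
qed

lemma weak_deriv_linear:
  fixes f g :: "real^'n \<Rightarrow> real"
  assumes S: "S \<in> sets lebesgue"
    and f: "is_weak_deriv S is f f'" "f \<in> L2 S" "f' \<in> L2 S" and g: "is_weak_deriv S is g g'" "g \<in> L2 S" "g' \<in> L2 S"
  shows "is_weak_deriv S is (\<lambda>x. f x - c * g x) (\<lambda>x. f' x - c * g' x)"
  unfolding is_weak_deriv_def
proof (intro conjI ballI)
  show "locally_integrable S (\<lambda>x. f x - c * g x)" "locally_integrable S (\<lambda>x. f' x - c * g' x)"
    using f g by (auto intro!: L2_locally_integrable L2_diff L2_mult S)
  fix \<phi> assume \<phi>: "\<phi> \<in> test_fun S"
  have t: "\<phi> \<in> L2 S" "partial_derivs is \<phi> \<in> L2 S"
    using test_fun_L2[OF _ S] \<phi> test_fun_partial_derivs by blast+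
  show "L2_inner S (\<lambda>x. f x - c * g x) (partial_derivs is \<phi>) = (- 1) ^ length is * L2_inner S (\<lambda>x. f' x - c * g' x) \<phi>"
    using f g \<phi> t by (simp add: L2_inner_diff_left L2_mult L2_inner_mult_left is_weak_deriv_def right_diff_distrib)
qed

text \<open>On a null set the essential supremum would be minus infinity; the positive measure of a
  cell excludes this. Together with membership in \<open>Linf\<close> this makes the conversion to a
  real in \<open>Linf_norm\<close> lossless.\<close>

lemma esssup_abs_nonneg:
  fixes h :: "real^'n \<Rightarrow> real"
  assumes K: "polytopal_domain K"
  shows "0 \<le> esssup (lebesgue_on K) (\<lambda>x. ereal \<bar>h x\<bar>)"
proof (rule ccontr)
  assume "\<not> ?thesis"
  then have neg: "esssup (lebesgue_on K) (\<lambda>x. ereal \<bar>h x\<bar>) < 0" by simp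
  have "AE x in lebesgue_on K. False"
    using esssup_AE[of "\<lambda>x. ereal \<bar>h x\<bar>" "lebesgue_on K"]
  proof eventually_elim
    case (elim x)
    then have "ereal \<bar>h x\<bar> < 0" using neg by (rule order.strict_trans1)
    then show False by simp
  qed
  then show False by (rule AE_const_on_cell[OF K])
qed

lemma Linf_norm_AE:
  assumes K: "polytopal_domain K" and h: "h \<in> Linf K"
  shows "AE x in lebesgue_on K. \<bar>h x\<bar> \<le> Linf_norm K h"
proof -
  have "ereal (Linf_norm K h) = esssup (lebesgue_on K) (\<lambda>x. ereal \<bar>h x\<bar>)"
    using esssup_abs_nonneg[OF K, of h] h unfolding Linf_norm_def Linf_def by (intro ereal_real') auto
  then have "AE x in lebesgue_on K. ereal \<bar>h x\<bar> \<le> ereal (Linf_norm K h)"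
    using esssup_AE[of "\<lambda>x. ereal \<bar>h x\<bar>" "lebesgue_on K"] by simp
  then show ?thesis by simp
qed

lemma Linf_norm_nonneg: "polytopal_domain K \<Longrightarrow> 0 \<le> Linf_norm K h"
  using esssup_abs_nonneg[of K h] by (simp add: Linf_norm_def real_of_ereal_pos)

text \<open>The norm refers to chosen weak derivatives, while the space only asserts that some
  bounded one exists; uniqueness transfers measurability and boundedness. Square integrability
  follows since the cell is bounded.\<close>

lemma W1inf_cell:
  fixes f :: "real^'n \<Rightarrow> real"
  assumes K: "polytopal_domain K" and f: "f \<in> W1inf K"
  shows "is_weak_deriv K [i] f (weak_deriv K [i] f)" "weak_deriv K [i] f \<in> L2 K"
    "AE x in lebesgue_on K. \<bar>weak_deriv K [i] f x\<bar> \<le> W1inf_norm K f" "0 \<le> W1inf_norm K f"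
proof -
  note Km = polytopal_domain_measure[OF K]
  obtain g where g: "g \<in> Linf K" "is_weak_deriv K [i] f g" using f by (auto simp: W1inf_def)
  show w: "is_weak_deriv K [i] f (weak_deriv K [i] f)" by (rule weak_deriv_works[OF g(2)])
  have ae: "AE x in lebesgue_on K. g x = weak_deriv K [i] f x" by (rule weak_deriv_unique[OF Km(1) g(2) w])
  have wm: "weak_deriv K [i] f \<in> borel_measurable (lebesgue_on K)"
    by (rule borel_measurable_lebesgue_on_AE[OF Linf_measurable[OF g(1)] ae Km(4)])
  have "esssup (lebesgue_on K) (\<lambda>x. ereal \<bar>weak_deriv K [i] f x\<bar>) = esssup (lebesgue_on K) (\<lambda>x. ereal \<bar>g x\<bar>)"
    by (rule esssup_AE_cong) (use ae wm Linf_measurable[OF g(1)] in auto)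
  then have wL: "weak_deriv K [i] f \<in> Linf K" using g(1) wm by (simp add: Linf_def)
  have le: "Linf_norm K (weak_deriv K [i] f) \<le> W1inf_norm K f"
    unfolding W1inf_norm_def by (rule max.coboundedI2, rule Max_ge) auto
  show b: "AE x in lebesgue_on K. \<bar>weak_deriv K [i] f x\<bar> \<le> W1inf_norm K f"
    using Linf_norm_AE[OF K wL] by eventually_elim (use le in simp)
  show "0 \<le> W1inf_norm K f" using Linf_norm_nonneg[OF K, of "weak_deriv K [i] f"] le by linarith
  have "AE x in lebesgue_on K. - W1inf_norm K f \<le> weak_deriv K [i] f x \<and> weak_deriv K [i] f x \<le> W1inf_norm K f"
    using b by eventually_elim auto
  then show "weak_deriv K [i] f \<in> L2 K" by (rule bounded_L2[OF K wm])
qed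

section \<open>The comparison control\<close>

lemma L2_inner_affine:
  fixes f g h d :: "real^'n \<Rightarrow> real"
  assumes "f \<in> L2 S" "g \<in> L2 S" "h \<in> L2 S" "d \<in> L2 S"
  shows "L2_inner S (\<lambda>x. f x + \<alpha> * (g x - h x)) d = L2_inner S d f + \<alpha> * (L2_inner S d g - L2_inner S d h)"
  using assms
  by (simp add: L2_inner_add_left L2_mult L2_diff L2_inner_mult_left L2_inner_diff_left L2_inner_commute[of S d])

lemma L2_inner_swap_diff: "L2_inner S f (\<lambda>x. g x - h x) = - L2_inner S f (\<lambda>x. h x - g x)"
  unfolding L2_inner_def by (subst Bochner_Integration.integral_minus[symmetric]) (simp add: inner_diff_right)

lemma zero_mem_insert_MAX:
  "finite A \<Longrightarrow> x \<in> A \<Longrightarrow> f x \<le> Max (insert 0 (f ` A))" "finite A \<Longrightarrow> (0::real) \<le> Max (insert 0 (f ` A))"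
  by auto

context
  fixes \<Omega> \<omega> :: "(real^'n) set" and \<M> :: "(real^'n) set set" and \<eta> :: real
  assumes \<Omega>: "polytopal_domain \<Omega>" and M: "polytopal_mesh \<Omega> \<M>"
    and \<omega>: "polytopal_domain \<omega>" and sub: "\<omega> \<subseteq> \<Omega>" and N: "polytopal_mesh \<omega> (submesh \<M> \<omega>)"
begin

lemmas \<Omega>_meas = polytopal_domain_measure[OF \<Omega>]
lemmas \<omega>_meas = polytopal_domain_measure[OF \<omega>]

lemma L2_control_domain: "f \<in> L2 \<Omega> \<Longrightarrow> f \<in> L2 \<omega>"
  by (rule L2_subset[OF _ sub \<omega>_meas(4) \<Omega>_meas(4)])

lemma submesh_mesh: "K \<in> submesh \<M> \<omega> \<Longrightarrow> K \<in> \<M>"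
  by (simp add: submesh_def)

lemma mesh_size_ge: "K \<in> \<M> \<Longrightarrow> diameter K \<le> mesh_size \<M>"
  using mesh_parts(1)[OF M] by (simp add: mesh_size_def)

lemma mesh_size_nonneg: "0 \<le> mesh_size \<M>"
proof -
  have "\<M> \<noteq> {}"
  proof
    assume "\<M> = {}"
    then have "closure \<Omega> = {}" using mesh_parts(4)[OF M] by simp
    then show False using \<Omega>_meas(3) by simp
  qed
  then obtain K where K: "K \<in> \<M>" by blast
  have "0 \<le> diameter K"
    using diameter_ge_0[OF polytopal_domain_measure(2)[OF mesh_cell(1)[OF M K]]] .
  then show ?thesis using mesh_size_ge[OF K] by linarith
qed

context
  fixes p ud :: "real^'n \<Rightarrow> real" and \<alpha> a b :: real
  assumes p: "p \<in> L2 \<Omega>" and ud: "ud \<in> L2 \<Omega>" and \<alpha>: "\<alpha> > 0" and ab: "a \<le> b"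
begin

text \<open>The zero in u of p + \<alpha> (u - ud), that is, the control that the optimality
  condition would select without bounds.\<close>

definition unconstrained :: "real^'n \<Rightarrow> real" where
  "unconstrained x = ud x - p x / \<alpha>"

definition cell_control :: "(real^'n) set \<Rightarrow> real" where
  "cell_control K = clip a b (cell_mean K unconstrained)"

text \<open>Unlike the cell-wise mean of the optimal control, this control satisfies a discrete variational
  inequality with the exact adjoint state.\<close>

definition comparison_control :: "real^'n \<Rightarrow> real" where
  "comparison_control x = (\<Sum>K\<in>submesh \<M> \<omega>. indicator K x * cell_control K)"

lemma unconstrained_L2: "unconstrained \<in> L2 \<Omega>"
proof -
  have "unconstrained = (\<lambda>x. ud x - (1 / \<alpha>) * p x)" by (simp add: unconstrained_def fun_eq_iff)
  then show ?thesis using L2_diff[OF ud L2_mult[OF p, of "1 / \<alpha>"]] by simp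
qed

lemma comparison_control_cell: "K \<in> submesh \<M> \<omega> \<Longrightarrow> x \<in> K \<Longrightarrow> comparison_control x = cell_control K"
  by (simp add: comparison_control_def mesh_sum_indicator[OF N])

lemma comparison_control_L2: "comparison_control \<in> L2 \<omega>"
  using piecewise_constant_L2[OF N \<omega>, of cell_control] by (simp add: comparison_control_def[abs_def])

lemma comparison_control_admissible: "comparison_control \<in> Uadh \<M> \<omega> a b"
proof -
  have "AE x in lborel. x \<in> \<omega> \<longrightarrow> a \<le> comparison_control x \<and> comparison_control x \<le> b"
    using mesh_AE_covered[OF N]
    by eventually_elim (auto simp: comparison_control_cell cell_control_def clip_bounds ab)
  then have "comparison_control \<in> Uad \<omega> a b"
    using comparison_control_L2 unfolding Uad_def AE_lebesgue_on_iff[OF \<omega>_meas(4)] by blast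
  moreover have "comparison_control \<in> Uh \<M>"
    unfolding Uh_def
  proof (intro CollectI ballI)
    fix K assume K: "K \<in> \<M>"
    show "\<exists>c. AE x in lebesgue_on K. comparison_control x = c"
    proof (cases "K \<in> submesh \<M> \<omega>")
      case True
      then show ?thesis by (intro exI[of _ "cell_control K"] AE_I2) (simp add: comparison_control_cell)
    next
      case False
      have "comparison_control x = 0" if "x \<in> K" for x
        unfolding comparison_control_def
        using mesh_disjoint[OF M _ K _ that] False by (intro sum.neutral) (auto simp: indicator_def dest: submesh_mesh)
      then show ?thesis by (intro exI[of _ 0] AE_I2) simp
    qed
  qed
  ultimately show ?thesis unfolding Uadh_def by blast
qed

lemma Uadh_cell:
  assumes v: "v \<in> Uadh \<M> \<omega> a b" and K: "K \<in> submesh \<M> \<omega>"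
  obtains c where "AE x in lebesgue_on K. v x = c" "a \<le> c" "c \<le> b"
proof -
  note pK = mesh_cell(1)[OF N K] and KM = submesh_mesh[OF K]
  note Km = polytopal_domain_measure[OF pK]
  obtain v' where v': "v' \<in> Uh \<M>" "\<forall>x\<in>\<omega>. v x = v' x" using v by (auto simp: Uadh_def)
  then obtain c where c: "AE x in lebesgue_on K. v' x = c" using KM by (auto simp: Uh_def)
  have vc: "AE x in lebesgue_on K. v x = c"
    using c mesh_cell(2)[OF N K] v'(2) unfolding AE_lebesgue_on_iff[OF Km(4)]
    by (auto elim!: eventually_mono)
  have "AE x in lebesgue_on \<omega>. a \<le> v x \<and> v x \<le> b" using v by (simp add: Uadh_def Uad_def)
  from AE_cell[OF this mesh_cell(2)[OF N K] Km(4) \<omega>_meas(4)] vc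
  have "AE x in lebesgue_on K. a \<le> c \<and> c \<le> b" by eventually_elim simp
  then have "a \<le> c \<and> c \<le> b" by (rule AE_const_on_cell[OF pK])
  with vc show ?thesis by (intro that) auto
qed

text \<open>On a cell the admissible discrete controls are constants, so only the mean of p +
  \<alpha> (v - ud) matters. This mean is \<alpha> times the clipped mean of
  \<open>unconstrained\<close> minus that mean, and the projection inequality for numbers
  applies.\<close>

lemma comparison_variational:
  assumes v: "v \<in> Uadh \<M> \<omega> a b"
  shows "0 \<le> L2_inner \<omega> (\<lambda>x. p x + \<alpha> * (comparison_control x - ud x)) (\<lambda>x. v x - comparison_control x)"
proof -
  have vL: "v \<in> L2 \<omega>" using v by (simp add: Uadh_def Uad_def)
  let ?g = "\<lambda>x. p x + \<alpha> * (comparison_control x - ud x)"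
  have gL: "?g \<in> L2 \<omega>"
    by (intro L2_add L2_mult L2_diff L2_control_domain p ud comparison_control_L2)
  have dL: "(\<lambda>x. v x - comparison_control x) \<in> L2 \<omega>" by (intro L2_diff vL comparison_control_L2)
  have "0 \<le> L2_inner K ?g (\<lambda>x. v x - comparison_control x)" if K: "K \<in> submesh \<M> \<omega>" for K
  proof -
    note pK = mesh_cell(1)[OF N K] and KL = L2_cell[OF N \<omega>_meas(4) K]
    obtain c where c: "AE x in lebesgue_on K. v x = c" "a \<le> c" "c \<le> b" using Uadh_cell[OF v K] .
    let ?g' = "\<lambda>x. \<alpha> * (cell_control K - unconstrained x)"
    have qK: "unconstrained \<in> L2 K" by (intro KL L2_control_domain unconstrained_L2)
    have g'L: "?g' \<in> L2 K" by (intro L2_mult L2_diff cell_const_L2[OF pK] qK)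
    have geq: "AE x in lebesgue_on K. ?g x = ?g' x"
      using comparison_control_cell[OF K] \<alpha> by (intro AE_I2) (simp add: unconstrained_def field_simps)
    have "AE x in lebesgue_on K. v x - comparison_control x = c - cell_control K"
      using c(1) AE_space by eventually_elim (simp add: comparison_control_cell[OF K])
    then have "L2_inner K ?g (\<lambda>x. v x - comparison_control x) = L2_inner K ?g' (\<lambda>x. c - cell_control K)"
      by (intro L2_inner_cong_AE KL gL dL g'L cell_const_L2[OF pK] geq)
    also have "\<dots> = (c - cell_control K) * measure lebesgue K * (\<alpha> * (cell_control K - cell_mean K unconstrained))"
      using L2_inner_cell_const[OF pK g'L]
      by (simp add: cell_mean_mult[OF pK] cell_mean_diff[OF pK cell_const_L2[OF pK] qK] cell_mean_const[OF pK])
    also have "\<dots> = measure lebesgue K * (\<alpha> * ((cell_control K - cell_mean K unconstrained) * (c - cell_control K)))"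
      by (simp add: mult_ac)
    also have "0 \<le> \<dots>"
      using clip_variational[OF ab c(2,3)] \<alpha> by (simp add: cell_control_def)
    finally show ?thesis .
  qed
  then show ?thesis unfolding L2_inner_mesh[OF N \<omega>_meas(4) gL dL] by (rule sum_nonneg)
qed

context
  fixes u :: "real^'n \<Rightarrow> real" and c0 :: real
  assumes u: "u \<in> Uad \<omega> a b" and u_eq: "AE x in lebesgue_on \<omega>. u x = clip a b (unconstrained x)"
    and star: "star_shaped_cells \<M>" and reg: "mesh_regular \<eta> \<M>" and \<eta>: "\<eta> > 0"
    and A4: "A4 \<M> \<omega> a b u c0"
    and p_Hm: "p \<in> Hm 2 \<Omega>" and ud_Hm: "ud \<in> Hm 2 \<Omega>"
begin

text \<open>The Lipschitz bound made uniform over the cells of \<M>_1. It is a radius, a bound on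
  the distance of \<open>u\<close> from some constant, so two values of \<open>u\<close> may differ
  by twice as much.\<close>

definition control_oscillation :: real where
  "control_oscillation = real CARD('n) * (1 + 2 / \<eta>) * mesh_size \<M> * W1inf_broken_norm (mesh1 \<M> \<omega> a b u) u"

definition unconstrained_deriv :: "'n \<Rightarrow> real^'n \<Rightarrow> real" where
  "unconstrained_deriv i x = weak_deriv \<Omega> [i] ud x - (1 / \<alpha>) * weak_deriv \<Omega> [i] p x"

lemma u_L2: "u \<in> L2 \<omega>" and u_bounds: "AE x in lebesgue_on \<omega>. a \<le> u x \<and> u x \<le> b"
  using u by (simp_all add: Uad_def)

lemma finite_mesh1: "finite (mesh1 \<M> \<omega> a b u)"
  using mesh_parts(1)[OF N] by (simp add: mesh1_def)

lemma broken_norm_nonneg: "0 \<le> W1inf_broken_norm (mesh1 \<M> \<omega> a b u) u"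
  unfolding W1inf_broken_norm_def by (rule zero_mem_insert_MAX(2)[OF finite_mesh1])

lemma control_oscillation_nonneg: "0 \<le> control_oscillation"
  using \<eta> mesh_size_nonneg broken_norm_nonneg by (simp add: control_oscillation_def)

lemma unconstrained_deriv_L2: "unconstrained_deriv i \<in> L2 \<Omega>"
  unfolding unconstrained_deriv_def[abs_def]
  by (intro L2_diff L2_mult Hm_weak_deriv(2)[OF \<Omega>_meas(1) ud_Hm] Hm_weak_deriv(2)[OF \<Omega>_meas(1) p_Hm]) simp_all

context
  fixes K assumes K: "K \<in> submesh \<M> \<omega>"
begin

lemmas pK = mesh_cell(1)[OF N K]
lemmas K_sub = mesh_cell(2)[OF N K]
lemmas Km = polytopal_domain_measure[OF pK]

lemma cell_star: "x \<in> K \<Longrightarrow> closed_segment (centroid K) x \<subseteq> K"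
  using star submesh_mesh[OF K] by (simp add: star_shaped_cells_def)

lemma cell_reg: "diameter K / inner_radius K \<le> \<eta>"
  using reg submesh_mesh[OF K] by (simp add: mesh_regular_def)

lemma cell_diameter: "0 < diameter K" "diameter K \<le> mesh_size \<M>"
  using cell_geometry(1)[OF pK cell_star cell_reg \<eta>] mesh_size_ge[OF submesh_mesh[OF K]] by auto

lemma u_cell: "u \<in> L2 K" "unconstrained \<in> L2 K"
  by (auto intro!: L2_cell[OF N \<omega>_meas(4) K] u_L2 L2_control_domain unconstrained_L2)

lemma u_cell_bounds: "AE x in lebesgue_on K. a \<le> u x \<and> u x \<le> b"
  by (rule AE_cell[OF u_bounds K_sub Km(4) \<omega>_meas(4)])

lemma u_cell_eq: "AE x in lebesgue_on K. u x = clip a b (unconstrained x)"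
  by (rule AE_cell[OF u_eq K_sub Km(4) \<omega>_meas(4)])

lemma u_cell_mean_bounds: "a \<le> cell_mean K u" "cell_mean K u \<le> b"
proof -
  have "cell_mean K (\<lambda>x. a) \<le> cell_mean K u"
    by (rule cell_mean_mono[OF pK cell_const_L2[OF pK] u_cell(1)]) (use u_cell_bounds in \<open>eventually_elim, simp\<close>)
  then show "a \<le> cell_mean K u" by (simp add: cell_mean_const[OF pK])
  have "cell_mean K u \<le> cell_mean K (\<lambda>x. b)"
    by (rule cell_mean_mono[OF pK u_cell(1) cell_const_L2[OF pK]]) (use u_cell_bounds in \<open>eventually_elim, simp\<close>)
  then show "cell_mean K u \<le> b" by (simp add: cell_mean_const[OF pK])
qed

lemma control_oscillation_cell:
  assumes K1: "K \<in> mesh1 \<M> \<omega> a b u"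
  shows "\<exists>m. AE x in lebesgue_on K. \<bar>u x - m\<bar> \<le> control_oscillation"
proof -
  have uW: "u \<in> W1inf K" using A4 K1 by (simp add: A4_def W1inf_broken_def)
  note W = W1inf_cell[OF pK uW]
  have le: "W1inf_norm K u \<le> W1inf_broken_norm (mesh1 \<M> \<omega> a b u) u"
    unfolding W1inf_broken_norm_def by (rule zero_mem_insert_MAX(1)[OF finite_mesh1 K1])
  obtain m where m: "AE x in lebesgue_on K. \<bar>u x - m\<bar> \<le> real CARD('n) * (1 + 2 / \<eta>) * diameter K * W1inf_norm K u"
    using Lipschitz_cell[OF pK cell_star cell_reg \<eta> u_cell(1) W(2,1,3,4)] by blast
  have "real CARD('n) * (1 + 2 / \<eta>) * diameter K * W1inf_norm K u \<le> control_oscillation"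
    unfolding control_oscillation_def using cell_diameter \<eta> le W(4)
    by (intro mult_mono mult_left_mono mult_nonneg_nonneg) auto
  with m have "AE x in lebesgue_on K. \<bar>u x - m\<bar> \<le> control_oscillation"
    by (auto elim!: eventually_mono)
  then show ?thesis by blast
qed

text \<open>A cell where \<open>a \<le> u \<le> b\<close> is neither strict nor an equality carries a set of positive measure on
  which a bound is attained; hence \<open>u\<close> stays within twice its oscillation of that bound.\<close>

lemma control_mean_error_mesh1:
  assumes K1: "K \<in> mesh1 \<M> \<omega> a b u"
  shows "\<bar>cell_control K - cell_mean K u\<bar> \<le> 2 * control_oscillation"
proof -
  let ?\<delta> = control_oscillation and ?m = "cell_mean K u" and ?c = "cell_control K"
  obtain m where m: "AE x in lebesgue_on K. \<bar>u x - m\<bar> \<le> ?\<delta>" using control_oscillation_cell[OF K1] by blast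
  have cb: "a \<le> ?c" "?c \<le> b" using clip_bounds[OF ab] by (auto simp: cell_control_def)
  note mb = u_cell_mean_bounds
  have not2: "\<not> (AE x in lebesgue_on K. a < u x \<and> u x < b)"
    using K1 K by (auto simp: mesh1_def mesh2_def)
  consider "\<not> (AE x in lebesgue_on K. u x \<noteq> a)" | "\<not> (AE x in lebesgue_on K. u x \<noteq> b)"
  proof (rule ccontr)
    assume "\<not> thesis"
    then have "AE x in lebesgue_on K. u x \<noteq> a" "AE x in lebesgue_on K. u x \<noteq> b" using that by blast+
    with u_cell_bounds have "AE x in lebesgue_on K. a < u x \<and> u x < b" by eventually_elim auto
    with not2 show False by simp
  qed
  then show ?thesis
  proof cases
    case 1
    have am: "\<bar>a - m\<bar> \<le> ?\<delta>"
    proof (rule ccontr)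
      assume "\<not> ?thesis"
      with m have "AE x in lebesgue_on K. u x \<noteq> a" by (auto elim!: eventually_mono)
      with 1 show False by simp
    qed
    have ub: "AE x in lebesgue_on K. u x \<le> a + 2 * ?\<delta>" using m by eventually_elim (use am in linarith)
    \<comment> \<open>If the interval is longer than twice the oscillation, the upper bound is never
      active on this cell, so clipping can only raise: the mean of \<open>unconstrained\<close> is
      at most that of \<open>u\<close>, and both compared values lie between a and a + 2 \<delta>.
      Otherwise all of [a, b] has length at most 2 \<delta>.\<close>
    show ?thesis
    proof (cases "a + 2 * ?\<delta> < b")
      case True
      have "AE x in lebesgue_on K. unconstrained x \<le> u x"
        using ub u_cell_eq by eventually_elim (use True in \<open>auto simp: clip_def max_def min_def split: if_splits\<close>)
      then have "cell_mean K unconstrained \<le> ?m"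
        by (rule cell_mean_mono[OF pK u_cell(2,1)])
      then have "?c \<le> clip a b ?m" unfolding cell_control_def by (rule clip_mono)
      then have "?c \<le> ?m" using clip_id[OF mb] by simp
      moreover have "?m \<le> cell_mean K (\<lambda>x. a + 2 * ?\<delta>)"
        by (rule cell_mean_mono[OF pK u_cell(1) cell_const_L2[OF pK] ub])
      then have "?m \<le> a + 2 * ?\<delta>" by (simp add: cell_mean_const[OF pK])
      ultimately show ?thesis using cb by linarith
    next
      case False
      then show ?thesis using cb mb by linarith
    qed
  next
    case 2
    have bm: "\<bar>b - m\<bar> \<le> ?\<delta>"
    proof (rule ccontr)
      assume "\<not> ?thesis"
      with m have "AE x in lebesgue_on K. u x \<noteq> b" by (auto elim!: eventually_mono)
      with 2 show False by simp
    qed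
    have lb: "AE x in lebesgue_on K. b - 2 * ?\<delta> \<le> u x" using m by eventually_elim (use bm in linarith)
    show ?thesis
    proof (cases "a < b - 2 * ?\<delta>")
      case True
      have "AE x in lebesgue_on K. u x \<le> unconstrained x"
        using lb u_cell_eq by eventually_elim (use True in \<open>auto simp: clip_def max_def min_def split: if_splits\<close>)
      then have "?m \<le> cell_mean K unconstrained"
        by (rule cell_mean_mono[OF pK u_cell(1,2)])
      then have "clip a b ?m \<le> ?c" unfolding cell_control_def by (rule clip_mono)
      then have "?m \<le> ?c" using clip_id[OF mb] by simp
      moreover have "cell_mean K (\<lambda>x. b - 2 * ?\<delta>) \<le> ?m"
        by (rule cell_mean_mono[OF pK cell_const_L2[OF pK] u_cell(1) lb])
      then have "b - 2 * ?\<delta> \<le> ?m" by (simp add: cell_mean_const[OF pK])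
      ultimately show ?thesis using cb by linarith
    next
      case False
      then show ?thesis using cb mb by linarith
    qed
  qed
qed

lemma mesh2_cases:
  assumes "K \<notin> mesh1 \<M> \<omega> a b u"
  obtains "AE x in lebesgue_on K. u x = a" | "AE x in lebesgue_on K. u x = b"
    | "AE x in lebesgue_on K. u x = unconstrained x"
proof -
  have K2: "K \<in> mesh2 \<M> \<omega> a b u" using assms K by (simp add: mesh1_def)
  have "AE x in lebesgue_on K. u x = unconstrained x" if "AE x in lebesgue_on K. a < u x \<and> u x < b"
    using that u_cell_eq by eventually_elim (auto simp: clip_def max_def min_def split: if_splits)
  with K2 that show ?thesis unfolding mesh2_def by blast
qed

text \<open>On cells of \<M>_2 clipping commutes with taking the mean: either it acts as the
  identity almost everywhere, or \<open>unconstrained\<close> lies on one side of the active bound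
  and so does its mean. When a = b an active bound says nothing about \<open>unconstrained\<close>,
  but then clipping has only one value.\<close>

lemma control_mean_mesh2:
  assumes K2: "K \<notin> mesh1 \<M> \<omega> a b u"
  shows "cell_control K = cell_mean K u"
  using K2
proof (cases rule: mesh2_cases)
  case 1
  have m: "cell_mean K u = a"
    using cell_mean_cong[OF pK u_cell(1) cell_const_L2[OF pK] 1] by (simp add: cell_mean_const[OF pK])
  show ?thesis
  proof (cases "a < b")
    case True
    have "AE x in lebesgue_on K. unconstrained x \<le> a"
      using 1 u_cell_eq by eventually_elim (use True in \<open>auto simp: clip_def max_def min_def split: if_splits\<close>)
    then have "cell_mean K unconstrained \<le> cell_mean K (\<lambda>x. a)"
      by (rule cell_mean_mono[OF pK u_cell(2) cell_const_L2[OF pK]])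
    then show ?thesis using ab m by (simp add: cell_control_def clip_def cell_mean_const[OF pK])
  next
    case False
    then show ?thesis using m clip_bounds[OF ab, of "cell_mean K unconstrained"] by (simp add: cell_control_def)
  qed
next
  case 2
  have m: "cell_mean K u = b"
    using cell_mean_cong[OF pK u_cell(1) cell_const_L2[OF pK] 2] by (simp add: cell_mean_const[OF pK])
  show ?thesis
  proof (cases "a < b")
    case True
    have "AE x in lebesgue_on K. b \<le> unconstrained x"
      using 2 u_cell_eq by eventually_elim (use True in \<open>auto simp: clip_def max_def min_def split: if_splits\<close>)
    then have "cell_mean K (\<lambda>x. b) \<le> cell_mean K unconstrained"
      by (rule cell_mean_mono[OF pK cell_const_L2[OF pK] u_cell(2)])
    then show ?thesis using ab m by (simp add: cell_control_def clip_def cell_mean_const[OF pK])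
  next
    case False
    then show ?thesis using m clip_bounds[OF ab, of "cell_mean K unconstrained"] by (simp add: cell_control_def)
  qed
next
  case 3
  have "cell_mean K u = cell_mean K unconstrained" by (rule cell_mean_cong[OF pK u_cell 3])
  then show ?thesis using clip_id[OF u_cell_mean_bounds] by (simp add: cell_control_def)
qed

lemma unconstrained_deriv_cell:
  "is_weak_deriv K [i] unconstrained (unconstrained_deriv i)" "unconstrained_deriv i \<in> L2 K"
proof -
  note \<Omega>o = \<Omega>_meas(1)
  have "is_weak_deriv \<Omega> [i] (\<lambda>x. ud x - (1 / \<alpha>) * p x) (\<lambda>x. weak_deriv \<Omega> [i] ud x - (1 / \<alpha>) * weak_deriv \<Omega> [i] p x)"
    using ud p Hm_weak_deriv[OF \<Omega>o ud_Hm, of "[i]"] Hm_weak_deriv[OF \<Omega>o p_Hm, of "[i]"]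
    by (intro weak_deriv_linear \<Omega>_meas(4)) simp_all
  then have "is_weak_deriv \<Omega> [i] unconstrained (unconstrained_deriv i)"
    by (simp add: unconstrained_def[abs_def] unconstrained_deriv_def[abs_def])
  then show "is_weak_deriv K [i] unconstrained (unconstrained_deriv i)"
    by (rule weak_deriv_restrict[OF \<Omega>_meas(4) Km(4) subset_trans[OF K_sub sub]])
  show "unconstrained_deriv i \<in> L2 K"
    by (rule L2_subset[OF unconstrained_deriv_L2 subset_trans[OF K_sub sub] Km(4) \<Omega>_meas(4)])
qed

text \<open>Each kind of cell needs at most one of the two terms: Poincare where \<open>u\<close>
  equals \<open>unconstrained\<close>, the Lipschitz bound on \<M>_1, none where \<open>u\<close> is
  constant. Adding them gives a bound of one form that can be summed over the mesh.\<close>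

lemma control_L2_oscillation_cell:
  "(L2_norm K (\<lambda>x. u x - cell_mean K u))\<^sup>2 \<le>
    Poincare_const CARD('n) \<eta> * (mesh_size \<M>)\<^sup>2 * (\<Sum>i\<in>UNIV. (L2_norm K (unconstrained_deriv i))\<^sup>2)
    + control_oscillation\<^sup>2 * measure lebesgue K"
  (is "_ \<le> ?A + ?B")
proof -
  have CP: "0 \<le> Poincare_const CARD('n) \<eta>" using \<eta> by (simp add: Poincare_const_def)
  have A: "0 \<le> ?A" using CP by (simp add: sum_nonneg)
  have B: "0 \<le> ?B" by simp
  note best = cell_mean_best[OF pK u_cell(1)]
  have const: "(L2_norm K (\<lambda>x. u x - c))\<^sup>2 = 0" if "AE x in lebesgue_on K. u x = c" for c
  proof -
    have "L2_norm K (\<lambda>x. u x - c) = L2_norm K (\<lambda>x. 0 :: real)"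
      by (rule L2_norm_cong_AE[OF L2_diff[OF u_cell(1) cell_const_L2[OF pK]] L2_zero])
        (use that in \<open>eventually_elim, simp\<close>)
    then show ?thesis by (simp add: L2_norm_zero)
  qed
  show ?thesis
  proof (cases "K \<in> mesh1 \<M> \<omega> a b u")
    case True
    obtain m where m: "AE x in lebesgue_on K. \<bar>u x - m\<bar> \<le> control_oscillation" using control_oscillation_cell[OF True] by blast
    have dL: "(\<lambda>x. u x - m) \<in> L2 K" by (rule L2_diff[OF u_cell(1) cell_const_L2[OF pK]])
    have "integral\<^sup>L (lebesgue_on K) (\<lambda>x. (u x - m)\<^sup>2) \<le> integral\<^sup>L (lebesgue_on K) (\<lambda>x. control_oscillation\<^sup>2)"
    proof (rule integral_mono_AE)
      show "AE x in lebesgue_on K. (u x - m)\<^sup>2 \<le> control_oscillation\<^sup>2"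
        using m by eventually_elim (rule power2_le_iff_abs_le[THEN iffD2], rule control_oscillation_nonneg)
      show "integrable (lebesgue_on K) (\<lambda>x. (u x - m)\<^sup>2)" using dL by (simp add: L2_def)
      show "integrable (lebesgue_on K) (\<lambda>x. control_oscillation\<^sup>2)"
        by (rule cell_integrable[OF pK cell_const_L2[OF pK]])
    qed
    then have "(L2_norm K (\<lambda>x. u x - m))\<^sup>2 \<le> ?B"
      unfolding cell_integral_const[OF pK] L2_norm_square L2_inner_def by (simp add: power2_eq_square)
    then show ?thesis using best[of m] A by linarith
  next
    case False
    then show ?thesis
    proof (cases rule: mesh2_cases)
      case 1
      then show ?thesis using best[of a] const[of a] A B by linarith
    next
      case 2
      then show ?thesis using best[of b] const[of b] A B by linarith
    next
      case 3
      have mean: "cell_mean K u = cell_mean K unconstrained" by (rule cell_mean_cong[OF pK u_cell 3])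
      have "L2_norm K (\<lambda>x. u x - cell_mean K u) = L2_norm K (\<lambda>x. unconstrained x - cell_mean K unconstrained)"
        by (rule L2_norm_cong_AE) (use 3 u_cell cell_const_L2[OF pK] mean in \<open>auto intro!: L2_diff elim!: eventually_mono\<close>)
      then have "(L2_norm K (\<lambda>x. u x - cell_mean K u))\<^sup>2 \<le>
          Poincare_const CARD('n) \<eta> * (diameter K)\<^sup>2 * (\<Sum>i\<in>UNIV. (L2_norm K (unconstrained_deriv i))\<^sup>2)"
        using Poincare_cell[OF pK cell_star cell_reg \<eta> u_cell(2) unconstrained_deriv_cell(2,1)] by simp
      also have "\<dots> \<le> ?A"
        using cell_diameter CP by (intro mult_right_mono mult_left_mono power_mono sum_nonneg) auto
      finally show ?thesis using B by linarith
    qed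
  qed
qed

end

lemma sum_submesh_le: "(\<Sum>K\<in>submesh \<M> \<omega>. measure lebesgue K) = measure lebesgue \<omega>"
proof -
  have "(\<lambda>x. 1 :: real) \<in> L2 \<omega>" by (rule cell_const_L2[OF \<omega>])
  from L2_norm_mesh[OF N \<omega>_meas(4) this] show ?thesis
    using L2_norm_cell_const[OF \<omega>, of 1] L2_norm_cell_const[OF mesh_cell(1)[OF N], of _ 1] by simp
qed

text \<open>Summation of the squares over cells. The factor sqrt(d) arises because each of the d
  first derivatives of \<open>unconstrained\<close> is bounded by the same Sobolev norms.\<close>

lemma control_L2_oscillation:
  "L2_norm \<omega> (\<lambda>x. u x - proj_mesh (submesh \<M> \<omega>) u x) \<le>
    sqrt (Poincare_const CARD('n) \<eta> * real CARD('n)) * mesh_size \<M> * (Hm_norm 2 \<Omega> ud + Hm_norm 2 \<Omega> p / \<alpha>)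
    + control_oscillation * sqrt (measure lebesgue \<Omega>)"
  (is "?E \<le> ?a * ?h * ?Q + ?d * sqrt ?V")
proof -
  let ?P = "proj_mesh (submesh \<M> \<omega>) u"
  let ?C = "Poincare_const CARD('n) \<eta>"
  have CP: "0 \<le> ?C" using \<eta> by (simp add: Poincare_const_def)
  have eL: "(\<lambda>x. u x - ?P x) \<in> L2 \<omega>" by (intro L2_diff u_L2 proj_mesh_L2[OF N \<omega>])
  have Q: "0 \<le> ?Q" using \<alpha> by (simp add: Hm_norm_nonneg)
  have a: "0 \<le> ?a" using CP by simp
  have nn: "0 \<le> ?a * ?h * ?Q" "0 \<le> ?d * sqrt ?V"
    by (intro mult_nonneg_nonneg a Q mesh_size_nonneg, intro mult_nonneg_nonneg control_oscillation_nonneg real_sqrt_ge_zero measure_nonneg)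
  have cell: "(L2_norm K (\<lambda>x. u x - ?P x))\<^sup>2 \<le>
      ?C * ?h\<^sup>2 * (\<Sum>i\<in>UNIV. (L2_norm K (unconstrained_deriv i))\<^sup>2) + ?d\<^sup>2 * measure lebesgue K"
    if K: "K \<in> submesh \<M> \<omega>" for K
  proof -
    have "L2_norm K (\<lambda>x. u x - ?P x) = L2_norm K (\<lambda>x. u x - cell_mean K u)"
    proof (rule L2_norm_cong_AE)
      show "AE x in lebesgue_on K. u x - ?P x = u x - cell_mean K u"
        by (rule AE_I2) (simp add: proj_mesh_cell[OF N K])
      show "(\<lambda>x. u x - ?P x) \<in> L2 K" by (rule L2_cell[OF N \<omega>_meas(4) K eL])
      show "(\<lambda>x. u x - cell_mean K u) \<in> L2 K"
        by (rule L2_diff[OF L2_cell[OF N \<omega>_meas(4) K u_L2] cell_const_L2[OF mesh_cell(1)[OF N K]]])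
    qed
    then show ?thesis using control_L2_oscillation_cell[OF K] by simp
  qed
  have D: "L2_norm \<omega> (unconstrained_deriv i) \<le> ?Q" for i
  proof -
    have L: "weak_deriv \<Omega> [i] ud \<in> L2 \<Omega>" "weak_deriv \<Omega> [i] p \<in> L2 \<Omega>"
      using Hm_weak_deriv(2)[OF \<Omega>_meas(1) ud_Hm, of "[i]"] Hm_weak_deriv(2)[OF \<Omega>_meas(1) p_Hm, of "[i]"] by simp_all
    have "L2_norm \<omega> (unconstrained_deriv i) \<le> L2_norm \<Omega> (unconstrained_deriv i)"
      by (rule L2_norm_subset[OF unconstrained_deriv_L2 sub \<omega>_meas(4) \<Omega>_meas(4)])
    also have "\<dots> = L2_norm \<Omega> (\<lambda>x. weak_deriv \<Omega> [i] ud x + (- (1 / \<alpha>)) *\<^sub>R weak_deriv \<Omega> [i] p x)"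
      by (simp add: unconstrained_deriv_def[abs_def])
    also have "\<dots> \<le> L2_norm \<Omega> (weak_deriv \<Omega> [i] ud) + (1 / \<alpha>) * L2_norm \<Omega> (weak_deriv \<Omega> [i] p)"
      using L2_norm_triangle[OF L(1) L2_scaleR[OF L(2), of "- (1 / \<alpha>)"]] \<alpha>
      unfolding L2_norm_scaleR by simp
    also have "\<dots> \<le> Hm_norm 2 \<Omega> ud + (1 / \<alpha>) * Hm_norm 2 \<Omega> p"
      using \<alpha> by (intro add_mono mult_left_mono weak_deriv_le_Hm_norm) auto
    finally show ?thesis by simp
  qed
  have "?E\<^sup>2 \<le> (\<Sum>K\<in>submesh \<M> \<omega>. ?C * ?h\<^sup>2 * (\<Sum>i\<in>UNIV. (L2_norm K (unconstrained_deriv i))\<^sup>2) + ?d\<^sup>2 * measure lebesgue K)"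
    unfolding L2_norm_mesh[OF N \<omega>_meas(4) eL] by (rule sum_mono[OF cell])
  also have "\<dots> = ?C * ?h\<^sup>2 * (\<Sum>i\<in>UNIV. \<Sum>K\<in>submesh \<M> \<omega>. (L2_norm K (unconstrained_deriv i))\<^sup>2) + ?d\<^sup>2 * measure lebesgue \<omega>"
    by (simp only: sum.distrib sum_distrib_left[symmetric] sum_submesh_le) (subst sum.swap, simp)
  also have "\<dots> = ?C * ?h\<^sup>2 * (\<Sum>i\<in>UNIV. (L2_norm \<omega> (unconstrained_deriv i))\<^sup>2) + ?d\<^sup>2 * measure lebesgue \<omega>"
    using L2_norm_mesh[OF N \<omega>_meas(4) L2_control_domain[OF unconstrained_deriv_L2]] by simp
  also have "\<dots> \<le> ?C * ?h\<^sup>2 * (\<Sum>i\<in>(UNIV::'n set). ?Q\<^sup>2) + ?d\<^sup>2 * ?V"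
  proof (intro add_mono mult_left_mono sum_mono power_mono D)
    show "measure lebesgue \<omega> \<le> ?V" by (rule measure_mono_fmeasurable[OF sub \<omega>_meas(4) \<Omega>_meas(9)])
  qed (use CP in \<open>auto simp: L2_norm_nonneg\<close>)
  also have "\<dots> = (?a * ?h * ?Q)\<^sup>2 + (?d * sqrt ?V)\<^sup>2"
    using CP by (simp add: power_mult_distrib mult_ac)
  also have "\<dots> \<le> (?a * ?h * ?Q + ?d * sqrt ?V)\<^sup>2"
    unfolding power2_sum using mult_nonneg_nonneg[OF nn] by linarith
  finally show ?thesis
    by (rule power2_le_imp_le) (rule add_nonneg_nonneg[OF nn])
qed

text \<open>(A4) measures the interior of the union of the closed cells; the cells are open and
  disjoint, hence contained in that interior and of additive measure.\<close>

lemma mesh1_measure: "(\<Sum>K\<in>mesh1 \<M> \<omega> a b u. measure lebesgue K) \<le> c0 * mesh_size \<M>"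
proof -
  let ?M1 = "mesh1 \<M> \<omega> a b u"
  let ?I = "interior (\<Union>K\<in>?M1. closure K)"
  have K: "K \<in> submesh \<M> \<omega>" if "K \<in> ?M1" for K using that by (simp add: mesh1_def)
  note pK = mesh_cell(1)[OF N K]
  have "(\<Sum>K\<in>?M1. measure lebesgue K) = measure lebesgue (\<Union>?M1)"
  proof (rule measure_Union'[symmetric, OF finite_mesh1])
    show "K \<in> lmeasurable" if "K \<in> ?M1" for K by (rule polytopal_domain_measure(9)[OF pK[OF that]])
    show "pairwise disjnt ?M1"
      using mesh_parts(3)[OF N] by (rule pairwise_mono) (auto simp: mesh1_def)
  qed
  also have "\<dots> \<le> measure lebesgue ?I"
  proof (rule measure_mono_fmeasurable)
    have op: "open K" if "K \<in> ?M1" for K by (rule polytopal_domain_measure(1)[OF pK[OF that]])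
    show "\<Union>?M1 \<subseteq> ?I"
      using op closure_subset by (intro interior_maximal open_Union) blast+
    show "\<Union>?M1 \<in> sets lebesgue" using open_Union[of ?M1] op by (simp add: borel_open)
    have "bounded (\<Union>K\<in>?M1. closure K)"
      using finite_mesh1 polytopal_domain_measure(2)[OF pK] by (auto intro!: bounded_UN bounded_closure)
    then have "bounded ?I" by (rule bounded_subset[OF _ interior_subset])
    then show "?I \<in> lmeasurable" by (simp add: lmeasurable_open)
  qed
  also have "\<dots> \<le> c0 * mesh_size \<M>" using A4 by (simp add: A4_def)
  finally show ?thesis .
qed

text \<open>The control error is tested with \<open>\<Pi>\<^sub>D z\<close>. On each cell, \<open>\<Pi>\<^sub>D z\<close> is split into its mean and a part of
  order \<open>h\<close> by (A2); the latter meets \<open>u - P\<^sub>M u\<close>, of order \<open>h\<close> as well. The mean meets the difference of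
  the means of the controls, which vanishes except on \<open>\<M>\<^sub>1\<close>: there it is of order \<open>h\<close>, on a set of measure
  of order \<open>h\<close>.\<close>

lemma comparison_control_tested:
  fixes D :: "('x::real_vector, 'n) hessian_disc"
  assumes D: "hessian_discretisation \<Omega> D" and A2: "A2 \<Omega> \<M> D c0" and A3: "A3 \<Omega> D c0" and c0: "c0 > 0"
    and z: "z \<in> XD D"
  shows "\<bar>L2_inner \<omega> (\<lambda>x. comparison_control x - u x) (PiD D z)\<bar> \<le>
    (c0 * mesh_size \<M> * L2_norm \<omega> (\<lambda>x. u x - proj_mesh (submesh \<M> \<omega>) u x)
      + 2 * c0\<^sup>2 * mesh_size \<M> * control_oscillation) * L2_norm \<Omega> (HessD D z)"
proof -
  let ?Z = "PiD D z" and ?H = "L2_norm \<Omega> (HessD D z)" and ?N = "submesh \<M> \<omega>" and ?h = "mesh_size \<M>"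
  let ?M1 = "mesh1 \<M> \<omega> a b u"
  have Z: "?Z \<in> L2 \<Omega>" by (rule PiD_L2[OF D z])
  have P: "proj_mesh \<M> ?Z \<in> L2 \<Omega>" by (rule proj_mesh_L2[OF M \<Omega>])
  have E: "(\<lambda>x. u x - proj_mesh ?N u x) \<in> L2 \<omega>" by (intro L2_diff u_L2 proj_mesh_L2[OF N \<omega>])
  have ZP: "(\<lambda>x. ?Z x - proj_mesh \<M> ?Z x) \<in> L2 \<Omega>" by (rule L2_diff[OF Z P])
  have C: "(\<lambda>x. comparison_control x - u x) \<in> L2 \<omega>" by (intro L2_diff u_L2 comparison_control_L2)
  \<comment> \<open>Both functions are split into mean and remainder. A remainder has mean zero, so
    the mixed products with constants vanish and only two terms survive.\<close>
  have cell: "L2_inner K (\<lambda>x. comparison_control x - u x) ?Z =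
      - L2_inner K (\<lambda>x. u x - proj_mesh ?N u x) (\<lambda>x. ?Z x - proj_mesh \<M> ?Z x)
      + cell_mean K ?Z * measure lebesgue K * (cell_control K - cell_mean K u)"
    if K: "K \<in> ?N" for K
  proof -
    note pK = mesh_cell(1)[OF N K] and KL = L2_cell[OF N \<omega>_meas(4) K]
    have c: "(\<lambda>x. r) \<in> L2 K" for r :: real by (rule cell_const_L2[OF pK])
    note uK = KL[OF u_L2] and ZK = KL[OF L2_control_domain[OF Z]]
    let ?m = "cell_mean K u" and ?n = "cell_mean K ?Z"
    have "L2_inner K (\<lambda>x. comparison_control x - u x) ?Z = L2_inner K (\<lambda>x. cell_control K - u x) ?Z"
      by (intro L2_inner_cong_AE KL[OF C] L2_diff c uK ZK AE_I2) (simp_all add: comparison_control_cell[OF K])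
    also have "\<dots> = cell_control K * measure lebesgue K * ?n - L2_inner K u ?Z"
      by (simp add: L2_inner_diff_left c uK ZK L2_inner_commute[of K "\<lambda>x. cell_control K"] L2_inner_cell_const[OF pK ZK])
    finally have 1: "L2_inner K (\<lambda>x. comparison_control x - u x) ?Z = cell_control K * measure lebesgue K * ?n - L2_inner K u ?Z" .
    have "L2_inner K (\<lambda>x. u x - proj_mesh ?N u x) (\<lambda>x. ?Z x - proj_mesh \<M> ?Z x) = L2_inner K (\<lambda>x. u x - ?m) (\<lambda>x. ?Z x - ?n)"
      by (intro L2_inner_cong_AE KL[OF E] KL[OF L2_control_domain[OF ZP]] L2_diff c uK ZK AE_I2)
        (simp_all add: proj_mesh_cell[OF N K] proj_mesh_cell[OF M submesh_mesh[OF K]])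
    also have "\<dots> = L2_inner K u ?Z - ?n * measure lebesgue K * ?m - (?m * measure lebesgue K * ?n - ?n * measure lebesgue K * ?m)"
      by (simp add: L2_inner_diff_left L2_inner_diff_right c uK ZK L2_diff L2_inner_commute[of K "\<lambda>x. ?m"]
          L2_inner_cell_const[OF pK ZK] L2_inner_cell_const[OF pK uK] L2_inner_cell_const[OF pK c] cell_mean_const[OF pK])
    finally show ?thesis unfolding 1 by (simp add: algebra_simps)
  qed
  \<comment> \<open>A uniform bound, by (A3), is needed here: on \<M>_1 the smallness comes from the
    total measure of the cells, with full order \<open>h\<close>, and an L2 bound on the means would
    give only its square root.\<close>
  have mean: "\<bar>cell_mean K ?Z\<bar> \<le> c0 * ?H" if K: "K \<in> ?N" for K
  proof -
    note pK = mesh_cell(1)[OF N K] and KL = L2_cell[OF N \<omega>_meas(4) K]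
    note ZK = KL[OF L2_control_domain[OF Z]]
    have "?Z \<in> Linf \<Omega>" "Linf_norm \<Omega> ?Z \<le> c0 * ?H" using A3 z by (auto simp: A3_def)
    with Linf_norm_AE[OF \<Omega>] have "AE x in lebesgue_on \<Omega>. \<bar>?Z x\<bar> \<le> c0 * ?H"
      by (fastforce elim!: eventually_mono)
    then have ae: "AE x in lebesgue_on K. \<bar>?Z x\<bar> \<le> c0 * ?H"
      by (rule AE_cell[OF _ subset_trans[OF mesh_cell(2)[OF N K] sub] polytopal_domain_measure(4)[OF pK] \<Omega>_meas(4)])
    have "cell_mean K ?Z \<le> cell_mean K (\<lambda>x. c0 * ?H)"
      by (rule cell_mean_mono[OF pK ZK cell_const_L2[OF pK]]) (use ae in \<open>eventually_elim, simp\<close>)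
    moreover have "cell_mean K (\<lambda>x. - (c0 * ?H)) \<le> cell_mean K ?Z"
      by (rule cell_mean_mono[OF pK cell_const_L2[OF pK] ZK]) (use ae in \<open>eventually_elim, simp\<close>)
    ultimately show ?thesis by (simp add: cell_mean_const[OF pK] abs_le_iff)
  qed
  let ?R = "\<lambda>K. cell_mean K ?Z * measure lebesgue K * (cell_control K - cell_mean K u)"
  have "L2_inner \<omega> (\<lambda>x. comparison_control x - u x) ?Z =
      - L2_inner \<omega> (\<lambda>x. u x - proj_mesh ?N u x) (\<lambda>x. ?Z x - proj_mesh \<M> ?Z x) + (\<Sum>K\<in>?N. ?R K)"
    unfolding L2_inner_mesh[OF N \<omega>_meas(4) C L2_control_domain[OF Z]] L2_inner_mesh[OF N \<omega>_meas(4) E L2_control_domain[OF ZP]]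
    by (simp add: cell sum.distrib sum_negf sum_subtractf)
  moreover have "\<bar>L2_inner \<omega> (\<lambda>x. u x - proj_mesh ?N u x) (\<lambda>x. ?Z x - proj_mesh \<M> ?Z x)\<bar>
      \<le> L2_norm \<omega> (\<lambda>x. u x - proj_mesh ?N u x) * (c0 * ?h * ?H)"
  proof (rule order_trans[OF L2_Cauchy_Schwarz[OF E L2_control_domain[OF ZP]] mult_left_mono[OF _ L2_norm_nonneg]])
    have "L2_norm \<omega> (\<lambda>x. ?Z x - proj_mesh \<M> ?Z x) \<le> L2_norm \<Omega> (\<lambda>x. ?Z x - proj_mesh \<M> ?Z x)"
      by (rule L2_norm_subset[OF ZP sub \<omega>_meas(4) \<Omega>_meas(4)])
    also have "\<dots> \<le> c0 * ?h * ?H" using A2 z by (simp add: A2_def)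
    finally show "L2_norm \<omega> (\<lambda>x. ?Z x - proj_mesh \<M> ?Z x) \<le> c0 * ?h * ?H" .
  qed
  moreover have "\<bar>\<Sum>K\<in>?N. ?R K\<bar> \<le> 2 * c0\<^sup>2 * ?h * control_oscillation * ?H"
  proof -
    have "(\<Sum>K\<in>?N. ?R K) = (\<Sum>K\<in>?M1. ?R K)"
      using mesh_parts(1)[OF N] control_mean_mesh2 by (intro sum.mono_neutral_right) (auto simp: mesh1_def)
    then have "\<bar>\<Sum>K\<in>?N. ?R K\<bar> \<le> (\<Sum>K\<in>?M1. \<bar>?R K\<bar>)" by (simp add: sum_abs)
    also have "\<dots> \<le> (\<Sum>K\<in>?M1. (c0 * ?H) * measure lebesgue K * (2 * control_oscillation))"
    proof (rule sum_mono)
      fix K assume K1: "K \<in> ?M1"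
      then have K: "K \<in> ?N" by (simp add: mesh1_def)
      show "\<bar>?R K\<bar> \<le> (c0 * ?H) * measure lebesgue K * (2 * control_oscillation)"
        unfolding abs_mult using mean[OF K] control_mean_error_mesh1[OF K K1] control_oscillation_nonneg c0
        by (intro mult_mono mult_nonneg_nonneg) (auto simp: L2_norm_nonneg)
    qed
    also have "\<dots> = (c0 * ?H) * (2 * control_oscillation) * (\<Sum>K\<in>?M1. measure lebesgue K)"
      by (simp add: sum_distrib_left mult_ac)
    also have "\<dots> \<le> (c0 * ?H) * (2 * control_oscillation) * (c0 * ?h)"
      using mesh1_measure control_oscillation_nonneg c0 by (intro mult_left_mono) (auto simp: L2_norm_nonneg)
    finally show ?thesis by (simp add: power2_eq_square mult_ac)
  qed
  ultimately have "\<bar>L2_inner \<omega> (\<lambda>x. comparison_control x - u x) ?Z\<bar> \<le>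
      L2_norm \<omega> (\<lambda>x. u x - proj_mesh ?N u x) * (c0 * ?h * ?H) + 2 * c0\<^sup>2 * ?h * control_oscillation * ?H"
    by linarith
  then show ?thesis by (simp add: algebra_simps)
qed

end

text \<open>Add the two variational inequalities. The difference of the discrete adjoint states
  tested with the difference of the controls is a squared norm of the difference of the states, by
  symmetry of the scheme, and has the favourable sign. What remains is the error of p' tested with a
  piecewise constant function, so the error may be replaced by its projection.\<close>

lemma comparison_control_superclose:
  fixes D :: "('x::real_vector, 'n) hessian_disc"
  assumes D: "hessian_discretisation \<Omega> D"
    and f: "f \<in> L2 \<Omega>" and yd: "yd \<in> L2 \<Omega>"
    and dKKT: "discrete_KKT \<Omega> D \<M> \<omega> f yd ud \<alpha> a b yD pD uh"
    and y': "hessian_scheme \<Omega> D (\<lambda>x. f x + extend_zero \<omega> comparison_control x) y'"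
    and p': "hessian_scheme \<Omega> D (\<lambda>x. PiD D y' x - yd x) p'"
  shows "\<alpha> * L2_norm \<omega> (\<lambda>x. uh x - comparison_control x) \<le> L2_norm \<Omega> (proj_mesh \<M> (\<lambda>x. p x - PiD D p' x))"
proof -
  have yD: "yD \<in> XD D" and pD: "pD \<in> XD D" and uh: "uh \<in> Uadh \<M> \<omega> a b"
    and yDs: "\<And>w. w \<in> XD D \<Longrightarrow> aD \<Omega> D yD w = L2_inner \<Omega> (\<lambda>x. f x + extend_zero \<omega> uh x) (PiD D w)"
    and pDs: "\<And>w. w \<in> XD D \<Longrightarrow> aD \<Omega> D w pD = L2_inner \<Omega> (\<lambda>x. PiD D yD x - yd x) (PiD D w)"
    and vih: "\<And>v. v \<in> Uadh \<M> \<omega> a b \<Longrightarrow> 0 \<le> L2_inner \<omega> (\<lambda>x. PiD D pD x + \<alpha> * (uh x - ud x)) (\<lambda>x. v x - uh x)"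
    using dKKT by (auto simp: discrete_KKT_def)
  let ?c = comparison_control
  let ?d = "\<lambda>x. uh x - ?c x"
  have uhL: "uh \<in> L2 \<omega>" using uh by (simp add: Uadh_def Uad_def)
  have dL: "?d \<in> L2 \<omega>" by (intro L2_diff uhL comparison_control_L2)
  note ext = extend_zero_L2[OF _ sub \<omega>_meas(4) \<Omega>_meas(4)]
  note ext_inner = L2_inner_extend_zero[OF sub \<omega>_meas(4) \<Omega>_meas(4)]
  have y'X: "y' \<in> XD D" and p'X: "p' \<in> XD D" using y' p' by (simp_all add: hessian_scheme_def)
  note PL = PiD_L2[OF D] and sp = discretisation_parts(1)[OF D]
  have yDh: "hessian_scheme \<Omega> D (\<lambda>x. f x + extend_zero \<omega> uh x) yD"
    using yD yDs by (simp add: hessian_scheme_def)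
  have pDh: "hessian_scheme \<Omega> D (\<lambda>x. PiD D yD x - yd x) pD"
    using pD pDs aD_sym[OF D, of pD] by (simp add: hessian_scheme_def)
  have g: "(\<lambda>x. f x + extend_zero \<omega> uh x) \<in> L2 \<Omega>" "(\<lambda>x. f x + extend_zero \<omega> ?c x) \<in> L2 \<Omega>"
    "(\<lambda>x. PiD D yD x - yd x) \<in> L2 \<Omega>" "(\<lambda>x. PiD D y' x - yd x) \<in> L2 \<Omega>"
    by (auto intro!: L2_add L2_diff f yd ext uhL comparison_control_L2 PL yD y'X)
  have "(\<lambda>x. (f x + extend_zero \<omega> uh x) - (f x + extend_zero \<omega> ?c x)) = extend_zero \<omega> ?d"
    by (simp add: fun_eq_iff extend_zero_def right_diff_distrib)
  then have sy: "hessian_scheme \<Omega> D (extend_zero \<omega> ?d) (yD - y')"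
    using hessian_scheme_diff[OF D yDh y' g(1,2)] by simp
  have sp': "hessian_scheme \<Omega> D (\<lambda>x. PiD D yD x - PiD D y' x) (pD - p')"
    using hessian_scheme_diff[OF D pDh p' g(3,4)] by simp
  \<comment> \<open>Each difference of solutions is used as test function in the equation of the
    other one.\<close>
  have mono: "0 \<le> L2_inner \<omega> ?d (PiD D pD) - L2_inner \<omega> ?d (PiD D p')"
  proof -
    have m: "yD - y' \<in> XD D" "pD - p' \<in> XD D" using sp yD y'X pD p'X by (auto intro: subspace_diff)
    have "L2_inner \<omega> ?d (PiD D pD) - L2_inner \<omega> ?d (PiD D p') = L2_inner \<Omega> (extend_zero \<omega> ?d) (PiD D (pD - p'))"
      using PiD_inner_comb[OF D pD p'X ext[OF dL], of 1 "-1"] by (simp add: ext_inner)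
    also have "\<dots> = aD \<Omega> D (pD - p') (yD - y')"
      using sy m aD_sym[OF D, of "pD - p'"] by (simp add: hessian_scheme_def)
    also have "\<dots> = L2_inner \<Omega> (\<lambda>x. PiD D yD x - PiD D y' x) (PiD D (yD - y'))"
      using sp' m by (simp add: hessian_scheme_def)
    also have "\<dots> = L2_inner \<Omega> (\<lambda>x. PiD D yD x - PiD D y' x) (\<lambda>x. PiD D yD x - PiD D y' x)"
    proof (rule L2_inner_cong_AE)
      show "AE x in lebesgue_on \<Omega>. PiD D (yD - y') x = PiD D yD x - PiD D y' x"
        using linear_into_L2_comb[OF discretisation_parts(2)[OF D] yD y'X, of 1 "-1"] by simp
    qed (use PL yD y'X m in \<open>auto intro!: L2_diff\<close>)
    also have "\<dots> \<ge> 0" by (metis L2_norm_square zero_le_power2)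
    finally show ?thesis .
  qed
  have pw: "p \<in> L2 \<omega>" "ud \<in> L2 \<omega>" "PiD D pD \<in> L2 \<omega>" "PiD D p' \<in> L2 \<omega>" "?c \<in> L2 \<omega>"
    using p ud PL pD p'X by (auto intro: L2_control_domain comparison_control_L2)
  have v1: "0 \<le> L2_inner \<omega> ?d p + \<alpha> * (L2_inner \<omega> ?d ?c - L2_inner \<omega> ?d ud)"
    using comparison_variational[OF uh] L2_inner_affine[OF pw(1,5,2) dL] by simp
  have v2: "L2_inner \<omega> ?d (PiD D pD) + \<alpha> * (L2_inner \<omega> ?d uh - L2_inner \<omega> ?d ud) \<le> 0"
    using vih[OF comparison_control_admissible] L2_inner_affine[OF pw(3) uhL pw(2) dL]
      L2_inner_swap_diff[of \<omega> _ ?c uh] by simp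
  let ?n = "L2_norm \<omega> ?d"
  have dd: "?n\<^sup>2 = L2_inner \<omega> ?d uh - L2_inner \<omega> ?d ?c"
    unfolding L2_norm_square by (rule L2_inner_diff_right[OF uhL pw(5) dL])
  have "\<alpha> * ?n\<^sup>2 \<le> L2_inner \<omega> ?d p - L2_inner \<omega> ?d (PiD D pD)"
    using v1 v2 unfolding dd by (simp add: algebra_simps)
  also have "\<dots> \<le> L2_inner \<omega> ?d p - L2_inner \<omega> ?d (PiD D p')" using mono by simp
  also have "\<dots> = L2_inner \<omega> ?d (\<lambda>x. p x - PiD D p' x)"
    using pw dL by (simp add: L2_inner_diff_right)
  \<comment> \<open>Both controls are constant on each cell up to null sets, so \<open>?d\<close>
    only sees the cell means of the adjoint error.\<close>
  also have "\<dots> = L2_inner \<omega> ?d (proj_mesh \<M> (\<lambda>x. p x - PiD D p' x))"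
  proof -
    let ?e = "\<lambda>x. p x - PiD D p' x"
    have eL: "?e \<in> L2 \<omega>" by (intro L2_diff pw)
    have qL: "proj_mesh \<M> ?e \<in> L2 \<omega>" by (rule L2_control_domain[OF proj_mesh_L2[OF M \<Omega>]])
    have "L2_inner K ?d ?e = L2_inner K ?d (proj_mesh \<M> ?e)" if K: "K \<in> submesh \<M> \<omega>" for K
    proof -
      note pK = mesh_cell(1)[OF N K] and KL = L2_cell[OF N \<omega>_meas(4) K]
      have c: "(\<lambda>x. r) \<in> L2 K" for r :: real by (rule cell_const_L2[OF pK])
      obtain k where k: "AE x in lebesgue_on K. uh x = k" using Uadh_cell[OF uh K] .
      let ?k = "k - cell_control K"
      have dk: "AE x in lebesgue_on K. ?d x = ?k"
        using k AE_space by eventually_elim (simp add: comparison_control_cell[OF K])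
      have "L2_inner K ?d ?e = L2_inner K (\<lambda>x. ?k) ?e"
        by (rule L2_inner_cong_AE[OF KL[OF dL] c KL[OF eL] KL[OF eL] dk]) simp
      also have "\<dots> = ?k * measure lebesgue K * cell_mean K ?e"
        by (subst L2_inner_commute) (rule L2_inner_cell_const[OF pK KL[OF eL]])
      also have "\<dots> = L2_inner K (\<lambda>x. cell_mean K ?e) (\<lambda>x. ?k)"
        by (simp only: L2_inner_cell_const[OF pK c] cell_mean_const[OF pK])
      also have "\<dots> = L2_inner K (\<lambda>x. ?k) (\<lambda>x. cell_mean K ?e)" by (rule L2_inner_commute)
      also have "\<dots> = L2_inner K ?d (proj_mesh \<M> ?e)"
      proof (rule L2_inner_cong_AE[OF c KL[OF dL] c KL[OF qL]])
        show "AE x in lebesgue_on K. ?k = ?d x" using dk by eventually_elim simp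
        show "AE x in lebesgue_on K. cell_mean K ?e = proj_mesh \<M> ?e x"
          by (rule AE_I2) (simp add: proj_mesh_cell[OF M submesh_mesh[OF K]])
      qed
      finally show ?thesis .
    qed
    then show ?thesis
      unfolding L2_inner_mesh[OF N \<omega>_meas(4) dL eL] L2_inner_mesh[OF N \<omega>_meas(4) dL qL] by simp
  qed
  also have "\<dots> \<le> ?n * L2_norm \<omega> (proj_mesh \<M> (\<lambda>x. p x - PiD D p' x))"
    using L2_Cauchy_Schwarz[OF dL L2_control_domain[OF proj_mesh_L2[OF M \<Omega>]]] abs_le_D1 by blast
  also have "\<dots> \<le> ?n * L2_norm \<Omega> (proj_mesh \<M> (\<lambda>x. p x - PiD D p' x))"
    by (intro mult_left_mono L2_norm_subset[OF proj_mesh_L2[OF M \<Omega>] sub \<omega>_meas(4) \<Omega>_meas(4)] L2_norm_nonneg)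
  finally have "?n * (\<alpha> * ?n) \<le> ?n * L2_norm \<Omega> (proj_mesh \<M> (\<lambda>x. p x - PiD D p' x))"
    by (simp add: power2_eq_square mult_ac)
  then show ?thesis
    using L2_norm_nonneg[of \<omega> ?d] by (cases "?n = 0") (auto simp: L2_norm_nonneg mult_le_cancel_left)
qed

end

end

section \<open>The superconvergence estimate\<close>

lemma minmod_nonneg: "0 \<le> minmod a b"
  by (simp add: minmod_def)

lemma L2_norm_triangle_sub:
  assumes "f \<in> L2 S" "g \<in> L2 S"
  shows "L2_norm S (\<lambda>x. f x - g x) \<le> L2_norm S f + L2_norm S g"
  using L2_norm_triangle[OF assms(1) L2_scaleR[OF assms(2), of "-1"]] by (simp add: L2_norm_def)

lemma L2_norm_mono_AE:
  assumes "f \<in> L2 S" "g \<in> L2 S" "AE x in lebesgue_on S. norm (f x) \<le> norm (g x)"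
  shows "L2_norm S f \<le> L2_norm S g"
  unfolding L2_norm_def
proof (intro real_sqrt_le_mono integral_mono_AE)
  show "AE x in lebesgue_on S. (norm (f x))\<^sup>2 \<le> (norm (g x))\<^sup>2"
    using assms(3) by eventually_elim (simp add: power_mono)
qed (use assms in \<open>simp_all add: L2_def\<close>)

text \<open>The coefficient of h^2 when v - u is tested. The first summand pairs (A2) with the
  oscillation of \<open>u\<close>, by Poincare and Lipschitz; the second pairs (A3) with the small
  measure of \<M>_1. \<open>V\<close> stands for the square root of the measure of the
  domain.\<close>

definition control_const :: "nat \<Rightarrow> real \<Rightarrow> real \<Rightarrow> real \<Rightarrow> real" where
  "control_const d V \<eta> c0 = c0 * (sqrt (Poincare_const d \<eta> * real d) + real d * (1 + 2 / \<eta>) * V)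
    + 2 * c0\<^sup>2 * (real d * (1 + 2 / \<eta>))"

text \<open>The coefficient in the error of p'. Under the factor cD^2: replacing the reconstructed
  state of \<open>v\<close> by y_M, and y_M by \<open>y\<close>, in the adjoint source. The last
  summand is (A1) for \<open>p\<close>.\<close>

definition adjoint_const :: "nat \<Rightarrow> real \<Rightarrow> real \<Rightarrow> real \<Rightarrow> real \<Rightarrow> real" where
  "adjoint_const d V cD \<eta> c0 = cD\<^sup>2 * (cD * control_const d V \<eta> c0 + c0 * (2 + V) + c0) + c0"

text \<open>A sum that majorises the separate constants of the state and of the adjoint state, so
  that one constant serves both estimates.\<close>

definition error_const :: "nat \<Rightarrow> real \<Rightarrow> real \<Rightarrow> real \<Rightarrow> real \<Rightarrow> real" where
  "error_const d V cD \<eta> c0 = c0 * (2 + V) + cD * control_const d V \<eta> c0 + adjoint_const d V cD \<eta> c0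
    + (cD\<^sup>2 + cD\<^sup>2 * cD\<^sup>2) * (adjoint_const d V cD \<eta> c0 + c0)"

text \<open>The links are yD, y', w1, y_M for the state and pD, p', q2, q1, p_M for the adjoint.
  Here y' and w1 have the controls \<open>v\<close> and \<open>u\<close>, p' is driven by y', q2 by
  y_M and q1 by \<open>y\<close>. First p' is estimated, through y'; this bounds the control error,
  and only then can yD and pD be reached.\<close>

lemma superconvergence:
  fixes \<Omega> \<omega> :: "(real^'n) set" and D :: "('x::real_vector, 'n) hessian_disc"
  assumes \<Omega>: "polytopal_domain \<Omega>" and A: "admissible_coeffs \<Omega> A"
    and bil: "\<forall>z\<in>H20 \<Omega>. \<forall>w\<in>H20 \<Omega>. bilinear_a \<Omega> A z w = L2_inner \<Omega> (hessianB B \<Omega> z) (hessianB B \<Omega> w)"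
    and M: "polytopal_mesh \<Omega> \<M>" and star: "star_shaped_cells \<M>" and \<eta>: "\<eta> > 0" and reg: "mesh_regular \<eta> \<M>"
    and \<omega>: "polytopal_domain \<omega>" and sub: "\<omega> \<subseteq> \<Omega>" and N: "polytopal_mesh \<omega> (submesh \<M> \<omega>)"
    and D: "hessian_discretisation \<Omega> D" and cD: "CD \<Omega> D \<le> cD"
    and f: "f \<in> L2 \<Omega>" and yd: "yd \<in> L2 \<Omega>" and ud_Hm: "ud \<in> Hm 2 \<Omega>" and \<alpha>: "\<alpha> > 0" and ab: "a \<le> b"
    and KKT: "KKT \<Omega> A \<omega> f yd ud \<alpha> a b y p u"
    and dKKT: "discrete_KKT \<Omega> D \<M> \<omega> f yd ud \<alpha> a b yD pD uh"
    and c0: "c0 > 0" and A2: "A2 \<Omega> \<M> D c0" and A3: "A3 \<Omega> D c0" and A4: "A4 \<M> \<omega> a b u c0"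
    and y4: "y \<in> Hm 4 \<Omega>" and p4: "p \<in> Hm 4 \<Omega>"
    and yM: "A1_assoc \<Omega> A \<M> D c0 y yM" and pM: "A1_assoc \<Omega> A \<M> D c0 p pM"
  defines "T \<equiv> W1inf_broken_norm (mesh1 \<M> \<omega> a b u) u + dataF \<Omega> a b yd ud f y p"
    and "E \<equiv> error_const CARD('n) (sqrt (measure lebesgue \<Omega>)) cD \<eta> c0"
  shows "L2_norm \<Omega> (\<lambda>x. yM x - PiD D yD x) \<le> E * (1 + 1 / \<alpha>)\<^sup>2 * (mesh_size \<M>)\<^sup>2 * T"
    and "L2_norm \<Omega> (\<lambda>x. pM x - PiD D pD x) \<le> E * (1 + 1 / \<alpha>)\<^sup>2 * (mesh_size \<M>)\<^sup>2 * T"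
proof -
  note \<Omega>m = polytopal_domain_measure[OF \<Omega>] and \<omega>m = polytopal_domain_measure[OF \<omega>]
  \<comment> \<open>\<beta> dominates both 1 and 1 / \<alpha>, so every power of 1 / \<alpha> met
    below is absorbed into a power of \<beta>.\<close>
  define h V \<beta> where "h = mesh_size \<M>" and "V = sqrt (measure lebesgue \<Omega>)" and "\<beta> = 1 + 1 / \<alpha>"
  define k0 k1 k2 where "k0 = c0 * (2 + V)" and "k1 = control_const CARD('n) V \<eta> c0"
    and "k2 = adjoint_const CARD('n) V cD \<eta> c0"
  have h: "0 \<le> h" unfolding h_def by (rule mesh_size_nonneg[OF \<Omega> M \<omega> sub N])
  have V: "0 \<le> V" by (simp add: V_def)
  have \<beta>: "1 \<le> \<beta>" "1 / \<alpha> \<le> \<beta>" using \<alpha> by (simp_all add: \<beta>_def)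
  have cD0: "0 \<le> cD" using CD_nonneg[OF D] cD by simp
  have k0: "0 \<le> k0" using c0 V by (simp add: k0_def)
  have k1: "0 \<le> k1" using c0 V \<eta> by (simp add: k1_def control_const_def Poincare_const_def)
  have k2_eq: "k2 = cD\<^sup>2 * (cD * k1 + k0 + c0) + c0"
    by (simp only: k2_def adjoint_const_def k0_def k1_def)
  have k2: "0 \<le> k2" using cD0 k0 k1 c0 by (simp add: k2_eq)

  have y0: "y \<in> H20 \<Omega>" and p0: "p \<in> H20 \<Omega>" and u: "u \<in> Uad \<omega> a b"
    and eqy: "\<And>w. w \<in> H20 \<Omega> \<Longrightarrow> bilinear_a \<Omega> A y w = L2_inner \<Omega> (\<lambda>x. f x + extend_zero \<omega> u x) w"
    and eqp: "\<And>w. w \<in> H20 \<Omega> \<Longrightarrow> bilinear_a \<Omega> A w p = L2_inner \<Omega> (\<lambda>x. y x - yd x) w"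
    and vi: "\<And>v. v \<in> Uad \<omega> a b \<Longrightarrow> 0 \<le> L2_inner \<omega> (\<lambda>x. p x + \<alpha> * (u x - ud x)) (\<lambda>x. v x - u x)"
    using KKT by (auto simp: KKT_def)
  have y2: "y \<in> Hm 2 \<Omega>" and p2: "p \<in> Hm 2 \<Omega>" using y4 p4 Hm_mono[of 2 4 \<Omega>] by auto
  have yL: "y \<in> L2 \<Omega>" and pL: "p \<in> L2 \<Omega>" and udL: "ud \<in> L2 \<Omega>" using y4 p4 ud_Hm by (simp_all add: Hm_def)
  have yML: "yM \<in> L2 \<Omega>" and pML: "pM \<in> L2 \<Omega>" using yM pM by (simp_all add: A1_assoc_def)
  have uL: "u \<in> L2 \<omega>" using u by (simp add: Uad_def)
  note toL = L2_subset[OF _ sub \<omega>m(4) \<Omega>m(4)]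
  note ext = extend_zero_L2[OF _ sub \<omega>m(4) \<Omega>m(4)]
  note ext_norm = L2_norm_extend_zero[OF sub \<omega>m(4) \<Omega>m(4)]
  have u_eq: "AE x in lebesgue_on \<omega>. u x = clip a b (unconstrained p ud \<alpha> x)"
    using control_projection_formula[OF \<omega> toL[OF pL] toL[OF udL] \<alpha> ab u vi]
    by (simp add: unconstrained_def[OF \<Omega> M \<omega> sub N pL udL \<alpha> ab])

  define W F where "W = W1inf_broken_norm (mesh1 \<M> \<omega> a b u) u" and "F = dataF \<Omega> a b yd ud f y p"
  have W0: "0 \<le> W"
    unfolding W_def by (rule broken_norm_nonneg[OF \<Omega> M \<omega> sub N pL udL \<alpha> ab u u_eq star reg \<eta> A4 p2 ud_Hm])
  have parts: "0 \<le> minmod a b" "0 \<le> L2_norm \<Omega> yd" "0 \<le> Hm_norm 2 \<Omega> ud" "0 \<le> L2_norm \<Omega> f" "0 \<le> Hm_norm 4 \<Omega> y" "0 \<le> Hm_norm 4 \<Omega> p"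
    by (simp_all add: minmod_nonneg L2_norm_nonneg Hm_norm_nonneg)
  have T_eq: "T = W + (minmod a b + L2_norm \<Omega> yd + Hm_norm 2 \<Omega> ud + L2_norm \<Omega> f + Hm_norm 4 \<Omega> y + Hm_norm 4 \<Omega> p)"
    by (simp add: T_def W_def dataF_def)
  have T0: "0 \<le> T" and WT: "W \<le> T" and mmT: "minmod a b \<le> T" and fT: "L2_norm \<Omega> f \<le> T"
    and udT: "Hm_norm 2 \<Omega> ud \<le> T" and yT: "Hm_norm 4 \<Omega> y \<le> T" and pT: "Hm_norm 4 \<Omega> p \<le> T"
    and yydT: "Hm_norm 4 \<Omega> y + L2_norm \<Omega> yd \<le> T"
    using W0 parts unfolding T_eq by linarith+
  have y2T: "Hm_norm 2 \<Omega> y \<le> T" and p2T: "Hm_norm 2 \<Omega> p \<le> T"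
    using Hm_norm_mono[of 2 4 \<Omega> y] Hm_norm_mono[of 2 4 \<Omega> p] yT pT by linarith+
  have T\<beta>: "T \<le> \<beta> * T" using mult_right_mono[OF \<beta>(1) T0] by simp
  have Q: "Hm_norm 2 \<Omega> ud + Hm_norm 2 \<Omega> p / \<alpha> \<le> \<beta> * T"
  proof -
    have "Hm_norm 2 \<Omega> p / \<alpha> \<le> T / \<alpha>" using p2T \<alpha> by (simp add: divide_right_mono)
    then show ?thesis using udT by (simp add: \<beta>_def distrib_right)
  qed

  let ?c = "comparison_control \<omega> \<M> p ud \<alpha> a b"
  have cL: "?c \<in> L2 \<omega>" by (rule comparison_control_L2[OF \<Omega> M \<omega> sub N pL udL \<alpha> ab])
  let ?g = "\<lambda>x. f x + extend_zero \<omega> u x" and ?g' = "\<lambda>x. f x + extend_zero \<omega> ?c x"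
  have gL: "?g \<in> L2 \<Omega>" "?g' \<in> L2 \<Omega>" by (intro L2_add f ext uL cL)+
  obtain w1 where w1: "hessian_scheme \<Omega> D ?g w1" using hessian_scheme_exists[OF D gL(1)] by blast
  obtain y' where y': "hessian_scheme \<Omega> D ?g' y'" using hessian_scheme_exists[OF D gL(2)] by blast
  have mX: "w1 \<in> XD D" "y' \<in> XD D" "yD \<in> XD D" "pD \<in> XD D"
    using w1 y' dKKT by (simp_all add: hessian_scheme_def discrete_KKT_def)
  note PL = PiD_L2[OF D]
  have sL: "(\<lambda>x. PiD D y' x - yd x) \<in> L2 \<Omega>" "(\<lambda>x. yM x - yd x) \<in> L2 \<Omega>" "(\<lambda>x. y x - yd x) \<in> L2 \<Omega>"
    "(\<lambda>x. PiD D yD x - yd x) \<in> L2 \<Omega>"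
    by (intro L2_diff PL mX yML yL yd)+
  obtain p' where p': "hessian_scheme \<Omega> D (\<lambda>x. PiD D y' x - yd x) p'" using hessian_scheme_exists[OF D sL(1)] by blast
  obtain q2 where q2: "hessian_scheme \<Omega> D (\<lambda>x. yM x - yd x) q2" using hessian_scheme_exists[OF D sL(2)] by blast
  obtain q1 where q1: "hessian_scheme \<Omega> D (\<lambda>x. y x - yd x) q1" using hessian_scheme_exists[OF D sL(3)] by blast
  have mX': "p' \<in> XD D" "q2 \<in> XD D" "q1 \<in> XD D" using p' q2 q1 by (simp_all add: hessian_scheme_def)

  \<comment> \<open>(A1) bounds the scheme's error by the norm of the full source, control included,
    whereas the data term contains no norm of the control. The projection formula supplies one, with
    minmod multiplied by the root of the measure.\<close>
  have u_norm: "L2_norm \<omega> u \<le> \<beta> * T + T * V"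
  proof -
    let ?q = "unconstrained p ud \<alpha>"
    have qL: "?q \<in> L2 \<Omega>" by (rule unconstrained_L2[OF \<Omega> M \<omega> sub N pL udL \<alpha> ab])
    have aL: "(\<lambda>x. \<bar>?q x\<bar>) \<in> L2 \<omega>"
      using toL[OF qL] by (simp add: L2_def borel_measurable_abs)
    have mL: "(\<lambda>x. minmod a b) \<in> L2 \<omega>" by (rule cell_const_L2[OF \<omega>])
    have "L2_norm \<omega> u \<le> L2_norm \<omega> (\<lambda>x. \<bar>?q x\<bar> + minmod a b)"
    proof (rule L2_norm_mono_AE[OF uL L2_add[OF aL mL]])
      show "AE x in lebesgue_on \<omega>. norm (u x) \<le> norm (\<bar>?q x\<bar> + minmod a b)"
        using u_eq by eventually_elim (use abs_clip_le[OF ab] parts(1) in auto)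
    qed
    also have "\<dots> \<le> L2_norm \<omega> (\<lambda>x. \<bar>?q x\<bar>) + L2_norm \<omega> (\<lambda>x. minmod a b)"
      by (rule L2_norm_triangle[OF aL mL])
    also have "L2_norm \<omega> (\<lambda>x. \<bar>?q x\<bar>) = L2_norm \<omega> ?q" by (simp add: L2_norm_def)
    also have "L2_norm \<omega> ?q \<le> L2_norm \<Omega> ?q" by (rule L2_norm_subset[OF qL sub \<omega>m(4) \<Omega>m(4)])
    also have "L2_norm \<Omega> ?q \<le> \<beta> * T"
    proof -
      have "?q = (\<lambda>x. ud x + (- (1 / \<alpha>)) *\<^sub>R p x)"
        by (simp add: fun_eq_iff unconstrained_def[OF \<Omega> M \<omega> sub N pL udL \<alpha> ab])
      then have "L2_norm \<Omega> ?q \<le> L2_norm \<Omega> ud + (1 / \<alpha>) * L2_norm \<Omega> p"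
        using L2_norm_triangle[OF udL L2_scaleR[OF pL, of "- (1 / \<alpha>)"]] \<alpha> unfolding L2_norm_scaleR by simp
      also have "\<dots> \<le> Hm_norm 2 \<Omega> ud + (1 / \<alpha>) * Hm_norm 2 \<Omega> p"
        using \<alpha> by (intro add_mono mult_left_mono L2_norm_le_Hm_norm[OF \<Omega>m(1)] ud_Hm p2) auto
      also have "\<dots> \<le> \<beta> * T" using Q by simp
      finally show ?thesis .
    qed
    also have "L2_norm \<omega> (\<lambda>x. minmod a b) \<le> T * V"
    proof -
      have "(L2_norm \<omega> (\<lambda>x. minmod a b))\<^sup>2 = (minmod a b)\<^sup>2 * measure lebesgue \<omega>"
        by (rule L2_norm_cell_const[OF \<omega>])
      also have "\<dots> \<le> T\<^sup>2 * measure lebesgue \<Omega>"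
        using mmT parts(1) measure_mono_fmeasurable[OF sub \<omega>m(4) \<Omega>m(9)] by (intro mult_mono power_mono) auto
      also have "\<dots> = (T * V)\<^sup>2" by (simp add: V_def power_mult_distrib)
      finally show ?thesis by (rule power2_le_imp_le) (rule mult_nonneg_nonneg[OF T0 V])
    qed
    finally show ?thesis by simp
  qed
  have g_norm: "L2_norm \<Omega> ?g \<le> (2 + V) * (\<beta> * T)"
  proof -
    have "L2_norm \<Omega> ?g \<le> L2_norm \<Omega> f + L2_norm \<omega> u"
      using L2_norm_triangle[OF f ext[OF uL]] by (simp add: ext_norm)
    moreover have "T * V \<le> V * (\<beta> * T)" using mult_left_mono[OF T\<beta> V] by (simp add: mult.commute)
    ultimately show ?thesis using u_norm fT T\<beta> by (simp add: distrib_right)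
  qed

  have e1: "L2_norm \<Omega> (\<lambda>x. PiD D w1 x - yM x) \<le> k0 * h\<^sup>2 * (\<beta> * T)"
  proof -
    have "solves_pde \<Omega> A y ?g" by (rule solves_pdeI[OF \<Omega>m(1) A y2 eqy])
    then have "L2_norm \<Omega> (\<lambda>x. PiD D w1 x - yM x) \<le> c0 * h\<^sup>2 * L2_norm \<Omega> ?g"
      using yM w1 gL(1) y4 y0 by (simp add: A1_assoc_def h_def)
    also have "\<dots> \<le> c0 * h\<^sup>2 * ((2 + V) * (\<beta> * T))" using g_norm c0 by (intro mult_left_mono) auto
    finally show ?thesis by (simp add: k0_def mult_ac)
  qed
  have e2: "L2_norm \<Omega> (\<lambda>x. PiD D q1 x - pM x) \<le> c0 * h\<^sup>2 * T"
  proof -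
    \<comment> \<open>In the adjoint equation the unknown sits in the second slot; the bilinear form
      is symmetric because it equals an L2 inner product of Hessians.\<close>
    have "bilinear_a \<Omega> A p w = L2_inner \<Omega> (\<lambda>x. y x - yd x) w" if "w \<in> H20 \<Omega>" for w
      using bil p0 that eqp[OF that] by (simp add: L2_inner_commute)
    then have "solves_pde \<Omega> A p (\<lambda>x. y x - yd x)" by (intro solves_pdeI[OF \<Omega>m(1) A p2])
    then have "L2_norm \<Omega> (\<lambda>x. PiD D q1 x - pM x) \<le> c0 * h\<^sup>2 * L2_norm \<Omega> (\<lambda>x. y x - yd x)"
      using pM q1 sL(3) p4 p0 by (simp add: A1_assoc_def h_def)
    also have "L2_norm \<Omega> (\<lambda>x. y x - yd x) \<le> T"
    proof -
      have "L2_norm \<Omega> (\<lambda>x. y x - yd x) \<le> L2_norm \<Omega> y + L2_norm \<Omega> yd"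
        by (rule L2_norm_triangle_sub[OF yL yd])
      then show ?thesis using L2_norm_le_Hm_norm[OF \<Omega>m(1) y4] yydT by simp
    qed
    finally show ?thesis using c0 by (simp add: mult_left_mono)
  qed
  \<comment> \<open>Here v - u is measured as a functional of discrete functions; its L2 norm would
    give order one only.\<close>
  have e3: "L2_norm \<Omega> (\<lambda>x. PiD D y' x - PiD D w1 x) \<le> cD * (k1 * h\<^sup>2 * (\<beta> * T))"
  proof (rule hessian_scheme_stable[OF D y' w1 gL(2,1) cD])
    let ?d = "control_oscillation \<omega> \<M> \<eta> a b u"
    let ?\<kappa> = "real CARD('n) * (1 + 2 / \<eta>)"
    let ?CP = "sqrt (Poincare_const CARD('n) \<eta> * real CARD('n))"
    note ctx = \<Omega> M \<omega> sub N pL udL \<alpha> ab u u_eq star reg \<eta> A4 p2 ud_Hm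
    have CP: "0 \<le> ?CP" using \<eta> by (simp add: Poincare_const_def)
    have \<kappa>: "0 \<le> ?\<kappa>" using \<eta> by simp
    have d: "?d = ?\<kappa> * h * W" by (simp add: control_oscillation_def[OF ctx] h_def W_def)
    have W\<beta>: "W \<le> \<beta> * T" using WT T\<beta> by simp
    have d_le: "?d \<le> ?\<kappa> * h * (\<beta> * T)" unfolding d using W\<beta> \<kappa> h by (intro mult_left_mono) auto
    let ?e = "L2_norm \<omega> (\<lambda>x. u x - proj_mesh (submesh \<M> \<omega>) u x)"
    have "?e \<le> ?CP * h * (Hm_norm 2 \<Omega> ud + Hm_norm 2 \<Omega> p / \<alpha>) + ?d * V"
      using control_L2_oscillation[OF ctx] by (simp add: h_def V_def)
    also have "\<dots> \<le> ?CP * h * (\<beta> * T) + ?\<kappa> * h * (\<beta> * T) * V"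
      using Q d_le CP h V by (intro add_mono mult_left_mono mult_right_mono) auto
    finally have e: "?e \<le> (?CP + ?\<kappa> * V) * h * (\<beta> * T)" by (simp add: algebra_simps)
    fix v assume v: "v \<in> XD D"
    let ?H = "L2_norm \<Omega> (HessD D v)"
    have "(\<lambda>x. ?g' x - ?g x) = extend_zero \<omega> (\<lambda>x. ?c x - u x)"
      by (simp add: fun_eq_iff extend_zero_def right_diff_distrib)
    then have "\<bar>L2_inner \<Omega> (\<lambda>x. ?g' x - ?g x) (PiD D v)\<bar> \<le> (c0 * h * ?e + 2 * c0\<^sup>2 * h * ?d) * ?H"
      using comparison_control_tested[OF ctx D A2 A3 c0 v] L2_inner_extend_zero[OF sub \<omega>m(4) \<Omega>m(4)]
      by (simp add: h_def)
    also have "\<dots> \<le> (c0 * h * ((?CP + ?\<kappa> * V) * h * (\<beta> * T)) + 2 * c0\<^sup>2 * h * (?\<kappa> * h * (\<beta> * T))) * ?H"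
      using e d_le c0 h by (intro mult_right_mono add_mono mult_left_mono) (auto simp: L2_norm_nonneg)
    also have "\<dots> = (k1 * h\<^sup>2 * (\<beta> * T)) * ?H"
      by (simp add: k1_def control_const_def power2_eq_square algebra_simps)
    finally show "\<bar>L2_inner \<Omega> (\<lambda>x. ?g' x - ?g x) (PiD D v)\<bar> \<le> (k1 * h\<^sup>2 * (\<beta> * T)) * ?H" .
  next
    show "0 \<le> k1 * h\<^sup>2 * (\<beta> * T)" using k1 T0 \<beta>(1) by (intro mult_nonneg_nonneg) auto
  qed
  have e4: "L2_norm \<Omega> (\<lambda>x. PiD D y' x - yM x) \<le> (cD * k1 + k0) * h\<^sup>2 * (\<beta> * T)"
    using L2_norm_diff_triangle[OF PL[OF mX(2)] PL[OF mX(1)] yML] e1 e3 by (simp add: algebra_simps)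
  have e5: "L2_norm \<Omega> (\<lambda>x. PiD D p' x - PiD D q2 x) \<le> cD\<^sup>2 * ((cD * k1 + k0) * h\<^sup>2 * (\<beta> * T))"
    using hessian_scheme_stable_L2[OF D p' q2 sL(1,2) cD] mult_left_mono[OF e4, of "cD\<^sup>2"] by simp
  \<comment> \<open>y - y_M is known to be small only when tested with reconstructions, so again the
    dual form of stability is used.\<close>
  have e6: "L2_norm \<Omega> (\<lambda>x. PiD D q2 x - PiD D q1 x) \<le> cD * (c0 * h\<^sup>2 * cD * T)"
  proof (rule hessian_scheme_stable[OF D q2 q1 sL(2,3) cD])
    fix v assume v: "v \<in> XD D"
    let ?H = "L2_norm \<Omega> (HessD D v)"
    have "\<bar>L2_inner \<Omega> (\<lambda>x. (yM x - yd x) - (y x - yd x)) (PiD D v)\<bar> = \<bar>L2_inner \<Omega> (\<lambda>x. y x - yM x) (PiD D v)\<bar>"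
      using L2_inner_swap_diff[of \<Omega> "PiD D v" yM y] by (simp add: L2_inner_commute[of \<Omega> _ "PiD D v"])
    also have "\<dots> \<le> c0 * h\<^sup>2 * L2_norm \<Omega> (PiD D v) * Hm_norm 2 \<Omega> y"
      using yM v by (simp add: A1_assoc_def h_def)
    also have "\<dots> \<le> c0 * h\<^sup>2 * (cD * ?H) * T"
      using PiD_le_CD[OF D v] mult_right_mono[OF cD L2_norm_nonneg[of \<Omega> "HessD D v"]] y2T c0 cD0
      by (intro mult_mono mult_left_mono mult_nonneg_nonneg) (auto simp: L2_norm_nonneg Hm_norm_nonneg)
    finally show "\<bar>L2_inner \<Omega> (\<lambda>x. (yM x - yd x) - (y x - yd x)) (PiD D v)\<bar> \<le> c0 * h\<^sup>2 * cD * T * ?H"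
      by (simp add: mult_ac)
  qed (use c0 cD0 T0 in simp)
  have X: "h\<^sup>2 * T \<le> h\<^sup>2 * (\<beta> * T)" using T\<beta> by (intro mult_left_mono) auto
  have e7: "L2_norm \<Omega> (\<lambda>x. PiD D p' x - pM x) \<le> k2 * h\<^sup>2 * (\<beta> * T)"
  proof -
    have "L2_norm \<Omega> (\<lambda>x. PiD D p' x - pM x) \<le> L2_norm \<Omega> (\<lambda>x. PiD D p' x - PiD D q2 x)
        + (L2_norm \<Omega> (\<lambda>x. PiD D q2 x - PiD D q1 x) + L2_norm \<Omega> (\<lambda>x. PiD D q1 x - pM x))"
      using L2_norm_diff_triangle[OF PL[OF mX'(1)] PL[OF mX'(2)] pML]
        L2_norm_diff_triangle[OF PL[OF mX'(2)] PL[OF mX'(3)] pML] by simp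
    also have "\<dots> \<le> cD\<^sup>2 * ((cD * k1 + k0) * h\<^sup>2 * (\<beta> * T)) + (cD\<^sup>2 * c0 * (h\<^sup>2 * T) + c0 * (h\<^sup>2 * T))"
      using e5 e6 e2 by (simp add: power2_eq_square mult_ac)
    also have "\<dots> \<le> cD\<^sup>2 * ((cD * k1 + k0) * h\<^sup>2 * (\<beta> * T)) + (cD\<^sup>2 * c0 * (h\<^sup>2 * (\<beta> * T)) + c0 * (h\<^sup>2 * (\<beta> * T)))"
      by (intro add_left_mono add_mono mult_left_mono X) (use c0 in simp_all)
    also have "\<dots> = k2 * h\<^sup>2 * (\<beta> * T)"
      by (simp add: k2_eq algebra_simps)
    finally show ?thesis .
  qed
  have e8: "L2_norm \<omega> (\<lambda>x. uh x - ?c x) \<le> (k2 + c0) * h\<^sup>2 * (\<beta>\<^sup>2 * T)"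
  proof -
    \<comment> \<open>Inserting p_M: (A1) bounds the projection of p - p_M, and the other part is
      small in the full norm, which projection does not increase.\<close>
    let ?a = "\<lambda>x. p x - pM x" and ?b = "\<lambda>x. PiD D p' x - pM x"
    have aL: "?a \<in> L2 \<Omega>" and bL: "?b \<in> L2 \<Omega>" by (intro L2_diff PL mX' pL pML)+
    have "proj_mesh \<M> (\<lambda>x. p x - PiD D p' x) = (\<lambda>x. proj_mesh \<M> ?a x - proj_mesh \<M> ?b x)"
      using proj_mesh_diff[OF M \<Omega> aL bL] by (simp add: fun_eq_iff)
    then have "L2_norm \<Omega> (proj_mesh \<M> (\<lambda>x. p x - PiD D p' x)) \<le> L2_norm \<Omega> (proj_mesh \<M> ?a) + L2_norm \<Omega> (proj_mesh \<M> ?b)"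
      using L2_norm_triangle_sub[OF proj_mesh_L2[OF M \<Omega>] proj_mesh_L2[OF M \<Omega>]] by simp
    also have "\<dots> \<le> c0 * h\<^sup>2 * T + k2 * h\<^sup>2 * (\<beta> * T)"
    proof (rule add_mono)
      have "L2_norm \<Omega> (proj_mesh \<M> ?a) \<le> c0 * h\<^sup>2 * Hm_norm 2 \<Omega> p"
        using pM by (simp add: A1_assoc_def h_def)
      also have "\<dots> \<le> c0 * h\<^sup>2 * T" using p2T c0 by (intro mult_left_mono) auto
      finally show "L2_norm \<Omega> (proj_mesh \<M> ?a) \<le> c0 * h\<^sup>2 * T" .
      show "L2_norm \<Omega> (proj_mesh \<M> ?b) \<le> k2 * h\<^sup>2 * (\<beta> * T)"
        using L2_norm_proj_mesh_le[OF M \<Omega> bL] e7 by simp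
    qed
    also have "\<dots> = c0 * (h\<^sup>2 * T) + k2 * h\<^sup>2 * (\<beta> * T)" by (simp add: mult.assoc)
    also have "\<dots> \<le> c0 * (h\<^sup>2 * (\<beta> * T)) + k2 * h\<^sup>2 * (\<beta> * T)"
      by (intro add_right_mono mult_left_mono X) (use c0 in simp)
    also have "\<dots> = (k2 + c0) * h\<^sup>2 * (\<beta> * T)" by (simp add: algebra_simps)
    finally have "\<alpha> * L2_norm \<omega> (\<lambda>x. uh x - ?c x) \<le> (k2 + c0) * h\<^sup>2 * (\<beta> * T)"
      using comparison_control_superclose[OF \<Omega> M \<omega> sub N pL udL \<alpha> ab D f yd dKKT y' p'] by simp
    then have "L2_norm \<omega> (\<lambda>x. uh x - ?c x) \<le> (1 / \<alpha>) * ((k2 + c0) * h\<^sup>2 * (\<beta> * T))"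
      using \<alpha> by (simp add: pos_le_divide_eq mult.commute)
    also have "\<dots> \<le> \<beta> * ((k2 + c0) * h\<^sup>2 * (\<beta> * T))"
      using \<beta> k2 c0 T0 by (intro mult_right_mono mult_nonneg_nonneg) auto
    finally show ?thesis by (simp add: power2_eq_square mult_ac)
  qed
  \<comment> \<open>The error of y' carries one power of \<beta> and the control error two, the
    second from dividing by \<alpha>; the former is raised to match.\<close>
  have X2: "h\<^sup>2 * (\<beta> * T) \<le> h\<^sup>2 * (\<beta>\<^sup>2 * T)"
    using \<beta>(1) T0 T\<beta> mult_right_mono[OF \<beta>(1), of "\<beta> * T"] by (intro mult_left_mono) (auto simp: power2_eq_square mult.assoc)
  have Y0: "0 \<le> h\<^sup>2 * (\<beta>\<^sup>2 * T)" using T0 by simp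
  have uhL: "uh \<in> L2 \<omega>" using dKKT by (simp add: discrete_KKT_def Uadh_def Uad_def)
  have yDh: "hessian_scheme \<Omega> D (\<lambda>x. f x + extend_zero \<omega> uh x) yD"
    using dKKT by (simp add: discrete_KKT_def hessian_scheme_def)
  have pDh: "hessian_scheme \<Omega> D (\<lambda>x. PiD D yD x - yd x) pD"
    using dKKT aD_sym[OF D, of pD] by (simp add: discrete_KKT_def hessian_scheme_def)
  have guL: "(\<lambda>x. f x + extend_zero \<omega> uh x) \<in> L2 \<Omega>" by (intro L2_add f ext uhL)
  have e9: "L2_norm \<Omega> (\<lambda>x. PiD D yD x - PiD D y' x) \<le> cD\<^sup>2 * ((k2 + c0) * (h\<^sup>2 * (\<beta>\<^sup>2 * T)))"
  proof -
    have "(\<lambda>x. (f x + extend_zero \<omega> uh x) - ?g' x) = extend_zero \<omega> (\<lambda>x. uh x - ?c x)"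
      by (simp add: fun_eq_iff extend_zero_def right_diff_distrib)
    then have "L2_norm \<Omega> (\<lambda>x. PiD D yD x - PiD D y' x) \<le> cD\<^sup>2 * L2_norm \<omega> (\<lambda>x. uh x - ?c x)"
      using hessian_scheme_stable_L2[OF D yDh y' guL gL(2) cD] ext_norm by simp
    also have "\<dots> \<le> cD\<^sup>2 * ((k2 + c0) * h\<^sup>2 * (\<beta>\<^sup>2 * T))" by (intro mult_left_mono e8) simp
    finally show ?thesis by (simp add: mult.assoc)
  qed
  have E: "E = k0 + cD * k1 + k2 + (cD\<^sup>2 + cD\<^sup>2 * cD\<^sup>2) * (k2 + c0)"
    by (simp add: E_def error_const_def k0_def k1_def k2_def V_def)
  have nn: "0 \<le> cD\<^sup>2 * (k2 + c0)" "0 \<le> cD\<^sup>2 * cD\<^sup>2 * (k2 + c0)" "0 \<le> cD * k1"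
    using k1 k2 c0 cD0 by simp_all
  have "L2_norm \<Omega> (\<lambda>x. yM x - PiD D yD x) \<le> L2_norm \<Omega> (\<lambda>x. PiD D y' x - yM x) + L2_norm \<Omega> (\<lambda>x. PiD D yD x - PiD D y' x)"
    using L2_norm_diff_triangle[OF yML PL[OF mX(2)] PL[OF mX(3)]]
      L2_norm_minus_commute[of \<Omega> yM "PiD D y'"] L2_norm_minus_commute[of \<Omega> "PiD D y'" "PiD D yD"] by simp
  also have "\<dots> \<le> (cD * k1 + k0) * (h\<^sup>2 * (\<beta>\<^sup>2 * T)) + cD\<^sup>2 * ((k2 + c0) * (h\<^sup>2 * (\<beta>\<^sup>2 * T)))"
  proof (rule add_mono[OF _ e9])
    show "L2_norm \<Omega> (\<lambda>x. PiD D y' x - yM x) \<le> (cD * k1 + k0) * (h\<^sup>2 * (\<beta>\<^sup>2 * T))"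
      by (rule order_trans[OF e4[unfolded mult.assoc[of _ "h\<^sup>2"]] mult_left_mono[OF X2]]) (use nn k0 in simp)
  qed
  also have "\<dots> = (cD * k1 + k0 + cD\<^sup>2 * (k2 + c0)) * (h\<^sup>2 * (\<beta>\<^sup>2 * T))" by (simp add: algebra_simps)
  also have "\<dots> \<le> E * (h\<^sup>2 * (\<beta>\<^sup>2 * T))"
    using nn k2 by (intro mult_right_mono Y0) (simp add: E distrib_right)
  finally show "L2_norm \<Omega> (\<lambda>x. yM x - PiD D yD x) \<le> E * (1 + 1 / \<alpha>)\<^sup>2 * (mesh_size \<M>)\<^sup>2 * T"
    by (simp add: \<beta>_def h_def mult_ac)
  have e10: "L2_norm \<Omega> (\<lambda>x. PiD D pD x - PiD D p' x) \<le> cD\<^sup>2 * (cD\<^sup>2 * ((k2 + c0) * (h\<^sup>2 * (\<beta>\<^sup>2 * T))))"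
    using hessian_scheme_stable_L2[OF D pDh p' sL(4,1) cD] mult_left_mono[OF e9, of "cD\<^sup>2"] by simp
  have "L2_norm \<Omega> (\<lambda>x. pM x - PiD D pD x) \<le> L2_norm \<Omega> (\<lambda>x. PiD D p' x - pM x) + L2_norm \<Omega> (\<lambda>x. PiD D pD x - PiD D p' x)"
    using L2_norm_diff_triangle[OF pML PL[OF mX'(1)] PL[OF mX(4)]]
      L2_norm_minus_commute[of \<Omega> pM "PiD D p'"] L2_norm_minus_commute[of \<Omega> "PiD D p'" "PiD D pD"] by simp
  also have "\<dots> \<le> k2 * (h\<^sup>2 * (\<beta>\<^sup>2 * T)) + cD\<^sup>2 * (cD\<^sup>2 * ((k2 + c0) * (h\<^sup>2 * (\<beta>\<^sup>2 * T))))"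
    by (rule add_mono[OF order_trans[OF e7[unfolded mult.assoc[of _ "h\<^sup>2"]] mult_left_mono[OF X2 k2]] e10])
  also have "\<dots> = (k2 + cD\<^sup>2 * cD\<^sup>2 * (k2 + c0)) * (h\<^sup>2 * (\<beta>\<^sup>2 * T))" by (simp add: algebra_simps)
  also have "\<dots> \<le> E * (h\<^sup>2 * (\<beta>\<^sup>2 * T))"
    using nn k0 by (intro mult_right_mono Y0) (simp add: E distrib_right)
  finally show "L2_norm \<Omega> (\<lambda>x. pM x - PiD D pD x) \<le> E * (1 + 1 / \<alpha>)\<^sup>2 * (mesh_size \<M>)\<^sup>2 * T"
    by (simp add: \<beta>_def h_def mult_ac)
qed

theorem corollary4p7:
  "\<exists>(C :: real \<Rightarrow> real)
    (C' :: (real^'n) set \<Rightarrow> (real^'n^'n \<Rightarrow> real^'n^'n) \<Rightarrow> real \<Rightarrow> real \<Rightarrow> real \<Rightarrow> real \<Rightarrow> real).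
   \<forall>\<Omega> B \<rho> cD \<eta> c0 \<alpha> A \<M> \<omega> (D :: ('x::real_vector, 'n) hessian_disc) f yd ud a b
     y p u yD pD uh yM pM.
     polytopal_domain \<Omega> \<and>
     linear B \<and> (\<forall>\<xi>. sym_mat \<xi> \<longrightarrow> sym_mat (B \<xi>)) \<and>
     admissible_coeffs \<Omega> A \<and>
     (\<forall>z\<in>H20 \<Omega>. \<forall>w\<in>H20 \<Omega>. bilinear_a \<Omega> A z w = L2_inner \<Omega> (hessianB B \<Omega> z) (hessianB B \<Omega> w)) \<and>
     \<rho> > 0 \<and> (\<forall>w\<in>H20 \<Omega>. L2_norm \<Omega> (hessianB B \<Omega> w) \<ge> \<rho> * Hm_norm 2 \<Omega> w) \<and>
     polytopal_mesh \<Omega> \<M> \<and> star_shaped_cells \<M> \<and> \<eta> > 0 \<and> mesh_regular \<eta> \<M> \<and>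
     polytopal_domain \<omega> \<and> \<omega> \<subseteq> \<Omega> \<and> polytopal_mesh \<omega> (submesh \<M> \<omega>) \<and>
     hessian_discretisation \<Omega> D \<and> CD \<Omega> D \<le> cD \<and>
     f \<in> L2 \<Omega> \<and> yd \<in> L2 \<Omega> \<and> ud \<in> Hm 2 \<Omega> \<and> \<alpha> > 0 \<and> a \<le> b \<and>
     KKT \<Omega> A \<omega> f yd ud \<alpha> a b y p u \<and>
     discrete_KKT \<Omega> D \<M> \<omega> f yd ud \<alpha> a b yD pD uh \<and>
     c0 > 0 \<and> A1 \<Omega> A \<M> D c0 \<and> A2 \<Omega> \<M> D c0 \<and> A3 \<Omega> D c0 \<and> A4 \<M> \<omega> a b u c0 \<and>
     y \<in> Hm 4 \<Omega> \<and> p \<in> Hm 4 \<Omega> \<and>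
     A1_assoc \<Omega> A \<M> D c0 y yM \<and> A1_assoc \<Omega> A \<M> D c0 p pM
     \<longrightarrow>
     L2_norm \<Omega> (\<lambda>x. yM x - PiD D yD x)
       \<le> C' \<Omega> B \<rho> cD \<eta> c0 * C \<alpha> * (mesh_size \<M>)\<^sup>2 *
         (W1inf_broken_norm (mesh1 \<M> \<omega> a b u) u + dataF \<Omega> a b yd ud f y p) \<and>
     L2_norm \<Omega> (\<lambda>x. pM x - PiD D pD x)
       \<le> C' \<Omega> B \<rho> cD \<eta> c0 * C \<alpha> * (mesh_size \<M>)\<^sup>2 *
         (W1inf_broken_norm (mesh1 \<M> \<omega> a b u) u + dataF \<Omega> a b yd ud f y p)"
proof -
  \<comment> \<open>The square is \<beta>^2, from the two occurrences of 1 / \<alpha>; the domain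
    enters the other witness through the square root of its measure.\<close>
  let ?C = "\<lambda>\<alpha>::real. (1 + 1 / \<alpha>)\<^sup>2"
  let ?C' = "\<lambda>(\<Omega> :: (real^'n) set) (B :: real^'n^'n \<Rightarrow> real^'n^'n) (\<rho> :: real) cD \<eta> c0.
      error_const CARD('n) (sqrt (measure lebesgue \<Omega>)) cD \<eta> c0"
  show ?thesis
    by (rule exI[of _ ?C], rule exI[of _ ?C'], intro allI impI, elim conjE, rule conjI)
      (rule superconvergence; assumption)+
qed

end
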